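(* Let $X$ be a rearrangement invariant space on $(-1,1)$ satisfying $1/2<\underline{\alpha}_X\le \overline{\alpha}_X<1$. For $f\in X$ define $(\widehat{T}_X(f))(x):=\frac{-1}{\sqrt{1-x^2}}\,T_X\big(\sqrt{1-t^2}f(t)\big)(x)$ for a.e. $x\in(-1,1)$. Then: (a) $\mathrm{Ker}(T_X)$ is the one-dimensional subspace of $X$ spanned by $1/\sqrt{1-x^2}$. (b) $\widehat{T}_X$ is a bounded linear operator from $X$ into $X$, $T_X\widehat T_X=I_X$, and $\int_{-1}^1(\widehat{T}_X(f))(x)\,dx=0$ for all $f\in X$. (c) $T_X\colon X\to X$ is surjective. (d) $\widehat T_XT_X=I_X-P_X$, where $P_X$ is the bounded projection on $X$ given by $P_X(f):=\left(\frac1\pi\int_{-1}^1 f(t)\,dt\right)\frac{1}{\sqrt{1-x^2}}$. (e) $\widehat{T}_X$ is an isomorphism onto its range $R(\widehat{T}_X)$, and $R(\widehat{T}_X)=\{f\in X:\int_{-1}^1 f(x)\,dx=0\}$. (f) $X=\{f\in X:\int_{-1}^{1} f(x)\,dx=0\}\oplus \langle 1/\sqrt{1-x^2}\rangle=R(\widehat{T}_X)\oplus\langle 1/\sqrt{1-x^2}\rangle$, where $\langle\cdot\rangle$ denotes linear span.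
   Context: We work on $(-1,1)$ with Lebesgue measure and Borel $\sigma$-algebra $\mathcal{B}$; $L^0$ is the space of complex measurable functions. A Banach function space (B.f.s.) is a Banach space $X\subseteq L^0$ with the ideal property ($|g|\le|f|$ a.e., $f\in X$ imply $g\in X$, $\|g\|_X\le\|f\|_X$) and the Fatou property. A rearrangement invariant (r.i.) space is a B.f.s. $X$ with $g\in X$, $\|g\|_X\le\|f\|_X$ whenever $f\in X$ and $g^*\le f^*$ ($f^*$ the decreasing rearrangement). For $t>0$ let $E_t f(s)=f(st)$ if $|st|\le1$, $0$ otherwise; the Boyd indices are $\underline{\alpha}_X=\sup_{0<t<1}\frac{\log\|E_{1/t}\|_{X\to X}}{\log t}$ and $\overline{\alpha}_X=\inf_{1<t<\infty}\frac{\log\|E_{1/t}\|_{X\to X}}{\log t}$. The finite Hilbert transform of $f\in L^1(-1,1)$ is $(Tf)(t)=\lim_{\varepsilon\to0^+}\frac1\pi\big(\int_{-1}^{t-\varepsilon}+\int_{t+\varepsilon}^1\big)\frac{f(x)}{x-t}\,dx$ (exists a.e.). When $0<\underline{\alpha}_X\le\overline{\alpha}_X<1$, $T$ maps $X$ boundedly into $X$; this operator is denoted $T_X$. $I_X$ is the identity on $X$. *)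

theory Defs
  imports "HOL-Analysis.Analysis"
begin

text \<open>The underlying measure space: (-1,1) with Lebesgue measure on the Borel sets.
  Elements of L^0 are represented by Borel measurable functions real => complex
  (values outside (-1,1) are irrelevant); all identities between elements of a
  function space are understood almost everywhere.\<close>

definition M11 :: "real measure" where
  "M11 = restrict_space lborel {-1<..<1}"

text \<open>A Banach function space is given by a set X of functions together with
  its (semi)norm N; N f = 0 iff f = 0 a.e., so X modulo null functions is a normed
  space.  Non-triviality (X is not the zero space) is part of the standing notion.\<close>

definition banach_function_space ::
  "(real \<Rightarrow> complex) set \<Rightarrow> ((real \<Rightarrow> complex) \<Rightarrow> real) \<Rightarrow> bool" where
  "banach_function_space X N \<longleftrightarrow>
     \<comment> \<open>subset of L^0\<close>
     X \<subseteq> borel_measurable M11 \<and>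
     \<comment> \<open>linear subspace\<close>
     (\<lambda>x. 0) \<in> X \<and>
     (\<forall>f\<in>X. \<forall>g\<in>X. (\<lambda>x. f x + g x) \<in> X) \<and>
     (\<forall>f\<in>X. \<forall>c. (\<lambda>x. c * f x) \<in> X) \<and>
     \<comment> \<open>norm\<close>
     (\<forall>f\<in>X. 0 \<le> N f) \<and>
     (\<forall>f\<in>X. N f = 0 \<longleftrightarrow> (AE x in M11. f x = 0)) \<and>
     (\<forall>f\<in>X. \<forall>g\<in>X. N (\<lambda>x. f x + g x) \<le> N f + N g) \<and>
     (\<forall>f\<in>X. \<forall>c. N (\<lambda>x. c * f x) = cmod c * N f) \<and>
     \<comment> \<open>completeness\<close>
     (\<forall>F. (\<forall>n. F n \<in> X) \<longrightarrow>
        (\<forall>e>0. \<exists>M. \<forall>m\<ge>M. \<forall>n\<ge>M. N (\<lambda>x. F m x - F n x) < e) \<longrightarrow>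
        (\<exists>f\<in>X. (\<lambda>n. N (\<lambda>x. F n x - f x)) \<longlonglongrightarrow> 0)) \<and>
     \<comment> \<open>ideal property\<close>
     (\<forall>f\<in>X. \<forall>g\<in>borel_measurable M11.
        (AE x in M11. cmod (g x) \<le> cmod (f x)) \<longrightarrow> g \<in> X \<and> N g \<le> N f) \<and>
     \<comment> \<open>Fatou property\<close>
     (\<forall>h :: nat \<Rightarrow> real \<Rightarrow> real. \<forall>g :: real \<Rightarrow> real.
        (\<forall>n. (\<lambda>x. complex_of_real (h n x)) \<in> X) \<longrightarrow>
        g \<in> borel_measurable M11 \<longrightarrow>
        (AE x in M11. (\<forall>n. 0 \<le> h n x \<and> h n x \<le> h (Suc n) x) \<and> (\<lambda>n. h n x) \<longlonglongrightarrow> g x) \<longrightarrow>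
        bdd_above (range (\<lambda>n. N (\<lambda>x. complex_of_real (h n x)))) \<longrightarrow>
        (\<lambda>x. complex_of_real (g x)) \<in> X \<and>
        N (\<lambda>x. complex_of_real (g x)) = (SUP n. N (\<lambda>x. complex_of_real (h n x)))) \<and>
     \<comment> \<open>non-triviality\<close>
     (\<exists>f\<in>X. \<not> (AE x in M11. f x = 0))"

definition distrib_fun :: "(real \<Rightarrow> complex) \<Rightarrow> real \<Rightarrow> real" where
  "distrib_fun f r = measure M11 {x \<in> space M11. cmod (f x) > r}"

definition decr_rearr :: "(real \<Rightarrow> complex) \<Rightarrow> real \<Rightarrow> real" where
  "decr_rearr f s = Inf {r. 0 \<le> r \<and> distrib_fun f r \<le> s}"

definition ri_space ::
  "(real \<Rightarrow> complex) set \<Rightarrow> ((real \<Rightarrow> complex) \<Rightarrow> real) \<Rightarrow> bool" where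
  "ri_space X N \<longleftrightarrow> banach_function_space X N \<and>
     (\<forall>f\<in>X. \<forall>g\<in>borel_measurable M11.
        (\<forall>s>0. decr_rearr g s \<le> decr_rearr f s) \<longrightarrow> g \<in> X \<and> N g \<le> N f)"

definition dil :: "real \<Rightarrow> (real \<Rightarrow> complex) \<Rightarrow> real \<Rightarrow> complex" where
  "dil t f s = (if \<bar>s * t\<bar> \<le> 1 then f (s * t) else 0)"

definition op_norm_on ::
  "(real \<Rightarrow> complex) set \<Rightarrow> ((real \<Rightarrow> complex) \<Rightarrow> real) \<Rightarrow>
   ((real \<Rightarrow> complex) \<Rightarrow> real \<Rightarrow> complex) \<Rightarrow> real" where
  "op_norm_on X N A = Sup {N (A f) | f. f \<in> X \<and> N f \<le> 1}"

definition boyd_lower ::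
  "(real \<Rightarrow> complex) set \<Rightarrow> ((real \<Rightarrow> complex) \<Rightarrow> real) \<Rightarrow> real" where
  "boyd_lower X N = (SUP t\<in>{0<..<1}. ln (op_norm_on X N (dil (1 / t))) / ln t)"

definition boyd_upper ::
  "(real \<Rightarrow> complex) set \<Rightarrow> ((real \<Rightarrow> complex) \<Rightarrow> real) \<Rightarrow> real" where
  "boyd_upper X N = (INF t\<in>{1<..}. ln (op_norm_on X N (dil (1 / t))) / ln t)"

definition fin_hilbert :: "(real \<Rightarrow> complex) \<Rightarrow> real \<Rightarrow> complex" where
  "fin_hilbert f t = Lim (at_right 0)
     (\<lambda>\<epsilon>. complex_of_real (1 / pi) *
        (LINT x:({-1<..<t - \<epsilon>} \<union> {t + \<epsilon><..<1})|lborel. f x / complex_of_real (x - t)))"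

definition wgt :: "real \<Rightarrow> complex" where
  "wgt x = complex_of_real (1 / sqrt (1 - x\<^sup>2))"

definition T_hat :: "(real \<Rightarrow> complex) \<Rightarrow> real \<Rightarrow> complex" where
  "T_hat f x = - wgt x * fin_hilbert (\<lambda>t. complex_of_real (sqrt (1 - t\<^sup>2)) * f t) x"

definition proj_P :: "(real \<Rightarrow> complex) \<Rightarrow> real \<Rightarrow> complex" where
  "proj_P f x = (complex_of_real (1 / pi) * (LINT t:{-1<..<1}|lborel. f t)) * wgt x"

end

theory Submission
  imports Defs "HOL-Complex_Analysis.Complex_Analysis" "HOL-Real_Asymp.Real_Asymp"
begin

text \<open>The boundedness of \<open>T\<close> and \<open>T_hat\<close> is obtained by real interpolation done by hand. Complex
  analysis for the Cauchy integral together with the Poisson maximal function gives weak type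
  \<open>(1,1)\<close> and \<open>(2,2)\<close> for the maximal truncations; splitting \<open>f\<close> at the height \<open>f*(s)\<close> then bounds
  the rearrangement of \<open>T f\<close> by a dyadic series in \<open>f*\<close>, which the Boyd index hypotheses
  control in \<open>X\<close>. The operator \<open>T_hat + T\<close> obeys a bound of the same kind.

  The formula \<open>T_hat T = I - P\<close> holds for \<open>cos (n arccos t) / sqrt (1 - t\<^sup>2)\<close> by the
  trigonometric identities for Chebyshev functions. Both sides are continuous along dominated
  pointwise convergent sequences (the norm of \<open>X\<close> need not be order continuous, so convergence in measure is used),
  which extends the formula to all of \<open>X\<close>. The remaining assertions follow from it.\<close>

section \<open>The Poisson kernel\<close>

text \<open>The weight \<open>1 / sqrt (1 - x\<^sup>2)\<close> is only in weak L^2. A lower index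
  above 1/2 is what places it in the space, and the same inequality makes the half of the dyadic
  series that stems from the (2,2) bound converge; an upper index below 1 makes the other half
  converge and embeds the space into L^1, where principal values make sense. Maximal truncations are
  estimated rather than \<open>T\<close> itself because \<open>fin_hilbert\<close> is a limit whose
  almost everywhere existence must come out of the same estimates. Weak-type results speak of Borel
  exceptional sets, which avoids suprema over uncountably many radii. The constants are accumulated
  factors: 5 from Vitali, 16 from a dyadic sum for the Poisson kernel, 2 from passing from the
  Cauchy transform to truncations, 4 * 4 from the four non-negative parts of a complex function,
  with product 2560. The weight in \<open>T_hat\<close> is not treated by weighted inequalities: the
  kernel of \<open>T_hat + T\<close> has no diagonal singularity, and it suffices to bound this
  operator at distance at least |x| from the end points, since a set of measure 2 |x| may be
  discarded at a level proportional to \<open>gser f x\<close>.\<close>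

definition pker :: "real \<Rightarrow> real \<Rightarrow> real" where
  "pker y u = y / (u\<^sup>2 + y\<^sup>2)"

lemma pker_nonneg: "0 \<le> y \<Longrightarrow> 0 \<le> pker y u"
  by (simp add: pker_def)

lemma borel_measurable_pker [measurable]: "pker y \<in> borel_measurable borel"
  unfolding pker_def by measurable

lemma pker_le: "0 < y \<Longrightarrow> pker y u \<le> 1 / y"
proof -
  assume y: "0 < y"
  have "y / (u\<^sup>2 + y\<^sup>2) \<le> y / y\<^sup>2"
    using y by (intro divide_left_mono) (auto intro!: mult_pos_pos add_nonneg_pos)
  then show ?thesis using y by (simp add: pker_def power2_eq_square)
qed

lemma nn_integral_pker_half:
  assumes "0 < y"
  shows "(\<integral>\<^sup>+u. ennreal (pker y u) * indicator {0..} u \<partial>lborel) = ennreal (pi / 2)"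
proof -
  have "(\<integral>\<^sup>+u. ennreal (pker y u) * indicator {0..} u \<partial>lborel) = ennreal (pi/2 - arctan (0 / y))"
  proof (rule nn_integral_FTC_atLeast)
    show "((\<lambda>u. arctan (u / y)) has_real_derivative pker y u) (at u)" for u
      using assms by (auto intro!: derivative_eq_intros simp: pker_def power2_eq_square field_simps)
    show "0 \<le> pker y u" for u using assms by (simp add: pker_nonneg)
    have "filterlim (\<lambda>u. u / y) at_top at_top"
      using assms by real_asymp
    then show "((\<lambda>u. arctan (u / y)) \<longlongrightarrow> pi / 2) at_top"
      using filterlim_compose[OF tendsto_arctan_at_top] by blast
  qed auto
  then show ?thesis by simp
qed

text \<open>\<open>pker\<close> is the Poisson kernel of the upper half-plane without its factor 1 /
  pi; this normalisation is the source of the factors pi in all Poisson formulas below.\<close>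

lemma nn_integral_pker:
  assumes "0 < y"
  shows "(\<integral>\<^sup>+u. ennreal (pker y u) \<partial>lborel) = ennreal pi"
proof -
  have ind: "(\<integral>\<^sup>+u. ennreal (pker y u) \<partial>lborel) =
      (\<integral>\<^sup>+u. ennreal (pker y u) * indicator {0..} u + ennreal (pker y u) * indicator {..0} u \<partial>lborel)"
  proof (rule nn_integral_cong_AE)
    have "AE u in lborel. (u::real) \<noteq> 0" by (rule AE_lborel_singleton)
    then show "AE u in lborel. ennreal (pker y u) = ennreal (pker y u) * indicator {0..} u + ennreal (pker y u) * indicator {..0} u"
      by eventually_elim (auto simp: indicator_def)
  qed
  have flip: "(\<integral>\<^sup>+u. ennreal (pker y u) * indicator {..0} u \<partial>lborel) = ennreal (pi/2)"
  proof -
    have "(\<integral>\<^sup>+u. ennreal (pker y u) * indicator {..0} u \<partial>lborel) =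
       ennreal \<bar>-1\<bar> * (\<integral>\<^sup>+u. ennreal (pker y (0 + (-1) * u)) * indicator {..0} (0 + (-1) * u) \<partial>lborel)"
      by (rule nn_integral_real_affine) auto
    also have "\<dots> = (\<integral>\<^sup>+u. ennreal (pker y u) * indicator {0..} u \<partial>lborel)"
      by (auto intro!: nn_integral_cong simp: pker_def indicator_def)
    finally show ?thesis using nn_integral_pker_half[OF assms] by simp
  qed
  show ?thesis
    unfolding ind by (subst nn_integral_add)
      (auto simp: flip nn_integral_pker_half[OF assms] simp flip: ennreal_plus)
qed

lemma has_bochner_integral_pker:
  assumes "0 < y"
  shows "has_bochner_integral lborel (pker y) pi"
  by (rule has_bochner_integral_nn_integral)
    (use assms nn_integral_pker[OF assms] in \<open>auto simp: pker_nonneg\<close>)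

lemma has_bochner_integral_pker_shift:
  assumes "0 < y"
  shows "has_bochner_integral lborel (\<lambda>s. pker y (s - a)) pi"
proof -
  have "has_bochner_integral lborel (\<lambda>s. pker y (- a + 1 * s)) (pi /\<^sub>R \<bar>1\<bar>)"
    by (subst lborel_has_bochner_integral_real_affine_iff[symmetric])
      (use has_bochner_integral_pker[OF assms] in auto)
  then show ?thesis by simp
qed

text \<open>The Poisson kernel is the difference of the Cauchy kernels at a point and at its mirror
  image, so Cauchy's theorem on large half-discs is all that is needed.\<close>

lemma Poisson_formula_0:
  fixes v :: "complex \<Rightarrow> complex"
  assumes hol: "v holomorphic_on {z. - d < Im z}" and d: "0 < d"
    and bd: "\<And>z. 0 \<le> Im z \<Longrightarrow> cmod (v z) \<le> B" and y: "0 < y"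
  shows "has_bochner_integral lborel (\<lambda>s. complex_of_real (pker y s) * v (complex_of_real s))
           (pi * v (\<i> * y))"
proof -
  define a where "a = \<i> * complex_of_real y"
  \<comment> \<open>The strip below the axis is at most \<open>y\<close> deep, so the mirror image
    \<open>- a\<close> of the pole stays outside \<open>S\<close> and \<open>g\<close> has no
    singularity there.\<close>
  define e where "e = min d y"
  define S where "S = {z. - e < Im z}"
  have e: "0 < e" using d y by (simp add: e_def)
  have S: "open S" "convex S"
    unfolding S_def using open_halfspace_Im_gt convex_halfspace_Im_gt by auto
  \<comment> \<open>Subtracting \<open>v a\<close> makes the singularity at \<open>a\<close>
    removable; the constant is put back at the end through the known mass of the kernel.\<close>
  define h where "h = (\<lambda>z. if z = a then deriv v a else (v z - v a) / (z - a))"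
  have holS: "v holomorphic_on S" by (rule holomorphic_on_subset[OF hol]) (auto simp: S_def e_def)
  have hh: "h holomorphic_on S" unfolding h_def by (rule pole_lemma_open[OF holS S(1)])
  define g where "g = (\<lambda>z. h z / (z + a))"
  have gh: "g holomorphic_on S"
    unfolding g_def using e
    by (intro holomorphic_intros hh) (auto simp: S_def a_def complex_eq_iff e_def)
  \<comment> \<open>These are the values of \<open>g\<close> on the real axis, because (s - a) (s +
    a) = s^2 + y^2.\<close>
  define f where "f = (\<lambda>s::real. (v s - v a) * complex_of_real (pker y s / y))"
  have B: "0 \<le> B" using bd[of 0] norm_ge_zero[of "v 0"] by (metis dual_order.trans zero_complex.sel(2) order_refl)
  have vcont: "continuous_on UNIV (\<lambda>s::real. v (complex_of_real s))"
    by (rule continuous_on_compose2[OF holomorphic_on_imp_continuous_on[OF holS]])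
      (use e in \<open>auto simp: S_def intro!: continuous_intros\<close>)
  have [measurable]: "(\<lambda>s::real. v (complex_of_real s)) \<in> borel_measurable borel"
    by (rule borel_measurable_continuous_onI[OF vcont])
  have pint: "integrable lborel (pker y)"
    using has_bochner_integral_pker[OF y] by (simp add: has_bochner_integral_iff)
  have vbd: "cmod (v (complex_of_real s)) \<le> B" for s using bd[of "complex_of_real s"] by simp
  have int_pv: "integrable lborel (\<lambda>s. complex_of_real (pker y s) * v (complex_of_real s))"
  proof (rule Bochner_Integration.integrable_bound)
    show "integrable lborel (\<lambda>s. B * pker y s)" using pint by simp
    show "AE s in lborel. cmod (complex_of_real (pker y s) * v (complex_of_real s)) \<le> norm (B * pker y s)"
    proof (rule AE_I2)
      fix s
      have "pker y s * cmod (v (complex_of_real s)) \<le> pker y s * B"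
        using vbd pker_nonneg[of y s] y by (intro mult_left_mono) auto
      then show "cmod (complex_of_real (pker y s) * v (complex_of_real s)) \<le> norm (B * pker y s)"
        using y B pker_nonneg[of y s] by (simp add: norm_mult abs_mult mult.commute)
    qed
  qed auto
  have int_pa: "has_bochner_integral lborel (\<lambda>s. complex_of_real (pker y s) * v a) (pi * v a)"
    by (intro has_bochner_integral_mult_left has_bochner_integral_of_real has_bochner_integral_pker y)
  have intf: "integrable lborel f"
  proof -
    have "integrable lborel (\<lambda>s. (complex_of_real (pker y s) * v (complex_of_real s) - complex_of_real (pker y s) * v a) / y)"
      using int_pv int_pa by (auto simp: has_bochner_integral_iff)
    also have "?this \<longleftrightarrow> integrable lborel f"
      by (rule Bochner_Integration.integrable_cong) (auto simp: f_def field_simps)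
    finally show ?thesis .
  qed
  \<comment> \<open>On the half-circle \<open>g\<close> is at most 2 B / (R^2 - y^2), and the path
    has length pi R, so the contribution is O(1 / R).\<close>
  have line: "cmod (integral {-R..R} f) \<le> (2 * B / (R\<^sup>2 - y\<^sup>2)) * R * pi" if R: "y < R" for R
  proof -
    have R0: "0 < R" using y R by simp
    define p where "p = part_circlepath 0 R 0 pi"
    define l where "l = linepath (complex_of_real (-R)) (complex_of_real R)"
    have pS: "path_image p \<subseteq> S"
      using R0 e by (auto simp: p_def path_image_part_circlepath' S_def closed_segment_eq_real_ivl intro!: less_le_trans[OF _ mult_nonneg_nonneg] sin_ge_zero)
    have lS: "path_image l \<subseteq> S"
      using e by (auto simp: l_def closed_segment_def S_def)
    have fin: "pathfinish l = pathstart p" "pathfinish p = pathstart l"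
      by (auto simp: l_def p_def cis_conv_exp[symmetric] exp_pi_i')
    have tot: "(g has_contour_integral 0) (l +++ p)"
      by (rule Cauchy_theorem_convex_simple[OF gh S(2)])
        (use fin pS lS in \<open>auto simp: l_def p_def path_image_join\<close>)
    have gl: "g contour_integrable_on l"
      unfolding l_def
      by (rule contour_integrable_continuous_linepath, rule continuous_on_subset[OF holomorphic_on_imp_continuous_on[OF gh]])
        (use lS in \<open>simp add: l_def\<close>)
    have gp: "g contour_integrable_on p"
      unfolding p_def
      by (rule contour_integrable_continuous_part_circlepath, rule continuous_on_subset[OF holomorphic_on_imp_continuous_on[OF gh]])
        (use pS in \<open>simp add: p_def\<close>)
    have sum: "contour_integral l g + contour_integral p g = 0"
      using tot fin gl gp contour_integral_join[of g l p] contour_integral_unique[OF tot]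
      by (simp add: l_def p_def)
    have "contour_integral l g = integral {-R..R} (\<lambda>s. g (complex_of_real s))"
      unfolding l_def using R0 by (subst contour_integral_linepath_Reals_eq) simp_all
    also have "\<dots> = integral {-R..R} f"
    proof (rule integral_cong)
      fix s :: real
      have ne: "complex_of_real s \<noteq> a" using y by (auto simp: a_def complex_eq_iff)
      have ne': "complex_of_real s + a \<noteq> 0" using y by (auto simp: a_def complex_eq_iff)
      have "(complex_of_real s - a) * (complex_of_real s + a) = complex_of_real (s\<^sup>2 + y\<^sup>2)"
        by (simp add: a_def algebra_simps power2_eq_square)
      then show "g (complex_of_real s) = f s"
        using ne ne' y by (simp add: g_def h_def f_def pker_def)
    qed
    finally have L: "contour_integral l g = integral {-R..R} f" .
    have "cmod (contour_integral p g) \<le> (2 * B / (R\<^sup>2 - y\<^sup>2)) * R * (pi - 0)"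
    proof (rule has_contour_integral_bound_part_circlepath[of g _ 0 R 0 pi])
      show "(g has_contour_integral contour_integral p g) (part_circlepath 0 R 0 pi)"
        using gp unfolding p_def by (rule has_contour_integral_integral)
      have "y\<^sup>2 < R\<^sup>2" using y R by (intro power_strict_mono) auto
      then show "0 \<le> 2 * B / (R\<^sup>2 - y\<^sup>2)" using B by simp
      fix z assume "z \<in> path_image (part_circlepath 0 R 0 pi)"
      then have z: "cmod z = R" "0 \<le> Im z"
        using R0 by (auto simp: path_image_part_circlepath' norm_mult closed_segment_eq_real_ivl intro!: mult_nonneg_nonneg sin_ge_zero)
      have ca: "cmod a = y" using y by (simp add: a_def norm_mult)
      have za: "z \<noteq> a" using z ca R by auto
      have "(R - y) * (R + y) = R\<^sup>2 - y\<^sup>2" by (simp add: algebra_simps power2_eq_square)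
      have prod: "(z - a) * (z + a) = z\<^sup>2 + complex_of_real (y\<^sup>2)"
        by (simp add: a_def algebra_simps power2_eq_square)
      have "R\<^sup>2 - y\<^sup>2 \<le> cmod (z\<^sup>2 + complex_of_real (y\<^sup>2))"
        using norm_diff_ineq[of "z\<^sup>2" "complex_of_real (y\<^sup>2)"] z by (simp add: norm_power del: of_real_power)
      then have den: "R\<^sup>2 - y\<^sup>2 \<le> cmod ((z - a) * (z + a))" using prod by simp
      have num: "cmod (v z - v a) \<le> 2 * B"
        using norm_triangle_ineq4[of "v z" "v a"] bd[of z] bd[of a] z y by (auto simp: a_def)
      have "cmod (g z) = cmod (v z - v a) / cmod ((z - a) * (z + a))"
        using za by (simp add: g_def h_def norm_divide norm_mult)
      also have "\<dots> \<le> 2 * B / (R\<^sup>2 - y\<^sup>2)"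
        using den num \<open>y\<^sup>2 < R\<^sup>2\<close> B by (intro frac_le) auto
      finally show "cmod (g z) \<le> 2 * B / (R\<^sup>2 - y\<^sup>2)" .
    qed (use R0 in auto)
    moreover have "integral {-R..R} f = - contour_integral p g"
      using sum L by (metis add.commute add.inverse_unique)
    ultimately show ?thesis by simp
  qed
  have lim0: "(\<lambda>n. integral {-real n..real n} f) \<longlonglongrightarrow> 0"
  proof (rule Lim_null_comparison)
    show "eventually (\<lambda>n. norm (integral {-real n..real n} f) \<le> (2 * B / ((real n)\<^sup>2 - y\<^sup>2)) * real n * pi) sequentially"
      using eventually_gt_at_top[of "nat \<lceil>y\<rceil>"]
      by eventually_elim (rule line, linarith)
    show "(\<lambda>n. (2 * B / ((real n)\<^sup>2 - y\<^sup>2)) * real n * pi) \<longlonglongrightarrow> 0"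
      by real_asymp
  qed
  have lim1: "(\<lambda>n. integral {-real n..real n} f) \<longlonglongrightarrow> (LINT s|lborel. f s)"
  proof -
    have eq: "integral {-real n..real n} f = (LINT s|lborel. indicator {-real n..real n} s *\<^sub>R f s)" for n
    proof -
      have "set_integrable lborel {-real n..real n} f"
        unfolding set_integrable_def by (rule integrable_mult_indicator[OF _ intf]) simp
      from set_borel_integral_eq_integral(2)[OF this] show ?thesis
        by (simp add: set_lebesgue_integral_def)
    qed
    show ?thesis unfolding eq
    proof (rule integral_dominated_convergence[where w = "\<lambda>s. norm (f s)"])
      show "AE s in lborel. (\<lambda>n. indicator {-real n..real n} s *\<^sub>R f s) \<longlonglongrightarrow> f s"
      proof (rule AE_I2)
        fix s
        have "eventually (\<lambda>n. indicator {-real n..real n} s *\<^sub>R f s = f s) sequentially"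
          using eventually_ge_at_top[of "nat \<lceil>\<bar>s\<bar>\<rceil>"]
          by eventually_elim (auto simp: indicator_def; linarith)
        then show "(\<lambda>n. indicator {-real n..real n} s *\<^sub>R f s) \<longlonglongrightarrow> f s" by (rule tendsto_eventually)
      qed
    qed (use intf in \<open>auto simp: indicator_def\<close>)
  qed
  have z0: "(LINT s|lborel. f s) = 0" using LIMSEQ_unique[OF lim1 lim0] .
  have "(LINT s|lborel. f s) = (LINT s|lborel. (complex_of_real (pker y s) * v (complex_of_real s) - complex_of_real (pker y s) * v a) / y)"
    by (rule Bochner_Integration.integral_cong) (auto simp: f_def field_simps)
  also have "\<dots> = ((LINT s|lborel. complex_of_real (pker y s) * v (complex_of_real s)) - pi * v a) / y"
    using int_pv int_pa by (simp add: has_bochner_integral_iff)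
  finally have "(LINT s|lborel. complex_of_real (pker y s) * v (complex_of_real s)) = pi * v a"
    using z0 y by simp
  then show ?thesis using int_pv by (simp add: has_bochner_integral_iff a_def)
qed

text \<open>Translating by \<open>Complex x d\<close> turns the line at height \<open>d\<close> into
  the boundary line. Only the half-plane above that line has to be bounded, so no boundary values on
  the real axis are required.\<close>

lemma Poisson_formula:
  fixes v :: "complex \<Rightarrow> complex"
  assumes hol: "v holomorphic_on {z. 0 < Im z}" and d: "0 < d"
    and bd: "\<And>z. d \<le> Im z \<Longrightarrow> cmod (v z) \<le> B" and y: "0 < y"
  shows "has_bochner_integral lborel (\<lambda>s. complex_of_real (pker y (s - x)) * v (Complex s d))
           (pi * v (Complex x (d + y)))"
proof -
  define w where "w = (\<lambda>z. v (z + Complex x d))"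
  have "has_bochner_integral lborel (\<lambda>s. complex_of_real (pker y s) * w (complex_of_real s)) (pi * w (\<i> * y))"
  proof (rule Poisson_formula_0[where d = d and B = B])
    show "w holomorphic_on {z. - d < Im z}"
      unfolding w_def
      by (rule holomorphic_on_compose_gen[OF _ hol, unfolded o_def]) (auto intro!: holomorphic_intros)
  qed (use d bd y in \<open>auto simp: w_def\<close>)
  then have "has_bochner_integral lborel (\<lambda>s. complex_of_real (pker y (- x + 1 * s)) * w (complex_of_real (- x + 1 * s))) ((pi * w (\<i> * y)) /\<^sub>R \<bar>1\<bar>)"
    by (subst (asm) lborel_has_bochner_integral_real_affine_iff[where c = 1 and t = "-x"]) auto
  moreover have "w (complex_of_real (- x + 1 * s)) = v (Complex s d)" for s
    by (simp add: w_def) (metis (no_types, lifting) Complex_eq add.commute add.left_commute add_diff_cancel_left' diff_add_cancel uminus_add_conv_diff)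
  moreover have "\<i> * complex_of_real y + Complex x d = Complex x (d + y)"
    by (simp add: complex_eq_iff)
  ultimately show ?thesis by (simp add: w_def)
qed

section \<open>The Hardy--Littlewood maximal function\<close>

text \<open>Vitali's selection among the balls of too large average: the disjoint ones carry total
  mass at most \<open>A\<close>, and their fivefold enlargements cover every bad centre. The
  exceptional set takes the place of a maximal function, whose measurability would otherwise need an
  argument.\<close>

lemma Hardy_Littlewood_weak:
  fixes g :: "real \<Rightarrow> real"
  assumes [measurable]: "g \<in> borel_measurable borel" and lam: "0 < lam"
    and fin: "(\<integral>\<^sup>+s. ennreal (g s) \<partial>lborel) = ennreal A" and A: "0 \<le> A"
  shows "\<exists>B \<in> sets borel. emeasure lborel B \<le> ennreal (5 * A / lam) \<and>
    (\<forall>x. x \<notin> B \<longrightarrow> (\<forall>r>0. (\<integral>\<^sup>+s. ennreal (g s) * indicator (cball x r) s \<partial>lborel) \<le> ennreal (lam * (2 * r))))"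
proof -
  define K where "K = {(x, r). 0 < r \<and> ennreal (lam * (2 * r)) < (\<integral>\<^sup>+s. ennreal (g s) * indicator (cball x r) s \<partial>lborel)}"
  define D where "D = density lborel (\<lambda>s. ennreal (g s))"
  have eD: "emeasure D (cball x r) = (\<integral>\<^sup>+s. ennreal (g s) * indicator (cball x r) s \<partial>lborel)" for x r
    unfolding D_def by (subst emeasure_density) auto
  \<comment> \<open>A ball with average above \<open>lam\<close> has length below
    \<open>A / lam\<close>; the selection lemma needs such a uniform bound on the radii.\<close>
  have rad: "0 < snd k \<and> snd k \<le> A / (2 * lam)" if "k \<in> K" for k
  proof -
    obtain x r where k: "k = (x, r)" by (cases k)
    have "ennreal (lam * (2 * r)) < (\<integral>\<^sup>+s. ennreal (g s) * indicator (cball x r) s \<partial>lborel)"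
      using that by (simp add: k K_def)
    also have "\<dots> \<le> (\<integral>\<^sup>+s. ennreal (g s) \<partial>lborel)"
      by (intro nn_integral_mono) (auto simp: indicator_def)
    finally have "ennreal (lam * (2 * r)) < ennreal A" using fin by simp
    then have "lam * (2 * r) < A" by (metis ennreal_leI not_le)
    then show ?thesis using that lam by (simp add: k K_def field_simps)
  qed
  obtain C where C: "countable C" "C \<subseteq> K"
     "pairwise (\<lambda>i j. disjnt (cball (fst i) (snd i)) (cball (fst j) (snd j))) C"
     "\<And>i. i \<in> K \<Longrightarrow> \<exists>j. j \<in> C \<and> \<not> disjnt (cball (fst i) (snd i)) (cball (fst j) (snd j)) \<and>
                        cball (fst i) (snd i) \<subseteq> ball (fst j) (5 * snd j)"
    by (rule Vitali_covering_lemma_cballs_balls[of K snd "A / (2 * lam)" fst]) (use rad in blast)+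
  define B where "B = (\<Union>j\<in>C. ball (fst j) (5 * snd j))"
  have "open B" unfolding B_def by auto
  then have Bm: "B \<in> sets borel" by auto
  have "emeasure lborel B = (\<integral>\<^sup>+x. indicator B x \<partial>lborel)" using Bm by simp
  also have "\<dots> \<le> (\<integral>\<^sup>+x. (\<integral>\<^sup>+j. indicator (ball (fst j) (5 * snd j)) x \<partial>count_space C) \<partial>lborel)"
  proof (intro nn_integral_mono)
    fix x
    show "indicator B x \<le> (\<integral>\<^sup>+j. indicator (ball (fst j) (5 * snd j)) x \<partial>count_space C)"
    proof (cases "x \<in> B")
      case True
      then obtain j where j: "j \<in> C" "x \<in> ball (fst j) (5 * snd j)" by (auto simp: B_def)
      have "indicator B x = (indicator (ball (fst j) (5 * snd j)) x :: ennreal)" using j True by simp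
      also have "\<dots> \<le> (\<integral>\<^sup>+j. indicator (ball (fst j) (5 * snd j)) x \<partial>count_space C)"
        using j(1) by (rule nn_integral_ge_point)
      finally show ?thesis .
    qed simp
  qed
  also have "\<dots> = (\<integral>\<^sup>+j. (\<integral>\<^sup>+x. indicator (ball (fst j) (5 * snd j)) x \<partial>lborel) \<partial>count_space C)"
    using C(1) by (intro nn_integral_count_space_nn_integral) (auto intro!: borel_measurable_indicator)
  also have "\<dots> \<le> (\<integral>\<^sup>+j. ennreal (5 / lam) * emeasure D (cball (fst j) (snd j)) \<partial>count_space C)"
  proof (intro nn_integral_mono)
    fix j assume "j \<in> space (count_space C)"
    then have jK: "j \<in> K" using C by auto
    obtain x r where j: "j = (x, r)" by (cases j)
    have r: "0 < r" "ennreal (lam * (2 * r)) \<le> emeasure D (cball x r)"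
      using jK by (auto simp: j K_def eD)
    have "(\<integral>\<^sup>+x. indicator (ball (fst j) (5 * snd j)) x \<partial>lborel) = ennreal (10 * r)"
      using r by (simp add: j ball_eq_greaterThanLessThan)
    also have "\<dots> = ennreal (5 / lam) * ennreal (lam * (2 * r))"
      using lam r by (simp add: ennreal_mult[symmetric])
    also have "\<dots> \<le> ennreal (5 / lam) * emeasure D (cball x r)"
      by (rule mult_left_mono[OF r(2)]) simp
    finally show "(\<integral>\<^sup>+x. indicator (ball (fst j) (5 * snd j)) x \<partial>lborel) \<le> ennreal (5 / lam) * emeasure D (cball (fst j) (snd j))"
      by (simp add: j)
  qed
  also have "\<dots> = ennreal (5 / lam) * (\<integral>\<^sup>+j. emeasure D (cball (fst j) (snd j)) \<partial>count_space C)"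
    by (rule nn_integral_cmult) simp
  also have "(\<integral>\<^sup>+j. emeasure D (cball (fst j) (snd j)) \<partial>count_space C) = emeasure D (\<Union>j\<in>C. cball (fst j) (snd j))"
    using C(1,3) by (intro emeasure_UN_countable[symmetric])
      (auto simp: D_def disjoint_family_on_def pairwise_def disjnt_def)
  also have "\<dots> \<le> emeasure D (space D)"
    by (rule emeasure_space)
  also have "\<dots> = ennreal A"
    using fin by (simp add: D_def emeasure_density)
  finally have "emeasure lborel B \<le> ennreal (5 / lam) * ennreal A" by (simp add: mult_left_mono)
  also have "\<dots> = ennreal (5 * A / lam)" using lam A by (simp add: ennreal_mult[symmetric])
  finally have eB: "emeasure lborel B \<le> ennreal (5 * A / lam)" .
  have "(\<integral>\<^sup>+s. ennreal (g s) * indicator (cball x r) s \<partial>lborel) \<le> ennreal (lam * (2 * r))"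
    if "x \<notin> B" "0 < r" for x r
  proof (rule ccontr)
    assume "\<not> ?thesis"
    then have "(x, r) \<in> K" using that by (auto simp: K_def)
    from C(4)[OF this] obtain j where "j \<in> C" "cball x r \<subseteq> ball (fst j) (5 * snd j)" by auto
    moreover have "x \<in> cball x r" using that by simp
    ultimately have "x \<in> B" unfolding B_def by blast
    then show False using that by simp
  qed
  then show ?thesis using Bm eB by blast
qed

text \<open>If |u| lies between 2^(j-1) y and 2^j y, then y / u^2 is at most 4 / (4^j y). Enlarging
  this annulus to the full interval produces averages over balls, which is what the maximal theorem
  controls.\<close>

lemma pker_le_dyadic:
  assumes y: "0 < y"
  shows "ennreal (pker y u) \<le> (\<Sum>j. ennreal (4 / 4 ^ j / y) * indicator {v. \<bar>v\<bar> \<le> 2 ^ j * y} u)"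
proof -
  define P where "P j \<longleftrightarrow> \<bar>u\<bar> \<le> 2 ^ j * y" for j :: nat
  obtain n :: nat where "\<bar>u\<bar> / y < 2 ^ n" using real_arch_pow[of 2 "\<bar>u\<bar> / y"] by auto
  then have Pn: "P n" using y by (simp add: P_def field_simps)
  define j where "j = (LEAST j. P j)"
  have Pj: "P j" unfolding j_def using Pn by (rule LeastI)
  have le: "pker y u \<le> 4 / 4 ^ j / y"
  proof (cases j)
    case 0
    have "1 / y \<le> 4 / y" using y by (simp add: divide_right_mono)
    then show ?thesis using pker_le[OF y, of u] 0 by simp
  next
    case (Suc i)
    have "\<not> P i" using not_less_Least[of i P] Suc by (simp add: j_def)
    then have "2 ^ i * y < \<bar>u\<bar>" by (simp add: P_def)
    then have "(2 ^ i * y)\<^sup>2 \<le> \<bar>u\<bar>\<^sup>2" using y by (intro power_mono) auto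
    moreover have "(2 ^ i * y)\<^sup>2 = 4 ^ i * y\<^sup>2"
    proof -
      have "((2::real) ^ i)\<^sup>2 = 4 ^ i" by (simp add: power2_eq_square power_mult_distrib[symmetric])
      then show ?thesis by (simp add: power_mult_distrib)
    qed
    ultimately have sq: "4 ^ i * y\<^sup>2 \<le> u\<^sup>2 + y\<^sup>2" by (simp add: add_increasing2)
    have "pker y u \<le> y / (4 ^ i * y\<^sup>2)"
      unfolding pker_def using sq y by (intro divide_left_mono) (auto intro!: mult_pos_pos add_nonneg_pos)
    also have "\<dots> = 4 / 4 ^ j / y" using y Suc by (simp add: power2_eq_square)
    finally show ?thesis .
  qed
  have "ennreal (pker y u) \<le> ennreal (4 / 4 ^ j / y) * indicator {v. \<bar>v\<bar> \<le> 2 ^ j * y} u"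
    using le Pj by (simp add: P_def ennreal_leI)
  also have "\<dots> = (\<Sum>i\<in>{j}. ennreal (4 / 4 ^ i / y) * indicator {v. \<bar>v\<bar> \<le> 2 ^ i * y} u)"
    by (simp only: sum.insert sum.empty finite.emptyI empty_iff not_False_eq_True add_0_right)
  also have "\<dots> \<le> (\<Sum>i. ennreal (4 / 4 ^ i / y) * indicator {v. \<bar>v\<bar> \<le> 2 ^ i * y} u)"
    by (rule sum_le_suminf) auto
  finally show ?thesis .
qed

text \<open>The j-th dyadic interval has length 2^(j+1) y and weight 4 / (4^j y), so it contributes
  at most 8 lam / 2^j; the geometric series sums to 16 lam.\<close>

lemma nn_integral_pker_le_averages:
  fixes g :: "real \<Rightarrow> real"
  assumes [measurable]: "g \<in> borel_measurable borel" and lam: "0 < lam" and y: "0 < y"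
    and av: "\<And>r. 0 < r \<Longrightarrow> (\<integral>\<^sup>+s. ennreal (g s) * indicator (cball x r) s \<partial>lborel) \<le> ennreal (lam * (2 * r))"
  shows "(\<integral>\<^sup>+s. ennreal (pker y (s - x)) * ennreal (g s) \<partial>lborel) \<le> ennreal (16 * lam)"
proof -
  have "(\<integral>\<^sup>+s. ennreal (pker y (s - x)) * ennreal (g s) \<partial>lborel) \<le>
    (\<integral>\<^sup>+s. (\<Sum>j. ennreal (4 / 4 ^ j / y) * (ennreal (g s) * indicator (cball x (2 ^ j * y)) s)) \<partial>lborel)"
  proof (intro nn_integral_mono)
    fix s
    have "ennreal (pker y (s - x)) * ennreal (g s) \<le>
       (\<Sum>j. ennreal (4 / 4 ^ j / y) * indicator {v. \<bar>v\<bar> \<le> 2 ^ j * y} (s - x)) * ennreal (g s)"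
      by (rule mult_right_mono[OF pker_le_dyadic[OF y]]) simp
    also have "\<dots> = (\<Sum>j. ennreal (4 / 4 ^ j / y) * indicator {v. \<bar>v\<bar> \<le> 2 ^ j * y} (s - x) * ennreal (g s))"
      by (rule ennreal_suminf_multc[symmetric])
    also have "\<dots> = (\<Sum>j. ennreal (4 / 4 ^ j / y) * (ennreal (g s) * indicator (cball x (2 ^ j * y)) s))"
      by (intro suminf_cong) (auto simp: indicator_def dist_real_def abs_minus_commute)
    finally show "ennreal (pker y (s - x)) * ennreal (g s) \<le>
       (\<Sum>j. ennreal (4 / 4 ^ j / y) * (ennreal (g s) * indicator (cball x (2 ^ j * y)) s))" .
  qed
  also have "\<dots> = (\<Sum>j. ennreal (4 / 4 ^ j / y) * (\<integral>\<^sup>+s. ennreal (g s) * indicator (cball x (2 ^ j * y)) s \<partial>lborel))"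
  proof -
    have [measurable]: "(\<lambda>s. ennreal (g s) * indicator (cball x (2 ^ j * y)) s) \<in> borel_measurable lborel" for j :: nat
      by (intro borel_measurable_times_ennreal borel_measurable_indicator) auto
    show ?thesis by (subst nn_integral_suminf) (auto simp: nn_integral_cmult)
  qed
  also have "\<dots> \<le> (\<Sum>j. ennreal (8 * lam * (1 / 2) ^ j))"
  proof (intro suminf_le)
    fix j :: nat
    have "ennreal (4 / 4 ^ j / y) * (\<integral>\<^sup>+s. ennreal (g s) * indicator (cball x (2 ^ j * y)) s \<partial>lborel)
      \<le> ennreal (4 / 4 ^ j / y) * ennreal (lam * (2 * (2 ^ j * y)))"
      using y by (intro mult_left_mono av) auto
    also have "\<dots> = ennreal (4 / 4 ^ j / y * (lam * (2 * (2 ^ j * y))))"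
      using y lam by (simp add: ennreal_mult[symmetric])
    also have "4 / 4 ^ j / y * (lam * (2 * (2 ^ j * y))) = 8 * lam * (1 / 2) ^ j"
    proof -
      have "(4::real) ^ j = 2 ^ j * 2 ^ j" by (simp add: power_mult_distrib[symmetric])
      then show ?thesis using y by (simp add: power_divide field_simps)
    qed
    finally show "ennreal (4 / 4 ^ j / y) * (\<integral>\<^sup>+s. ennreal (g s) * indicator (cball x (2 ^ j * y)) s \<partial>lborel)
      \<le> ennreal (8 * lam * (1 / 2) ^ j)" .
  qed auto
  also have "\<dots> = ennreal (\<Sum>j. 8 * lam * (1 / 2) ^ j)"
    using lam by (intro suminf_ennreal2) (auto intro!: summable_mult summable_geometric)
  also have "(\<Sum>j. 8 * lam * (1 / 2) ^ j) = 16 * lam"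
    by (subst suminf_mult) (auto simp: suminf_geometric intro!: summable_geometric)
  finally show ?thesis .
qed

text \<open>The maximal theorem is used at the level c / 16, whence 80 = 5 * 16.\<close>

lemma Poisson_maximal_weak:
  fixes g :: "real \<Rightarrow> real"
  assumes [measurable]: "g \<in> borel_measurable borel" and c: "0 < c"
    and fin: "(\<integral>\<^sup>+s. ennreal (g s) \<partial>lborel) = ennreal A" and A: "0 \<le> A"
  shows "\<exists>B \<in> sets borel. emeasure lborel B \<le> ennreal (80 * A / c) \<and>
    (\<forall>x. x \<notin> B \<longrightarrow> (\<forall>y>0. (\<integral>\<^sup>+s. ennreal (pker y (s - x)) * ennreal (g s) \<partial>lborel) \<le> ennreal c))"
proof -
  obtain B where B: "B \<in> sets borel" "emeasure lborel B \<le> ennreal (5 * A / (c / 16))"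
     "\<forall>x. x \<notin> B \<longrightarrow> (\<forall>r>0. (\<integral>\<^sup>+s. ennreal (g s) * indicator (cball x r) s \<partial>lborel) \<le> ennreal (c / 16 * (2 * r)))"
    using Hardy_Littlewood_weak[OF assms(1) _ fin A, of "c / 16"] c by auto
  have "(\<integral>\<^sup>+s. ennreal (pker y (s - x)) * ennreal (g s) \<partial>lborel) \<le> ennreal c"
    if "x \<notin> B" "0 < y" for x y
    using nn_integral_pker_le_averages[of g "c / 16" y x] B(3) that c by simp
  moreover have "5 * A / (c / 16) = 80 * A / c" by simp
  ultimately show ?thesis using B(1,2) by metis
qed

section \<open>The Cauchy transform and truncated Hilbert kernels\<close>

text \<open>The Cauchy integral, with the sign chosen so that its imaginary part is a positive
  Poisson integral when \<open>f\<close> is non-negative.\<close>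

definition ctr :: "(real \<Rightarrow> real) \<Rightarrow> complex \<Rightarrow> complex" where
  "ctr f z = (LINT t|lborel. complex_of_real (f t) / (complex_of_real t - z))"

lemma norm_of_real_minus_ge_Im: "\<bar>Im z\<bar> \<le> cmod (complex_of_real t - z)"
  using abs_Im_le_cmod[of "complex_of_real t - z"] by simp

lemma integrable_ctr:
  assumes f: "integrable lborel f" and z: "0 < Im z"
  shows "integrable lborel (\<lambda>t. complex_of_real (f t) / (complex_of_real t - z))"
proof (rule Bochner_Integration.integrable_bound)
  show "integrable lborel (\<lambda>t. f t / Im z)" using f by simp
  have [measurable]: "f \<in> borel_measurable borel" using f by auto
  show "(\<lambda>t. complex_of_real (f t) / (complex_of_real t - z)) \<in> borel_measurable lborel" by measurable
  show "AE t in lborel. norm (complex_of_real (f t) / (complex_of_real t - z)) \<le> norm (f t / Im z)"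
  proof (rule AE_I2)
    fix t
    have "\<bar>f t\<bar> / cmod (complex_of_real t - z) \<le> \<bar>f t\<bar> / Im z"
      using norm_of_real_minus_ge_Im[of z t] z by (intro divide_left_mono mult_pos_pos) auto
    then show "norm (complex_of_real (f t) / (complex_of_real t - z)) \<le> norm (f t / Im z)"
      using z by (simp add: norm_divide)
  qed
qed

lemma norm_ctr_le:
  assumes f: "integrable lborel f" and z: "0 < Im z"
  shows "cmod (ctr f z) \<le> (LINT t|lborel. \<bar>f t\<bar>) / Im z"
proof -
  have "cmod (ctr f z) \<le> (LINT t|lborel. norm (complex_of_real (f t) / (complex_of_real t - z)))"
    unfolding ctr_def by (rule integral_norm_bound)
  also have "\<dots> \<le> (LINT t|lborel. \<bar>f t\<bar> / Im z)"
  proof (rule integral_mono)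
    show "integrable lborel (\<lambda>t. norm (complex_of_real (f t) / (complex_of_real t - z)))"
      by (rule integrable_norm[OF integrable_ctr[OF f z]])
    show "integrable lborel (\<lambda>t. \<bar>f t\<bar> / Im z)" using f by simp
    fix t
    show "norm (complex_of_real (f t) / (complex_of_real t - z)) \<le> \<bar>f t\<bar> / Im z"
      using norm_of_real_minus_ge_Im[of z t] z by (auto simp: norm_divide intro!: divide_left_mono mult_pos_pos)
  qed
  finally show ?thesis by simp
qed

text \<open>Differentiation under the integral with an explicit error: the difference quotient minus
  the candidate derivative carries a factor \<open>h\<close>, and for |h| < d / 2 the remaining
  kernel is at most 2 / d^3.\<close>

lemma holomorphic_ctr:
  assumes f: "integrable lborel f"
  shows "ctr f holomorphic_on {z. 0 < Im z}"
proof -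
  define D where "D = (\<lambda>z. LINT t|lborel. complex_of_real (f t) / (complex_of_real t - z)\<^sup>2)"
  have [measurable]: "f \<in> borel_measurable borel" using f by auto
  have "(ctr f has_field_derivative D z) (at z)" if z: "0 < Im z" for z
  proof -
    define d where "d = Im z"
    define M where "M = (LINT t|lborel. \<bar>f t\<bar>)"
    have M: "0 \<le> M" unfolding M_def by simp
    have iD: "integrable lborel (\<lambda>t. complex_of_real (f t) / (complex_of_real t - z)\<^sup>2)"
    proof (rule Bochner_Integration.integrable_bound)
      show "integrable lborel (\<lambda>t. f t / d\<^sup>2)" using f by simp
      show "AE t in lborel. norm (complex_of_real (f t) / (complex_of_real t - z)\<^sup>2) \<le> norm (f t / d\<^sup>2)"
      proof (rule AE_I2)
        fix t
        have "d\<^sup>2 \<le> (cmod (complex_of_real t - z))\<^sup>2"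
          using norm_of_real_minus_ge_Im[of z t] z by (intro power_mono) (auto simp: d_def)
        then have "\<bar>f t\<bar> / (cmod (complex_of_real t - z))\<^sup>2 \<le> \<bar>f t\<bar> / d\<^sup>2"
          using z by (intro divide_left_mono mult_pos_pos) (auto simp: d_def)
        then show "norm (complex_of_real (f t) / (complex_of_real t - z)\<^sup>2) \<le> norm (f t / d\<^sup>2)"
          by (simp add: norm_divide norm_power)
      qed
    qed auto
    have est: "cmod ((ctr f (z + h) - ctr f z) / h - D z) \<le> cmod h * (2 * M / d ^ 3)"
      if h: "h \<noteq> 0" "cmod h < d / 2" for h
    proof -
      have zh: "d / 2 \<le> Im (z + h)" using h abs_Im_le_cmod[of h] by (simp add: d_def)
      then have zh0: "0 < Im (z + h)" using z by (simp add: d_def)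
      note i1 = integrable_ctr[OF f z] and i2 = integrable_ctr[OF f zh0]
      have "(ctr f (z + h) - ctr f z) / h - D z =
        (LINT t|lborel. (complex_of_real (f t) / (complex_of_real t - (z + h)) - complex_of_real (f t) / (complex_of_real t - z)) / h
           - complex_of_real (f t) / (complex_of_real t - z)\<^sup>2)"
        unfolding ctr_def D_def using i1 i2 iD by simp
      also have "\<dots> = (LINT t|lborel. h * (complex_of_real (f t) / ((complex_of_real t - z)\<^sup>2 * (complex_of_real t - (z + h)))))"
      proof (rule Bochner_Integration.integral_cong)
        fix t
        have a: "complex_of_real t - z \<noteq> 0" "complex_of_real t - (z + h) \<noteq> 0"
          using z zh0 by (auto simp: complex_eq_iff)
        show "(complex_of_real (f t) / (complex_of_real t - (z + h)) - complex_of_real (f t) / (complex_of_real t - z)) / h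
           - complex_of_real (f t) / (complex_of_real t - z)\<^sup>2 = h * (complex_of_real (f t) / ((complex_of_real t - z)\<^sup>2 * (complex_of_real t - (z + h))))"
        proof -
          define p q where "p = complex_of_real t - z" and "q = complex_of_real t - (z + h)"
          have hpq: "h = p - q" by (simp add: p_def q_def)
          have "(complex_of_real (f t) / q - complex_of_real (f t) / p) / h - complex_of_real (f t) / p\<^sup>2 = h * (complex_of_real (f t) / (p\<^sup>2 * q))"
            using a h(1) by (simp add: p_def[symmetric] q_def[symmetric] divide_simps) (simp add: hpq power2_eq_square algebra_simps)
          then show ?thesis by (simp add: p_def q_def)
        qed
      qed simp
      also have "cmod \<dots> \<le> (LINT t|lborel. cmod h * (2 / d ^ 3) * \<bar>f t\<bar>)"
      proof (rule Bochner_Integration.integral_norm_bound_integral)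
        show i3: "integrable lborel (\<lambda>t. cmod h * (2 / d ^ 3) * \<bar>f t\<bar>)" using f by simp
        show bd: "norm (h * (complex_of_real (f t) / ((complex_of_real t - z)\<^sup>2 * (complex_of_real t - (z + h))))) \<le> cmod h * (2 / d ^ 3) * \<bar>f t\<bar>" for t
        proof -
          have "d\<^sup>2 * (d / 2) \<le> (cmod (complex_of_real t - z))\<^sup>2 * cmod (complex_of_real t - (z + h))"
            using norm_of_real_minus_ge_Im[of z t] norm_of_real_minus_ge_Im[of "z + h" t] z zh
            by (intro mult_mono power_mono) (auto simp: d_def)
          moreover have "0 < (cmod (complex_of_real t - z))\<^sup>2 * cmod (complex_of_real t - (z + h))"
            using norm_of_real_minus_ge_Im[of z t] norm_of_real_minus_ge_Im[of "z + h" t] z zh0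
            by (intro mult_pos_pos zero_less_power) linarith+
          ultimately have "\<bar>f t\<bar> / ((cmod (complex_of_real t - z))\<^sup>2 * cmod (complex_of_real t - (z + h))) \<le> \<bar>f t\<bar> / (d\<^sup>2 * (d / 2))"
            using z by (intro divide_left_mono) (auto simp: d_def intro!: mult_pos_pos)
          then have "cmod h * (\<bar>f t\<bar> / ((cmod (complex_of_real t - z))\<^sup>2 * cmod (complex_of_real t - (z + h)))) \<le> cmod h * (\<bar>f t\<bar> / (d\<^sup>2 * (d / 2)))"
            by (rule mult_left_mono) simp
          then show ?thesis by (simp add: norm_mult norm_divide norm_power power3_eq_cube power2_eq_square mult_ac)
        qed
        show "integrable lborel (\<lambda>t. h * (complex_of_real (f t) / ((complex_of_real t - z)\<^sup>2 * (complex_of_real t - (z + h)))))"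
          by (rule Bochner_Integration.integrable_bound[OF i3]) (use bd z in \<open>auto intro!: AE_I2 simp: d_def\<close>)
      qed
      also have "\<dots> = cmod h * (2 * M / d ^ 3)" by (simp add: M_def)
      finally show ?thesis .
    qed
    have "((\<lambda>h. (ctr f (z + h) - ctr f z) / h - D z) \<longlongrightarrow> 0) (at 0)"
    proof (rule Lim_null_comparison)
      show "eventually (\<lambda>h. norm ((ctr f (z + h) - ctr f z) / h - D z) \<le> cmod h * (2 * M / d ^ 3)) (at 0)"
        unfolding eventually_at
        by (rule exI[of _ "d / 2"]) (use z est in \<open>auto simp: d_def\<close>)
      show "((\<lambda>h. cmod h * (2 * M / d ^ 3)) \<longlongrightarrow> 0) (at 0)"
        by (rule tendsto_mult_left_zero, rule tendsto_norm_zero) (rule tendsto_ident_at)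
    qed
    then show ?thesis unfolding DERIV_def by (simp add: LIM_zero_iff)
  qed
  then have "ctr f field_differentiable at z within {z. 0 < Im z}" if "0 < Im z" for z
    using that by (meson field_differentiable_at_within field_differentiable_def)
  then show ?thesis by (simp add: holomorphic_on_def)
qed

lemma integrable_mult_bounded:
  fixes f k :: "real \<Rightarrow> real"
  assumes "integrable lborel f" and [measurable]: "k \<in> borel_measurable borel" and k: "\<And>t. \<bar>k t\<bar> \<le> C"
  shows "integrable lborel (\<lambda>t. f t * k t)"
proof (rule Bochner_Integration.integrable_bound)
  have [measurable]: "f \<in> borel_measurable borel" using assms(1) by auto
  show "integrable lborel (\<lambda>t. C * f t)" using assms(1) by simp
  show "(\<lambda>t. f t * k t) \<in> borel_measurable lborel" by measurable
  have "0 \<le> C" using k[of 0] by linarith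
  have "\<bar>f t\<bar> * \<bar>k t\<bar> \<le> \<bar>f t\<bar> * C" for t by (rule mult_left_mono[OF k]) simp
  then show "AE t in lborel. norm (f t * k t) \<le> norm (C * f t)"
    using \<open>0 \<le> C\<close> by (auto simp: abs_mult mult.commute)
qed

text \<open>The conjugate Poisson kernel, that is, the real part of 1 / (u - i y), whose imaginary
  part is \<open>pker y u\<close>.\<close>

definition qker :: "real \<Rightarrow> real \<Rightarrow> real" where
  "qker y u = u / (u\<^sup>2 + y\<^sup>2)"

definition hker :: "real \<Rightarrow> real \<Rightarrow> real" where
  "hker e u = (if e < \<bar>u\<bar> then 1 / u else 0)"

lemma borel_measurable_qker [measurable]: "qker y \<in> borel_measurable borel"
  unfolding qker_def by measurable

lemma borel_measurable_hker [measurable]: "hker e \<in> borel_measurable borel"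
  unfolding hker_def by measurable

lemma abs_pker_le: "0 < y \<Longrightarrow> \<bar>pker y u\<bar> \<le> 1 / y"
  using pker_le[of y u] pker_nonneg[of y u] by simp

lemma abs_hker_le: "0 < e \<Longrightarrow> \<bar>hker e u\<bar> \<le> 1 / e"
  by (auto simp: hker_def abs_div frac_le)

text \<open>For |u| > y the difference equals (y / u) \<open>pker y u\<close>; for |u| <= y only the
  conjugate kernel is left and |u| <= y bounds its numerator. Hence a sharp truncation at radius
  \<open>y\<close> may be traded for the harmonic extension at height \<open>y\<close>.\<close>

lemma abs_hker_minus_qker_le:
  assumes y: "0 < y"
  shows "\<bar>hker y u - qker y u\<bar> \<le> pker y u"
proof (cases "y < \<bar>u\<bar>")
  case True
  have pos: "0 < u\<^sup>2 + y\<^sup>2" using y by (simp add: add_nonneg_pos)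
  have u: "u \<noteq> 0" using True y by auto
  have "hker y u - qker y u = y / u * (y / (u\<^sup>2 + y\<^sup>2))"
    using True u pos by (simp add: hker_def qker_def divide_simps) (simp add: power2_eq_square algebra_simps)
  then have "\<bar>hker y u - qker y u\<bar> = y / \<bar>u\<bar> * (y / (u\<^sup>2 + y\<^sup>2))"
    using y pos by (simp add: abs_mult)
  also have "\<dots> \<le> 1 * (y / (u\<^sup>2 + y\<^sup>2))"
    using True y pos by (intro mult_right_mono) auto
  finally show ?thesis by (simp add: pker_def)
next
  case False
  have pos: "0 < u\<^sup>2 + y\<^sup>2" using y by (simp add: add_nonneg_pos)
  then show ?thesis using False by (simp add: hker_def qker_def pker_def divide_right_mono)
qed

lemma abs_qker_le:
  assumes "0 < y" shows "\<bar>qker y u\<bar> \<le> 2 / y"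
  using abs_hker_minus_qker_le[OF assms, of u] abs_hker_le[OF assms, of u] pker_le[OF assms, of u] by simp

lemma ctr_Re_Im:
  assumes f: "integrable lborel f" and y: "0 < y"
  shows "Im (ctr f (Complex x y)) = (LINT t|lborel. f t * pker y (t - x))"
    and "Re (ctr f (Complex x y)) = (LINT t|lborel. f t * qker y (t - x))"
proof -
  have i: "integrable lborel (\<lambda>t. complex_of_real (f t) / (complex_of_real t - Complex x y))"
    using integrable_ctr[OF f, of "Complex x y"] y by simp
  have e: "complex_of_real (f t) / (complex_of_real t - Complex x y) = Complex (f t * qker y (t - x)) (f t * pker y (t - x))" for t
    by (simp add: complex_eq_iff Re_divide Im_divide qker_def pker_def)
  show "Im (ctr f (Complex x y)) = (LINT t|lborel. f t * pker y (t - x))"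
    unfolding ctr_def using integral_Im[OF i] by (simp add: e)
  show "Re (ctr f (Complex x y)) = (LINT t|lborel. f t * qker y (t - x))"
    unfolding ctr_def using integral_Re[OF i] by (simp add: e)
qed

text \<open>The real part of \<open>ctr\<close> is the smoothed truncation and its imaginary part
  bounds the smoothing error, because \<open>f\<close> is non-negative. Each accounts for one of the
  two copies of the modulus.\<close>

lemma truncated_le_ctr:
  assumes f: "integrable lborel f" and nn: "\<And>t. 0 \<le> f t" and y: "0 < y"
  shows "\<bar>LINT t|lborel. f t * hker y (t - x)\<bar> \<le> 2 * cmod (ctr f (Complex x y))"
proof -
  have ih: "integrable lborel (\<lambda>t. f t * hker y (t - x))"
    by (rule integrable_mult_bounded[OF f]) (auto intro: abs_hker_le[OF y])
  have ip: "integrable lborel (\<lambda>t. f t * pker y (t - x))"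
    by (rule integrable_mult_bounded[OF f]) (auto intro: abs_pker_le[OF y])
  have iq: "integrable lborel (\<lambda>t. f t * qker y (t - x))"
    by (rule integrable_mult_bounded[OF f]) (auto intro: abs_qker_le[OF y])
  have "\<bar>(LINT t|lborel. f t * hker y (t - x)) - (LINT t|lborel. f t * qker y (t - x))\<bar>
     = \<bar>LINT t|lborel. f t * hker y (t - x) - f t * qker y (t - x)\<bar>"
    using ih iq by simp
  also have "\<dots> \<le> (LINT t|lborel. \<bar>f t * hker y (t - x) - f t * qker y (t - x)\<bar>)"
    by (rule integral_abs_bound)
  also have "\<dots> \<le> (LINT t|lborel. f t * pker y (t - x))"
  proof (rule integral_mono)
    show "integrable lborel (\<lambda>t. \<bar>f t * hker y (t - x) - f t * qker y (t - x)\<bar>)"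
      using ih iq by (intro integrable_abs Bochner_Integration.integrable_diff)
    show "\<bar>f t * hker y (t - x) - f t * qker y (t - x)\<bar> \<le> f t * pker y (t - x)" for t
      using abs_hker_minus_qker_le[OF y, of "t - x"] nn[of t]
      by (simp add: right_diff_distrib[symmetric] abs_mult mult_left_mono)
  qed (rule ip)
  finally show ?thesis
    using ctr_Re_Im[OF f y, of x] abs_Re_le_cmod[of "ctr f (Complex x y)"] abs_Im_le_cmod[of "ctr f (Complex x y)"]
    by linarith
qed

text \<open>\<open>n * pker n s\<close> is n^2 / (s^2 + n^2) and tends to 1, so Fatou recovers the
  full integral from Poisson means taken at large heights. The error \<open>e\<close> leaves room
  for terms that only vanish in the limit.\<close>

lemma nn_integral_le_of_Poisson_bound:
  fixes u :: "real \<Rightarrow> ennreal" and e :: "nat \<Rightarrow> real"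
  assumes [measurable]: "u \<in> borel_measurable borel"
    and le: "\<And>n::nat. 0 < n \<Longrightarrow> (\<integral>\<^sup>+s. ennreal (n * pker n s) * u s \<partial>lborel) \<le> ennreal (K + e n)"
    and e: "e \<longlonglongrightarrow> 0"
  shows "(\<integral>\<^sup>+s. u s \<partial>lborel) \<le> ennreal K"
proof -
  have lim: "(\<lambda>n. ennreal (real n * pker (real n) s) * u s) \<longlonglongrightarrow> u s" for s
  proof -
    have "(\<lambda>n. real n * pker (real n) s) \<longlonglongrightarrow> 1" unfolding pker_def by real_asymp
    then have "(\<lambda>n. ennreal (real n * pker (real n) s)) \<longlonglongrightarrow> ennreal 1" by (rule tendsto_ennrealI)
    then have "(\<lambda>n. ennreal (real n * pker (real n) s) * u s) \<longlonglongrightarrow> ennreal 1 * u s"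
      by (rule tendsto_mult_ennreal) auto
    then show ?thesis by simp
  qed
  have "(\<integral>\<^sup>+s. u s \<partial>lborel) = (\<integral>\<^sup>+s. liminf (\<lambda>n. ennreal (real n * pker (real n) s) * u s) \<partial>lborel)"
    using lim_imp_Liminf[OF _ lim] by (simp add: trivial_limit_sequentially)
  also have "\<dots> \<le> liminf (\<lambda>n. \<integral>\<^sup>+s. ennreal (real n * pker (real n) s) * u s \<partial>lborel)"
    by (rule nn_integral_liminf) measurable
  also have "\<dots> \<le> liminf (\<lambda>n. ennreal (K + e n))"
    by (rule Liminf_mono, rule eventually_mono[OF eventually_gt_at_top[of "0::nat"]]) (rule le)
  also have "\<dots> = ennreal K"
  proof (rule lim_imp_Liminf)
    show "(\<lambda>n. ennreal (K + e n)) \<longlonglongrightarrow> ennreal K"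
      by (rule tendsto_ennrealI) (use tendsto_add[OF tendsto_const e, of K] in simp)
  qed simp
  finally show ?thesis .
qed

section \<open>Weak-type estimates\<close>

lemma Poisson_maximal_weak_le:
  fixes g :: "real \<Rightarrow> real"
  assumes g: "g \<in> borel_measurable borel" and c: "0 < c"
    and fin: "(\<integral>\<^sup>+s. ennreal (g s) \<partial>lborel) \<le> ennreal A" and A: "0 \<le> A"
  shows "\<exists>B \<in> sets borel. emeasure lborel B \<le> ennreal (80 * A / c) \<and>
    (\<forall>x. x \<notin> B \<longrightarrow> (\<forall>y>0. (\<integral>\<^sup>+s. ennreal (pker y (s - x)) * ennreal (g s) \<partial>lborel) \<le> ennreal c))"
proof -
  have "(\<integral>\<^sup>+s. ennreal (g s) \<partial>lborel) < top" using fin by (rule le_less_trans) simp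
  then obtain A' where A': "0 \<le> A'" "(\<integral>\<^sup>+s. ennreal (g s) \<partial>lborel) = ennreal A'"
    by (metis ennreal_cases less_irrefl)
  then have "A' \<le> A" using fin A by simp
  then have "ennreal (80 * A' / c) \<le> ennreal (80 * A / c)"
    using c by (intro ennreal_leI divide_right_mono) auto
  then show ?thesis using Poisson_maximal_weak[OF g c A'(2) A'(1)] by (meson order_trans)
qed

lemma borel_measurable_holomorphic_line:
  assumes "v holomorphic_on {z. 0 < Im z}" and "0 < d"
  shows "(\<lambda>s. v (Complex s d)) \<in> borel_measurable borel"
proof (rule borel_measurable_continuous_onI)
  have "continuous_on UNIV (\<lambda>s. Complex s d)"
    unfolding Complex_eq by (intro continuous_intros)
  then show "continuous_on UNIV (\<lambda>s. v (Complex s d))"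
    by (rule continuous_on_compose2[OF holomorphic_on_imp_continuous_on[OF assms(1)]]) (use assms(2) in auto)
qed

lemma ctr_bound_strip:
  assumes f: "integrable lborel f" and d: "0 < d" and z: "d \<le> Im z"
  shows "cmod (ctr f z) \<le> (LINT t|lborel. \<bar>f t\<bar>) / d"
proof -
  have "(LINT t|lborel. \<bar>f t\<bar>) / Im z \<le> (LINT t|lborel. \<bar>f t\<bar>) / d"
    using d z by (intro divide_left_mono) auto
  then show ?thesis using norm_ctr_le[OF f, of z] d z by linarith
qed

text \<open>With \<open>F = ctr f\<close>, the function \<open>w = F / (F + i lam)\<close> has non-negative real part on the
  upper half-plane, and \<open>Re w \<ge> 1/2\<close> wherever \<open>\<bar>F\<bar> \<ge> lam\<close>. The total mass of \<open>Re w\<close> on a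
  horizontal line is read off from the decay of \<open>w\<close> at \<open>i y\<close> as \<open>y\<close> tends to infinity.\<close>

lemma weak11_ctr:
  assumes f: "integrable lborel f" and nn: "\<And>t. 0 \<le> f t" and lam: "0 < lam" and d: "0 < d"
  shows "\<exists>B \<in> sets borel. emeasure lborel B \<le> ennreal (80 * (pi * (LINT t|lborel. f t) / lam)) \<and>
    (\<forall>x. x \<notin> B \<longrightarrow> (\<forall>y>0. cmod (ctr f (Complex x (d + y))) < lam))"
proof -
  define m where "m = (LINT t|lborel. f t)"
  have m: "0 \<le> m" unfolding m_def using nn by simp
  have mabs: "(LINT t|lborel. \<bar>f t\<bar>) = m" unfolding m_def using nn by simp
  define w where "w = (\<lambda>z. ctr f z / (ctr f z + \<i> * lam))"
  have Im0: "0 \<le> Im (ctr f z)" if "0 < Im z" for z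
  proof -
    have "Im (ctr f (Complex (Re z) (Im z))) = (LINT t|lborel. f t * pker (Im z) (t - Re z))"
      by (rule ctr_Re_Im(1)[OF f that])
    also have "\<dots> \<ge> 0" using nn that by (intro integral_nonneg_AE AE_I2 mult_nonneg_nonneg pker_nonneg) auto
    finally show ?thesis by simp
  qed
  have den: "lam \<le> cmod (ctr f z + \<i> * lam)" "cmod (ctr f z) \<le> cmod (ctr f z + \<i> * lam)" if "0 < Im z" for z
  proof -
    show "lam \<le> cmod (ctr f z + \<i> * lam)"
      using abs_Im_le_cmod[of "ctr f z + \<i> * lam"] Im0[OF that] lam by simp
    have "(Im (ctr f z))\<^sup>2 \<le> (Im (ctr f z) + lam)\<^sup>2" using Im0[OF that] lam by (intro power_mono) auto
    then show "cmod (ctr f z) \<le> cmod (ctr f z + \<i> * lam)" by (simp add: cmod_def)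
  qed
  have hol: "w holomorphic_on {z. 0 < Im z}"
    unfolding w_def by (intro holomorphic_intros holomorphic_ctr[OF f]) (use den lam in fastforce)
  have Rew: "Re (w z) = ((cmod (ctr f z))\<^sup>2 + lam * Im (ctr f z)) / (cmod (ctr f z + \<i> * lam))\<^sup>2" for z
    unfolding w_def Re_divide cmod_power2 by (simp add: power2_eq_square algebra_simps)
  have Re0: "0 \<le> Re (w z)" if "0 < Im z" for z
    unfolding Rew using Im0[OF that] lam by simp
  have Rehalf: "1 / 2 \<le> Re (w z)" if "0 < Im z" "lam \<le> cmod (ctr f z)" for z
  proof -
    have "lam\<^sup>2 \<le> (cmod (ctr f z))\<^sup>2" using that lam by (intro power_mono) auto
    moreover have "(cmod (ctr f z + \<i> * lam))\<^sup>2 = (cmod (ctr f z))\<^sup>2 + 2 * lam * Im (ctr f z) + lam\<^sup>2"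
      unfolding cmod_power2 by (simp add: power2_eq_square algebra_simps)
    moreover have "0 < (cmod (ctr f z + \<i> * lam))\<^sup>2" using den(1)[OF that(1)] lam by (intro zero_less_power) linarith
    ultimately show ?thesis unfolding Rew by (simp add: field_simps)
  qed
  have wle: "cmod (w z) \<le> 1" if "0 < Im z" for z
    using den[OF that] lam by (simp add: w_def norm_divide divide_le_eq)
  define V where "V = (\<lambda>s. Re (w (Complex s d)))"
  have [measurable]: "V \<in> borel_measurable borel"
    unfolding V_def using borel_measurable_holomorphic_line[OF hol d] by measurable
  have V0: "0 \<le> V s" for s unfolding V_def using d by (intro Re0) simp
  have P: "(\<integral>\<^sup>+s. ennreal (pker y (s - x)) * ennreal (V s) \<partial>lborel) = ennreal (pi * Re (w (Complex x (d + y))))"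
    if y: "0 < y" for x y
  proof -
    have "has_bochner_integral lborel (\<lambda>s. complex_of_real (pker y (s - x)) * w (Complex s d)) (pi * w (Complex x (d + y)))"
      by (rule Poisson_formula[OF hol d _ y, where B = 1]) (use wle d in auto)
    then have "has_bochner_integral lborel (\<lambda>s. Re (complex_of_real (pker y (s - x)) * w (Complex s d))) (Re (pi * w (Complex x (d + y))))"
      by (rule has_bochner_integral_bounded_linear[OF bounded_linear_Re])
    then have h: "has_bochner_integral lborel (\<lambda>s. pker y (s - x) * V s) (pi * Re (w (Complex x (d + y))))"
      by (simp add: V_def)
    have "(\<integral>\<^sup>+s. ennreal (pker y (s - x)) * ennreal (V s) \<partial>lborel) = (\<integral>\<^sup>+s. ennreal (pker y (s - x) * V s) \<partial>lborel)"
      using y by (intro nn_integral_cong) (simp add: ennreal_mult pker_nonneg V0)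
    also have "\<dots> = ennreal (LINT s|lborel. pker y (s - x) * V s)"
      using h y by (intro nn_integral_eq_integral) (auto simp: has_bochner_integral_iff pker_nonneg V0)
    finally show ?thesis using h by (simp add: has_bochner_integral_iff)
  qed
  have VA: "(\<integral>\<^sup>+s. ennreal (V s) \<partial>lborel) \<le> ennreal (pi * m / lam)"
  proof (rule nn_integral_le_of_Poisson_bound[where e = "\<lambda>_. 0"])
    fix n :: nat assume n: "0 < n"
    have "(\<integral>\<^sup>+s. ennreal (n * pker n s) * ennreal (V s) \<partial>lborel) = (\<integral>\<^sup>+s. ennreal n * (ennreal (pker n (s - 0)) * ennreal (V s)) \<partial>lborel)"
      using n by (intro nn_integral_cong) (simp add: ennreal_mult pker_nonneg mult.assoc)
    also have "\<dots> = ennreal n * ennreal (pi * Re (w (Complex 0 (d + n))))"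
      using n P[of "real n" 0] by (subst nn_integral_cmult) auto
    also have "\<dots> = ennreal (n * (pi * Re (w (Complex 0 (d + n)))))"
      using Re0[of "Complex 0 (d + n)"] d by (intro ennreal_mult[symmetric]) auto
    also have "\<dots> \<le> ennreal (pi * m / lam + 0)"
    proof (rule ennreal_leI)
      have I: "0 < Im (Complex 0 (d + n))" using d by simp
      have "Re (w (Complex 0 (d + n))) \<le> cmod (w (Complex 0 (d + n)))" by (rule complex_Re_le_cmod)
      also have "\<dots> \<le> (m / (d + n)) / lam"
        unfolding w_def norm_divide
        using norm_ctr_le[OF f I] den(1)[OF I] lam d m by (intro frac_le) (auto simp: mabs)
      also have "\<dots> \<le> (m / n) / lam"
        using lam d m n by (intro divide_right_mono divide_left_mono mult_pos_pos) auto
      finally have "n * pi * Re (w (Complex 0 (d + n))) \<le> n * pi * ((m / n) / lam)"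
        by (intro mult_left_mono) auto
      then show "n * (pi * Re (w (Complex 0 (d + n)))) \<le> pi * m / lam + 0" using n by (simp add: field_simps)
    qed
    finally show "(\<integral>\<^sup>+s. ennreal (n * pker n s) * ennreal (V s) \<partial>lborel) \<le> ennreal (pi * m / lam + 0)" .
  qed auto
  \<comment> \<open>The level 1 is low enough: a value with modulus at least \<open>lam\<close>
    gives real part at least 1/2 and therefore a Poisson integral of at least pi / 2 > 1.\<close>
  obtain B where B: "B \<in> sets borel" "emeasure lborel B \<le> ennreal (80 * (pi * m / lam) / 1)"
    "\<forall>x. x \<notin> B \<longrightarrow> (\<forall>y>0. (\<integral>\<^sup>+s. ennreal (pker y (s - x)) * ennreal (V s) \<partial>lborel) \<le> ennreal 1)"
    using Poisson_maximal_weak_le[OF _ _ VA, of 1] m lam by auto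
  have "cmod (ctr f (Complex x (d + y))) < lam" if x: "x \<notin> B" and y: "0 < y" for x y
  proof (rule ccontr)
    assume "\<not> ?thesis"
    then have "1 / 2 \<le> Re (w (Complex x (d + y)))" using d y by (intro Rehalf) auto
    moreover have "ennreal (pi * Re (w (Complex x (d + y)))) \<le> ennreal 1"
      using B(3) x y by (simp add: P)
    then have "pi * Re (w (Complex x (d + y))) \<le> 1" by simp
    ultimately have "pi * (1 / 2) \<le> 1" by (smt (verit) mult_left_mono pi_gt_zero)
    then show False using pi_gt3 by simp
  qed
  then show ?thesis using B(1,2) unfolding m_def by auto
qed

text \<open>Jensen's inequality for the probability density \<open>pker / pi\<close>, in the form
  that a weighted variance is non-negative, followed by Tonelli. Each of the two steps costs one
  factor pi.\<close>

lemma Poisson_integral_square: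
  assumes f: "integrable lborel f" and f2: "integrable lborel (\<lambda>t. (f t)\<^sup>2)" and d: "0 < d"
  shows "(\<integral>\<^sup>+x. ennreal ((LINT t|lborel. f t * pker d (t - x))\<^sup>2) \<partial>lborel) \<le> ennreal (pi\<^sup>2 * (LINT t|lborel. (f t)\<^sup>2))"
proof -
  have [measurable]: "f \<in> borel_measurable borel" using f by auto
  have pt: "ennreal ((LINT t|lborel. f t * pker d (t - x))\<^sup>2) \<le> ennreal pi * (\<integral>\<^sup>+t. ennreal ((f t)\<^sup>2) * ennreal (pker d (t - x)) \<partial>lborel)" for x
  proof -
    define P where "P = (LINT t|lborel. f t * pker d (t - x))"
    have i1: "integrable lborel (\<lambda>t. f t * pker d (t - x))"
      by (rule integrable_mult_bounded[OF f]) (auto intro: abs_pker_le[OF d])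
    have i2: "integrable lborel (\<lambda>t. (f t)\<^sup>2 * pker d (t - x))"
      by (rule integrable_mult_bounded[OF f2]) (auto intro: abs_pker_le[OF d])
    have i3: "has_bochner_integral lborel (\<lambda>t. pker d (t - x)) pi"
      by (rule has_bochner_integral_pker_shift[OF d])
    have "0 \<le> (LINT t|lborel. (f t - P / pi)\<^sup>2 * pker d (t - x))"
      using d by (intro integral_nonneg_AE AE_I2 mult_nonneg_nonneg pker_nonneg) auto
    also have "\<dots> = (LINT t|lborel. (f t)\<^sup>2 * pker d (t - x) - (2 * P / pi) * (f t * pker d (t - x)) + (P / pi)\<^sup>2 * pker d (t - x))"
      by (intro Bochner_Integration.integral_cong) (auto simp: power2_eq_square algebra_simps)
    also have "\<dots> = (LINT t|lborel. (f t)\<^sup>2 * pker d (t - x)) - (2 * P / pi) * P + (P / pi)\<^sup>2 * pi"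
      using i1 i2 i3 by (simp add: P_def has_bochner_integral_iff)
    finally have "P\<^sup>2 \<le> pi * (LINT t|lborel. (f t)\<^sup>2 * pker d (t - x))"
      by (simp add: power2_eq_square field_simps)
    then have "ennreal (P\<^sup>2) \<le> ennreal pi * ennreal (LINT t|lborel. (f t)\<^sup>2 * pker d (t - x))"
      using d by (subst ennreal_mult[symmetric])
        (auto intro!: ennreal_leI integral_nonneg_AE AE_I2 mult_nonneg_nonneg pker_nonneg)
    also have "ennreal (LINT t|lborel. (f t)\<^sup>2 * pker d (t - x)) = (\<integral>\<^sup>+t. ennreal ((f t)\<^sup>2 * pker d (t - x)) \<partial>lborel)"
      using i2 d by (intro nn_integral_eq_integral[symmetric]) (auto simp: pker_nonneg)
    also have "\<dots> = (\<integral>\<^sup>+t. ennreal ((f t)\<^sup>2) * ennreal (pker d (t - x)) \<partial>lborel)"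
      using d by (intro nn_integral_cong) (simp add: ennreal_mult pker_nonneg)
    finally show ?thesis by (simp add: P_def)
  qed
  have "(\<integral>\<^sup>+x. ennreal ((LINT t|lborel. f t * pker d (t - x))\<^sup>2) \<partial>lborel) \<le>
     (\<integral>\<^sup>+x. ennreal pi * (\<integral>\<^sup>+t. ennreal ((f t)\<^sup>2) * ennreal (pker d (t - x)) \<partial>lborel) \<partial>lborel)"
    by (intro nn_integral_mono pt)
  also have "\<dots> = ennreal pi * (\<integral>\<^sup>+x. (\<integral>\<^sup>+t. ennreal ((f t)\<^sup>2) * ennreal (pker d (t - x)) \<partial>lborel) \<partial>lborel)"
    by (rule nn_integral_cmult) measurable
  also have "(\<integral>\<^sup>+x. (\<integral>\<^sup>+t. ennreal ((f t)\<^sup>2) * ennreal (pker d (t - x)) \<partial>lborel) \<partial>lborel) =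
     (\<integral>\<^sup>+t. (\<integral>\<^sup>+x. ennreal ((f t)\<^sup>2) * ennreal (pker d (t - x)) \<partial>lborel) \<partial>lborel)"
    by (rule lborel_pair.Fubini') measurable
  also have "\<dots> = (\<integral>\<^sup>+t. ennreal ((f t)\<^sup>2) * ennreal pi \<partial>lborel)"
  proof (intro nn_integral_cong)
    fix t
    have "(\<integral>\<^sup>+x. ennreal ((f t)\<^sup>2) * ennreal (pker d (t - x)) \<partial>lborel) = ennreal ((f t)\<^sup>2) * (\<integral>\<^sup>+x. ennreal (pker d (x - t)) \<partial>lborel)"
      by (subst nn_integral_cmult) (auto simp: pker_def power2_commute)
    also have "(\<integral>\<^sup>+x. ennreal (pker d (x - t)) \<partial>lborel) = ennreal pi"
      using has_bochner_integral_pker_shift[OF d, of t] d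
      by (subst nn_integral_eq_integral) (auto simp: has_bochner_integral_iff pker_nonneg)
    finally show "(\<integral>\<^sup>+x. ennreal ((f t)\<^sup>2) * ennreal (pker d (t - x)) \<partial>lborel) = ennreal ((f t)\<^sup>2) * ennreal pi" .
  qed
  also have "\<dots> = ennreal (LINT t|lborel. (f t)\<^sup>2) * ennreal pi"
    by (subst nn_integral_multc, simp, subst nn_integral_eq_integral[OF f2]) auto
  finally show ?thesis
    by (simp add: ennreal_mult[symmetric] power2_eq_square mult_ac)
qed

text \<open>Applied to \<open>F\<^sup>2\<close>, the same limit shows that on a horizontal line \<open>Re F\<close> and \<open>Im F\<close> have
  comparable square integrals; \<open>Im F\<close> is a Poisson integral of \<open>f\<close>.\<close>

lemma weak22_ctr:
  assumes f: "integrable lborel f" and f2: "integrable lborel (\<lambda>t. (f t)\<^sup>2)" and lam: "0 < lam" and d: "0 < d"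
  shows "\<exists>B \<in> sets borel. emeasure lborel B \<le> ennreal (80 * (2 * (pi\<^sup>2 * (LINT t|lborel. (f t)\<^sup>2))) / (3 * lam\<^sup>2)) \<and>
    (\<forall>x. x \<notin> B \<longrightarrow> (\<forall>y>0. cmod (ctr f (Complex x (d + y))) < lam))"
proof -
  define m where "m = (LINT t|lborel. \<bar>f t\<bar>)"
  define S where "S = pi\<^sup>2 * (LINT t|lborel. (f t)\<^sup>2)"
  have m: "0 \<le> m" unfolding m_def by simp
  have S: "0 \<le> S" unfolding S_def by simp
  define v where "v = (\<lambda>z. (ctr f z)\<^sup>2)"
  have hol: "v holomorphic_on {z. 0 < Im z}"
    unfolding v_def by (intro holomorphic_intros holomorphic_ctr[OF f])
  have bd: "cmod (v z) \<le> (m / d)\<^sup>2" if "d \<le> Im z" for z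
    unfolding v_def norm_power m_def using ctr_bound_strip[OF f d that] by (rule power_mono) simp
  define G where "G = (\<lambda>s. (cmod (ctr f (Complex s d)))\<^sup>2)"
  define P where "P = (\<lambda>s. Im (ctr f (Complex s d)))"
  have [measurable]: "(\<lambda>s. ctr f (Complex s d)) \<in> borel_measurable borel"
    by (rule borel_measurable_holomorphic_line[OF holomorphic_ctr[OF f] d])
  have [measurable]: "G \<in> borel_measurable borel" "P \<in> borel_measurable borel"
    unfolding G_def P_def by measurable
  have Peq: "P s = (LINT t|lborel. f t * pker d (t - s))" for s
    unfolding P_def by (rule ctr_Re_Im(1)[OF f d])
  have P2n: "(\<integral>\<^sup>+s. ennreal ((P s)\<^sup>2) \<partial>lborel) \<le> ennreal S"
    unfolding Peq S_def by (rule Poisson_integral_square[OF f f2 d])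
  have iP2: "integrable lborel (\<lambda>s. (P s)\<^sup>2)"
    by (rule integrableI_nonneg) (use P2n in \<open>auto intro: le_less_trans\<close>)
  have P2: "(LINT s|lborel. (P s)\<^sup>2) \<le> S"
    using P2n S nn_integral_eq_integral[OF iP2] by simp
  have Pf: "has_bochner_integral lborel (\<lambda>s. complex_of_real (pker y (s - x)) * v (Complex s d)) (pi * v (Complex x (d + y)))"
    if "0 < y" for x y
    by (rule Poisson_formula[OF hol d bd that])
  have GA: "(\<integral>\<^sup>+s. ennreal (G s) \<partial>lborel) \<le> ennreal (2 * S)"
  proof (rule nn_integral_le_of_Poisson_bound[where e = "\<lambda>n. pi * m\<^sup>2 * real n / (d + real n)\<^sup>2"])
    fix n :: nat assume n: "0 < n"
    have n': "0 < real n" using n by simp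
    have "has_bochner_integral lborel (\<lambda>s. Re (complex_of_real (pker n (s - 0)) * v (Complex s d))) (Re (pi * v (Complex 0 (d + n))))"
      by (rule has_bochner_integral_bounded_linear[OF bounded_linear_Re Pf[OF n']])
    then have h: "has_bochner_integral lborel (\<lambda>s. pker n s * Re (v (Complex s d))) (pi * Re (v (Complex 0 (d + n))))"
      by simp
    have i2: "integrable lborel (\<lambda>s. (P s)\<^sup>2 * pker n s)"
      by (rule integrable_mult_bounded[OF iP2]) (auto intro: abs_pker_le[OF n'])
    \<comment> \<open>|F|^2 = Re (F^2) + 2 (Im F)^2. The first summand is a Poisson mean of a
      holomorphic function and dies out with growing height; the second leaves the bound 2
      S.\<close>
    have Geq: "n * pker n s * G s = n * (pker n s * Re (v (Complex s d))) + 2 * n * ((P s)\<^sup>2 * pker n s)" for s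
      unfolding G_def v_def P_def cmod_power2 by (simp add: power2_eq_square algebra_simps)
    have iG: "integrable lborel (\<lambda>s. n * pker n s * G s)"
      unfolding Geq using h i2 by (auto simp: has_bochner_integral_iff)
    have "(\<integral>\<^sup>+s. ennreal (n * pker n s) * ennreal (G s) \<partial>lborel) = (\<integral>\<^sup>+s. ennreal (n * pker n s * G s) \<partial>lborel)"
      by (intro nn_integral_cong) (simp add: ennreal_mult pker_nonneg G_def)
    also have "\<dots> = ennreal (LINT s|lborel. n * pker n s * G s)"
      by (rule nn_integral_eq_integral[OF iG]) (simp add: pker_nonneg G_def)
    also have "(LINT s|lborel. n * pker n s * G s) = n * (pi * Re (v (Complex 0 (d + n)))) + 2 * n * (LINT s|lborel. (P s)\<^sup>2 * pker n s)"
      unfolding Geq using h i2 by (simp add: has_bochner_integral_iff)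
    also have "\<dots> \<le> n * (pi * (m / (d + n))\<^sup>2) + 2 * S"
    proof (rule add_mono)
      have "Re (v (Complex 0 (d + n))) \<le> cmod (v (Complex 0 (d + n)))" by (rule complex_Re_le_cmod)
      also have "\<dots> \<le> (m / (d + n))\<^sup>2"
        unfolding v_def norm_power m_def using norm_ctr_le[OF f, of "Complex 0 (d + n)"] d by (intro power_mono) auto
      finally have "n * pi * Re (v (Complex 0 (d + n))) \<le> n * pi * (m / (d + n))\<^sup>2" by (intro mult_left_mono) auto
      then show "n * (pi * Re (v (Complex 0 (d + n)))) \<le> n * (pi * (m / (d + n))\<^sup>2)" by simp
      have "n * (LINT s|lborel. (P s)\<^sup>2 * pker n s) = (LINT s|lborel. n * ((P s)\<^sup>2 * pker n s))" by simp
      also have "\<dots> \<le> (LINT s|lborel. (P s)\<^sup>2)"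
      proof (rule integral_mono)
        fix s
        have "n * pker n s \<le> 1" using pker_le[OF n', of s] n by (simp add: field_simps)
        then have "(P s)\<^sup>2 * (n * pker n s) \<le> (P s)\<^sup>2 * 1" by (intro mult_left_mono) auto
        then show "n * ((P s)\<^sup>2 * pker n s) \<le> (P s)\<^sup>2" by (simp add: mult_ac)
      qed (use i2 iP2 in auto)
      finally show "2 * n * (LINT s|lborel. (P s)\<^sup>2 * pker n s) \<le> 2 * S" using P2 by simp
    qed
    also have "n * (pi * (m / (d + n))\<^sup>2) + 2 * S = 2 * S + pi * m\<^sup>2 * n / (d + n)\<^sup>2"
      by (simp add: power_divide)
    finally show "(\<integral>\<^sup>+s. ennreal (n * pker n s) * ennreal (G s) \<partial>lborel) \<le> ennreal (2 * S + pi * m\<^sup>2 * real n / (d + real n)\<^sup>2)"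
      by (simp add: ennreal_leI)
  next
    show "(\<lambda>n. pi * m\<^sup>2 * real n / (d + real n)\<^sup>2) \<longlonglongrightarrow> 0" by real_asymp
  qed measurable
  \<comment> \<open>The level is chosen just below pi * lam^2, which a Poisson integral of
    \<open>G\<close> would have to reach wherever the modulus is at least
    \<open>lam\<close>.\<close>
  obtain B where B: "B \<in> sets borel" "emeasure lborel B \<le> ennreal (80 * (2 * S) / (3 * lam\<^sup>2))"
    "\<forall>x. x \<notin> B \<longrightarrow> (\<forall>y>0. (\<integral>\<^sup>+s. ennreal (pker y (s - x)) * ennreal (G s) \<partial>lborel) \<le> ennreal (3 * lam\<^sup>2))"
    using Poisson_maximal_weak_le[OF _ _ GA, of "3 * lam\<^sup>2"] S lam by auto
  have "cmod (ctr f (Complex x (d + y))) < lam" if x: "x \<notin> B" and y: "0 < y" for x y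
  proof (rule ccontr)
    assume "\<not> ?thesis"
    then have "lam\<^sup>2 \<le> (cmod (ctr f (Complex x (d + y))))\<^sup>2" using lam by (intro power_mono) auto
    then have "pi * lam\<^sup>2 \<le> cmod (pi * v (Complex x (d + y)))" by (simp add: v_def norm_mult norm_power)
    then have "ennreal (pi * lam\<^sup>2) \<le> ennreal (cmod (LINT s|lborel. complex_of_real (pker y (s - x)) * v (Complex s d)))"
      using Pf[OF y, of x] by (simp add: has_bochner_integral_iff ennreal_leI)
    also have "\<dots> \<le> (\<integral>\<^sup>+s. norm (complex_of_real (pker y (s - x)) * v (Complex s d)) \<partial>lborel)"
      using Pf[OF y, of x] by (intro integral_norm_bound_ennreal) (simp add: has_bochner_integral_iff)
    also have "\<dots> = (\<integral>\<^sup>+s. ennreal (pker y (s - x)) * ennreal (G s) \<partial>lborel)"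
      using y by (intro nn_integral_cong) (simp add: norm_mult pker_nonneg G_def v_def norm_power ennreal_mult)
    also have "\<dots> \<le> ennreal (3 * lam\<^sup>2)" using B(3) x y by blast
    finally have "pi * lam\<^sup>2 \<le> 3 * lam\<^sup>2" by simp
    then show False using pi_gt3 lam by simp
  qed
  then show ?thesis using B(1,2) unfolding S_def by auto
qed

text \<open>The exceptional sets for d = 1 / (n + 1) need not be monotone, so their lower limit is
  taken: it is an increasing union of sets of measure at most \<open>c\<close>, and a point outside
  it avoids the n-th set for infinitely many n.\<close>

lemma exceptional_set_limit:
  fixes Q :: "real \<Rightarrow> real \<Rightarrow> bool"
  assumes "\<And>d. 0 < d \<Longrightarrow> \<exists>B \<in> sets borel. emeasure lborel B \<le> c \<and> (\<forall>x. x \<notin> B \<longrightarrow> (\<forall>e>d. Q x e))"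
  shows "\<exists>B \<in> sets borel. emeasure lborel B \<le> c \<and> (\<forall>x. x \<notin> B \<longrightarrow> (\<forall>e>0. Q x e))"
proof -
  have "\<forall>n. \<exists>B. B \<in> sets borel \<and> emeasure lborel B \<le> c \<and> (\<forall>x. x \<notin> B \<longrightarrow> (\<forall>e>1 / real (Suc n). Q x e))"
    using assms by (metis of_nat_0_less_iff zero_less_Suc zero_less_divide_1_iff)
  then obtain B where B: "\<And>n. B n \<in> sets borel" "\<And>n. emeasure lborel (B n) \<le> c"
    "\<And>n x e. x \<notin> B n \<Longrightarrow> e > 1 / real (Suc n) \<Longrightarrow> Q x e"
    unfolding choice_iff by blast
  define D where "D n = (\<Inter>k\<in>{n..}. B k)" for n
  have Dm [measurable]: "D n \<in> sets lborel" for n unfolding D_def using B(1) by auto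
  have inc: "incseq D" by (auto simp: incseq_def D_def)
  have Dc: "emeasure lborel (D n) \<le> c" for n
    using emeasure_mono[of "D n" "B n" lborel] B(1,2)[of n] by (auto simp: D_def intro: order_trans)
  have "emeasure lborel (\<Union>n. D n) = (SUP n. emeasure lborel (D n))"
    using inc Dm by (intro SUP_emeasure_incseq[symmetric]) auto
  also have "\<dots> \<le> c" by (rule SUP_least) (rule Dc)
  finally have "emeasure lborel (\<Union>n. D n) \<le> c" .
  moreover have "Q x e" if x: "x \<notin> (\<Union>n. D n)" and e: "0 < e" for x e
  proof -
    obtain n where n: "1 / real (Suc n) < e" using e by (metis nat_approx_posE)
    from x have "x \<notin> D n" by blast
    then obtain k where k: "n \<le> k" "x \<notin> B k" by (auto simp: D_def)
    have "1 / real (Suc k) \<le> 1 / real (Suc n)" using k by (simp add: frac_le)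
    then show ?thesis using n by (intro B(3)[OF k(2)]) linarith
  qed
  moreover have "(\<Union>n. D n) \<in> sets borel" using Dm by auto
  ultimately show ?thesis by blast
qed

text \<open>A truncation at radius \<open>e\<close> is compared with \<open>ctr f\<close> at height
  \<open>e\<close>, written as d + (e - d) because the estimates for \<open>ctr\<close> start from a
  line at height \<open>d\<close>; the limit of small \<open>d\<close> then reaches all
  radii.\<close>

lemma weak11_truncated_nonneg:
  assumes f: "integrable lborel f" and nn: "\<And>t. 0 \<le> f t" and lam: "0 < lam"
  shows "\<exists>B \<in> sets borel. emeasure lborel B \<le> ennreal (160 * pi * (LINT t|lborel. f t) / lam) \<and>
    (\<forall>x. x \<notin> B \<longrightarrow> (\<forall>e>0. \<bar>LINT t|lborel. f t * hker e (t - x)\<bar> \<le> lam))"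
proof (rule exceptional_set_limit)
  fix d :: real assume d: "0 < d"
  obtain B where B: "B \<in> sets borel" "emeasure lborel B \<le> ennreal (80 * (pi * (LINT t|lborel. f t) / (lam / 2)))"
    "\<forall>x. x \<notin> B \<longrightarrow> (\<forall>y>0. cmod (ctr f (Complex x (d + y))) < lam / 2)"
    using weak11_ctr[OF f nn _ d, of "lam / 2"] lam by auto
  have "\<bar>LINT t|lborel. f t * hker e (t - x)\<bar> \<le> lam" if "x \<notin> B" "d < e" for x e
    using truncated_le_ctr[OF f nn, of e x] B(3)[rule_format, OF that(1), of "e - d"] that(2) d by simp
  then show "\<exists>B \<in> sets borel. emeasure lborel B \<le> ennreal (160 * pi * (LINT t|lborel. f t) / lam) \<and>
    (\<forall>x. x \<notin> B \<longrightarrow> (\<forall>e>d. \<bar>LINT t|lborel. f t * hker e (t - x)\<bar> \<le> lam))"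
    using B(1,2) by (intro bexI[of _ B]) (auto simp: mult_ac)
qed

lemma weak22_truncated_nonneg:
  assumes f: "integrable lborel f" and f2: "integrable lborel (\<lambda>t. (f t)\<^sup>2)"
    and nn: "\<And>t. 0 \<le> f t" and lam: "0 < lam"
  shows "\<exists>B \<in> sets borel. emeasure lborel B \<le> ennreal (640 * pi\<^sup>2 / 3 * (LINT t|lborel. (f t)\<^sup>2) / lam\<^sup>2) \<and>
    (\<forall>x. x \<notin> B \<longrightarrow> (\<forall>e>0. \<bar>LINT t|lborel. f t * hker e (t - x)\<bar> \<le> lam))"
proof (rule exceptional_set_limit)
  fix d :: real assume d: "0 < d"
  obtain B where B: "B \<in> sets borel" "emeasure lborel B \<le> ennreal (80 * (2 * (pi\<^sup>2 * (LINT t|lborel. (f t)\<^sup>2))) / (3 * (lam / 2)\<^sup>2))"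
    "\<forall>x. x \<notin> B \<longrightarrow> (\<forall>y>0. cmod (ctr f (Complex x (d + y))) < lam / 2)"
    using weak22_ctr[OF f f2 _ d, of "lam / 2"] lam by auto
  have "\<bar>LINT t|lborel. f t * hker e (t - x)\<bar> \<le> lam" if "x \<notin> B" "d < e" for x e
    using truncated_le_ctr[OF f nn, of e x] B(3)[rule_format, OF that(1), of "e - d"] that(2) d by simp
  moreover have "80 * (2 * (pi\<^sup>2 * (LINT t|lborel. (f t)\<^sup>2))) / (3 * (lam / 2)\<^sup>2) = 640 * pi\<^sup>2 / 3 * (LINT t|lborel. (f t)\<^sup>2) / lam\<^sup>2"
    using lam by (simp add: power_divide field_simps)
  ultimately show "\<exists>B \<in> sets borel. emeasure lborel B \<le> ennreal (640 * pi\<^sup>2 / 3 * (LINT t|lborel. (f t)\<^sup>2) / lam\<^sup>2) \<and>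
    (\<forall>x. x \<notin> B \<longrightarrow> (\<forall>e>d. \<bar>LINT t|lborel. f t * hker e (t - x)\<bar> \<le> lam))"
    using B(1,2) by (intro bexI[of _ B]) auto
qed

section \<open>Truncated integrals of complex functions\<close>

definition tru :: "real \<Rightarrow> (real \<Rightarrow> complex) \<Rightarrow> real \<Rightarrow> complex" where
  "tru e f x = (LINT t|lborel. f t * complex_of_real (hker e (t - x)))"

text \<open>The positive and negative parts of real and imaginary part. Indexing them by a number
  lets one finite union collect the four exceptional sets, each obtained for a non-negative function
  at a quarter of the level.\<close>

definition cpart :: "nat \<Rightarrow> complex \<Rightarrow> real" where
  "cpart i z = (if i = 0 then max 0 (Re z) else if i = 1 then max 0 (- Re z)
     else if i = 2 then max 0 (Im z) else max 0 (- Im z))"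

lemma cpart_nonneg: "0 \<le> cpart i z" by (simp add: cpart_def)

lemma borel_measurable_cpart [measurable]: "cpart i \<in> borel_measurable borel"
  unfolding cpart_def by measurable

lemma cpart_le: "cpart i z \<le> cmod z"
  using abs_Re_le_cmod[of z] abs_Im_le_cmod[of z] by (auto simp: cpart_def)

lemma cpart_decomp:
  "z = complex_of_real (cpart 0 z) - complex_of_real (cpart 1 z) + \<i> * complex_of_real (cpart 2 z) - \<i> * complex_of_real (cpart 3 z)"
  by (simp add: complex_eq_iff cpart_def max_def)

lemma integrable_cpart:
  assumes "integrable lborel f" shows "integrable lborel (\<lambda>t. cpart i (f t))"
proof (rule Bochner_Integration.integrable_bound[OF assms])
  have [measurable]: "f \<in> borel_measurable borel" using assms by auto
  show "(\<lambda>t. cpart i (f t)) \<in> borel_measurable lborel" by measurable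
qed (simp add: cpart_nonneg cpart_le)

lemma norm_tru_le:
  assumes f: "integrable lborel f" and e: "0 < e"
    and le: "\<And>i. i < 4 \<Longrightarrow> \<bar>LINT t|lborel. cpart i (f t) * hker e (t - x)\<bar> \<le> lam / 4"
  shows "cmod (tru e f x) \<le> lam"
proof -
  have i: "integrable lborel (\<lambda>t. cpart i (f t) * hker e (t - x))" for i
    by (rule integrable_mult_bounded[OF integrable_cpart[OF f]]) (auto intro: abs_hker_le[OF e])
  define J where "J i = (LINT t|lborel. cpart i (f t) * hker e (t - x))" for i
  have hb: "has_bochner_integral lborel (\<lambda>t. complex_of_real (cpart i (f t) * hker e (t - x))) (complex_of_real (J i))" for i
    unfolding J_def by (intro has_bochner_integral_of_real has_bochner_integral_integrable i)
  have "has_bochner_integral lborel (\<lambda>t. complex_of_real (cpart 0 (f t) * hker e (t - x)) - complex_of_real (cpart 1 (f t) * hker e (t - x))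
     + \<i> * complex_of_real (cpart 2 (f t) * hker e (t - x)) - \<i> * complex_of_real (cpart 3 (f t) * hker e (t - x)))
     (complex_of_real (J 0) - complex_of_real (J 1) + \<i> * complex_of_real (J 2) - \<i> * complex_of_real (J 3))"
    by (intro has_bochner_integral_diff has_bochner_integral_add has_bochner_integral_mult_right hb)
  also have "(\<lambda>t. complex_of_real (cpart 0 (f t) * hker e (t - x)) - complex_of_real (cpart 1 (f t) * hker e (t - x))
     + \<i> * complex_of_real (cpart 2 (f t) * hker e (t - x)) - \<i> * complex_of_real (cpart 3 (f t) * hker e (t - x)))
     = (\<lambda>t. f t * complex_of_real (hker e (t - x)))"
    by (subst (5) cpart_decomp) (auto simp: algebra_simps)
  finally have "tru e f x = complex_of_real (J 0) - complex_of_real (J 1) + \<i> * complex_of_real (J 2) - \<i> * complex_of_real (J 3)"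
    unfolding tru_def by (rule has_bochner_integral_integral_eq)
  also have "cmod \<dots> \<le> \<bar>J 0\<bar> + \<bar>J 1\<bar> + \<bar>J 2\<bar> + \<bar>J 3\<bar>"
    by (rule order_trans[OF norm_triangle_ineq4] add_mono order_trans[OF norm_triangle_ineq] | simp add: norm_mult)+
  also have "\<dots> \<le> lam" using le[of 0] le[of 1] le[of 2] le[of 3] by (simp add: J_def)
  finally show ?thesis .
qed

lemma exceptional_set_cpart:
  assumes f: "integrable lborel f" and A: "0 \<le> A"
    and ex: "\<And>i. i < 4 \<Longrightarrow> \<exists>B \<in> sets borel. emeasure lborel B \<le> ennreal A \<and>
      (\<forall>x. x \<notin> B \<longrightarrow> (\<forall>e>0. \<bar>LINT t|lborel. cpart i (f t) * hker e (t - x)\<bar> \<le> lam / 4))"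
  shows "\<exists>B \<in> sets borel. emeasure lborel B \<le> ennreal (4 * A) \<and> (\<forall>x. x \<notin> B \<longrightarrow> (\<forall>e>0. cmod (tru e f x) \<le> lam))"
proof -
  have "\<forall>i\<in>{..<4::nat}. \<exists>B. B \<in> sets borel \<and> emeasure lborel B \<le> ennreal A \<and>
      (\<forall>x. x \<notin> B \<longrightarrow> (\<forall>e>0. \<bar>LINT t|lborel. cpart i (f t) * hker e (t - x)\<bar> \<le> lam / 4))"
    using ex by blast
  then obtain B where B: "\<And>i. i < 4 \<Longrightarrow> B i \<in> sets borel" "\<And>i. i < 4 \<Longrightarrow> emeasure lborel (B i) \<le> ennreal A"
    "\<And>i x e. i < (4::nat) \<Longrightarrow> x \<notin> B i \<Longrightarrow> 0 < e \<Longrightarrow> \<bar>LINT t|lborel. cpart i (f t) * hker e (t - x)\<bar> \<le> lam / 4"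
    unfolding bchoice_iff by blast
  have "emeasure lborel (\<Union>i<4. B i) \<le> (\<Sum>i<4. emeasure lborel (B i))"
    by (rule emeasure_subadditive_finite) (use B(1) in auto)
  also have "\<dots> \<le> (\<Sum>i<(4::nat). ennreal A)" by (intro sum_mono B(2)) auto
  also have "\<dots> = ennreal (4 * A)" using A by (simp add: ennreal_mult)
  finally have "emeasure lborel (\<Union>i<4. B i) \<le> ennreal (4 * A)" .
  moreover have "(\<Union>i<4. B i) \<in> sets borel" using B(1) by auto
  moreover have "cmod (tru e f x) \<le> lam" if "x \<notin> (\<Union>i<4. B i)" "0 < e" for x e
    using that by (intro norm_tru_le[OF f] B(3)) auto
  ultimately show ?thesis by blast
qed

theorem weak11_tru:
  assumes f: "integrable lborel f" and lam: "0 < lam"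
  shows "\<exists>B \<in> sets borel. emeasure lborel B \<le> ennreal (2560 * pi * (LINT t|lborel. cmod (f t)) / lam) \<and>
    (\<forall>x. x \<notin> B \<longrightarrow> (\<forall>e>0. cmod (tru e f x) \<le> lam))"
proof -
  have "\<exists>B \<in> sets borel. emeasure lborel B \<le> ennreal (640 * pi * (LINT t|lborel. cmod (f t)) / lam) \<and>
      (\<forall>x. x \<notin> B \<longrightarrow> (\<forall>e>0. \<bar>LINT t|lborel. cpart i (f t) * hker e (t - x)\<bar> \<le> lam / 4))" for i
  proof -
    have "(LINT t|lborel. cpart i (f t)) \<le> (LINT t|lborel. cmod (f t))"
      by (rule integral_mono) (use f integrable_cpart[OF f] cpart_le in auto)
    then have "160 * pi * (LINT t|lborel. cpart i (f t)) / (lam / 4) \<le> 640 * pi * (LINT t|lborel. cmod (f t)) / lam"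
      using lam by (simp add: divide_right_mono)
    then show ?thesis
      using weak11_truncated_nonneg[OF integrable_cpart[OF f] cpart_nonneg, of "lam / 4" i] lam
      by (meson ennreal_leI order_trans zero_less_divide_iff zero_less_numeral)
  qed
  from exceptional_set_cpart[OF f _ this] show ?thesis using lam by (simp add: mult.assoc)
qed

theorem weak22_tru:
  assumes f: "integrable lborel f" and f2: "integrable lborel (\<lambda>t. (cmod (f t))\<^sup>2)" and lam: "0 < lam"
  shows "\<exists>B \<in> sets borel. emeasure lborel B \<le> ennreal (40960 * pi\<^sup>2 / 3 * (LINT t|lborel. (cmod (f t))\<^sup>2) / lam\<^sup>2) \<and>
    (\<forall>x. x \<notin> B \<longrightarrow> (\<forall>e>0. cmod (tru e f x) \<le> lam))"
proof -
  have [measurable]: "f \<in> borel_measurable borel" using f by auto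
  have "\<exists>B \<in> sets borel. emeasure lborel B \<le> ennreal (10240 * pi\<^sup>2 / 3 * (LINT t|lborel. (cmod (f t))\<^sup>2) / lam\<^sup>2) \<and>
      (\<forall>x. x \<notin> B \<longrightarrow> (\<forall>e>0. \<bar>LINT t|lborel. cpart i (f t) * hker e (t - x)\<bar> \<le> lam / 4))" for i
  proof -
    have le: "(cpart i (f t))\<^sup>2 \<le> (cmod (f t))\<^sup>2" for t
      using cpart_le[of i "f t"] cpart_nonneg[of i "f t"] by (rule power_mono)
    have i2: "integrable lborel (\<lambda>t. (cpart i (f t))\<^sup>2)"
      by (rule Bochner_Integration.integrable_bound[OF f2]) (use le in auto)
    have "(LINT t|lborel. (cpart i (f t))\<^sup>2) \<le> (LINT t|lborel. (cmod (f t))\<^sup>2)"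
      by (rule integral_mono) (use f2 i2 le in auto)
    then have "640 * pi\<^sup>2 / 3 * (LINT t|lborel. (cpart i (f t))\<^sup>2) / (lam / 4)\<^sup>2 \<le> 10240 * pi\<^sup>2 / 3 * (LINT t|lborel. (cmod (f t))\<^sup>2) / lam\<^sup>2"
      using lam by (simp add: power_divide divide_right_mono)
    then show ?thesis
      using weak22_truncated_nonneg[OF integrable_cpart[OF f] i2 cpart_nonneg, of "lam / 4"] lam
      by (meson ennreal_leI order_trans zero_less_divide_iff zero_less_numeral)
  qed
  from exceptional_set_cpart[OF f _ this] show ?thesis using lam by (simp add: mult.assoc)
qed

section \<open>Principal values of Chebyshev functions\<close>

definition rw :: "real \<Rightarrow> real" where
  "rw t = indicator {-1<..<1} t * (1 / sqrt (1 - t\<^sup>2))"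

lemma one_minus_sq_pos: "- 1 < t \<Longrightarrow> t < 1 \<Longrightarrow> 0 < 1 - (t::real)\<^sup>2"
  using abs_square_less_1[of t] by (simp add: abs_less_iff)

lemma one_minus_sq_nonneg: "- 1 \<le> t \<Longrightarrow> t \<le> 1 \<Longrightarrow> 0 \<le> 1 - (t::real)\<^sup>2"
  using abs_square_le_1[of t] by (simp add: abs_le_iff)

lemma rw_nonneg: "0 \<le> rw t"
  by (auto simp: rw_def indicator_def dest: one_minus_sq_pos)

lemma borel_measurable_rw [measurable]: "rw \<in> borel_measurable borel"
  unfolding rw_def by measurable

text \<open>ln ((t - x)^2) / 2 is ln |t - x|, valid on both sides of the singularity. With t = cos a
  and x = cos b the function is (1 / sin b) times the logarithm of |sin ((a - b) / 2)| / sin ((a +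
  b) / 2).\<close>

lemma rw_antiderivative:
  assumes x: "- 1 < x" "x < 1" and t: "- 1 < t" "t < 1" "t \<noteq> x"
  shows "((\<lambda>t. (ln ((t - x)\<^sup>2) / 2 - ln (1 - x * t + sqrt (1 - x\<^sup>2) * sqrt (1 - t\<^sup>2))) / sqrt (1 - x\<^sup>2))
    has_real_derivative 1 / sqrt (1 - t\<^sup>2) / (t - x)) (at t)"
proof -
  define R r where "R = sqrt (1 - x\<^sup>2)" and "r = sqrt (1 - t\<^sup>2)"
  have R: "0 < R" "R * R = 1 - x * x" and r: "0 < r" "r * r = 1 - t * t"
    using one_minus_sq_pos[OF x] one_minus_sq_pos[OF t(1,2)] by (auto simp: R_def r_def power2_eq_square)
  have "\<bar>x * t\<bar> < 1" using x t by (simp add: abs_mult) (metis abs_less_iff abs_mult_less mult_1 minus_less_iff)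
  then have D: "0 < 1 - x * t + R * r" using R r by (intro add_pos_pos) auto
  have "((\<lambda>t. (ln ((t - x)\<^sup>2) / 2 - ln (1 - x * t + R * sqrt (1 - t\<^sup>2))) / R)
    has_real_derivative ((2 * (t - x) / (t - x)\<^sup>2) / 2 - (- x + R * (- (2 * t) * (inverse r / 2))) / (1 - x * t + R * r)) / R) (at t)"
    using R D t one_minus_sq_pos[OF t(1,2)] unfolding r_def
    by (auto intro!: derivative_eq_intros simp: field_simps)
  moreover have "((2 * (t - x) / (t - x)\<^sup>2) / 2 - (- x + R * (- (2 * t) * (inverse r / 2))) / (1 - x * t + R * r)) / R = 1 / r / (t - x)"
  proof -
    have e1: "(2 * (t - x) / (t - x)\<^sup>2) / 2 = 1 / (t - x)"
    proof -
      have *: "u \<noteq> 0 \<Longrightarrow> (2 * u / u\<^sup>2) / 2 = 1 / u" for u :: real by (simp add: power2_eq_square)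
      show ?thesis using t by (intro *) simp
    qed
    have e2: "- x + R * (- (2 * t) * (inverse r / 2)) = - (x * r + R * t) / r" using r by (simp add: field_simps)
    have num: "(1 - x * t + R * r) * r + (t - x) * (x * r + R * t) = R * (1 - x * t + R * r)"
    proof -
      have "(1 - x * t + R * r) * r + (t - x) * (x * r + R * t) = r * (1 - x * x) + R * (r * r + t * t - x * t)"
        by (simp add: algebra_simps)
      also have "\<dots> = r * (R * R) + R * (1 - x * t)" using R r by simp
      finally show ?thesis by (simp add: algebra_simps)
    qed
    have "1 / (t - x) - (- (x * r + R * t) / r) / (1 - x * t + R * r) =
      ((1 - x * t + R * r) * r + (t - x) * (x * r + R * t)) / ((t - x) * r * (1 - x * t + R * r))"
      using t r D by (simp add: divide_simps) (simp add: algebra_simps)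
    also have "\<dots> = R / ((t - x) * r)" unfolding num using D by simp
    finally show ?thesis unfolding e1 e2 using R by (simp add: mult.commute)
  qed
  ultimately show ?thesis unfolding R_def r_def by simp
qed

text \<open>The interval may touch 1 or -1, where the integrand is unbounded; the antiderivative
  remains continuous there, which is enough for the interior form of the fundamental
  theorem.\<close>

lemma rw_kernel_has_integral:
  assumes x: "- 1 < x" "x < 1" and ab: "- 1 \<le> a" "a \<le> b" "b \<le> 1" "x \<notin> {a..b}"
  defines "A \<equiv> (\<lambda>t. (ln ((t - x)\<^sup>2) / 2 - ln (1 - x * t + sqrt (1 - x\<^sup>2) * sqrt (1 - t\<^sup>2))) / sqrt (1 - x\<^sup>2))"
  shows "((\<lambda>t. 1 / sqrt (1 - t\<^sup>2) / (t - x)) has_integral (A b - A a)) {a..b}"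
proof (rule fundamental_theorem_of_calculus_interior[OF ab(2)])
  have R: "0 < sqrt (1 - x\<^sup>2)" using one_minus_sq_pos[OF x] by simp
  have D: "0 < 1 - x * t + sqrt (1 - x\<^sup>2) * sqrt (1 - t\<^sup>2)" if "t \<in> {a..b}" for t
  proof -
    have t: "\<bar>t\<bar> \<le> 1" using that ab by auto
    have "\<bar>x * t\<bar> \<le> \<bar>x\<bar> * 1" unfolding abs_mult using t by (intro mult_left_mono) auto
    then have "x * t < 1" using x by linarith
    moreover have "0 \<le> sqrt (1 - t\<^sup>2)" using one_minus_sq_nonneg[of t] t by simp
    ultimately show ?thesis using R by (intro add_pos_nonneg mult_nonneg_nonneg) auto
  qed
  have ne: "t \<noteq> x" if "t \<in> {a..b}" for t using that ab by auto
  show "continuous_on {a..b} A"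
    unfolding A_def using R D ne by (intro continuous_intros) (auto simp: less_imp_neq[symmetric] intro: less_imp_neq)
  fix t assume "t \<in> {a<..<b}"
  then show "(A has_vector_derivative 1 / sqrt (1 - t\<^sup>2) / (t - x)) (at t)"
    unfolding A_def has_real_derivative_iff_has_vector_derivative[symmetric]
    using x ab by (intro rw_antiderivative) auto
qed

lemma has_bochner_integral_rw: "has_bochner_integral lborel rw pi"
proof (rule has_bochner_integral_nn_integral)
  have "((\<lambda>t. 1 / sqrt (1 - t\<^sup>2)) has_integral (arcsin 1 - arcsin (-1))) {-1..1::real}"
  proof (rule fundamental_theorem_of_calculus_interior)
    show "continuous_on {-1..1} arcsin" by (rule continuous_on_arcsin')
    fix t :: real assume "t \<in> {-1<..<1}"
    then show "(arcsin has_vector_derivative 1 / sqrt (1 - t\<^sup>2)) (at t)"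
      unfolding has_real_derivative_iff_has_vector_derivative[symmetric]
      using DERIV_arcsin[of t] by (simp add: inverse_eq_divide)
  qed simp
  then have "((\<lambda>t. 1 / sqrt (1 - t\<^sup>2)) has_integral pi) {-1..1::real}" by simp
  then have "integral\<^sup>N lborel (\<lambda>t. indicator {-1..1::real} t * (1 / sqrt (1 - t\<^sup>2))) = pi"
    by (rule nn_integral_has_integral_lebesgue[rotated]) (auto simp: abs_square_le_1)
  also have "integral\<^sup>N lborel (\<lambda>t. indicator {-1..1::real} t * (1 / sqrt (1 - t\<^sup>2))) = (\<integral>\<^sup>+t. ennreal (rw t) \<partial>lborel)"
    by (intro nn_integral_cong) (auto simp: rw_def indicator_def less_le)
  finally show "(\<integral>\<^sup>+t. ennreal (rw t) \<partial>lborel) = ennreal pi" .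
qed (auto simp: rw_nonneg)

lemma integrable_rw: "integrable lborel rw"
  using has_bochner_integral_rw by (simp add: has_bochner_integral_iff)

text \<open>The antiderivative vanishes at both end points of (-1,1), and its singular parts ln |t -
  x| at \<open>x - e\<close> and \<open>x + e\<close> are equal and cancel. What is left is the
  regular part \<open>D\<close>, continuous at \<open>x\<close>.\<close>

lemma tru_rw:
  assumes x: "- 1 < x" "x < 1" and e: "0 < e" "e < 1 - x" "e < 1 + x"
  defines "D \<equiv> (\<lambda>t. ln (1 - x * t + sqrt (1 - x\<^sup>2) * sqrt (1 - t\<^sup>2)) / sqrt (1 - x\<^sup>2))"
  shows "tru e (\<lambda>t. complex_of_real (rw t)) x = complex_of_real (D (x + e) - D (x - e))"
proof -
  let ?k = "\<lambda>t. 1 / sqrt (1 - t\<^sup>2) / (t - x)"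
  let ?h = "\<lambda>t. rw t * hker e (t - x)"
  have ih: "integrable lborel ?h"
    by (rule integrable_mult_bounded[OF integrable_rw]) (auto intro: abs_hker_le[OF e(1)])
  define A where "A = (\<lambda>t. (ln ((t - x)\<^sup>2) / 2 - ln (1 - x * t + sqrt (1 - x\<^sup>2) * sqrt (1 - t\<^sup>2))) / sqrt (1 - x\<^sup>2))"
  have i1: "(?h has_integral (A (x - e) - A (-1))) {-1..x - e}"
  proof (rule has_integral_spike[of "{-1, x - e}" _ _ ?k])
    show "(?k has_integral (A (x - e) - A (-1))) {-1..x - e}"
      unfolding A_def by (rule rw_kernel_has_integral[OF x]) (use e x in auto)
  qed (use e x in \<open>auto simp: rw_def hker_def indicator_def\<close>)
  have i2: "(?h has_integral (A 1 - A (x + e))) {x + e..1}"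
  proof (rule has_integral_spike[of "{1, x + e}" _ _ ?k])
    show "(?k has_integral (A 1 - A (x + e))) {x + e..1}"
      unfolding A_def by (rule rw_kernel_has_integral[OF x]) (use e x in auto)
  qed (use e x in \<open>auto simp: rw_def hker_def indicator_def\<close>)
  have "(?h has_integral (A (x - e) - A (-1)) + (A 1 - A (x + e))) ({-1..x - e} \<union> {x + e..1})"
    by (rule has_integral_Un[OF i1 i2]) (use e in auto)
  then have "(?h has_integral (A (x - e) - A (-1)) + (A 1 - A (x + e))) UNIV"
    by (rule has_integral_on_superset) (use e x in \<open>auto simp: rw_def hker_def indicator_def\<close>)
  then have J: "(LINT t|lborel. ?h t) = (A (x - e) - A (-1)) + (A 1 - A (x + e))"
    using has_integral_integral_lborel[OF ih] has_integral_unique by blast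
  have A1: "A 1 = 0" "A (-1) = 0"
  proof -
    have l1: "ln ((1 - x)\<^sup>2) = 2 * ln (1 - x)" and l2: "ln ((1 + x)\<^sup>2) = 2 * ln (1 + x)"
      using x by (auto simp: ln_realpow)
    show "A 1 = 0" using l1 by (simp add: A_def)
    have "(- 1 - x)\<^sup>2 = (1 + x)\<^sup>2" by (simp add: power2_eq_square algebra_simps)
    then show "A (-1) = 0" using l2 by (simp add: A_def)
  qed
  have "tru e (\<lambda>t. complex_of_real (rw t)) x = complex_of_real (LINT t|lborel. ?h t)"
    unfolding tru_def of_real_mult[symmetric] by (rule integral_complex_of_real)
  also have "(LINT t|lborel. ?h t) = D (x + e) - D (x - e)"
    unfolding J A1 by (simp add: A_def D_def diff_divide_distrib)
  finally show ?thesis .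
qed

text \<open>Principal value without the factor 1 / pi. A relation asserts existence and value
  together, whereas \<open>fin_hilbert\<close>, built from \<open>Lim\<close>, also has some value
  where no limit exists.\<close>

definition has_pv :: "(real \<Rightarrow> complex) \<Rightarrow> real \<Rightarrow> complex \<Rightarrow> bool" where
  "has_pv f x l \<longleftrightarrow> ((\<lambda>e. tru e f x) \<longlongrightarrow> l) (at_right 0)"

lemma has_pv_rw:
  assumes x: "- 1 < x" "x < 1"
  shows "has_pv (\<lambda>t. complex_of_real (rw t)) x 0"
proof -
  define D where "D = (\<lambda>t. ln (1 - x * t + sqrt (1 - x\<^sup>2) * sqrt (1 - t\<^sup>2)) / sqrt (1 - x\<^sup>2))"
  have pos: "0 < 1 - x\<^sup>2" by (rule one_minus_sq_pos[OF x])
  have "1 - x * x + sqrt (1 - x\<^sup>2) * sqrt (1 - x\<^sup>2) > 0" using pos by (simp add: power2_eq_square)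
  then have cD: "isCont D x" unfolding D_def using pos by (intro continuous_intros) auto
  have l1: "((\<lambda>e. D (x + e)) \<longlongrightarrow> D x) (at_right 0)" and l2: "((\<lambda>e. D (x - e)) \<longlongrightarrow> D x) (at_right 0)"
    by (rule isCont_tendsto_compose[OF cD] | (rule tendsto_eq_intros refl | simp)+)+
  have "((\<lambda>e. complex_of_real (D (x + e) - D (x - e))) \<longlongrightarrow> complex_of_real (D x - D x)) (at_right 0)"
    by (intro tendsto_intros l1 l2)
  moreover have "eventually (\<lambda>e. complex_of_real (D (x + e) - D (x - e)) = tru e (\<lambda>t. complex_of_real (rw t)) x) (at_right 0)"
  proof -
    have "eventually (\<lambda>e. 0 < e \<and> e < min (1 - x) (1 + x)) (at_right 0)"
      using x by (intro eventually_conj eventually_at_right_less eventually_at_rightI[of 0 "min (1 - x) (1 + x)"]) auto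
    then show ?thesis by eventually_elim (use tru_rw[OF x] in \<open>simp add: D_def\<close>)
  qed
  ultimately show ?thesis unfolding has_pv_def using tendsto_cong by fastforce
qed

lemma integrable_mult_hker:
  assumes f: "integrable lborel (f :: real \<Rightarrow> complex)" and e: "0 < e"
  shows "integrable lborel (\<lambda>t. f t * complex_of_real (hker e (t - x)))"
proof (rule Bochner_Integration.integrable_bound)
  have [measurable]: "f \<in> borel_measurable borel" using f by auto
  show "integrable lborel (\<lambda>t. cmod (f t) * (1 / e))" using f by simp
  show "(\<lambda>t. f t * complex_of_real (hker e (t - x))) \<in> borel_measurable lborel" by measurable
  have "cmod (f t) * \<bar>hker e (t - x)\<bar> \<le> cmod (f t) * (1 / e)" for t by (rule mult_left_mono[OF abs_hker_le[OF e]]) simp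
  then show "AE t in lborel. norm (f t * complex_of_real (hker e (t - x))) \<le> norm (cmod (f t) * (1 / e))"
    using e by (simp add: norm_mult)
qed

lemma tru_add:
  assumes "integrable lborel f" "integrable lborel g" "0 < e"
  shows "tru e (\<lambda>t. f t + g t) x = tru e f x + tru e g x"
  unfolding tru_def using integrable_mult_hker[OF assms(1,3)] integrable_mult_hker[OF assms(2,3)]
  by (simp add: distrib_right)

lemma tru_cmult: "tru e (\<lambda>t. c * f t) x = c * tru e f x"
  unfolding tru_def by (simp add: mult.assoc)

lemma eventually_at_right_0: "eventually (\<lambda>e::real. 0 < e) (at_right 0)"
  by (simp add: eventually_at_right_less)

lemma has_pv_add:
  assumes "integrable lborel f" "integrable lborel g" "has_pv f x a" "has_pv g x b"
  shows "has_pv (\<lambda>t. f t + g t) x (a + b)"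
proof -
  have "((\<lambda>e. tru e f x + tru e g x) \<longlongrightarrow> a + b) (at_right 0)"
    using assms(3,4) unfolding has_pv_def by (rule tendsto_add)
  moreover have "eventually (\<lambda>e. tru e f x + tru e g x = tru e (\<lambda>t. f t + g t) x) (at_right 0)"
    using eventually_at_right_0 by eventually_elim (simp add: tru_add assms)
  ultimately show ?thesis unfolding has_pv_def using tendsto_cong by fastforce
qed

lemma has_pv_cmult: "has_pv f x a \<Longrightarrow> has_pv (\<lambda>t. c * f t) x (c * a)"
  unfolding has_pv_def tru_cmult by (intro tendsto_intros)

lemma tendsto_integral_outside:
  assumes f: "integrable lborel (f :: real \<Rightarrow> complex)"
  shows "((\<lambda>e. LINT t|lborel. f t * indicator {t. e < \<bar>t - x\<bar>} t) \<longlongrightarrow> (LINT t|lborel. f t)) (at_right 0)"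
proof -
  have [measurable]: "f \<in> borel_measurable borel" using f by auto
  have "((\<lambda>r. LINT t|lborel. f t * indicator {t. inverse r < \<bar>t - x\<bar>} t) \<longlongrightarrow> (LINT t|lborel. f t)) at_top"
  proof (rule integral_dominated_convergence_at_top[where w = "\<lambda>t. cmod (f t)"])
    show "AE t in lborel. ((\<lambda>r. f t * indicator {t. inverse r < \<bar>t - x\<bar>} t) \<longlongrightarrow> f t) at_top"
    proof -
      have "AE t in lborel. t \<noteq> x" by (rule AE_lborel_singleton)
      then show ?thesis
      proof eventually_elim
        case (elim t)
        have "((\<lambda>r::real. inverse r) \<longlongrightarrow> 0) at_top" by (rule tendsto_inverse_0_at_top) (rule filterlim_ident)
        then have "eventually (\<lambda>r. inverse r < \<bar>t - x\<bar>) at_top" using elim by (intro order_tendstoD) auto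
        then have "eventually (\<lambda>r. f t * indicator {t. inverse r < \<bar>t - x\<bar>} t = f t) at_top"
          by eventually_elim simp
        then show ?case by (rule tendsto_eventually)
      qed
    qed
    show "eventually (\<lambda>r. AE t in lborel. norm (f t * indicator {t. inverse r < \<bar>t - x\<bar>} t) \<le> cmod (f t)) at_top"
      by (intro always_eventually allI AE_I2) (simp add: indicator_def norm_mult)
  qed (use f in auto)
  then show ?thesis by (simp add: filterlim_at_right_to_top)
qed

text \<open>t / (t - x) = x / (t - x) + 1 outside the truncated interval, and the summand 1
  contributes the plain integral in the limit.\<close>

lemma has_pv_mult_ident:
  assumes f: "integrable lborel f" and pv: "has_pv f x l"
  shows "has_pv (\<lambda>t. complex_of_real t * f t) x (complex_of_real x * l + (LINT t|lborel. f t))"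
proof -
  have [measurable]: "f \<in> borel_measurable borel" using f by auto
  have "((\<lambda>e. complex_of_real x * tru e f x + (LINT t|lborel. f t * indicator {t. e < \<bar>t - x\<bar>} t)) \<longlongrightarrow>
     complex_of_real x * l + (LINT t|lborel. f t)) (at_right 0)"
    using pv unfolding has_pv_def by (intro tendsto_intros tendsto_integral_outside f)
  moreover have "eventually (\<lambda>e. complex_of_real x * tru e f x + (LINT t|lborel. f t * indicator {t. e < \<bar>t - x\<bar>} t)
     = tru e (\<lambda>t. complex_of_real t * f t) x) (at_right 0)"
    using eventually_at_right_0
  proof eventually_elim
    case (elim e)
    have i: "integrable lborel (\<lambda>t. f t * indicator {t. e < \<bar>t - x\<bar>} t)"
      by (rule Bochner_Integration.integrable_bound[OF f]) (auto simp: indicator_def norm_mult)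
    have "complex_of_real x * tru e f x + (LINT t|lborel. f t * indicator {t. e < \<bar>t - x\<bar>} t) =
      (LINT t|lborel. complex_of_real x * (f t * complex_of_real (hker e (t - x))) + f t * indicator {t. e < \<bar>t - x\<bar>} t)"
      unfolding tru_def using integrable_mult_hker[OF f elim] i by simp
    also have "\<dots> = tru e (\<lambda>t. complex_of_real t * f t) x"
      unfolding tru_def
    proof (rule Bochner_Integration.integral_cong)
      fix t
      have "complex_of_real x * complex_of_real (hker e (t - x)) + indicator {t. e < \<bar>t - x\<bar>} t = complex_of_real t * complex_of_real (hker e (t - x))"
        using elim by (auto simp: hker_def indicator_def field_simps complex_eq_iff)
      then have "f t * (complex_of_real x * complex_of_real (hker e (t - x)) + indicator {t. e < \<bar>t - x\<bar>} t) = f t * (complex_of_real t * complex_of_real (hker e (t - x)))" by simp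
      then show "complex_of_real x * (f t * complex_of_real (hker e (t - x))) + f t * indicator {t. e < \<bar>t - x\<bar>} t = complex_of_real t * f t * complex_of_real (hker e (t - x))"
        by (simp add: algebra_simps)
    qed simp
    finally show ?case .
  qed
  ultimately show ?thesis unfolding has_pv_def using tendsto_cong by fastforce
qed

text \<open>The Chebyshev polynomial of the first kind of degree \<open>n\<close> over sqrt (1 -
  t^2), extended by zero to the line.\<close>

definition chw :: "nat \<Rightarrow> real \<Rightarrow> complex" where
  "chw n t = complex_of_real (rw t * cos (n * arccos t))"

lemma integrable_chw: "integrable lborel (chw n)"
proof (rule Bochner_Integration.integrable_bound[OF integrable_rw])
  have "(\<lambda>t. indicator {-1<..<1} t *\<^sub>R cos (n * arccos t)) \<in> borel_measurable borel"
    by (rule borel_measurable_continuous_on_indicator)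
      (auto intro!: continuous_intros continuous_on_subset[OF continuous_on_arccos'])
  then have "(\<lambda>t. complex_of_real (rw t * (indicator {-1<..<1} t *\<^sub>R cos (n * arccos t)))) \<in> borel_measurable borel"
    by measurable
  also have "(\<lambda>t. complex_of_real (rw t * (indicator {-1<..<1} t *\<^sub>R cos (n * arccos t)))) = chw n"
    by (auto simp: chw_def rw_def indicator_def)
  finally show "chw n \<in> borel_measurable lborel" by simp
  have "\<bar>rw t * cos (n * arccos t)\<bar> \<le> rw t * 1" for t
    unfolding abs_mult using rw_nonneg[of t] by (intro mult_mono) auto
  then show "AE t in lborel. norm (chw n t) \<le> norm (rw t)"
    using rw_nonneg by (simp add: chw_def norm_mult abs_mult)
qed

lemma integral_chw:
  "(LINT t|lborel. chw n t) = (if n = 0 then complex_of_real pi else 0)"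
proof (cases "n = 0")
  case True
  have "(LINT t|lborel. chw n t) = complex_of_real (LINT t|lborel. rw t)"
    unfolding chw_def True by (simp add: integral_complex_of_real)
  then show ?thesis using True has_bochner_integral_rw by (simp add: has_bochner_integral_iff)
next
  case False
  let ?g = "\<lambda>t. rw t * cos (n * arccos t)"
  let ?A = "\<lambda>t. - sin (n * arccos t) / n"
  have i: "integrable lborel ?g"
    using integrable_Re[OF integrable_chw[of n]] by (simp add: chw_def)
  have "(?g has_integral (?A 1 - ?A (-1))) {-1..1}"
  proof (rule fundamental_theorem_of_calculus_interior)
    show "continuous_on {-1..1} ?A"
      by (intro continuous_intros continuous_on_arccos') (use False in auto)
    fix t :: real assume t: "t \<in> {-1<..<1}"
    have "(?A has_real_derivative - (cos (n * arccos t) * (n * inverse (- sqrt (1 - t\<^sup>2)))) / n) (at t)"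
      using t False by (auto intro!: derivative_eq_intros)
    moreover have "- (cos (n * arccos t) * (n * inverse (- sqrt (1 - t\<^sup>2)))) / n = ?g t"
      using t False by (simp add: rw_def field_simps)
    ultimately show "(?A has_vector_derivative ?g t) (at t)"
      unfolding has_real_derivative_iff_has_vector_derivative[symmetric] by simp
  qed simp
  moreover have "?A 1 - ?A (-1) = 0" using False by (simp add: sin_npi)
  ultimately have "(?g has_integral 0) {-1..1}" by metis
  then have "(?g has_integral 0) UNIV"
    by (rule has_integral_on_superset) (auto simp: rw_def indicator_def)
  then have "(LINT t|lborel. ?g t) = 0"
    using has_integral_integral_lborel[OF i] has_integral_unique by blast
  then show ?thesis unfolding chw_def using False by (simp only: integral_complex_of_real) simp
qed

lemma cos_step: "cos ((real n + 2) * a) = 2 * cos a * cos ((real n + 1) * a) - cos (n * a)"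
  using cos_add[of "(real n + 1) * a" a] cos_diff[of "(real n + 1) * a" a] by (simp add: algebra_simps)

lemma sin_step: "sin ((real n + 2) * a) = 2 * cos a * sin ((real n + 1) * a) - sin (n * a)"
  using sin_add[of "(real n + 1) * a" a] sin_diff[of "(real n + 1) * a" a] by (simp add: algebra_simps)

lemma chw_step: "chw (Suc (Suc n)) = (\<lambda>t. 2 * (complex_of_real t * chw (Suc n) t) + (- 1) * chw n t)"
proof
  fix t
  show "chw (Suc (Suc n)) t = 2 * (complex_of_real t * chw (Suc n) t) + (- 1) * chw n t"
  proof (cases "t \<in> {-1<..<1}")
    case True
    have "cos (real (Suc (Suc n)) * arccos t) = 2 * cos (arccos t) * cos (real (Suc n) * arccos t) - cos (n * arccos t)"
      using cos_step[of n "arccos t"] by (simp add: add.commute)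
    also have "cos (arccos t) = t" using True by simp
    finally have e: "cos (real (Suc (Suc n)) * arccos t) = 2 * t * cos (real (Suc n) * arccos t) - cos (n * arccos t)" .
    have "rw t * cos (real (Suc (Suc n)) * arccos t) = 2 * (t * (rw t * cos (real (Suc n) * arccos t))) - rw t * cos (n * arccos t)"
      unfolding e by algebra
    from arg_cong[OF this, of complex_of_real] show ?thesis by (simp add: chw_def del: of_nat_Suc)
  qed (simp add: chw_def rw_def)
qed

lemma chw_supp: "1 < \<bar>t\<bar> \<Longrightarrow> chw n t = 0"
  by (auto simp: chw_def rw_def indicator_def)

lemma integrable_ident_mult:
  assumes f: "integrable lborel f" and sf: "\<And>t. 1 < \<bar>t\<bar> \<Longrightarrow> f t = 0"
  shows "integrable lborel (\<lambda>t. complex_of_real t * f t)"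
proof (rule Bochner_Integration.integrable_bound[OF f])
  have [measurable]: "f \<in> borel_measurable borel" using f by auto
  show "(\<lambda>t. complex_of_real t * f t) \<in> borel_measurable lborel" by measurable
  have "\<bar>t\<bar> * cmod (f t) \<le> cmod (f t)" for t
    using sf[of t] by (cases "1 < \<bar>t\<bar>") (auto intro: mult_left_le_one_le)
  then show "AE t in lborel. norm (complex_of_real t * f t) \<le> norm (f t)" by (simp add: norm_mult)
qed

text \<open>Both sides obey the three-term Chebyshev recurrence: multiplication by \<open>t\<close>
  acts on principal values up to the mean of the function, and among the Chebyshev functions only
  \<open>chw 0\<close> has non-zero mean, which starts the sine sequence at order 1. Classically,
  T_n / sqrt (1 - t^2) is sent to pi U_(n-1).\<close>

theorem has_pv_chw:
  assumes x: "- 1 < x" "x < 1"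
  shows "has_pv (chw n) x (complex_of_real (pi * (rw x * sin (n * arccos x))))"
proof (induction n rule: induct_nat_012)
  case 0
  have "chw 0 = (\<lambda>t. complex_of_real (rw t))" by (auto simp: chw_def)
  then show ?case using has_pv_rw[OF x] by simp
next
  case 1
  have c0: "chw 0 = (\<lambda>t. complex_of_real (rw t))" by (auto simp: chw_def)
  have "has_pv (\<lambda>t. complex_of_real t * chw 0 t) x (complex_of_real x * 0 + (LINT t|lborel. chw 0 t))"
    by (rule has_pv_mult_ident[OF integrable_chw]) (use has_pv_rw[OF x] c0 in auto)
  moreover have "(\<lambda>t. complex_of_real t * chw 0 t) = chw 1"
  proof
    fix t show "complex_of_real t * chw 0 t = chw 1 t"
      by (cases "t \<in> {-1<..<1}") (auto simp: chw_def rw_def)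
  qed
  moreover have "rw x * sin (1 * arccos x) = 1"
    using x one_minus_sq_pos[OF x] by (simp add: rw_def sin_arccos)
  ultimately show ?case by (simp add: integral_chw)
next
  case (ge2 n)
  have p: "has_pv (\<lambda>t. complex_of_real t * chw (Suc n) t) x (complex_of_real x * (complex_of_real (pi * (rw x * sin (Suc n * arccos x)))) + (LINT t|lborel. chw (Suc n) t))"
    by (rule has_pv_mult_ident[OF integrable_chw ge2(2)])
  have "has_pv (\<lambda>t. 2 * (complex_of_real t * chw (Suc n) t) + (- 1) * chw n t) x
    (2 * (complex_of_real x * (complex_of_real (pi * (rw x * sin (Suc n * arccos x)))) + (LINT t|lborel. chw (Suc n) t)) +
     (- 1) * (complex_of_real (pi * (rw x * sin (n * arccos x)))))"
    by (intro has_pv_add has_pv_cmult p ge2(1) integrable_mult_right integrable_ident_mult integrable_chw chw_supp)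
  moreover have e: "sin (real (Suc (Suc n)) * arccos x) = 2 * x * sin (real (Suc n) * arccos x) - sin (n * arccos x)"
    using sin_step[of n "arccos x"] x by (simp add: add.commute)
  have "pi * (rw x * sin (real (Suc (Suc n)) * arccos x)) = 2 * (x * (pi * (rw x * sin (real (Suc n) * arccos x)))) - pi * (rw x * sin (n * arccos x))"
    unfolding e by algebra
  from arg_cong[OF this, of complex_of_real]
  have "complex_of_real (pi * (rw x * sin (real (Suc (Suc n)) * arccos x))) = 2 * (complex_of_real x * (complex_of_real (pi * (rw x * sin (Suc n * arccos x)))) + (LINT t|lborel. chw (Suc n) t)) +
     (- 1) * (complex_of_real (pi * (rw x * sin (n * arccos x))))"
    by (simp add: integral_chw del: of_nat_Suc)
  ultimately show ?case unfolding chw_step by (simp only:)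
qed

section \<open>Functions on the interval\<close>

lemma space_M11 [simp]: "space M11 = {-1<..<1}"
  by (simp add: M11_def space_restrict_space)

lemma AE_M11_iff: "(AE x in M11. P x) \<longleftrightarrow> (AE x in lborel. x \<in> {-1<..<1} \<longrightarrow> P x)"
  unfolding M11_def by (subst AE_restrict_space_iff) auto

lemma borel_measurable_M11: "f \<in> borel_measurable borel \<Longrightarrow> f \<in> borel_measurable M11"
  unfolding M11_def by (simp add: measurable_restrict_space1)

lemma sets_M11_iff: "A \<in> sets M11 \<longleftrightarrow> A \<subseteq> {-1<..<1} \<and> A \<in> sets borel"
  unfolding M11_def by (subst sets_restrict_space_iff) auto

lemma emeasure_M11: "A \<subseteq> {-1<..<1} \<Longrightarrow> emeasure M11 A = emeasure lborel A"
  unfolding M11_def by (rule emeasure_restrict_space) auto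

lemma borel_measurable_M11_cont:
  fixes f :: "real \<Rightarrow> 'b::topological_space"
  assumes "continuous_on {-1<..<1} f" shows "f \<in> borel_measurable M11"
proof -
  have "f \<in> borel_measurable (restrict_space borel {-1<..<1})"
    using assms by (rule borel_measurable_continuous_on_restrict)
  then show ?thesis by (simp add: M11_def measurable_def space_restrict_space sets_restrict_space)
qed

text \<open>The functions \<open>sqrt (1 - t\<^sup>2) p(t)\<close> are used instead of polynomials because the
  inversion formulas can be verified on them directly.\<close>

lemma dominated_function_induct:
  fixes Q :: "(real \<Rightarrow> complex) \<Rightarrow> bool" and Y :: "(real \<Rightarrow> complex) set"
  assumes meas: "\<And>f. f \<in> Y \<Longrightarrow> f \<in> borel_measurable M11"
    and solid: "\<And>f g K. f \<in> Y \<Longrightarrow> g \<in> borel_measurable M11 \<Longrightarrow> (\<And>x. x \<in> {-1<..<1} \<Longrightarrow> cmod (g x) \<le> K * cmod (f x)) \<Longrightarrow> g \<in> Y"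
    and plus: "\<And>f g. f \<in> Y \<Longrightarrow> g \<in> Y \<Longrightarrow> (\<lambda>x. f x + g x) \<in> Y"
    and one: "(\<lambda>_. 1) \<in> Y"
    and add: "\<And>f g. f \<in> Y \<Longrightarrow> g \<in> Y \<Longrightarrow> Q f \<Longrightarrow> Q g \<Longrightarrow> Q (\<lambda>x. f x + g x)"
    and cmult: "\<And>f c. f \<in> Y \<Longrightarrow> Q f \<Longrightarrow> Q (\<lambda>x. c * f x)"
    and lim: "\<And>g f h. (\<And>n::nat. g n \<in> Y) \<Longrightarrow> (\<And>n. Q (g n)) \<Longrightarrow> f \<in> Y \<Longrightarrow> h \<in> Y \<Longrightarrow>
       (\<And>n x. x \<in> {-1<..<1} \<Longrightarrow> cmod (g n x) \<le> cmod (h x)) \<Longrightarrow>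
       (\<And>x. x \<in> {-1<..<1} \<Longrightarrow> (\<lambda>n. g n x) \<longlonglongrightarrow> f x) \<Longrightarrow> Q f"
    and base: "\<And>n. Q (\<lambda>t. complex_of_real (sqrt (1 - t\<^sup>2) * t ^ n))"
    and f: "f \<in> Y"
  shows "Q f"
proof -
  have bdd: "g \<in> Y" if "g \<in> borel_measurable M11" "\<And>x. x \<in> {-1<..<1} \<Longrightarrow> cmod (g x) \<le> K" for g K
    by (rule solid[OF one that(1), of K]) (use that(2) in auto)
  \<comment> \<open>A constant sequence in the limit axiom moves \<open>Q\<close> between functions
    that agree on the interval, since members of \<open>Y\<close> may differ outside it.\<close>
  have cong: "Q g" if "g \<in> Y" "Q h" "h \<in> Y" "\<And>x. x \<in> {-1<..<1} \<Longrightarrow> g x = h x" for g h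
    by (rule lim[of "\<lambda>_. h" g h]) (use that in auto)
  have scal: "(\<lambda>x. c * g x) \<in> Y" if "g \<in> Y" for g c
    by (rule solid[OF that, of _ "cmod c"]) (use meas[OF that] in \<open>auto simp: norm_mult\<close>)
  have sums: "(\<lambda>x. \<Sum>i\<in>I. g i x) \<in> Y \<and> Q (\<lambda>x. \<Sum>i\<in>I. g i x)"
    if "finite I" "\<And>i. i \<in> I \<Longrightarrow> g i \<in> Y" "\<And>i. i \<in> I \<Longrightarrow> Q (g i)" for I :: "'i set" and g
    using that
  proof (induction I rule: finite_induct)
    case empty
    have z: "(\<lambda>x. 0) \<in> Y" using scal[OF one, of 0] by simp
    have b: "(\<lambda>t. complex_of_real (sqrt (1 - t\<^sup>2) * t ^ 0)) \<in> Y"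
    proof (rule bdd[where K = 1])
      show "(\<lambda>t. complex_of_real (sqrt (1 - t\<^sup>2) * t ^ 0)) \<in> borel_measurable M11"
        by (rule borel_measurable_M11) measurable
    qed (auto simp: abs_square_le_1)
    have "Q (\<lambda>x. 0 * complex_of_real (sqrt (1 - x\<^sup>2) * x ^ 0))" by (rule cmult[OF b base])
    then show ?case using z by simp
  next
    case (insert i I)
    then show ?case by (simp add: plus add)
  qed
  have Qpoly: "(\<lambda>t. complex_of_real (sqrt (1 - t\<^sup>2) * p t)) \<in> Y \<and> Q (\<lambda>t. complex_of_real (sqrt (1 - t\<^sup>2) * p t))"
    if "real_polynomial_function p" for p
  proof -
    obtain a n where p: "p = (\<lambda>x. \<Sum>i\<le>n. a i * x ^ i)" using \<open>real_polynomial_function p\<close> by (auto simp: real_polynomial_function_iff_sum)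
    have b: "(\<lambda>t. complex_of_real (sqrt (1 - t\<^sup>2) * t ^ i)) \<in> Y" for i
    proof (rule bdd[where K = 1])
      show "(\<lambda>t. complex_of_real (sqrt (1 - t\<^sup>2) * t ^ i)) \<in> borel_measurable M11"
        by (rule borel_measurable_M11) measurable
      fix x :: real assume "x \<in> {-1<..<1}"
      then have x: "\<bar>x\<bar> \<le> 1" by auto
      have "\<bar>sqrt (1 - x\<^sup>2)\<bar> * \<bar>x\<bar> ^ i \<le> 1 * 1"
        using x by (intro mult_mono power_le_one) (auto simp: abs_square_le_1)
      then show "cmod (complex_of_real (sqrt (1 - x\<^sup>2) * x ^ i)) \<le> 1" by (simp add: norm_mult norm_power abs_mult power_abs)
    qed
    have eq: "(\<lambda>t. complex_of_real (sqrt (1 - t\<^sup>2) * p t)) = (\<lambda>t. \<Sum>i\<le>n. complex_of_real (a i) * complex_of_real (sqrt (1 - t\<^sup>2) * t ^ i))"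
      by (simp add: p sum_distrib_left algebra_simps)
    show ?thesis unfolding eq
      by (rule sums) (use b in \<open>auto intro!: scal cmult base simp del: of_real_mult\<close>)
  qed
  have Qsqrt: "Q (\<lambda>t. complex_of_real (sqrt (1 - t\<^sup>2) * \<phi> t))" if \<phi>: "continuous_on {-1..1} \<phi>" for \<phi>
  proof -
    have "\<exists>p. real_polynomial_function p \<and> (\<forall>x\<in>{-1..1}. \<bar>\<phi> x - p x\<bar> < inverse (real (Suc n)))" for n
      by (rule Stone_Weierstrass_real_polynomial_function[OF compact_Icc \<phi>, of "inverse (real (Suc n))"]) auto
    then obtain p where p: "\<And>n. real_polynomial_function (p n)" "\<And>n x. x \<in> {-1..1} \<Longrightarrow> \<bar>\<phi> x - p n x\<bar> < inverse (real (Suc n))"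
      by metis
    have "bounded (\<phi> ` {-1..1})" by (intro compact_imp_bounded compact_continuous_image \<phi> compact_Icc)
    then obtain K where K: "\<And>x. x \<in> {-1..1} \<Longrightarrow> \<bar>\<phi> x\<bar> \<le> K" unfolding bounded_iff by (metis imageI real_norm_def)
    have sq: "\<bar>sqrt (1 - x\<^sup>2)\<bar> \<le> 1" if "x \<in> {-1<..<1}" for x :: real using that by (auto simp: abs_square_le_1)
    have K0: "0 \<le> K" using K[of 0] by auto
    show ?thesis
    proof (rule lim[of "\<lambda>n t. complex_of_real (sqrt (1 - t\<^sup>2) * p n t)" _ "\<lambda>_. complex_of_real (K + 1)"])
      show "(\<lambda>t. complex_of_real (sqrt (1 - t\<^sup>2) * p n t)) \<in> Y" "Q (\<lambda>t. complex_of_real (sqrt (1 - t\<^sup>2) * p n t))" for n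
        using Qpoly[OF p(1)] by auto
      show "(\<lambda>t. complex_of_real (sqrt (1 - t\<^sup>2) * \<phi> t)) \<in> Y"
      proof (rule bdd[where K = K])
        show "(\<lambda>t. complex_of_real (sqrt (1 - t\<^sup>2) * \<phi> t)) \<in> borel_measurable M11"
          by (rule borel_measurable_M11_cont) (auto intro!: continuous_intros continuous_on_subset[OF \<phi>])
        fix x :: real assume x: "x \<in> {-1<..<1}"
        have "\<bar>sqrt (1 - x\<^sup>2)\<bar> * \<bar>\<phi> x\<bar> \<le> 1 * K" using sq[OF x] K[of x] x by (intro mult_mono) auto
        then show "cmod (complex_of_real (sqrt (1 - x\<^sup>2) * \<phi> x)) \<le> K" by (simp add: norm_mult abs_mult)
      qed
      show "(\<lambda>_. complex_of_real (K + 1)) \<in> Y" using scal[OF one, of "complex_of_real (K + 1)"] by simp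
      fix n and x :: real assume x: "x \<in> {-1<..<1}"
      have "\<bar>p n x\<bar> \<le> K + 1"
      proof -
        have "\<bar>\<phi> x - p n x\<bar> < 1" using p(2)[of x n] x by (auto intro: less_le_trans simp: inverse_eq_divide)
        then show ?thesis using K[of x] x by auto
      qed
      then have "\<bar>sqrt (1 - x\<^sup>2)\<bar> * \<bar>p n x\<bar> \<le> 1 * (K + 1)" using sq[OF x] by (intro mult_mono) auto
      then show "cmod (complex_of_real (sqrt (1 - x\<^sup>2) * p n x)) \<le> cmod (complex_of_real (K + 1))"
        using K0 by (simp only: norm_of_real) (simp add: abs_mult)
    next
      fix x :: real assume x: "x \<in> {-1<..<1}"
      have "(\<lambda>n. \<phi> x - p n x) \<longlonglongrightarrow> 0"
        by (rule Lim_null_comparison[OF always_eventually LIMSEQ_inverse_real_of_nat]) (use p(2)[of x] x in \<open>auto intro: less_imp_le\<close>)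
      then have "(\<lambda>n. \<phi> x - (\<phi> x - p n x)) \<longlonglongrightarrow> \<phi> x - 0" by (intro tendsto_intros)
      then have "(\<lambda>n. p n x) \<longlonglongrightarrow> \<phi> x" by simp
      then show "(\<lambda>n. complex_of_real (sqrt (1 - x\<^sup>2) * p n x)) \<longlonglongrightarrow> complex_of_real (sqrt (1 - x\<^sup>2) * \<phi> x)"
        by (intro tendsto_intros)
    qed
  qed
  have Qcont: "(\<lambda>t. complex_of_real (\<phi> t)) \<in> Y \<and> Q (\<lambda>t. complex_of_real (\<phi> t))" if \<phi>: "continuous_on {-1..1} \<phi>" for \<phi>
  proof -
    have "bounded (\<phi> ` {-1..1})" by (intro compact_imp_bounded compact_continuous_image \<phi> compact_Icc)
    then obtain K where K: "\<And>x. x \<in> {-1..1} \<Longrightarrow> \<bar>\<phi> x\<bar> \<le> K" unfolding bounded_iff by (metis imageI real_norm_def)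
    have K0: "0 \<le> K" using K[of 0] by auto
    \<comment> \<open>The maximum in the denominator keeps the second factor continuous up to the
      end points; at each interior point \<open>g n\<close> equals the given function as soon as 1 /
      (n + 1) drops below sqrt (1 - t^2).\<close>
    define g where "g n t = sqrt (1 - t\<^sup>2) * (\<phi> t / max (sqrt (1 - t\<^sup>2)) (inverse (real (Suc n))))" for n t
    have den: "0 < max (sqrt (1 - t\<^sup>2)) (inverse (real (Suc n)))" for t n by (simp add: less_max_iff_disj)
    have c: "continuous_on {-1..1} (\<lambda>t. \<phi> t / max (sqrt (1 - t\<^sup>2)) (inverse (real (Suc n))))" for n
      using den by (intro continuous_intros \<phi>) (auto simp: less_imp_neq[symmetric])
    have gb: "\<bar>g n x\<bar> \<le> K" if x: "x \<in> {-1<..<1}" for n x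
    proof -
      have s0: "0 \<le> sqrt (1 - x\<^sup>2)" using x by (auto simp: abs_square_le_1)
      have "sqrt (1 - x\<^sup>2) / max (sqrt (1 - x\<^sup>2)) (inverse (real (Suc n))) \<le> 1" using den by (simp add: divide_le_eq_1)
      then have "sqrt (1 - x\<^sup>2) / max (sqrt (1 - x\<^sup>2)) (inverse (real (Suc n))) * \<bar>\<phi> x\<bar> \<le> 1 * K"
        using K[of x] x K0 s0 den[of x n] by (intro mult_mono divide_nonneg_pos) auto
      then show ?thesis using s0 den[of x n] by (simp add: g_def abs_mult)
    qed
    have gc: "continuous_on {-1..1} (g n)" for n unfolding g_def by (intro continuous_intros c)
    have YK: "(\<lambda>t. complex_of_real (\<psi> t)) \<in> Y" if "continuous_on {-1..1} \<psi>" "\<And>x. x \<in> {-1<..<1} \<Longrightarrow> \<bar>\<psi> x\<bar> \<le> K" for \<psi>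
      by (rule bdd[where K = K], rule borel_measurable_M11_cont)
        (use that in \<open>auto intro!: continuous_intros continuous_on_subset[OF that(1)]\<close>)
    have Y: "(\<lambda>t. complex_of_real (\<phi> t)) \<in> Y" by (rule YK[OF \<phi>]) (use K in auto)
    moreover have "Q (\<lambda>t. complex_of_real (\<phi> t))"
    proof (rule lim[of "\<lambda>n t. complex_of_real (g n t)" _ "\<lambda>_. complex_of_real K"])
      show "(\<lambda>t. complex_of_real (g n t)) \<in> Y" for n by (rule YK[OF gc gb])
      show "Q (\<lambda>t. complex_of_real (g n t))" for n unfolding g_def by (rule Qsqrt[OF c])
      show "(\<lambda>_. complex_of_real K) \<in> Y" using scal[OF one, of "complex_of_real K"] by simp
      show "cmod (complex_of_real (g n x)) \<le> cmod (complex_of_real K)" if "x \<in> {-1<..<1}" for n x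
        using gb[OF that] K0 by simp
      fix x :: real assume x: "x \<in> {-1<..<1}"
      have s0: "0 < sqrt (1 - x\<^sup>2)" using x by (auto simp: abs_square_less_1 abs_less_iff)
      have "eventually (\<lambda>n. inverse (real (Suc n)) < sqrt (1 - x\<^sup>2)) sequentially"
        by (rule order_tendstoD(2)[OF LIMSEQ_inverse_real_of_nat s0])
      then have "eventually (\<lambda>n. complex_of_real (g n x) = complex_of_real (\<phi> x)) sequentially"
        by eventually_elim (use s0 in \<open>simp add: g_def max_def\<close>)
      then show "(\<lambda>n. complex_of_real (g n x)) \<longlonglongrightarrow> complex_of_real (\<phi> x)" by (rule tendsto_eventually)
    qed (use Y in auto)
    ultimately show ?thesis by blast
  qed
  have indY: "(\<lambda>t. indicator A t) \<in> Y" if "A \<in> sets borel" for A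
    by (rule bdd[where K = 1]) (use that in \<open>auto intro!: borel_measurable_M11 simp: indicator_def\<close>)
  have Qgt: "Q (\<lambda>t. indicator {a<..} t)" for a :: real
  proof (rule lim[of "\<lambda>n t. complex_of_real (min 1 (real n * max 0 (t - a)))" _ "\<lambda>_. 1"])
    have c: "continuous_on {-1..1} (\<lambda>t. min 1 (real n * max 0 (t - a)))" for n by (intro continuous_intros)
    show "(\<lambda>t. complex_of_real (min 1 (real n * max 0 (t - a)))) \<in> Y" "Q (\<lambda>t. complex_of_real (min 1 (real n * max 0 (t - a))))" for n
      using Qcont[OF c] by auto
    show "cmod (complex_of_real (min 1 (real n * max 0 (x - a)))) \<le> cmod 1" for n x by simp
    show "(\<lambda>n. complex_of_real (min 1 (real n * max 0 (x - a)))) \<longlonglongrightarrow> indicator {a<..} x" for x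
    proof (cases "a < x")
      case True
      obtain N :: nat where "1 / (x - a) < real N" using reals_Archimedean2 by blast
      then have N: "1 < real N * (x - a)" using True by (simp add: field_simps)
      have "complex_of_real (min 1 (real n * max 0 (x - a))) = 1" if "N \<le> n" for n
      proof -
        have "real N * (x - a) \<le> real n * (x - a)" using that True by (intro mult_right_mono) auto
        then have "1 < real n * (x - a)" using N by linarith
        then show ?thesis using True by (simp add: min_def max_def)
      qed
      then have "eventually (\<lambda>n. complex_of_real (min 1 (real n * max 0 (x - a))) = indicator {a<..} x) sequentially"
        using True by (auto simp: eventually_sequentially simp del: of_real_eq_1_iff)
      then show ?thesis by (rule tendsto_eventually)
    qed simp
  qed (use one indY in auto)
  have Qind: "Q (\<lambda>t. indicator A t)" if A: "A \<in> sets (borel :: real measure)" for A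
  proof -
    \<comment> \<open>Half-lines form an intersection-stable generator of the Borel sets, so closure
      under complements and disjoint unions is enough for all indicators.\<close>
    have sb: "sets (borel :: real measure) = sigma_sets UNIV (range greaterThan)" by (subst borel_Ioi) simp
    have "{a<..} \<inter> {b<..} = {max a b<..}" for a b :: real by auto
    then have "Int_stable (range (greaterThan :: real \<Rightarrow> _))" by (auto simp: Int_stable_def)
    moreover have "range (greaterThan :: real \<Rightarrow> _) \<subseteq> Pow UNIV" by simp
    moreover have "A \<in> sigma_sets UNIV (range greaterThan)" using A sb by simp
    ultimately show ?thesis
    proof (induct rule: sigma_sets_induct_disjoint)
      case (basic A) then show ?case using Qgt by auto
    next
      case empty
      then show ?case using cmult[OF one, of 0] Qcont[of "\<lambda>_. 1"] by simp
    next
      case (compl A)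
      then have A: "A \<in> sets borel" by (simp add: sb)
      have "Q (\<lambda>t. complex_of_real 1 + (- 1) * indicator A t)"
        by (rule add[OF _ scal[OF indY[OF A]] _ cmult[OF indY[OF A] compl(2)]]) (use Qcont[of "\<lambda>_. 1"] in auto)
      also have "(\<lambda>t. complex_of_real 1 + (- 1) * indicator A t) = (\<lambda>t. indicator (UNIV - A) t :: complex)"
        by (auto simp: indicator_def)
      finally show ?case .
    next
      case (union A)
      have A: "A i \<in> sets borel" for i using union(2) by (auto simp: sb)
      show ?case
      proof (rule lim[of "\<lambda>n t. \<Sum>i<n. indicator (A i) t" _ "\<lambda>_. 1"])
        have *: "(\<lambda>t. \<Sum>i<n. indicator (A i) t) \<in> Y \<and> Q (\<lambda>t. \<Sum>i<n. indicator (A i) t)" for n :: nat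
          by (rule sums) (use union indY[OF A] in auto)
        then show "(\<lambda>t. \<Sum>i<n. indicator (A i) t) \<in> Y" "Q (\<lambda>t. \<Sum>i<n. indicator (A i) t)" for n :: nat by auto
        have eq: "(\<Sum>i<n. indicator (A i) t) = (indicator (\<Union>i<n. A i) t :: complex)" for n t
          using union(1) by (intro indicator_UN_disjoint[symmetric]) (auto simp: disjoint_family_on_def)
        show "cmod (\<Sum>i<n. indicator (A i) x) \<le> cmod 1" for n x unfolding eq by (simp add: indicator_def)
        show "(\<lambda>n. \<Sum>i<n. indicator (A i) x) \<longlonglongrightarrow> (indicator (\<Union>i. A i) x :: complex)" for x
          unfolding eq by (rule LIMSEQ_indicator_UN)
      qed (use one indY A in auto)
    qed
  qed
  have Qsimple: "g \<in> Y \<and> Q g" if g: "simple_function M11 g" for g :: "real \<Rightarrow> complex"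
  proof -
    let ?h = "\<lambda>x. \<Sum>y\<in>g ` space M11. y * indicator (g -` {y} \<inter> space M11) x"
    have S: "g -` {y} \<inter> space M11 \<in> sets borel" if "y \<in> g ` space M11" for y
      using simple_functionD(2)[OF g, of "{y}"] by (auto simp: sets_M11_iff)
    have t: "(\<lambda>x. y * indicator (g -` {y} \<inter> space M11) x) \<in> Y"  "Q (\<lambda>x. y * indicator (g -` {y} \<inter> space M11) x)"
      if "y \<in> g ` space M11" for y
      using scal[OF indY[OF S[OF that]], of y] cmult[OF indY[OF S[OF that]] Qind[OF S[OF that]], of y] by blast+
    define hh where "hh = ?h"
    have h: "hh \<in> Y \<and> Q hh"
      unfolding hh_def by (rule sums[OF simple_functionD(1)[OF g]]) (use t in blast)+
    have eq: "g x = hh x" if "x \<in> {-1<..<1}" for x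
    proof -
      have "g x = (\<Sum>y\<in>g ` space M11. indicator (g -` {y} \<inter> space M11) x *\<^sub>R y)"
        by (rule simple_function_indicator_representation_banach[OF g]) (use that in simp)
      also have "\<dots> = hh x" unfolding hh_def by (intro sum.cong refl) (auto simp: indicator_def)
      finally show ?thesis .
    qed
    have gm: "g \<in> borel_measurable M11" using g by (rule borel_measurable_simple_function)
    have "g \<in> Y" by (rule solid[OF conjunct1[OF h] gm, of 1]) (simp add: eq)
    then show ?thesis using cong[OF _ conjunct2[OF h] conjunct1[OF h] eq] by blast
  qed
  obtain s where s: "\<And>i. simple_function M11 (s i)" "\<And>x. x \<in> space M11 \<Longrightarrow> (\<lambda>i. s i x) \<longlonglongrightarrow> f x"
    "\<And>i x. x \<in> space M11 \<Longrightarrow> dist (s i x) 0 \<le> 2 * dist (f x) 0"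
    using borel_measurable_implies_sequence_metric[OF meas[OF f], of 0] by blast
  show ?thesis
    \<comment> \<open>The simple approximants are bounded by 2 |f|, so the dominating function is
      \<open>2 * f\<close>, a member of \<open>Y\<close> even when \<open>f\<close> is
      unbounded.\<close>
    by (rule lim[of s f "\<lambda>x. 2 * f x"]) (use s Qsimple f scal[OF f, of 2] in \<open>auto simp: norm_mult\<close>)
qed

section \<open>Existence of the finite Hilbert transform\<close>

text \<open>Elements of the space carry arbitrary values outside the interval. Extension by zero
  turns them into Borel functions on the line, to which the whole-line estimates apply.\<close>

definition cut11 :: "(real \<Rightarrow> complex) \<Rightarrow> real \<Rightarrow> complex" where
  "cut11 f t = indicator {-1<..<1} t *\<^sub>R f t"

lemma borel_measurable_cut11: "cut11 f \<in> borel_measurable borel \<longleftrightarrow> f \<in> borel_measurable M11"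
  unfolding M11_def cut11_def by (subst borel_measurable_restrict_space_iff) auto

lemma set_integrable_cut11: "set_integrable lborel {-1<..<1} f \<longleftrightarrow> integrable lborel (cut11 f)"
  by (simp add: set_integrable_def cut11_def[abs_def])

lemma set_integral_cut11: "(LINT t:{-1<..<1}|lborel. f t) = (LINT t|lborel. cut11 f t)"
  by (simp add: set_lebesgue_integral_def cut11_def[abs_def])

lemma cut11_in [simp]: "- 1 < t \<Longrightarrow> t < 1 \<Longrightarrow> cut11 f t = f t"
  by (simp add: cut11_def)

lemma cut11_add: "cut11 (\<lambda>x. f x + g x) = (\<lambda>t. cut11 f t + cut11 g t)"
  by (auto simp: cut11_def indicator_def)

lemma cut11_cmult: "cut11 (\<lambda>x. c * f x) = (\<lambda>t. c * cut11 f t)"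
  by (auto simp: cut11_def indicator_def)

lemma cut11_cong: "(\<And>x. x \<in> {-1<..<1} \<Longrightarrow> f x = g x) \<Longrightarrow> cut11 f = cut11 g"
  by (intro ext) (auto simp: cut11_def indicator_def)

lemma truncated_eq_tru:
  assumes x: "- 1 < x" "x < 1" and e: "0 < e"
  shows "(LINT t:({-1<..<x - e} \<union> {x + e<..<1})|lborel. f t / complex_of_real (t - x)) = tru e (cut11 f) x"
  unfolding set_lebesgue_integral_def tru_def
  by (intro Bochner_Integration.integral_cong refl)
    (use x e in \<open>auto simp: cut11_def hker_def indicator_def divide_inverse\<close>)

lemma fin_hilbert_eq_Lim:
  assumes x: "- 1 < x" "x < 1"
  shows "fin_hilbert f x = Lim (at_right 0) (\<lambda>e. complex_of_real (1 / pi) * tru e (cut11 f) x)"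
proof -
  have ev: "eventually (\<lambda>e. complex_of_real (1 / pi) * (LINT t:({-1<..<x - e} \<union> {x + e<..<1})|lborel. f t / complex_of_real (t - x)) = complex_of_real (1 / pi) * tru e (cut11 f) x) (at_right 0)"
    using eventually_at_right_0 by eventually_elim (simp only: truncated_eq_tru[OF x])
  show ?thesis
    unfolding fin_hilbert_def t2_space_class.Lim_def by (simp only: tendsto_cong[OF ev])
qed

lemma has_pv_imp_fin_hilbert:
  assumes x: "- 1 < x" "x < 1" and pv: "has_pv (cut11 f) x l"
  shows "fin_hilbert f x = l / pi"
proof -
  have "((\<lambda>e. complex_of_real (1 / pi) * tru e (cut11 f) x) \<longlongrightarrow> complex_of_real (1 / pi) * l) (at_right 0)"
    using pv unfolding has_pv_def by (intro tendsto_intros)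
  then show ?thesis unfolding fin_hilbert_eq_Lim[OF x]
    by (subst tendsto_Lim) auto
qed

text \<open>The limits of the approximants differ by at most the sum of their errors and thus form a
  Cauchy sequence. Existence of a limit follows without any candidate for it.\<close>

lemma tendsto_at_right_uniform_approx:
  fixes h :: "real \<Rightarrow> complex"
  assumes "\<And>k::nat. \<exists>g l. (g \<longlongrightarrow> l) (at_right 0) \<and> eventually (\<lambda>e. cmod (h e - g e) \<le> 1 / real (Suc k)) (at_right 0)"
  shows "\<exists>L. (h \<longlongrightarrow> L) (at_right 0)"
proof -
  obtain g l where gl: "\<And>k. (g k \<longlongrightarrow> l k) (at_right 0)" "\<And>k. eventually (\<lambda>e. cmod (h e - g k e) \<le> 1 / real (Suc k)) (at_right 0)"
    using assms by metis
  have dl: "cmod (l k - l j) \<le> 1 / real (Suc k) + 1 / real (Suc j)" for k j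
  proof (rule tendsto_upperbound)
    show "((\<lambda>e. cmod (g k e - g j e)) \<longlongrightarrow> cmod (l k - l j)) (at_right 0)"
      by (intro tendsto_intros gl)
    show "eventually (\<lambda>e. cmod (g k e - g j e) \<le> 1 / real (Suc k) + 1 / real (Suc j)) (at_right 0)"
      using gl(2)[of k] gl(2)[of j]
    proof eventually_elim
      case (elim e)
      have "cmod (g k e - g j e) \<le> cmod (h e - g k e) + cmod (h e - g j e)"
        using norm_triangle_ineq4[of "h e - g j e" "h e - g k e"] by simp
      then show ?case using elim by linarith
    qed
  qed simp
  have "Cauchy l"
  proof (rule metric_CauchyI)
    fix r :: real assume r: "0 < r"
    obtain n where n: "1 / real (Suc n) < r / 2" using r by (metis half_gt_zero nat_approx_posE)
    have "1 / real (Suc k) < r / 2" if "n \<le> k" for k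
      using n that by (meson frac_le le_less_trans of_nat_mono Suc_le_mono zero_le_one order_refl of_nat_0_less_iff zero_less_Suc)
    then show "\<exists>M. \<forall>m\<ge>M. \<forall>n\<ge>M. dist (l m) (l n) < r"
      using dl by (intro exI[of _ n]) (smt (verit) dist_norm field_sum_of_halves)
  qed
  then obtain L where L: "l \<longlonglongrightarrow> L" using Cauchy_convergent convergent_def by blast
  have lL: "cmod (l k - L) \<le> 1 / real (Suc k)" for k
  proof (rule tendsto_upperbound[OF _ always_eventually])
    show "(\<lambda>j. cmod (l k - l j) - 1 / real (Suc j)) \<longlonglongrightarrow> cmod (l k - L)"
      using tendsto_diff[OF tendsto_norm[OF tendsto_diff[OF tendsto_const L]] LIMSEQ_inverse_real_of_nat, of "l k"]
      by (simp add: inverse_eq_divide)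
    show "\<forall>j. cmod (l k - l j) - 1 / real (Suc j) \<le> 1 / real (Suc k)" using dl[of k] by (auto simp: algebra_simps)
  qed simp
  have "(h \<longlongrightarrow> L) (at_right 0)"
  proof (rule tendstoI)
    fix r :: real assume r: "0 < r"
    obtain k where k: "1 / real (Suc k) < r / 3" using r by (metis nat_approx_posE zero_less_divide_iff zero_less_numeral)
    have "eventually (\<lambda>e. dist (g k e) (l k) < r / 3) (at_right 0)"
      using r by (intro tendstoD[OF gl(1)]) simp
    then show "eventually (\<lambda>e. dist (h e) L < r) (at_right 0)"
      using gl(2)[of k]
    proof eventually_elim
      case (elim e)
      have "dist (h e) L \<le> dist (h e) (g k e) + dist (g k e) (l k) + dist (l k) L"
        by (meson add_mono dist_triangle order_refl order_trans)
      then show ?case using elim lL[of k] k by (simp add: dist_norm)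
    qed
  qed
  then show ?thesis by blast
qed

text \<open>The maximal principle: outside a set of measure O(J n), all truncations of
  \<open>F - G n\<close> are small at once. Intersecting these sets over \<open>n\<close> leaves a
  null set, and off it each tolerance is met by some \<open>G n\<close> whose principal value
  exists.\<close>

lemma has_pv_ae_limit:
  assumes F: "integrable lborel F" and G: "\<And>n. integrable lborel (G n)"
    and lim: "(\<lambda>n. LINT t|lborel. cmod (F t - G n t)) \<longlonglongrightarrow> 0"
    and pv: "\<And>n. AE x in lborel. x \<in> S \<longrightarrow> (\<exists>l. has_pv (G n) x l)"
  shows "AE x in lborel. x \<in> S \<longrightarrow> (\<exists>l. has_pv F x l)"
proof -
  define J where "J n = (LINT t|lborel. cmod (F t - G n t))" for n
  have "\<forall>k n. \<exists>B. B \<in> sets borel \<and> emeasure lborel B \<le> ennreal (2560 * pi * J n / (1 / real (Suc k))) \<and>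
    (\<forall>x. x \<notin> B \<longrightarrow> (\<forall>e>0. cmod (tru e (\<lambda>t. F t - G n t) x) \<le> 1 / real (Suc k)))"
    using weak11_tru[OF Bochner_Integration.integrable_diff[OF F G]] unfolding J_def by (meson of_nat_0_less_iff zero_less_Suc zero_less_divide_1_iff)
  then obtain B where B: "\<And>k n. B k n \<in> sets borel" "\<And>k n. emeasure lborel (B k n) \<le> ennreal (2560 * pi * J n / (1 / real (Suc k)))"
    "\<And>k n x e. x \<notin> B k n \<Longrightarrow> 0 < e \<Longrightarrow> cmod (tru e (\<lambda>t. F t - G n t) x) \<le> 1 / real (Suc k)"
    by metis
  define E where "E k = (\<Inter>n. B k n)" for k
  have "emeasure lborel (E k) = 0" for k
  proof -
    have "emeasure lborel (E k) \<le> ennreal (2560 * pi * J n / (1 / real (Suc k)))" for n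
      using emeasure_mono[of "E k" "B k n" lborel] B(1,2)[of k n] by (auto simp: E_def intro: order_trans)
    moreover have "(\<lambda>n. ennreal (2560 * pi * J n / (1 / real (Suc k)))) \<longlonglongrightarrow> ennreal (2560 * pi * 0 / (1 / real (Suc k)))"
      using lim unfolding J_def[symmetric] by (intro tendsto_intros) auto
    ultimately have "emeasure lborel (E k) \<le> ennreal (2560 * pi * 0 / (1 / real (Suc k)))"
      by (intro tendsto_lowerbound[OF _ always_eventually]) auto
    then show ?thesis by simp
  qed
  moreover have "E k \<in> sets borel" for k unfolding E_def using B(1) by auto
  ultimately have "AE x in lborel. x \<notin> E k" for k by (intro AE_not_in) (auto simp: null_sets_def)
  then have "AE x in lborel. \<forall>k. x \<notin> E k" by (simp add: AE_all_countable)
  moreover have "AE x in lborel. \<forall>n. x \<in> S \<longrightarrow> (\<exists>l. has_pv (G n) x l)"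
    unfolding AE_all_countable using pv by blast
  ultimately show ?thesis
  proof eventually_elim
    case (elim x)
    show ?case
    proof
      assume x: "x \<in> S"
      show "\<exists>l. has_pv F x l" unfolding has_pv_def
      proof (rule tendsto_at_right_uniform_approx)
        fix k
        obtain n where n: "x \<notin> B k n" using elim(1) by (auto simp: E_def)
        obtain l where l: "has_pv (G n) x l" using elim(2) x by blast
        have "cmod (tru e F x - tru e (G n) x) \<le> 1 / real (Suc k)" if e: "0 < e" for e
        proof -
          have "tru e (\<lambda>t. F t - G n t) x = tru e F x - tru e (G n) x"
            unfolding tru_def using integrable_mult_hker[OF F e] integrable_mult_hker[OF G e] by (simp add: left_diff_distrib)
          then show ?thesis using B(3)[OF n e] by simp
        qed
        then have "eventually (\<lambda>e. cmod (tru e F x - tru e (G n) x) \<le> 1 / real (Suc k)) (at_right 0)"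
          using eventually_at_right_0 by (auto elim: eventually_mono)
        then show "\<exists>g l. (g \<longlongrightarrow> l) (at_right 0) \<and> eventually (\<lambda>e. cmod (tru e F x - g e) \<le> 1 / real (Suc k)) (at_right 0)"
          using l unfolding has_pv_def by blast
      qed
    qed
  qed
qed

lemma integrable_cut_bound:
  assumes f: "integrable lborel (cut11 f)" and g: "g \<in> borel_measurable M11"
    and le: "\<And>x. x \<in> {-1<..<1} \<Longrightarrow> cmod (g x) \<le> K * cmod (f x)"
  shows "integrable lborel (cut11 g)"
proof (rule Bochner_Integration.integrable_bound)
  show "integrable lborel (\<lambda>x. K * cmod (cut11 f x))" using f by simp
  show "cut11 g \<in> borel_measurable lborel" using g by (simp add: borel_measurable_cut11)
  show "AE x in lborel. norm (cut11 g x) \<le> norm (K * cmod (cut11 f x))"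
    by (intro AE_I2) (use le in \<open>fastforce simp: cut11_def indicator_def\<close>)
qed

lemma has_pv_rw_power:
  assumes x: "- 1 < x" "x < 1"
  shows "integrable lborel (\<lambda>t. complex_of_real (rw t * t ^ n)) \<and> (\<exists>l. has_pv (\<lambda>t. complex_of_real (rw t * t ^ n)) x l)"
proof (induction n)
  case 0
  then show ?case using has_pv_rw[OF x] integrable_rw by auto
next
  case (Suc n)
  have s: "1 < \<bar>t\<bar> \<Longrightarrow> complex_of_real (rw t * t ^ n) = 0" for t by (auto simp: rw_def indicator_def)
  have eq: "(\<lambda>t. complex_of_real t * complex_of_real (rw t * t ^ n)) = (\<lambda>t. complex_of_real (rw t * t ^ Suc n))"
    by (simp add: algebra_simps)
  show ?case
    using integrable_ident_mult[OF conjunct1[OF Suc] s] has_pv_mult_ident[OF conjunct1[OF Suc]] conjunct2[OF Suc]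
    unfolding eq by blast
qed

theorem has_pv_ae:
  assumes fm: "integrable lborel (cut11 f)"
  shows "AE x in lborel. x \<in> {-1<..<1} \<longrightarrow> (\<exists>l. has_pv (cut11 f) x l)"
proof -
  let ?Y = "{f. integrable lborel (cut11 f)}"
  let ?Q = "\<lambda>f. AE x in lborel. x \<in> {-1<..<1} \<longrightarrow> (\<exists>l. has_pv (cut11 f) x l)"
  show ?thesis
  proof (rule dominated_function_induct[where Y = ?Y and Q = ?Q])
    fix g :: "real \<Rightarrow> complex" assume "g \<in> ?Y"
    then have "cut11 g \<in> borel_measurable borel" by auto
    then show "g \<in> borel_measurable M11" by (simp add: borel_measurable_cut11)
  next
    fix f g :: "real \<Rightarrow> complex" and K :: real
    assume "f \<in> ?Y" "g \<in> borel_measurable M11" "\<And>x. x \<in> {-1<..<1} \<Longrightarrow> cmod (g x) \<le> K * cmod (f x)"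
    then show "g \<in> ?Y" using integrable_cut_bound by blast
  next
    fix f g assume "f \<in> ?Y" "g \<in> ?Y"
    then show "(\<lambda>x. f x + g x) \<in> ?Y" by (simp add: cut11_add)
  next
    have "integrable lborel (\<lambda>t::real. indicator {-1<..<1} t *\<^sub>R (1 :: complex))"
      by (intro integrable_scaleR_left integrable_real_indicator) auto
    then show "(\<lambda>_. 1) \<in> ?Y" by (simp add: cut11_def[abs_def])
  next
    fix f g assume Y: "f \<in> ?Y" "g \<in> ?Y" and Q: "?Q f" "?Q g"
    from Q show "?Q (\<lambda>x. f x + g x)"
    proof eventually_elim
      case (elim x)
      then show ?case using has_pv_add[of "cut11 f" "cut11 g" x] Y unfolding cut11_add by auto
    qed
  next
    fix f c assume Q: "?Q f"
    from Q show "?Q (\<lambda>x. c * f x)"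
    proof eventually_elim
      case (elim x)
      then show ?case using has_pv_cmult[of "cut11 f" x _ c] unfolding cut11_cmult by blast
    qed
  next
    fix g :: "nat \<Rightarrow> real \<Rightarrow> complex" and f h
    assume g: "\<And>n. g n \<in> ?Y" and Qg: "\<And>n. ?Q (g n)" and f: "f \<in> ?Y" and h: "h \<in> ?Y"
      and le: "\<And>n x. x \<in> {-1<..<1} \<Longrightarrow> cmod (g n x) \<le> cmod (h x)"
      and lim: "\<And>x. x \<in> {-1<..<1} \<Longrightarrow> (\<lambda>n. g n x) \<longlonglongrightarrow> f x"
    show "?Q f"
    proof (rule has_pv_ae_limit[where G = "\<lambda>n. cut11 (g n)"])
      show "integrable lborel (cut11 f)" "integrable lborel (cut11 (g n))" for n using f g by auto
      have "(\<lambda>n. LINT t|lborel. cmod (cut11 f t - cut11 (g n) t)) \<longlonglongrightarrow> (LINT t|(lborel :: real measure). (0 :: real))"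
      proof (rule integral_dominated_convergence[where w = "\<lambda>t. cmod (cut11 f t) + cmod (cut11 h t)"])
        have [measurable]: "cut11 f \<in> borel_measurable borel" "cut11 (g n) \<in> borel_measurable borel" for n using f g by auto
        show "(\<lambda>t. cmod (cut11 f t - cut11 (g n) t)) \<in> borel_measurable lborel" for n by measurable
        show "AE t in lborel. (\<lambda>n. cmod (cut11 f t - cut11 (g n) t)) \<longlonglongrightarrow> 0"
        proof (rule AE_I2)
          fix t show "(\<lambda>n. cmod (cut11 f t - cut11 (g n) t)) \<longlonglongrightarrow> 0"
          proof (cases "t \<in> {-1<..<1}")
            case True
            have "(\<lambda>n. cmod (f t - g n t)) \<longlonglongrightarrow> cmod (f t - f t)" by (intro tendsto_intros lim True)
            then show ?thesis using True by simp
          qed (simp add: cut11_def)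
        qed
        show "AE t in lborel. norm (cmod (cut11 f t - cut11 (g n) t)) \<le> cmod (cut11 f t) + cmod (cut11 h t)" for n
        proof (rule AE_I2)
          fix t show "norm (cmod (cut11 f t - cut11 (g n) t)) \<le> cmod (cut11 f t) + cmod (cut11 h t)"
            using norm_triangle_ineq4[of "f t" "g n t"] le[of t n] by (cases "t \<in> {-1<..<1}") (auto simp: cut11_def)
        qed
      qed (use f h in auto)
      then show "(\<lambda>n. LINT t|lborel. cmod (cut11 f t - cut11 (g n) t)) \<longlonglongrightarrow> 0" by simp
    qed (use Qg in auto)
  next
    fix n
    show "?Q (\<lambda>t. complex_of_real (sqrt (1 - t\<^sup>2) * t ^ n))"
    proof (intro AE_I2 impI)
      fix x :: real assume "x \<in> {-1<..<1}"
      then have x: "- 1 < x" "x < 1" by auto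
      \<comment> \<open>sqrt (1 - t^2) is (1 - t^2) times the weight, which reduces the base
        functions to weighted powers.\<close>
      have eq: "cut11 (\<lambda>t. complex_of_real (sqrt (1 - t\<^sup>2) * t ^ n)) = (\<lambda>t. complex_of_real (rw t * t ^ n) + (- 1) * complex_of_real (rw t * t ^ (n + 2)))"
      proof
        fix t
        show "cut11 (\<lambda>t. complex_of_real (sqrt (1 - t\<^sup>2) * t ^ n)) t = complex_of_real (rw t * t ^ n) + (- 1) * complex_of_real (rw t * t ^ (n + 2))"
        proof (cases "t \<in> {-1<..<1}")
          case True
          then have "0 < 1 - t\<^sup>2" using one_minus_sq_pos[of t] by auto
          then have e: "sqrt (1 - t\<^sup>2) = rw t * (1 - t\<^sup>2)" using True by (simp add: rw_def real_div_sqrt)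
          have "sqrt (1 - t\<^sup>2) * t ^ n = rw t * t ^ n + (- 1) * (rw t * t ^ (n + 2))"
            unfolding e by (simp add: power_add algebra_simps power2_eq_square)
          then have "complex_of_real (sqrt (1 - t\<^sup>2) * t ^ n) = complex_of_real (rw t * t ^ n + (- 1) * (rw t * t ^ (n + 2)))" by (simp only:)
          then show ?thesis using True by simp
        qed (simp add: cut11_def rw_def)
      qed
      obtain a b where "has_pv (\<lambda>t. complex_of_real (rw t * t ^ n)) x a" "has_pv (\<lambda>t. complex_of_real (rw t * t ^ (n + 2))) x b"
        using has_pv_rw_power[OF x] by blast
      then have "has_pv (\<lambda>t. complex_of_real (rw t * t ^ n) + (- 1) * complex_of_real (rw t * t ^ (n + 2))) x (a + (- 1) * b)"
        by (intro has_pv_add has_pv_cmult integrable_mult_right conjunct1[OF has_pv_rw_power[OF x]])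
      then show "\<exists>l. has_pv (cut11 (\<lambda>t. complex_of_real (sqrt (1 - t\<^sup>2) * t ^ n))) x l" unfolding eq by blast
    qed
  qed (use fm in auto)
qed

theorem has_pv_fin_hilbert_ae:
  assumes fm: "integrable lborel (cut11 f)"
  shows "AE x in M11. has_pv (cut11 f) x (pi * fin_hilbert f x)"
  unfolding AE_M11_iff using has_pv_ae[OF fm]
  by eventually_elim (auto simp: has_pv_imp_fin_hilbert)

lemma finite_measure_M11: "finite_measure M11"
  by (rule finite_measureI) (simp add: emeasure_M11)

section \<open>Borel measurability of the finite Hilbert transform\<close>

lemma borel_measurable_tru [measurable]:
  assumes [measurable]: "F \<in> borel_measurable borel"
  shows "(\<lambda>x. tru e F x) \<in> borel_measurable borel"
  unfolding tru_def by measurable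

text \<open>The strict inequality in \<open>hker\<close> is what makes truncation continuous from
  the right in the radius; with radii decreasing to \<open>e\<close> the kernels eventually agree at
  every point.\<close>

lemma tru_right_continuous:
  assumes F: "integrable lborel F" and e: "0 < e" and q: "\<And>n. e < q n" "q \<longlonglongrightarrow> e"
  shows "(\<lambda>n. tru (q n) F x) \<longlonglongrightarrow> tru e F x"
  unfolding tru_def
proof (rule integral_dominated_convergence[where w = "\<lambda>t. cmod (F t) * (1 / e)"])
  have [measurable]: "F \<in> borel_measurable borel" using F by auto
  show "(\<lambda>t. F t * complex_of_real (hker e (t - x))) \<in> borel_measurable lborel" by measurable
  show "(\<lambda>t. F t * complex_of_real (hker (q n) (t - x))) \<in> borel_measurable lborel" for n by measurable
  show "integrable lborel (\<lambda>t. cmod (F t) * (1 / e))" using F by simp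
  show "AE t in lborel. (\<lambda>n. F t * complex_of_real (hker (q n) (t - x))) \<longlonglongrightarrow> F t * complex_of_real (hker e (t - x))"
  proof (rule AE_I2)
    fix t
    have "eventually (\<lambda>n. hker (q n) (t - x) = hker e (t - x)) sequentially"
    proof (cases "e < \<bar>t - x\<bar>")
      case True
      have "eventually (\<lambda>n. q n < \<bar>t - x\<bar>) sequentially" by (rule order_tendstoD(2)[OF q(2) True])
      then show ?thesis by eventually_elim (use True in \<open>simp add: hker_def\<close>)
    next
      case False
      then show ?thesis using q(1) by (intro always_eventually allI) (auto simp: hker_def dest: less_trans)
    qed
    then have "(\<lambda>n. hker (q n) (t - x)) \<longlonglongrightarrow> hker e (t - x)" by (rule tendsto_eventually)
    then show "(\<lambda>n. F t * complex_of_real (hker (q n) (t - x))) \<longlonglongrightarrow> F t * complex_of_real (hker e (t - x))"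
      by (intro tendsto_intros)
  qed
  fix n
  have "\<bar>hker (q n) u\<bar> \<le> 1 / e" for u
    using abs_hker_le[of "q n" u] q(1)[of n] e by (meson frac_le less_imp_le less_trans order_refl order_trans zero_le_one)
  then have "cmod (F t) * \<bar>hker (q n) (t - x)\<bar> \<le> cmod (F t) * (1 / e)" for t by (intro mult_left_mono) auto
  then show "AE t in lborel. norm (F t * complex_of_real (hker (q n) (t - x))) \<le> cmod (F t) * (1 / e)"
    by (simp add: norm_mult)
qed

lemma rat_seq_right:
  fixes e :: real
  obtains q :: "nat \<Rightarrow> rat" where "\<And>n. e < of_rat (q n)" "(\<lambda>n. real_of_rat (q n)) \<longlonglongrightarrow> e"
proof -
  have "\<exists>q. e < real_of_rat q \<and> real_of_rat q < e + 1 / real (Suc n)" for n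
    by (rule of_rat_dense) simp
  then obtain q where q: "\<And>n. e < real_of_rat (q n)" "\<And>n. real_of_rat (q n) < e + 1 / real (Suc n)" by metis
  have "(\<lambda>n. real_of_rat (q n)) \<longlonglongrightarrow> e"
  proof (rule tendsto_sandwich[OF always_eventually always_eventually tendsto_const])
    show "(\<lambda>n. e + 1 / real (Suc n)) \<longlonglongrightarrow> e"
      using tendsto_add[OF tendsto_const LIMSEQ_inverse_real_of_nat, of e] by (simp add: inverse_eq_divide)
  qed (use q in \<open>auto intro: less_imp_le\<close>)
  then show ?thesis using that q(1) by blast
qed

text \<open>A Cauchy criterion restricted to rational radii, so that the set of convergence is
  described by countably many measurable conditions. Right continuity in the radius recovers the
  real radii.\<close>

lemma convergent_tru_iff:
  assumes F: "integrable lborel F"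
  shows "(\<exists>L. ((\<lambda>e. tru e F x) \<longlongrightarrow> L) (at_right 0)) \<longleftrightarrow>
    (\<forall>k. \<exists>m. \<forall>p q :: rat. 0 < p \<and> real_of_rat p < 1 / real (Suc m) \<and> 0 < q \<and> real_of_rat q < 1 / real (Suc m)
       \<longrightarrow> cmod (tru (of_rat p) F x - tru (of_rat q) F x) \<le> 1 / real (Suc k))" (is "?L \<longleftrightarrow> ?R")
proof
  assume ?L
  then obtain L where L: "((\<lambda>e. tru e F x) \<longlongrightarrow> L) (at_right 0)" by blast
  show ?R
  proof
    fix k
    have "eventually (\<lambda>e. dist (tru e F x) L < 1 / real (Suc k) / 2) (at_right 0)"
      by (rule tendstoD[OF L]) simp
    then obtain b where b: "0 < b" "\<And>e. 0 < e \<Longrightarrow> e < b \<Longrightarrow> dist (tru e F x) L < 1 / real (Suc k) / 2"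
      by (auto simp: eventually_at_right_field)
    obtain m where m: "1 / real (Suc m) < b" using b(1) by (metis nat_approx_posE)
    have "cmod (tru p F x - tru q F x) \<le> 1 / real (Suc k)"
      if "0 < p" "p < 1 / real (Suc m)" "0 < q" "q < 1 / real (Suc m)" for p q
    proof -
      have "dist (tru p F x) (tru q F x) \<le> dist (tru p F x) L + dist (tru q F x) L" by (rule dist_triangle2)
      also have "\<dots> \<le> 1 / real (Suc k) / 2 + 1 / real (Suc k) / 2"
        using b(2)[of p] b(2)[of q] that m by (intro add_mono less_imp_le) auto
      finally show ?thesis unfolding dist_norm by (simp only: field_sum_of_halves)
    qed
    then show "\<exists>m. \<forall>p q :: rat. 0 < p \<and> real_of_rat p < 1 / real (Suc m) \<and> 0 < q \<and> real_of_rat q < 1 / real (Suc m)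
       \<longrightarrow> cmod (tru (of_rat p) F x - tru (of_rat q) F x) \<le> 1 / real (Suc k)"
      by (intro exI[of _ m]) auto
  qed
next
  assume R: ?R
  show ?L
  proof (rule tendsto_at_right_uniform_approx)
    fix k
    obtain m where m: "\<And>p q :: rat. 0 < p \<Longrightarrow> real_of_rat p < 1 / real (Suc m) \<Longrightarrow> 0 < q \<Longrightarrow> real_of_rat q < 1 / real (Suc m)
       \<Longrightarrow> cmod (tru (of_rat p) F x - tru (of_rat q) F x) \<le> 1 / real (Suc k)" using R by metis
    define q0 :: rat where "q0 = 1 / of_nat (Suc (Suc m))"
    have q0: "0 < q0" "real_of_rat q0 < 1 / real (Suc m)" by (auto simp: q0_def of_rat_divide of_rat_add divide_simps)
    have le: "cmod (tru e F x - tru (of_rat q0) F x) \<le> 1 / real (Suc k)" if e: "0 < e" "e < 1 / real (Suc m)" for e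
    proof -
      obtain r :: "nat \<Rightarrow> rat" where r: "\<And>n. e < of_rat (r n)" "(\<lambda>n. real_of_rat (r n)) \<longlonglongrightarrow> e" by (rule rat_seq_right[of e]) blast
      have c: "(\<lambda>n. tru (of_rat (r n)) F x) \<longlonglongrightarrow> tru e F x" by (rule tru_right_continuous[OF F e(1) r])
      show ?thesis
      proof (rule tendsto_upperbound)
        show "(\<lambda>n. cmod (tru (of_rat (r n)) F x - tru (of_rat q0) F x)) \<longlonglongrightarrow> cmod (tru e F x - tru (of_rat q0) F x)"
          by (intro tendsto_intros c)
        have "eventually (\<lambda>n. real_of_rat (r n) < 1 / real (Suc m)) sequentially"
          by (rule order_tendstoD(2)[OF r(2) e(2)])
        then show "eventually (\<lambda>n. cmod (tru (of_rat (r n)) F x - tru (of_rat q0) F x) \<le> 1 / real (Suc k)) sequentially"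
        proof eventually_elim
          case (elim n)
          have "0 < real_of_rat (r n)" using r(1)[of n] e by linarith
          then show ?case using elim q0 by (intro m) auto
        qed
      qed simp
    qed
    have "eventually (\<lambda>e. cmod (tru e F x - tru (of_rat q0) F x) \<le> 1 / real (Suc k)) (at_right 0)"
      unfolding eventually_at_right_field by (rule exI[of _ "1 / real (Suc m)"]) (use le in auto)
    then show "\<exists>g l. (g \<longlongrightarrow> l) (at_right 0) \<and> eventually (\<lambda>e. cmod (tru e F x - g e) \<le> 1 / real (Suc k)) (at_right 0)"
      by (intro exI[of _ "\<lambda>_. tru (of_rat q0) F x"] exI[of _ "tru (of_rat q0) F x"]) simp
  qed
qed

text \<open>The measure is carried by the Borel sets and is not complete, so agreement almost
  everywhere with a Borel function would not suffice; the values at points of divergence matter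
  too.\<close>

theorem borel_measurable_fin_hilbert:
  assumes f: "integrable lborel (cut11 f)"
  shows "fin_hilbert f \<in> borel_measurable M11"
proof -
  have [measurable]: "cut11 f \<in> borel_measurable borel" using f by auto
  define C where "C = {x. \<exists>L. ((\<lambda>e. tru e (cut11 f) x) \<longlongrightarrow> L) (at_right 0)}"
  have [measurable]: "(\<lambda>x. tru e (cut11 f) x) \<in> borel_measurable borel" for e
    by (rule borel_measurable_tru) measurable
  have C: "Measurable.pred borel (\<lambda>x. x \<in> C)"
    unfolding C_def mem_Collect_eq convergent_tru_iff[OF f]
    by (intro pred_intros_countable pred_intros_logic borel_measurable_le) measurable
  \<comment> \<open>\<open>Lim\<close> is a definite description. Where no limit exists it reduces
    to this one unspecified value, the same at every such point, so \<open>H\<close> can match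
    \<open>fin_hilbert\<close> at all points of the interval.\<close>
  define z where "z = (THE l::complex. False)"
  define H where "H x = (if x \<in> C then lim (\<lambda>n. complex_of_real (1 / pi) * tru (1 / real (Suc n)) (cut11 f) x) else z)" for x
  have Cs [measurable]: "C \<in> sets borel" using C by (simp add: pred_def)
  have [measurable]: "(\<lambda>x. lim (\<lambda>n. complex_of_real (1 / pi) * tru (1 / real (Suc n)) (cut11 f) x)) \<in> borel_measurable borel"
    by (rule borel_measurable_lim_metric) measurable
  have "H \<in> borel_measurable borel"
    unfolding H_def by measurable
  then have "H \<in> borel_measurable M11" by (rule borel_measurable_M11)
  moreover have "H x = fin_hilbert f x" if "x \<in> space M11" for x
  proof -
    have x: "- 1 < x" "x < 1" using that by auto
    show ?thesis
    proof (cases "x \<in> C")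
      case True
      then obtain L where L: "((\<lambda>e. tru e (cut11 f) x) \<longlongrightarrow> L) (at_right 0)" by (auto simp: C_def)
      have s: "filterlim (\<lambda>n. 1 / real (Suc n)) (at_right 0) sequentially"
        using LIMSEQ_inverse_real_of_nat by (auto simp: filterlim_at inverse_eq_divide intro!: always_eventually)
      have "(\<lambda>n. complex_of_real (1 / pi) * tru (1 / real (Suc n)) (cut11 f) x) \<longlonglongrightarrow> complex_of_real (1 / pi) * L"
        by (intro tendsto_intros filterlim_compose[OF L s])
      then have "H x = complex_of_real (1 / pi) * L" using True by (simp add: H_def limI)
      also have "\<dots> = L / pi" by simp
      also have "\<dots> = fin_hilbert f x" using has_pv_imp_fin_hilbert[OF x] L by (simp add: has_pv_def)
      finally show ?thesis .
    next
      case False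
      have "\<not> ((\<lambda>e. complex_of_real (1 / pi) * tru e (cut11 f) x) \<longlongrightarrow> l) (at_right 0)" for l
      proof
        assume "((\<lambda>e. complex_of_real (1 / pi) * tru e (cut11 f) x) \<longlongrightarrow> l) (at_right 0)"
        then have "((\<lambda>e. complex_of_real pi * (complex_of_real (1 / pi) * tru e (cut11 f) x)) \<longlongrightarrow> complex_of_real pi * l) (at_right 0)"
          by (intro tendsto_intros)
        then show False using False by (auto simp: C_def)
      qed
      then show ?thesis using False unfolding fin_hilbert_eq_Lim[OF x] H_def z_def t2_space_class.Lim_def by simp
    qed
  qed
  ultimately show ?thesis using measurable_cong[of M11 H "fin_hilbert f" borel] by blast
qed

section \<open>Weak-type bounds for the distribution function of the transform\<close>

lemma measure_M11_le_emeasure: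
  assumes "B \<in> sets borel" "emeasure lborel B \<le> ennreal c" "0 \<le> c"
    and "S \<in> sets M11" and "AE x in M11. x \<in> S \<longrightarrow> x \<in> B"
  shows "measure M11 S \<le> c"
proof -
  have "emeasure M11 S \<le> emeasure M11 (B \<inter> {-1<..<1})"
  proof (rule emeasure_mono_AE)
    show "AE x in M11. x \<in> S \<longrightarrow> x \<in> B \<inter> {-1<..<1}"
      using assms(5) AE_space by eventually_elim auto
    show "B \<inter> {-1<..<1} \<in> sets M11" using assms(1) by (auto simp: sets_M11_iff)
  qed
  also have "\<dots> = emeasure lborel (B \<inter> {-1<..<1})" by (rule emeasure_M11) auto
  also have "\<dots> \<le> emeasure lborel B" using assms(1) by (intro emeasure_mono) auto
  also have "\<dots> \<le> ennreal c" by fact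
  finally show ?thesis using assms(3) by (simp add: measure_def enn2real_leI)
qed

lemma distrib_set [measurable]:
  "f \<in> borel_measurable M11 \<Longrightarrow> {x \<in> space M11. cmod (f x) > r} \<in> sets M11"
  by measurable

theorem distrib_fin_hilbert_weak11:
  assumes f: "integrable lborel (cut11 f)" and lam: "0 < lam"
  shows "distrib_fun (fin_hilbert f) lam \<le> 2560 * (LINT t|lborel. cmod (cut11 f t)) / lam"
proof -
  obtain B where B: "B \<in> sets borel" "emeasure lborel B \<le> ennreal (2560 * pi * (LINT t|lborel. cmod (cut11 f t)) / (pi * lam))"
    "\<forall>x. x \<notin> B \<longrightarrow> (\<forall>e>0. cmod (tru e (cut11 f) x) \<le> pi * lam)"
    using weak11_tru[OF f, of "pi * lam"] lam by auto
  have ae: "AE x in M11. x \<in> {x \<in> space M11. cmod (fin_hilbert f x) > lam} \<longrightarrow> x \<in> B"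
    using has_pv_fin_hilbert_ae[OF f]
  proof eventually_elim
    case (elim x)
    show ?case
    proof (rule impI, rule ccontr)
      assume x: "x \<in> {x \<in> space M11. lam < cmod (fin_hilbert f x)}" "x \<notin> B"
      have "cmod (pi * fin_hilbert f x) \<le> pi * lam"
      proof (rule tendsto_upperbound)
        show "((\<lambda>e. cmod (tru e (cut11 f) x)) \<longlongrightarrow> cmod (pi * fin_hilbert f x)) (at_right 0)"
          using elim unfolding has_pv_def by (rule tendsto_norm)
        show "eventually (\<lambda>e. cmod (tru e (cut11 f) x) \<le> pi * lam) (at_right 0)"
          using eventually_at_right_0 by eventually_elim (use B(3) x in auto)
      qed simp
      then show False using x by (simp add: norm_mult)
    qed
  qed
  have "distrib_fun (fin_hilbert f) lam \<le> 2560 * pi * (LINT t|lborel. cmod (cut11 f t)) / (pi * lam)"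
    unfolding distrib_fun_def
    by (intro measure_M11_le_emeasure[OF B(1,2) _ distrib_set[OF borel_measurable_fin_hilbert[OF f]] ae]) (use lam in simp)
  also have "\<dots> = 2560 * (LINT t|lborel. cmod (cut11 f t)) / lam" by simp
  finally show ?thesis .
qed

theorem distrib_fin_hilbert_weak22:
  assumes f: "integrable lborel (cut11 f)" and f2: "integrable lborel (\<lambda>t. (cmod (cut11 f t))\<^sup>2)" and lam: "0 < lam"
  shows "distrib_fun (fin_hilbert f) lam \<le> 13654 * (LINT t|lborel. (cmod (cut11 f t))\<^sup>2) / lam\<^sup>2"
proof -
  let ?J = "LINT t|lborel. (cmod (cut11 f t))\<^sup>2"
  obtain B where B: "B \<in> sets borel" "emeasure lborel B \<le> ennreal (40960 * pi\<^sup>2 / 3 * ?J / (pi * lam)\<^sup>2)"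
    "\<forall>x. x \<notin> B \<longrightarrow> (\<forall>e>0. cmod (tru e (cut11 f) x) \<le> pi * lam)"
    using weak22_tru[OF f f2, of "pi * lam"] lam by auto
  have ae: "AE x in M11. x \<in> {x \<in> space M11. cmod (fin_hilbert f x) > lam} \<longrightarrow> x \<in> B"
    using has_pv_fin_hilbert_ae[OF f]
  proof eventually_elim
    case (elim x)
    show ?case
    proof (rule impI, rule ccontr)
      assume x: "x \<in> {x \<in> space M11. lam < cmod (fin_hilbert f x)}" "x \<notin> B"
      have "cmod (pi * fin_hilbert f x) \<le> pi * lam"
      proof (rule tendsto_upperbound)
        show "((\<lambda>e. cmod (tru e (cut11 f) x)) \<longlongrightarrow> cmod (pi * fin_hilbert f x)) (at_right 0)"
          using elim unfolding has_pv_def by (rule tendsto_norm)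
        show "eventually (\<lambda>e. cmod (tru e (cut11 f) x) \<le> pi * lam) (at_right 0)"
          using eventually_at_right_0 by eventually_elim (use B(3) x in auto)
      qed simp
      then show False using x by (simp add: norm_mult)
    qed
  qed
  have "distrib_fun (fin_hilbert f) lam \<le> 40960 * pi\<^sup>2 / 3 * ?J / (pi * lam)\<^sup>2"
    unfolding distrib_fun_def
    by (intro measure_M11_le_emeasure[OF B(1,2) _ distrib_set[OF borel_measurable_fin_hilbert[OF f]] ae]) (use lam in simp)
  also have "\<dots> = 40960 / 3 * ?J / lam\<^sup>2" by (simp add: power_mult_distrib)
  \<comment> \<open>40960 / 3 = 13653.33..., rounded up.\<close>
  also have "\<dots> \<le> 13654 * ?J / lam\<^sup>2" by (intro divide_right_mono mult_right_mono) auto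
  finally show ?thesis .
qed

section \<open>Distribution functions and rearrangement invariant spaces\<close>

lemma distrib_fun_nonneg: "0 \<le> distrib_fun f r"
  by (simp add: distrib_fun_def)

lemma distrib_fun_le_2: "distrib_fun f r \<le> 2"
proof -
  interpret finite_measure M11 by (rule finite_measure_M11)
  have "distrib_fun f r \<le> measure M11 (space M11)" unfolding distrib_fun_def by (rule bounded_measure)
  also have "\<dots> = 2" unfolding measure_def by (simp add: emeasure_M11)
  finally show ?thesis .
qed

lemma distrib_fun_mono:
  assumes f: "f \<in> borel_measurable M11" and le: "AE x in M11. cmod (g x) \<le> cmod (f x)" and r: "r \<le> r'"
  shows "distrib_fun g r' \<le> distrib_fun f r"
proof -
  interpret finite_measure M11 by (rule finite_measure_M11)
  show ?thesis unfolding distrib_fun_def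
    by (rule finite_measure_mono_AE[OF _ distrib_set[OF f]]) (use le r in \<open>auto elim: eventually_mono\<close>)
qed

lemma distrib_fun_antimono:
  "f \<in> borel_measurable M11 \<Longrightarrow> r \<le> r' \<Longrightarrow> distrib_fun f r' \<le> distrib_fun f r"
  by (rule distrib_fun_mono) auto

lemma distrib_fun_right_cont:
  assumes f: "f \<in> borel_measurable M11" and le: "\<And>e. 0 < e \<Longrightarrow> distrib_fun f (r + e) \<le> s"
  shows "distrib_fun f r \<le> s"
proof -
  interpret finite_measure M11 by (rule finite_measure_M11)
  define A where "A n = {x \<in> space M11. cmod (f x) > r + 1 / real (Suc n)}" for n
  have "range A \<subseteq> sets M11" unfolding A_def using distrib_set[OF f] by auto
  moreover have "incseq A"
  proof (rule incseq_SucI)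
    fix n
    have "1 / real (Suc (Suc n)) \<le> 1 / real (Suc n)" by (simp add: frac_le)
    then show "A n \<subseteq> A (Suc n)" by (auto simp: A_def)
  qed
  ultimately have "(\<lambda>n. measure M11 (A n)) \<longlonglongrightarrow> measure M11 (\<Union>n. A n)" by (rule finite_Lim_measure_incseq)
  moreover have "(\<Union>n. A n) = {x \<in> space M11. cmod (f x) > r}"
  proof (intro equalityI subsetI)
    fix x assume "x \<in> {x \<in> space M11. cmod (f x) > r}"
    then have x: "x \<in> space M11" "0 < cmod (f x) - r" by auto
    obtain n where "1 / real (Suc n) < cmod (f x) - r" using x(2) by (metis nat_approx_posE)
    then show "x \<in> (\<Union>n. A n)" using x(1) by (auto simp: A_def algebra_simps intro!: exI[of _ n])
  next
    fix x assume "x \<in> (\<Union>n. A n)"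
    then obtain n where "x \<in> space M11" "r + 1 / real (Suc n) < cmod (f x)" by (auto simp: A_def)
    moreover have "0 < 1 / real (Suc n)" by simp
    ultimately have "r < cmod (f x)" by linarith
    then show "x \<in> {x \<in> space M11. cmod (f x) > r}" using \<open>x \<in> space M11\<close> by blast
  qed
  ultimately have "(\<lambda>n. distrib_fun f (r + 1 / real (Suc n))) \<longlonglongrightarrow> distrib_fun f r" by (simp add: A_def distrib_fun_def)
  then show ?thesis by (rule tendsto_upperbound[OF _ always_eventually]) (use le in auto)
qed

lemma distrib_fun_tendsto_0:
  assumes f: "f \<in> borel_measurable M11"
  shows "(\<lambda>n. distrib_fun f (real n)) \<longlonglongrightarrow> 0"
proof -
  interpret finite_measure M11 by (rule finite_measure_M11)
  define A where "A n = {x \<in> space M11. cmod (f x) > real n}" for n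
  have "range A \<subseteq> sets M11" unfolding A_def using distrib_set[OF f] by auto
  moreover have "decseq A" by (rule decseq_SucI) (auto simp: A_def)
  ultimately have "(\<lambda>n. measure M11 (A n)) \<longlonglongrightarrow> measure M11 (\<Inter>n. A n)" by (rule finite_Lim_measure_decseq)
  moreover have "(\<Inter>n. A n) = {}"
  proof (intro equals0I)
    fix x assume x: "x \<in> (\<Inter>n. A n)"
    obtain n where n: "cmod (f x) < real n" using reals_Archimedean2 by blast
    have "x \<in> A n" using x by blast
    then show False using n by (simp add: A_def)
  qed
  ultimately show ?thesis by (simp add: A_def distrib_fun_def)
qed

text \<open>Since the interval has finite measure the distribution function tends to 0, so some
  level is admissible; right continuity then shows that the infimum defining the rearrangement is
  attained.\<close>

lemma
  assumes f: "f \<in> borel_measurable M11" and s: "0 < s"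
  shows decr_rearr_nonneg: "0 \<le> decr_rearr f s" and distrib_fun_decr_rearr: "distrib_fun f (decr_rearr f s) \<le> s"
proof -
  let ?S = "{r. 0 \<le> r \<and> distrib_fun f r \<le> s}"
  have "eventually (\<lambda>n. distrib_fun f (real n) < s) sequentially"
    by (rule order_tendstoD(2)[OF distrib_fun_tendsto_0[OF f] s])
  then obtain n :: nat where "distrib_fun f (real n) < s" by (auto simp: eventually_sequentially)
  then have n: "real n \<in> ?S" by simp
  show "0 \<le> decr_rearr f s" unfolding decr_rearr_def by (rule cInf_greatest) (use n in blast)+
  show "distrib_fun f (decr_rearr f s) \<le> s"
  proof (rule distrib_fun_right_cont[OF f])
    fix e :: real assume "0 < e"
    then have "Inf ?S < decr_rearr f s + e" by (simp add: decr_rearr_def)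
    then obtain r where r: "r \<in> ?S" "r < decr_rearr f s + e" using cInf_lessD[of ?S] n by blast
    have "distrib_fun f (decr_rearr f s + e) \<le> distrib_fun f r" using distrib_fun_antimono[OF f] r(2) by simp
    then show "distrib_fun f (decr_rearr f s + e) \<le> s" using r(1) by simp
  qed
qed

lemma decr_rearr_leI: "0 \<le> r \<Longrightarrow> distrib_fun f r \<le> s \<Longrightarrow> decr_rearr f s \<le> r"
  unfolding decr_rearr_def by (rule cInf_lower) (auto intro: bdd_belowI[of _ 0])

lemma decr_rearr_mono:
  assumes f: "f \<in> borel_measurable M11" and s: "0 < s" "s \<le> s'"
    and le: "\<And>r. 0 \<le> r \<Longrightarrow> distrib_fun g r \<le> distrib_fun f r"
  shows "decr_rearr g s' \<le> decr_rearr f s"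
  using decr_rearr_nonneg[OF f s(1)] distrib_fun_decr_rearr[OF f s(1)] le s(2)
  by (intro decr_rearr_leI) (auto intro: order_trans)

lemma decr_rearr_eq_0:
  assumes f: "f \<in> borel_measurable M11" and s: "2 \<le> s" shows "decr_rearr f s = 0"
  using decr_rearr_leI[of 0 f s] distrib_fun_le_2[of f 0] decr_rearr_nonneg[OF f, of s] s by simp

section \<open>Affine changes of variable and dilations\<close>

lemma affine_vimage_borel:
  fixes A :: "real set"
  assumes A: "A \<in> sets borel" shows "{x. d + c * x \<in> A} \<in> sets borel"
proof -
  have "(\<lambda>x. d + c * x) -` A \<inter> space borel \<in> sets borel"
    by (rule measurable_sets[OF _ A]) measurable
  then show ?thesis by (simp add: vimage_def)
qed

lemma emeasure_affine_vimage:
  assumes A: "A \<in> sets borel" and c: "c \<noteq> (0::real)"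
  shows "emeasure lborel A = ennreal \<bar>c\<bar> * emeasure lborel {x. d + c * x \<in> A}"
proof -
  have m: "{x. d + c * x \<in> A} \<in> sets borel"
    by (rule affine_vimage_borel[OF A])
  have "emeasure lborel A = (\<integral>\<^sup>+x. indicator A x \<partial>lborel)" using A by simp
  also have "\<dots> = ennreal \<bar>c\<bar> * (\<integral>\<^sup>+x. indicator A (d + c * x) \<partial>lborel)"
    using A c by (intro nn_integral_real_affine) auto
  also have "(\<integral>\<^sup>+x. indicator A (d + c * x) \<partial>lborel) = (\<integral>\<^sup>+x. indicator {x. d + c * x \<in> A} x \<partial>lborel)"
    by (intro nn_integral_cong) (auto simp: indicator_def)
  finally show ?thesis using m by simp
qed

lemma measure_affine_vimage:
  assumes A: "A \<in> sets borel" and c: "c \<noteq> (0::real)"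
  shows "measure lborel {x. d + c * x \<in> A} = measure lborel A / \<bar>c\<bar>"
  using arg_cong[OF emeasure_affine_vimage[OF assms, of d], of enn2real] c
  by (simp add: measure_def enn2real_mult)

lemma distrib_fun_lborel: "distrib_fun f r = measure lborel {x. - 1 < x \<and> x < 1 \<and> cmod (f x) > r}"
proof -
  have e: "{x \<in> space M11. cmod (f x) > r} = {x. - 1 < x \<and> x < 1 \<and> cmod (f x) > r}" by auto
  show ?thesis unfolding distrib_fun_def measure_def e by (subst emeasure_M11) auto
qed

lemma distrib_set_borel: "f \<in> borel_measurable M11 \<Longrightarrow> {x. - 1 < x \<and> x < 1 \<and> cmod (f x) > r} \<in> sets borel"
  using distrib_set[of f r] by (auto simp: sets_M11_iff)

lemma borel_measurable_M11_affine:
  assumes g: "g \<in> borel_measurable M11" and S: "S \<in> sets borel" "\<And>x. x \<in> S \<Longrightarrow> - 1 < d + c * x \<and> d + c * x < 1"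
  shows "(\<lambda>x. if x \<in> S then g (d + c * x) else (0::complex)) \<in> borel_measurable M11"
proof -
  have [measurable]: "cut11 g \<in> borel_measurable borel" using g by (simp add: borel_measurable_cut11)
  have "(\<lambda>x. indicator S x *\<^sub>R cut11 g (d + c * x)) \<in> borel_measurable borel" using S(1) by measurable
  also have "(\<lambda>x. indicator S x *\<^sub>R cut11 g (d + c * x)) = (\<lambda>x. if x \<in> S then g (d + c * x) else (0::complex))"
    using S(2) by (auto simp: indicator_def)
  finally show ?thesis by (rule borel_measurable_M11)
qed

text \<open>\<open>dil\<close> reads \<open>f\<close> at the end points 1 and -1, about which
  measurability on the open interval says nothing. At most two arguments lead there, and they are
  listed as separate cases.\<close>

lemma borel_measurable_dil:
  assumes f: "f \<in> borel_measurable M11" and c: "0 < c"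
  shows "dil c f \<in> borel_measurable M11"
proof -
  have [measurable]: "cut11 f \<in> borel_measurable borel" using f by (simp add: borel_measurable_cut11)
  have "(\<lambda>s. if \<bar>s * c\<bar> < 1 then cut11 f (s * c) else if s * c = 1 then f 1 else if s * c = - 1 then f (- 1) else 0) \<in> borel_measurable borel"
    by measurable
  also have "(\<lambda>s. if \<bar>s * c\<bar> < 1 then cut11 f (s * c) else if s * c = 1 then f 1 else if s * c = - 1 then f (- 1) else 0) = dil c f"
    by (auto simp: dil_def cut11_def indicator_def fun_eq_iff abs_if split: if_splits)
  finally show ?thesis by (rule borel_measurable_M11)
qed

lemma distrib_fun_dil:
  assumes f: "f \<in> borel_measurable M11" and c: "0 < c" and r: "0 \<le> r"
  shows "distrib_fun (dil c f) r \<le> distrib_fun f r / c"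
proof -
  let ?A = "{x. - 1 < x \<and> x < 1 \<and> cmod (f x) > r}"
  have A: "?A \<in> sets borel" by (rule distrib_set_borel[OF f])
  have vm: "{x. 0 + c * x \<in> ?A} \<in> sets borel"
    by (rule affine_vimage_borel[OF A])
  have fm: "emeasure lborel {x. 0 + c * x \<in> ?A} < top"
  proof -
    have "emeasure lborel {x. 0 + c * x \<in> ?A} \<le> emeasure lborel {- 1 / c..1 / c}"
      using c by (intro emeasure_mono) (auto simp: field_simps)
    also have "\<dots> < top" using emeasure_bounded_finite[of "{- 1 / c..1 / c}"] by simp
    finally show ?thesis .
  qed
  have "distrib_fun (dil c f) r = measure lborel {x. - 1 < x \<and> x < 1 \<and> cmod (dil c f x) > r}" by (rule distrib_fun_lborel)
  also have "\<dots> = enn2real (emeasure lborel {x. - 1 < x \<and> x < 1 \<and> cmod (dil c f x) > r})" by (simp add: measure_def)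
  also have "\<dots> \<le> enn2real (emeasure lborel {x. 0 + c * x \<in> ?A})"
  proof (rule enn2real_mono[OF emeasure_mono_AE fm])
    have "AE x in lborel. x \<noteq> 1 / c \<and> x \<noteq> - 1 / c" using AE_lborel_singleton by (auto simp: AE_conj_iff)
    then show "AE x in lborel. x \<in> {x. - 1 < x \<and> x < 1 \<and> cmod (dil c f x) > r} \<longrightarrow> x \<in> {x. 0 + c * x \<in> ?A}"
      by eventually_elim (use c r in \<open>auto simp: dil_def field_simps abs_le_iff less_le split: if_splits\<close>)
    show "{x. 0 + c * x \<in> ?A} \<in> sets lborel" using vm by simp
  qed
  also have "\<dots> = measure lborel ?A / \<bar>c\<bar>" unfolding measure_def[symmetric] using c by (intro measure_affine_vimage[OF A]) simp
  finally show ?thesis using c by (simp add: distrib_fun_lborel)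
qed

locale rispace =
  fixes X :: "(real \<Rightarrow> complex) set" and N :: "(real \<Rightarrow> complex) \<Rightarrow> real"
  assumes ri: "ri_space X N"
begin

lemma bfs: "banach_function_space X N" using ri by (simp add: ri_space_def)

lemmas bfs_conj = bfs[unfolded banach_function_space_def]

lemma X_meas: "f \<in> X \<Longrightarrow> f \<in> borel_measurable M11"
  by (rule subsetD[OF bfs_conj[THEN conjunct1]])

lemma X_zero: "(\<lambda>x. 0) \<in> X"
  by (rule bfs_conj[THEN conjunct2, THEN conjunct1])

lemma X_add: "f \<in> X \<Longrightarrow> g \<in> X \<Longrightarrow> (\<lambda>x. f x + g x) \<in> X"
  by (rule bfs_conj[THEN conjunct2, THEN conjunct2, THEN conjunct1, rule_format])

lemma X_cmult: "f \<in> X \<Longrightarrow> (\<lambda>x. c * f x) \<in> X"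
  by (rule bfs_conj[THEN conjunct2, THEN conjunct2, THEN conjunct2, THEN conjunct1, rule_format])

lemma N_nonneg: "f \<in> X \<Longrightarrow> 0 \<le> N f"
  by (rule bfs_conj[THEN conjunct2, THEN conjunct2, THEN conjunct2, THEN conjunct2, THEN conjunct1, rule_format])

lemma N_zero_iff: "f \<in> X \<Longrightarrow> N f = 0 \<longleftrightarrow> (AE x in M11. f x = 0)"
  by (rule bfs_conj[THEN conjunct2, THEN conjunct2, THEN conjunct2, THEN conjunct2, THEN conjunct2, THEN conjunct1, rule_format])

lemma N_add: "f \<in> X \<Longrightarrow> g \<in> X \<Longrightarrow> N (\<lambda>x. f x + g x) \<le> N f + N g"
  by (rule bfs_conj[THEN conjunct2, THEN conjunct2, THEN conjunct2, THEN conjunct2, THEN conjunct2, THEN conjunct2, THEN conjunct1, rule_format])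

lemma N_cmult: "f \<in> X \<Longrightarrow> N (\<lambda>x. c * f x) = cmod c * N f"
  by (rule bfs_conj[THEN conjunct2, THEN conjunct2, THEN conjunct2, THEN conjunct2, THEN conjunct2, THEN conjunct2, THEN conjunct2, THEN conjunct1, rule_format])

lemma X_nontrivial: "\<exists>f\<in>X. \<not> (AE x in M11. f x = 0)"
  by (rule bfs_conj[THEN conjunct2, THEN conjunct2, THEN conjunct2, THEN conjunct2, THEN conjunct2, THEN conjunct2, THEN conjunct2, THEN conjunct2, THEN conjunct2, THEN conjunct2, THEN conjunct2])

lemma X_ideal:
  "f \<in> X \<Longrightarrow> g \<in> borel_measurable M11 \<Longrightarrow> AE x in M11. cmod (g x) \<le> cmod (f x) \<Longrightarrow> g \<in> X \<and> N g \<le> N f"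
  by (rule bfs_conj[THEN conjunct2, THEN conjunct2, THEN conjunct2, THEN conjunct2, THEN conjunct2, THEN conjunct2, THEN conjunct2, THEN conjunct2, THEN conjunct2, THEN conjunct1, THEN bspec, THEN bspec, THEN mp])

lemma X_fatou:
  fixes h :: "nat \<Rightarrow> real \<Rightarrow> real" and g :: "real \<Rightarrow> real"
  assumes "\<And>n. (\<lambda>x. complex_of_real (h n x)) \<in> X" "g \<in> borel_measurable M11"
    "AE x in M11. (\<forall>n. 0 \<le> h n x \<and> h n x \<le> h (Suc n) x) \<and> (\<lambda>n. h n x) \<longlonglongrightarrow> g x"
    "bdd_above (range (\<lambda>n. N (\<lambda>x. complex_of_real (h n x))))"
  shows "(\<lambda>x. complex_of_real (g x)) \<in> X \<and> N (\<lambda>x. complex_of_real (g x)) = (SUP n. N (\<lambda>x. complex_of_real (h n x)))"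
  by (rule bfs_conj[THEN conjunct2, THEN conjunct2, THEN conjunct2, THEN conjunct2, THEN conjunct2, THEN conjunct2, THEN conjunct2, THEN conjunct2, THEN conjunct2, THEN conjunct2, THEN conjunct1, THEN spec, THEN spec, THEN mp, THEN mp, THEN mp, THEN mp])
    (use assms in simp_all)

text \<open>Rearrangement invariance in terms of distribution functions, which is the quantity that
  weak-type estimates bound.\<close>

lemma X_distrib:
  assumes "f \<in> X" "g \<in> borel_measurable M11" "\<And>r. 0 \<le> r \<Longrightarrow> distrib_fun g r \<le> distrib_fun f r"
  shows "g \<in> X \<and> N g \<le> N f"
proof -
  have "\<forall>s>0. decr_rearr g s \<le> decr_rearr f s"
    using decr_rearr_mono[OF X_meas[OF assms(1)] _ order_refl assms(3)] by simp
  moreover have "\<forall>f\<in>X. \<forall>g\<in>borel_measurable M11. (\<forall>s>0. decr_rearr g s \<le> decr_rearr f s) \<longrightarrow> g \<in> X \<and> N g \<le> N f"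
    using ri unfolding ri_space_def by (rule conjunct2)
  ultimately show ?thesis using assms(1,2) by simp
qed

lemma X_cong:
  assumes "f \<in> X" "g \<in> borel_measurable M11" "AE x in M11. g x = f x"
  shows "g \<in> X" "N g = N f"
proof -
  have "AE x in M11. cmod (g x) \<le> cmod (f x)" using assms(3) by eventually_elim simp
  then have 1: "g \<in> X \<and> N g \<le> N f" by (rule X_ideal[OF assms(1,2)])
  have "AE x in M11. cmod (f x) \<le> cmod (g x)" using assms(3) by eventually_elim simp
  then have "f \<in> X \<and> N f \<le> N g" by (rule X_ideal[OF conjunct1[OF 1] X_meas[OF assms(1)]])
  with 1 show "g \<in> X" "N g = N f" by auto
qed

text \<open>Compressing \<open>g\<close> to each half of the interval halves its distribution function.\<close>

lemma X_distrib_double: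
  assumes f: "f \<in> X" and g: "g \<in> borel_measurable M11"
    and le: "\<And>r. 0 \<le> r \<Longrightarrow> distrib_fun g r \<le> 2 * distrib_fun f r"
  shows "g \<in> X \<and> N g \<le> 2 * N f"
proof -
  define g0 where "g0 = (\<lambda>x. if x \<in> {-1<..<0} then g (1 + 2 * x) else 0)"
  define g1 where "g1 = (\<lambda>x. if x \<in> {0<..<1} then g (- 1 + 2 * x) else 0)"
  have m: "g0 \<in> borel_measurable M11" "g1 \<in> borel_measurable M11"
    unfolding g0_def g1_def using borel_measurable_M11_affine[OF g, of "{-1<..<0}" 1 2] borel_measurable_M11_affine[OF g, of "{0<..<1}" "- 1" 2]
    by auto
  define A where "A r = {x. - 1 < x \<and> x < 1 \<and> cmod (g x) > r}" for r
  have A: "A r \<in> sets borel" for r unfolding A_def by (rule distrib_set_borel[OF g])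
  have s0: "{x. - 1 < x \<and> x < 1 \<and> cmod (g0 x) > r} = {x. 1 + 2 * x \<in> A r}" if "0 \<le> r" for r
    using that by (auto simp: g0_def A_def)
  have s1: "{x. - 1 < x \<and> x < 1 \<and> cmod (g1 x) > r} = {x. - 1 + 2 * x \<in> A r}" if "0 \<le> r" for r
    using that by (auto simp: g1_def A_def)
  have d0: "distrib_fun g0 r = distrib_fun g r / 2" if "0 \<le> r" for r
    unfolding distrib_fun_lborel s0[OF that] by (subst measure_affine_vimage[OF A]) (auto simp: A_def)
  have d1: "distrib_fun g1 r = distrib_fun g r / 2" if "0 \<le> r" for r
    unfolding distrib_fun_lborel s1[OF that] by (subst measure_affine_vimage[OF A]) (auto simp: A_def)
  have X0: "g0 \<in> X \<and> N g0 \<le> N f"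
  proof (rule X_distrib[OF f m(1)])
    fix r :: real assume r: "0 \<le> r"
    show "distrib_fun g0 r \<le> distrib_fun f r" using d0[OF r] le[OF r] by linarith
  qed
  have X1: "g1 \<in> X \<and> N g1 \<le> N f"
  proof (rule X_distrib[OF f m(2)])
    fix r :: real assume r: "0 \<le> r"
    show "distrib_fun g1 r \<le> distrib_fun f r" using d1[OF r] le[OF r] by linarith
  qed
  define h where "h = (\<lambda>x. g0 x + g1 x)"
  have hX: "h \<in> X" "N h \<le> 2 * N f" using X_add N_add X0 X1 by (force simp: h_def)+
  have dh: "distrib_fun g r \<le> distrib_fun h r" if r: "0 \<le> r" for r
  proof -
    interpret finite_measure M11 by (rule finite_measure_M11)
    have "distrib_fun g r = measure M11 {x \<in> space M11. cmod (g0 x) > r} + measure M11 {x \<in> space M11. cmod (g1 x) > r}"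
      using d0[OF r] d1[OF r] by (simp add: distrib_fun_def)
    also have "\<dots> = measure M11 ({x \<in> space M11. cmod (g0 x) > r} \<union> {x \<in> space M11. cmod (g1 x) > r})"
    proof (rule finite_measure_Union[symmetric, OF distrib_set[OF m(1)] distrib_set[OF m(2)]])
      show "{x \<in> space M11. r < cmod (g0 x)} \<inter> {x \<in> space M11. r < cmod (g1 x)} = {}"
      proof (intro equals0I, elim IntE CollectE conjE)
        fix x assume "r < cmod (g0 x)" "r < cmod (g1 x)"
        then have "g0 x \<noteq> 0" "g1 x \<noteq> 0" using r by auto
        then show False unfolding g0_def g1_def by (cases "x < 0") auto
      qed
    qed
    also have "\<dots> \<le> measure M11 {x \<in> space M11. cmod (h x) > r}"
      using r by (intro finite_measure_mono distrib_set X_meas[OF hX(1)]) (auto simp: h_def g0_def g1_def split: if_splits)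
    finally show ?thesis by (simp add: distrib_fun_def)
  qed
  from X_distrib[OF hX(1) g dh] hX(2) show ?thesis by simp
qed

lemma X_dil_ge1:
  assumes f: "f \<in> X" and c: "1 \<le> c" shows "dil c f \<in> X \<and> N (dil c f) \<le> N f"
proof (rule X_distrib[OF f borel_measurable_dil[OF X_meas[OF f]]])
  fix r :: real assume "0 \<le> r"
  then have "distrib_fun (dil c f) r \<le> distrib_fun f r / c" using distrib_fun_dil[OF X_meas[OF f]] c by simp
  also have "\<dots> \<le> distrib_fun f r / 1" using c by (intro divide_left_mono distrib_fun_nonneg) auto
  finally show "distrib_fun (dil c f) r \<le> distrib_fun f r" by simp
qed (use c in simp)

text \<open>The side condition excludes a > 1 with b < 1, where \<open>x * a\<close> may leave
  [-1, 1] and be cut off although \<open>x * (a * b)\<close> lies inside.\<close>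

lemma dil_dil:
  assumes "0 < a" "0 < b" "a \<le> 1 \<or> 1 \<le> b" "x \<in> {-1<..<1}"
  shows "dil a (dil b f) x = dil (a * b) f x"
proof -
  have "\<bar>x * a\<bar> \<le> 1" if "\<bar>x * (a * b)\<bar> \<le> 1 \<or> a \<le> 1"
  proof (cases "a \<le> 1")
    case True
    have "\<bar>x\<bar> * \<bar>a\<bar> \<le> 1 * 1" using assms True by (intro mult_mono) auto
    then show ?thesis by (simp add: abs_mult)
  next
    case False
    then have "\<bar>x * a\<bar> * 1 \<le> \<bar>x * a\<bar> * b" using assms by (intro mult_left_mono) auto
    also have "\<dots> = \<bar>x * (a * b)\<bar>" using assms by (simp add: abs_mult)
    finally show ?thesis using that False by simp
  qed
  then show ?thesis using assms by (auto simp: dil_def mult.assoc)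
qed

lemma X_dil_dil:
  assumes f: "f \<in> X" and ab: "0 < a" "0 < b" "a \<le> 1 \<or> 1 \<le> b" and X: "dil a (dil b f) \<in> X"
  shows "dil (a * b) f \<in> X" "N (dil (a * b) f) = N (dil a (dil b f))"
proof -
  have m: "dil (a * b) f \<in> borel_measurable M11"
    using ab by (intro borel_measurable_dil X_meas[OF f]) simp
  have ae: "AE x in M11. dil (a * b) f x = dil a (dil b f) x"
    unfolding AE_M11_iff by (intro AE_I2 impI dil_dil[OF ab, symmetric])
  show "dil (a * b) f \<in> X" "N (dil (a * b) f) = N (dil a (dil b f))"
    by (rule X_cong[OF X m ae])+
qed

text \<open>Halving the dilation factor at most doubles the distribution function and hence the
  norm. This crude bound ensures that the supremum in \<open>op_norm_on\<close> is taken over a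
  bounded set.\<close>

lemma X_dil_half_power:
  "f \<in> X \<Longrightarrow> 1 / 2 ^ k \<le> c \<Longrightarrow> dil c f \<in> X \<and> N (dil c f) \<le> 2 ^ k * N f"
proof (induction k arbitrary: c f)
  case 0
  then show ?case using X_dil_ge1 by simp
next
  case (Suc k)
  have c0: "0 < c" using Suc.prems(2) by (rule less_le_trans[rotated]) simp
  have d: "dil (2 * c) f \<in> X \<and> N (dil (2 * c) f) \<le> 2 ^ k * N f"
    by (rule Suc.IH[OF Suc.prems(1)]) (use Suc.prems(2) in \<open>simp add: field_simps\<close>)
  have h: "dil (1 / 2) (dil (2 * c) f) \<in> X \<and> N (dil (1 / 2) (dil (2 * c) f)) \<le> 2 * N (dil (2 * c) f)"
  proof (rule X_distrib_double)
    show "distrib_fun (dil (1 / 2) (dil (2 * c) f)) r \<le> 2 * distrib_fun (dil (2 * c) f) r" if "0 \<le> r" for r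
      using distrib_fun_dil[OF X_meas, of "dil (2 * c) f" "1 / 2" r] d that by simp
  qed (use d borel_measurable_dil X_meas in auto)
  have "dil ((1 / 2) * (2 * c)) f \<in> X" "N (dil ((1 / 2) * (2 * c)) f) = N (dil (1 / 2) (dil (2 * c) f))"
    using X_dil_dil[OF Suc.prems(1), of "1 / 2" "2 * c"] h c0 by auto
  then show ?case using h d by simp
qed

lemma X_dil:
  assumes c: "0 < c" shows "\<exists>K. \<forall>f\<in>X. dil c f \<in> X \<and> N (dil c f) \<le> K * N f"
proof -
  have "(1::real) < 2" by simp
  from real_arch_pow[OF this, of "1 / c"] obtain k :: nat where k: "1 / c < 2 ^ k" by (elim exE)
  have "1 / 2 ^ k \<le> c" using less_imp_le[OF k] c by (simp add: divide_le_eq mult.commute)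
  then show ?thesis by (intro exI[of _ "2 ^ k"] ballI X_dil_half_power)
qed

lemma X_dil_mem: "f \<in> X \<Longrightarrow> 0 < c \<Longrightarrow> dil c f \<in> X"
  using X_dil[of c] by auto

lemma op_norm_dil:
  assumes c: "0 < c"
  shows "0 \<le> op_norm_on X N (dil c)" and "f \<in> X \<Longrightarrow> N (dil c f) \<le> op_norm_on X N (dil c) * N f"
proof -
  obtain K where K0: "\<forall>f\<in>X. dil c f \<in> X \<and> N (dil c f) \<le> K * N f" using X_dil[OF c] ..
  note K = bspec[OF K0]
  let ?S = "{N (dil c f) | f. f \<in> X \<and> N f \<le> 1}"
  have bdd: "bdd_above ?S"
  proof (rule bdd_aboveI[of _ "max 0 K"])
    fix y assume "y \<in> ?S"
    then obtain f where f: "f \<in> X" "N f \<le> 1" "y = N (dil c f)" by blast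
    have "y \<le> K * N f" using K f by blast
    also have "\<dots> \<le> max 0 K * 1" using f N_nonneg[OF f(1)] by (intro mult_mono) auto
    finally show "y \<le> max 0 K" by simp
  qed
  have le: "N (dil c f) \<le> op_norm_on X N (dil c)" if "f \<in> X" "N f \<le> 1" for f
    unfolding op_norm_on_def by (rule cSup_upper[OF _ bdd]) (use that in blast)
  have z: "N (\<lambda>x. 0) = 0" using N_zero_iff[OF X_zero] by simp
  show "0 \<le> op_norm_on X N (dil c)"
    using le[OF X_zero] z N_nonneg K X_zero by (metis order_trans zero_le_one)
  assume f: "f \<in> X"
  show "N (dil c f) \<le> op_norm_on X N (dil c) * N f"
  proof (cases "N f = 0")
    case True
    then show ?thesis using K[OF f] by simp
  next
    case False
    then have p: "0 < N f" using N_nonneg[OF f] by simp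
    let ?g = "\<lambda>x. complex_of_real (1 / N f) * f x"
    have cm: "cmod (complex_of_real (1 / N f)) = 1 / N f" using p by (simp only: norm_of_real) simp
    then have g: "?g \<in> X" "N ?g = 1" using X_cmult[OF f] N_cmult[OF f, of "complex_of_real (1 / N f)"] p by (blast, simp only:) simp
    have "dil c ?g = (\<lambda>x. complex_of_real (1 / N f) * dil c f x)" by (auto simp: dil_def)
    then have "N (dil c ?g) = 1 / N f * N (dil c f)" using N_cmult[of "dil c f" "complex_of_real (1 / N f)"] K[OF f] by (simp only: cm)
    then have "1 / N f * N (dil c f) \<le> op_norm_on X N (dil c)" using le[OF g(1)] g(2) by simp
    then show ?thesis using p by (simp add: field_simps)
  qed
qed

lemma dil_power:
  assumes f: "f \<in> X" and a: "0 < a" "\<And>f. f \<in> X \<Longrightarrow> N (dil a f) \<le> K * N f" "0 \<le> K"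
  shows "N (dil (a ^ n) f) \<le> K ^ n * N f"
proof (induction n)
  case 0
  then show ?case using X_dil_ge1[OF f, of 1] by simp
next
  case (Suc n)
  have e: "N (dil (a * a ^ n) f) = N (dil a (dil (a ^ n) f))"
  proof (rule X_dil_dil(2)[OF f])
    show "a \<le> 1 \<or> 1 \<le> a ^ n" by (metis linear one_le_power)
  qed (use a X_dil_mem f in auto)
  have "N (dil a (dil (a ^ n) f)) \<le> K * N (dil (a ^ n) f)" by (rule a(2)) (use X_dil_mem f a in auto)
  also have "\<dots> \<le> K * (K ^ n * N f)" by (rule mult_left_mono[OF Suc a(3)])
  finally show ?case using e by simp
qed

text \<open>A supremum above 1/2 supplies one \<open>t\<close> at which the dilation norm is exactly
  \<open>t powr \<alpha>\<close>. Iterating that dilation handles the powers of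
  \<open>1 / t\<close>; the leftover factor \<open>b \<ge> 1\<close> does not increase norms, and
  rounding costs the constant \<open>t powr (- \<alpha>)\<close>.\<close>

lemma dil_bound_lower_index:
  assumes lo: "1 / 2 < boyd_lower X N"
  shows "\<exists>\<alpha> C. 1 / 2 < \<alpha> \<and> 0 < C \<and> (\<forall>f\<in>X. \<forall>c\<ge>1. N (dil c f) \<le> C * c powr (- \<alpha>) * N f)"
proof -
  have "\<exists>y \<in> (\<lambda>t. ln (op_norm_on X N (dil (1 / t))) / ln t) ` {0<..<1}. 1 / 2 < y"
    by (rule less_cSupD) (use lo in \<open>auto simp: boyd_lower_def\<close>)
  then obtain t where t: "0 < t" "t < 1" "1 / 2 < ln (op_norm_on X N (dil (1 / t))) / ln t" by auto
  define M where "M = op_norm_on X N (dil (1 / t))"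
  define \<alpha> where "\<alpha> = ln M / ln t"
  have \<alpha>: "1 / 2 < \<alpha>" using t(3) by (simp add: \<alpha>_def M_def)
  have M0: "0 \<le> M" unfolding M_def using t by (intro op_norm_dil) simp
  \<comment> \<open>In HOL \<open>ln 0 = 0\<close>, so a vanishing norm would make the exponent
    0.\<close>
  have "M \<noteq> 0" using \<alpha> by (auto simp: \<alpha>_def)
  then have M: "M = t powr \<alpha>" using M0 t by (simp add: powr_def \<alpha>_def)
  have step: "N (dil (1 / t) f) \<le> M * N f" if "f \<in> X" for f
    unfolding M_def using t that by (intro op_norm_dil) auto
  have "N (dil c f) \<le> t powr (- \<alpha>) * c powr (- \<alpha>) * N f" if f: "f \<in> X" and c: "1 \<le> c" for f c
  proof -
    have t1: "1 < 1 / t" using t by simp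
    define n where "n = nat \<lfloor>log (1 / t) c\<rfloor>"
    have l0: "0 \<le> log (1 / t) c" using c t1 by simp
    have n: "real n \<le> log (1 / t) c" "log (1 / t) c < real n + 1" using l0 by (auto simp: n_def; linarith)+
    have c1: "(1 / t) ^ n \<le> c" using n(1) t(1) t1 c le_log_iff[of "1 / t" c "real n"] powr_realpow[of "1 / t" n] by simp
    have c2: "c < (1 / t) ^ (n + 1)" using n(2) t(1) t1 c log_less_iff[of "1 / t" c "real n + 1"] powr_realpow[of "1 / t" "n + 1"] by (simp add: add.commute)
    define b where "b = c / (1 / t) ^ n"
    have tn: "0 < (1 / t) ^ n" using t by simp
    have b: "1 \<le> b" using c1 tn by (simp add: b_def le_divide_eq)
    have bX: "dil b f \<in> X" "N (dil b f) \<le> N f" using X_dil_ge1[OF f b] by auto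
    have "N (dil ((1 / t) ^ n * b) f) = N (dil ((1 / t) ^ n) (dil b f))"
      using tn b by (intro X_dil_dil(2)[OF f] X_dil_mem bX) auto
    moreover have "(1 / t) ^ n * b = c" using t by (simp add: b_def power_divide)
    ultimately have "N (dil c f) = N (dil ((1 / t) ^ n) (dil b f))" by simp
    also have "\<dots> \<le> M ^ n * N (dil b f)" by (rule dil_power[OF bX(1) _ step M0]) (use t in auto)
    also have "\<dots> \<le> M ^ n * N f" using bX(2) M0 by (intro mult_left_mono) auto
    also have "\<dots> \<le> t powr (- \<alpha>) * c powr (- \<alpha>) * N f"
    proof (rule mult_right_mono[OF _ N_nonneg[OF f]])
      have "c powr \<alpha> \<le> ((1 / t) ^ (n + 1)) powr \<alpha>" using c2 c \<alpha> by (intro powr_mono2) auto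
      also have "((1 / t) ^ (n + 1)) powr \<alpha> = (1 / t) powr ((n + 1) * \<alpha>)" using t by (subst powr_realpow[symmetric]) (auto simp: powr_powr)
      also have "\<dots> = t powr (- ((n + 1) * \<alpha>))" using t by (simp add: powr_minus_divide powr_divide)
      finally have "c powr \<alpha> \<le> t powr (- ((n + 1) * \<alpha>))" .
      then have "t powr (n * \<alpha>) * c powr \<alpha> \<le> t powr (n * \<alpha>) * t powr (- ((n + 1) * \<alpha>))" by (intro mult_left_mono) auto
      also have "\<dots> = t powr (- \<alpha>)" by (simp add: powr_add[symmetric] algebra_simps)
      finally have "t powr (n * \<alpha>) * c powr \<alpha> \<le> t powr (- \<alpha>)" .
      then have "t powr (n * \<alpha>) * c powr \<alpha> * c powr (- \<alpha>) \<le> t powr (- \<alpha>) * c powr (- \<alpha>)" by (intro mult_right_mono) auto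
      then have "t powr (n * \<alpha>) \<le> t powr (- \<alpha>) * c powr (- \<alpha>)" using c by (simp add: mult.assoc powr_add[symmetric])
      moreover have "M ^ n = t powr (n * \<alpha>)" using t by (simp add: M powr_power mult.commute)
      ultimately show "M ^ n \<le> t powr (- \<alpha>) * c powr (- \<alpha>)" by simp
    qed
    finally show ?thesis .
  qed
  then show ?thesis using \<alpha> t by (intro exI[of _ \<alpha>] exI[of _ "t powr (- \<alpha>)"]) auto
qed

lemma dil_bound_upper_index:
  assumes up: "boyd_upper X N < 1"
  shows "\<exists>\<beta> C. 0 < \<beta> \<and> \<beta> < 1 \<and> 0 < C \<and> (\<forall>f\<in>X. \<forall>c>0. c \<le> 1 \<longrightarrow> N (dil c f) \<le> C * c powr (- \<beta>) * N f)"
proof -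
  have "\<exists>y \<in> (\<lambda>t. ln (op_norm_on X N (dil (1 / t))) / ln t) ` {1<..}. y < 1"
    by (rule cInf_lessD) (use up in \<open>auto simp: boyd_upper_def\<close>)
  then obtain t where t: "1 < t" "ln (op_norm_on X N (dil (1 / t))) / ln t < 1" by auto
  define M where "M = op_norm_on X N (dil (1 / t))"
  \<comment> \<open>The maximum with 1/2 only serves to make the exponent positive while keeping it
    below 1.\<close>
  define \<beta> where "\<beta> = max (1 / 2) (ln M / ln t)"
  have \<beta>: "0 < \<beta>" "\<beta> < 1" using t(2) by (auto simp: \<beta>_def M_def)
  have M0: "0 \<le> M" unfolding M_def using t by (intro op_norm_dil) simp
  have M: "M \<le> t powr \<beta>"
  proof (cases "M = 0")
    case False
    have "M = t powr (ln M / ln t)" using M0 False t by (simp add: powr_def)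
    also have "\<dots> \<le> t powr \<beta>" using t by (intro powr_mono) (auto simp: \<beta>_def)
    finally show ?thesis .
  qed simp
  have step: "N (dil (1 / t) f) \<le> t powr \<beta> * N f" if f: "f \<in> X" for f
  proof -
    have "N (dil (1 / t) f) \<le> M * N f" unfolding M_def using t f by (intro op_norm_dil) auto
    also have "\<dots> \<le> t powr \<beta> * N f" using M N_nonneg[OF f] by (rule mult_right_mono)
    finally show ?thesis .
  qed
  have "N (dil c f) \<le> t powr \<beta> * c powr (- \<beta>) * N f" if f: "f \<in> X" and c: "0 < c" "c \<le> 1" for f c
  proof -
    define n where "n = nat \<lfloor>log t (1 / c)\<rfloor>"
    have l0: "0 \<le> log t (1 / c)" using c t by (simp add: log_divide)
    have n: "real n \<le> log t (1 / c)" "log t (1 / c) < real n + 1" using l0 by (auto simp: n_def; linarith)+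
    have c1: "t ^ n \<le> 1 / c" using n(1) t c le_log_iff[of t "1 / c" "real n"] by (simp add: powr_realpow)
    have c2: "1 / c < t ^ (n + 1)" using n(2) t c log_less_iff[of t "1 / c" "real n + 1"] powr_realpow[of t "n + 1"] by (simp add: add.commute)
    \<comment> \<open>One power of \<open>t\<close> more than fits below 1 / c is taken, so that the
      remaining dilation has factor at least 1 and is harmless.\<close>
    define b where "b = c * t ^ (n + 1)"
    have b: "1 \<le> b" using c2 c by (simp add: b_def field_simps)
    have bX: "dil b f \<in> X" "N (dil b f) \<le> N f" using X_dil_ge1[OF f b] by auto
    have "N (dil ((1 / t) ^ (n + 1) * b) f) = N (dil ((1 / t) ^ (n + 1)) (dil b f))"
      using t b by (intro X_dil_dil(2)[OF f] X_dil_mem bX) auto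
    moreover have "(1 / t) ^ (n + 1) * b = c" using t by (simp add: b_def power_divide)
    ultimately have "N (dil c f) = N (dil ((1 / t) ^ (n + 1)) (dil b f))" by simp
    also have "\<dots> \<le> (t powr \<beta>) ^ (n + 1) * N (dil b f)" by (rule dil_power[OF bX(1) _ step]) (use t in auto)
    also have "\<dots> \<le> (t powr \<beta>) ^ (n + 1) * N f" using bX(2) by (intro mult_left_mono) auto
    also have "\<dots> \<le> t powr \<beta> * c powr (- \<beta>) * N f"
    proof (rule mult_right_mono[OF _ N_nonneg[OF f]])
      have "(t ^ n) powr \<beta> \<le> (1 / c) powr \<beta>" using c1 t \<beta> by (intro powr_mono2) auto
      moreover have "(t ^ n) powr \<beta> = (t powr \<beta>) ^ n" using t by (simp add: powr_realpow[symmetric] powr_powr powr_power mult.commute)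
      moreover have "(1 / c) powr \<beta> = c powr (- \<beta>)" using c by (simp add: powr_minus_divide powr_divide)
      ultimately have "(t powr \<beta>) ^ n \<le> c powr (- \<beta>)" by simp
      then have "t powr \<beta> * (t powr \<beta>) ^ n \<le> t powr \<beta> * c powr (- \<beta>)" by (intro mult_left_mono) auto
      then show "(t powr \<beta>) ^ (n + 1) \<le> t powr \<beta> * c powr (- \<beta>)" by simp
    qed
    finally show ?thesis .
  qed
  then show ?thesis using \<beta> t by (intro exI[of _ \<beta>] exI[of _ "t powr \<beta>"]) auto
qed

end

section \<open>Spaces with non-trivial Boyd indices\<close>

text \<open>A value above 1 lies in a single dyadic block from 2^j to 2^(j+1), whose own term
  already dominates it; smaller values are absorbed by the leading 1.\<close>

lemma abs_le_dyadic_levels: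
  fixes a :: real
  shows "ennreal a \<le> 1 + (\<Sum>j. ennreal (2 ^ Suc j) * indicator {v. 2 ^ j < v} a)"
proof (cases "a \<le> 1")
  case True
  then have "ennreal a \<le> 1" using ennreal_leI[of a 1] by simp
  then show ?thesis by (rule order_trans) simp
next
  case False
  obtain n :: nat where n: "a \<le> 2 ^ n" using real_arch_pow[of 2 a] by (auto intro: less_imp_le)
  define j where "j = (LEAST n. a \<le> 2 ^ n)"
  have j: "a \<le> 2 ^ j" unfolding j_def using n by (rule LeastI)
  obtain i where i: "j = Suc i" using False j by (cases j) auto
  have "\<not> a \<le> 2 ^ i" using not_less_Least[of i "\<lambda>n. a \<le> 2 ^ n"] i by (simp add: j_def)
  then have "ennreal a \<le> ennreal (2 ^ Suc i) * indicator {v. 2 ^ i < v} a" using j i by (simp add: ennreal_leI del: power_Suc)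
  also have "\<dots> = (\<Sum>k\<in>{i}. ennreal (2 ^ Suc k) * indicator {v. 2 ^ k < v} a)"
    by (simp only: sum.insert sum.empty finite.emptyI empty_iff not_False_eq_True add_0_right)
  also have "\<dots> \<le> (\<Sum>k. ennreal (2 ^ Suc k) * indicator {v. 2 ^ k < v} a)" by (rule sum_le_suminf) auto
  finally show ?thesis by (rule order_trans) simp
qed

lemma nn_integral_M11:
  assumes f: "f \<in> borel_measurable M11"
  shows "(\<integral>\<^sup>+x. ennreal (cmod (cut11 f x)) \<partial>lborel) = (\<integral>\<^sup>+x. ennreal (cmod (f x)) \<partial>M11)"
proof -
  have "(\<integral>\<^sup>+x. ennreal (cmod (f x)) \<partial>M11) = (\<integral>\<^sup>+x. ennreal (cmod (f x)) * indicator {-1<..<1} x \<partial>lborel)"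
    unfolding M11_def by (rule nn_integral_restrict_space) auto
  also have "\<dots> = (\<integral>\<^sup>+x. ennreal (cmod (cut11 f x)) \<partial>lborel)"
    by (intro nn_integral_cong) (auto simp: cut11_def indicator_def)
  finally show ?thesis by simp
qed

text \<open>Freezes the two Boyd indices into power bounds for dilations with explicit constants;
  from here on the indices enter only in this form.\<close>

locale boyd_space = rispace +
  fixes \<alpha> \<beta> Ca Cb :: real
  assumes al: "1 / 2 < \<alpha>" and be: "0 < \<beta>" "\<beta> < 1" and Ca: "0 < Ca" and Cb: "0 < Cb"
    and dil_ge: "\<And>f c. f \<in> X \<Longrightarrow> 1 \<le> c \<Longrightarrow> N (dil c f) \<le> Ca * c powr (- \<alpha>) * N f"
    and dil_le: "\<And>f c. f \<in> X \<Longrightarrow> 0 < c \<Longrightarrow> c \<le> 1 \<Longrightarrow> N (dil c f) \<le> Cb * c powr (- \<beta>) * N f"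
begin

text \<open>If |f| exceeds \<open>r\<close> on a set of measure \<open>m\<close>, then a block of
  height \<open>r\<close> on a centred interval of length \<open>m\<close> is dominated by
  \<open>f\<close> in distribution. Dilating it by m / 2 spreads it over the whole interval, which
  brings the constants into the space and bounds \<open>r\<close> in terms of
  \<open>m\<close>.\<close>

lemma X_one_and_bound:
  assumes f: "f \<in> X" and r: "0 < r" and m: "0 < distrib_fun f r"
  shows "(\<lambda>_. 1) \<in> X \<and> r * N (\<lambda>_. 1) \<le> Cb * (distrib_fun f r / 2) powr (- \<beta>) * N f"
proof -
  define m where "m = distrib_fun f r"
  have m0: "0 < m" "m \<le> 2" using m distrib_fun_le_2[of f r] by (auto simp: m_def)
  define J where "J x = (if \<bar>x\<bar> < m / 2 then complex_of_real r else 0)" for x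
  have Jm: "J \<in> borel_measurable M11" unfolding J_def by (rule borel_measurable_M11) measurable
  have J: "J \<in> X \<and> N J \<le> N f"
  proof (rule X_distrib[OF f Jm])
    fix q :: real assume q: "0 \<le> q"
    show "distrib_fun J q \<le> distrib_fun f q"
    proof (cases "q < r")
      case True
      have "distrib_fun J q \<le> measure lborel {- m / 2..m / 2}"
        unfolding distrib_fun_lborel measure_def
        by (intro enn2real_mono emeasure_mono) (use q m0 in \<open>auto simp: J_def split: if_splits\<close>)
      also have "\<dots> = m" using m0 by simp
      also have "m \<le> distrib_fun f q" unfolding m_def using distrib_fun_antimono[OF X_meas[OF f]] True by simp
      finally show ?thesis .
    next
      case False
      then have "{x. - 1 < x \<and> x < 1 \<and> cmod (J x) > q} = {}" using r q by (auto simp: J_def)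
      then have "distrib_fun J q = 0" unfolding distrib_fun_lborel by (simp only: measure_empty)
      then show ?thesis using distrib_fun_nonneg by simp
    qed
  qed
  have d: "dil (m / 2) J \<in> X" using J m0 by (intro X_dil_mem) auto
  have Nd: "N (dil (m / 2) J) \<le> Cb * (m / 2) powr (- \<beta>) * N f"
  proof -
    have "N (dil (m / 2) J) \<le> Cb * (m / 2) powr (- \<beta>) * N J" using J m0 by (intro dil_le) auto
    also have "\<dots> \<le> Cb * (m / 2) powr (- \<beta>) * N f" using J Cb by (intro mult_left_mono) auto
    finally show ?thesis .
  qed
  have ae: "AE x in M11. complex_of_real r = dil (m / 2) J x"
    unfolding AE_M11_iff
  proof (intro AE_I2 impI)
    fix x :: real assume x: "x \<in> {-1<..<1}"
    have "\<bar>x\<bar> * (m / 2) < 1 * (m / 2)" using x m0 by (intro mult_strict_right_mono) auto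
    moreover have "\<bar>x * (m / 2)\<bar> = \<bar>x\<bar> * (m / 2)" using m0 by (simp add: abs_mult)
    ultimately have a: "\<bar>x * (m / 2)\<bar> < m / 2" by simp
    then have "\<bar>x * (m / 2)\<bar> \<le> 1" using m0 by linarith
    with a show "complex_of_real r = dil (m / 2) J x" by (simp only: dil_def J_def if_True)
  qed
  have c: "(\<lambda>_. complex_of_real r) \<in> X" "N (\<lambda>_. complex_of_real r) = N (dil (m / 2) J)"
    by (rule X_cong[OF d _ ae]; simp)+
  have "(\<lambda>x. complex_of_real (1 / r) * complex_of_real r) \<in> X" by (rule X_cmult[OF c(1)])
  then have one: "(\<lambda>_. 1) \<in> X" using r by simp
  have "N (\<lambda>x. complex_of_real r * 1) = cmod (complex_of_real r) * N (\<lambda>_. 1)" by (rule N_cmult[OF one])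
  then show ?thesis using one c(2) Nd r by (simp add: m_def)
qed

lemma X_one: "(\<lambda>_. 1) \<in> X"
proof -
  obtain f where f: "f \<in> X" "\<not> (AE x in M11. f x = 0)" using X_nontrivial by blast
  interpret finite_measure M11 by (rule finite_measure_M11)
  have "\<exists>r>0. 0 < distrib_fun f r"
  proof (rule ccontr)
    assume n: "\<not> (\<exists>r>0. 0 < distrib_fun f r)"
    have "distrib_fun f r \<le> 0" if "0 < r" for r
    proof (rule ccontr)
      assume "\<not> distrib_fun f r \<le> 0"
      then have "0 < distrib_fun f r" by simp
      then show False using n that by blast
    qed
    then have "distrib_fun f 0 \<le> 0" by (rule distrib_fun_right_cont[OF X_meas[OF f(1)]]) simp
    then have "distrib_fun f 0 = 0" by (intro order_antisym distrib_fun_nonneg)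
    then have "measure M11 {x \<in> space M11. cmod (f x) > 0} = 0" by (simp only: distrib_fun_def)
    then have "{x \<in> space M11. cmod (f x) > 0} \<in> null_sets M11"
      using distrib_set[OF X_meas[OF f(1)], of 0] by (simp add: null_sets_def emeasure_eq_measure)
    then have "AE x in M11. x \<notin> {x \<in> space M11. cmod (f x) > 0}" by (rule AE_not_in)
    then have "AE x in M11. f x = 0" using AE_space by eventually_elim auto
    then show False using f(2) by blast
  qed
  then obtain r where "0 < r" "0 < distrib_fun f r" by blast
  then show ?thesis by (rule conjunct1[OF X_one_and_bound[OF f(1)]])
qed

lemma N_one_pos: "0 < N (\<lambda>_. 1)"
proof -
  have "\<not> (AE x in M11. (1::complex) = 0)"
  proof
    assume "AE x in M11. (1::complex) = 0"
    then have "AE x in M11. x \<notin> space M11" by eventually_elim simp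
    then have "space M11 \<in> null_sets M11" using AE_iff_null_sets[OF sets.top[of M11]] by blast
    then show False by (simp add: null_sets_def emeasure_M11)
  qed
  then have "N (\<lambda>_. 1) \<noteq> 0" using N_zero_iff[OF X_one] by simp
  then show ?thesis using N_nonneg[OF X_one] by simp
qed

lemma X_solid:
  assumes f: "f \<in> X" and g: "g \<in> borel_measurable M11" and le: "\<And>x. x \<in> {-1<..<1} \<Longrightarrow> cmod (g x) \<le> K * cmod (f x)"
  shows "g \<in> X"
proof -
  have "(\<lambda>x. complex_of_real K * f x) \<in> X" by (rule X_cmult[OF f])
  moreover have "AE x in M11. cmod (g x) \<le> cmod (complex_of_real K * f x)"
    unfolding AE_M11_iff
  proof (intro AE_I2 impI)
    fix x :: real assume "x \<in> {-1<..<1}"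
    then have "cmod (g x) \<le> K * cmod (f x)" by (rule le)
    also have "\<dots> \<le> \<bar>K\<bar> * cmod (f x)" by (intro mult_right_mono) auto
    finally show "cmod (g x) \<le> cmod (complex_of_real K * f x)" by (simp add: norm_mult)
  qed
  ultimately show ?thesis using X_ideal g by blast
qed

text \<open>The embedding into weak L^(1/\<beta>), by solving the previous inequality for the
  measure of the level set.\<close>

lemma distrib_fun_bound:
  assumes f: "f \<in> X" "N f \<le> 1" and r: "0 < r"
  shows "distrib_fun f r \<le> 2 * (Cb / N (\<lambda>_. 1)) powr (1 / \<beta>) * r powr (- 1 / \<beta>)"
proof (cases "distrib_fun f r = 0")
  case False
  define m where "m = distrib_fun f r"
  have m: "0 < m" using False distrib_fun_nonneg[of f r] by (simp add: m_def)
  have "r * N (\<lambda>_. 1) \<le> Cb * (m / 2) powr (- \<beta>) * N f" using X_one_and_bound[OF f(1) r] m by (simp add: m_def)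
  also have "\<dots> \<le> Cb * (m / 2) powr (- \<beta>) * 1" using f(2) Cb by (intro mult_left_mono) auto
  finally have "(m / 2) powr \<beta> * (r * N (\<lambda>_. 1)) \<le> (m / 2) powr \<beta> * (Cb * (m / 2) powr (- \<beta>))"
    by (intro mult_left_mono) auto
  also have "\<dots> = Cb" using m by (simp add: powr_minus)
  finally have "(m / 2) powr \<beta> \<le> Cb / N (\<lambda>_. 1) / r" using N_one_pos r by (simp add: field_simps)
  then have "((m / 2) powr \<beta>) powr (1 / \<beta>) \<le> (Cb / N (\<lambda>_. 1) / r) powr (1 / \<beta>)" using be by (intro powr_mono2) auto
  also have "((m / 2) powr \<beta>) powr (1 / \<beta>) = m / 2" using be m by (simp add: powr_powr)
  also have "(Cb / N (\<lambda>_. 1) / r) powr (1 / \<beta>) = (Cb / N (\<lambda>_. 1)) powr (1 / \<beta>) * r powr (- 1 / \<beta>)"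
    using Cb N_one_pos r by (subst powr_divide) (auto simp: powr_minus divide_inverse)
  finally show ?thesis by (simp add: m_def)
qed simp

text \<open>Since 1 / \<beta> > 1, the dyadic level sets contribute a geometric series of ratio 2^(1
  - 1/\<beta>) < 1. The first summand 2 is the length of the interval.\<close>

lemma X_nn_integral_unit:
  "\<exists>K. \<forall>f\<in>X. N f \<le> 1 \<longrightarrow> (\<integral>\<^sup>+x. ennreal (cmod (f x)) \<partial>M11) \<le> ennreal K"
proof -
  interpret finite_measure M11 by (rule finite_measure_M11)
  define Q where "Q = 2 * (Cb / N (\<lambda>_. 1)) powr (1 / \<beta>)"
  have Q: "0 \<le> Q" by (simp add: Q_def)
  define \<rho> where "\<rho> = (2::real) powr (1 - 1 / \<beta>)"
  have "(2::real) powr (1 - 1 / \<beta>) < 2 powr 0" using be by (intro powr_less_mono) (auto simp: field_simps)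
  then have \<rho>: "0 < \<rho>" "\<rho> < 1" by (auto simp: \<rho>_def)
  have trm: "2 ^ Suc j * (Q * (2 ^ j) powr (- 1 / \<beta>)) = 2 * Q * \<rho> ^ j" for j
  proof -
    have "(2 ^ j) powr (- 1 / \<beta>) = ((2::real) powr (- 1 / \<beta>)) ^ j"
      by (simp add: powr_realpow[symmetric] powr_powr powr_power mult.commute)
    moreover have "\<rho> = 2 * 2 powr (- 1 / \<beta>)" unfolding \<rho>_def by (simp add: powr_diff powr_minus divide_inverse)
    ultimately show ?thesis by (simp add: power_mult_distrib)
  qed
  have "(\<integral>\<^sup>+x. ennreal (cmod (f x)) \<partial>M11) \<le> ennreal (2 + 2 * Q / (1 - \<rho>))" if f: "f \<in> X" "N f \<le> 1" for f
  proof -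
    have [measurable]: "f \<in> borel_measurable M11" by (rule X_meas[OF f(1)])
    have "(\<integral>\<^sup>+x. ennreal (cmod (f x)) \<partial>M11) \<le> (\<integral>\<^sup>+x. 1 + (\<Sum>j. ennreal (2 ^ Suc j) * indicator {v. 2 ^ j < v} (cmod (f x))) \<partial>M11)"
      by (intro nn_integral_mono abs_le_dyadic_levels)
    also have "\<dots> = (\<integral>\<^sup>+x. 1 \<partial>M11) + (\<integral>\<^sup>+x. (\<Sum>j. ennreal (2 ^ Suc j) * indicator {v. 2 ^ j < v} (cmod (f x))) \<partial>M11)"
      by (rule nn_integral_add) measurable
    also have "(\<integral>\<^sup>+x. (\<Sum>j. ennreal (2 ^ Suc j) * indicator {v. 2 ^ j < v} (cmod (f x))) \<partial>M11) = (\<Sum>j. \<integral>\<^sup>+x. ennreal (2 ^ Suc j) * indicator {v. 2 ^ j < v} (cmod (f x)) \<partial>M11)"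
      by (rule nn_integral_suminf) measurable
    also have "\<dots> \<le> (\<Sum>j. ennreal (2 * Q * \<rho> ^ j))"
    proof (intro suminf_le)
      fix j :: nat
      have "(\<integral>\<^sup>+x. ennreal (2 ^ Suc j) * indicator {v. 2 ^ j < v} (cmod (f x)) \<partial>M11) =
        (\<integral>\<^sup>+x. ennreal (2 ^ Suc j) * indicator {x \<in> space M11. cmod (f x) > 2 ^ j} x \<partial>M11)"
        by (intro nn_integral_cong) (auto simp: indicator_def)
      also have "\<dots> = ennreal (2 ^ Suc j) * (\<integral>\<^sup>+x. indicator {x \<in> space M11. cmod (f x) > 2 ^ j} x \<partial>M11)"
        by (rule nn_integral_cmult[OF borel_measurable_indicator[OF distrib_set[OF X_meas[OF f(1)]]]])
      also have "(\<integral>\<^sup>+x. indicator {x \<in> space M11. cmod (f x) > 2 ^ j} x \<partial>M11) = ennreal (distrib_fun f (2 ^ j))"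
        using distrib_set[OF X_meas[OF f(1)], of "2 ^ j"] by (subst nn_integral_indicator) (auto simp: distrib_fun_def emeasure_eq_measure)
      also have "ennreal (2 ^ Suc j) * ennreal (distrib_fun f (2 ^ j)) = ennreal (2 ^ Suc j * distrib_fun f (2 ^ j))"
        by (rule ennreal_mult[symmetric]) (auto simp: distrib_fun_nonneg)
      also have "\<dots> \<le> ennreal (2 ^ Suc j * (Q * (2 ^ j) powr (- 1 / \<beta>)))"
        using distrib_fun_bound[OF f, of "2 ^ j"] by (intro ennreal_leI mult_left_mono) (auto simp: Q_def)
      also have "\<dots> = ennreal (2 * Q * \<rho> ^ j)" by (simp only: trm)
      finally show "(\<integral>\<^sup>+x. ennreal (2 ^ Suc j) * indicator {v. 2 ^ j < v} (cmod (f x)) \<partial>M11) \<le> ennreal (2 * Q * \<rho> ^ j)" .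
    qed auto
    also have "\<dots> = ennreal (\<Sum>j. 2 * Q * \<rho> ^ j)"
      using Q \<rho> by (intro suminf_ennreal2) (auto intro!: summable_mult summable_geometric)
    also have "(\<Sum>j. 2 * Q * \<rho> ^ j) = 2 * Q / (1 - \<rho>)"
      using \<rho> by (subst suminf_mult) (auto simp: suminf_geometric intro!: summable_geometric)
    also have "(\<integral>\<^sup>+x. 1 \<partial>M11) = ennreal 2" by (simp add: emeasure_M11)
    finally have "(\<integral>\<^sup>+x. ennreal (cmod (f x)) \<partial>M11) \<le> ennreal 2 + ennreal (2 * Q / (1 - \<rho>))" by simp
    also have "\<dots> = ennreal (2 + 2 * Q / (1 - \<rho>))" by (rule ennreal_plus[symmetric]) (use Q \<rho> in auto)
    finally show ?thesis .
  qed
  then show ?thesis by blast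
qed

lemma X_integrable:
  "\<exists>K. 0 < K \<and> (\<forall>f\<in>X. integrable lborel (cut11 f) \<and> (LINT t|lborel. cmod (cut11 f t)) \<le> K * N f)"
proof -
  obtain K0 where K0: "\<forall>f\<in>X. N f \<le> 1 \<longrightarrow> (\<integral>\<^sup>+x. ennreal (cmod (f x)) \<partial>M11) \<le> ennreal K0" using X_nn_integral_unit ..
  define K where "K = max 1 K0"
  have K: "0 < K" by (simp add: K_def)
  have unit: "integrable lborel (cut11 f) \<and> (LINT t|lborel. cmod (cut11 f t)) \<le> K" if f: "f \<in> X" "N f \<le> 1" for f
  proof -
    have m: "cut11 f \<in> borel_measurable lborel" using X_meas[OF f(1)] by (simp add: borel_measurable_cut11)
    have "(\<integral>\<^sup>+x. ennreal (cmod (cut11 f x)) \<partial>lborel) \<le> ennreal K0" using K0 f nn_integral_M11[OF X_meas[OF f(1)]] by simp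
    also have "\<dots> \<le> ennreal K" by (intro ennreal_leI) (simp add: K_def)
    finally have le: "(\<integral>\<^sup>+x. ennreal (cmod (cut11 f x)) \<partial>lborel) \<le> ennreal K" .
    then have i: "integrable lborel (cut11 f)" using m by (intro integrableI_bounded) (auto intro: le_less_trans)
    have "ennreal (LINT t|lborel. cmod (cut11 f t)) = (\<integral>\<^sup>+x. ennreal (cmod (cut11 f x)) \<partial>lborel)"
      using i by (intro nn_integral_eq_integral[symmetric]) auto
    then show ?thesis using i le K by (metis ennreal_le_iff less_imp_le)
  qed
  have "integrable lborel (cut11 f) \<and> (LINT t|lborel. cmod (cut11 f t)) \<le> K * N f" if f: "f \<in> X" for f
  proof (cases "N f = 0")
    case True
    have "AE x in M11. f x = 0" using N_zero_iff[OF f] True by simp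
    then have "AE x in lborel. cmod (cut11 f x) = 0"
      unfolding AE_M11_iff by eventually_elim (auto simp: cut11_def indicator_def)
    then have "(LINT t|lborel. cmod (cut11 f t)) = 0" by (rule integral_eq_zero_AE)
    then show ?thesis using unit[OF f] True by simp
  next
    case False
    then have p: "0 < N f" using N_nonneg[OF f] by simp
    let ?g = "\<lambda>x. complex_of_real (1 / N f) * f x"
    have cm: "cmod (complex_of_real (1 / N f)) = 1 / N f" using p by (simp only: norm_of_real) simp
    have "N ?g \<le> 1" using N_cmult[OF f, of "complex_of_real (1 / N f)"] p by (simp only: cm) simp
    then have u: "integrable lborel (cut11 ?g) \<and> (LINT t|lborel. cmod (cut11 ?g t)) \<le> K" by (intro unit X_cmult[OF f])
    have "cut11 f = (\<lambda>t. complex_of_real (N f) * cut11 ?g t)" using p by (auto simp: cut11_def)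
    moreover have "integrable lborel (\<lambda>t. complex_of_real (N f) * cut11 ?g t)" using u by (intro integrable_mult_right) simp
    ultimately have i: "integrable lborel (cut11 f)" by (simp only:)
    have "(LINT t|lborel. cmod (cut11 ?g t)) = (LINT t|lborel. (1 / N f) * cmod (cut11 f t))"
      unfolding cut11_cmult norm_mult cm ..
    also have "\<dots> = (1 / N f) * (LINT t|lborel. cmod (cut11 f t))" by (rule integral_mult_right_zero)
    finally have "(1 / N f) * (LINT t|lborel. cmod (cut11 f t)) \<le> K" using u by simp
    then show ?thesis using i p by (simp add: field_simps)
  qed
  then show ?thesis using K by blast
qed

lemma X_int: "f \<in> X \<Longrightarrow> integrable lborel (cut11 f)"
  using X_integrable by (elim exE conjE) (drule (1) bspec, erule conjunct1)

text \<open>The hypothesis says that the rearrangement of \<open>g\<close> at 2 |x| is at most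
  \<open>G x\<close>. If {|g| > r} has measure m, then every |x| < m / 2 must satisfy G x > r, and
  these x already form a set of measure m. Pointwise bounds on level sets thereby become norm
  bounds.\<close>

lemma X_radial_dominated:
  fixes G :: "real \<Rightarrow> real"
  assumes G: "(\<lambda>x. complex_of_real (G x)) \<in> X" and g: "g \<in> borel_measurable M11"
    and le: "AE x in M11. distrib_fun g (G x) \<le> 2 * \<bar>x\<bar>"
  shows "\<And>r. 0 \<le> r \<Longrightarrow> distrib_fun g r \<le> distrib_fun (\<lambda>x. complex_of_real (G x)) r"
    and "g \<in> X \<and> N g \<le> N (\<lambda>x. complex_of_real (G x))"
proof -
  interpret finite_measure M11 by (rule finite_measure_M11)
  show d: "distrib_fun g r \<le> distrib_fun (\<lambda>x. complex_of_real (G x)) r" if r: "0 \<le> r" for r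
  proof -
    define m where "m = distrib_fun g r"
    have m: "0 \<le> m" "m \<le> 2" using distrib_fun_nonneg distrib_fun_le_2 by (auto simp: m_def)
    have "m = measure lborel {- (m / 2)<..<m / 2}" using m by simp
    also have "\<dots> = measure M11 {- (m / 2)<..<m / 2}"
      unfolding measure_def using m by (subst emeasure_M11) auto
    also have "\<dots> \<le> measure M11 {x \<in> space M11. cmod (complex_of_real (G x)) > r}"
    proof (rule finite_measure_mono_AE[OF _ distrib_set[OF X_meas[OF G]]])
      show "AE x in M11. x \<in> {- (m / 2)<..<m / 2} \<longrightarrow> x \<in> {x \<in> space M11. cmod (complex_of_real (G x)) > r}"
        using le AE_space
      proof eventually_elim
        case (elim x)
        show ?case
        proof
          assume x: "x \<in> {- (m / 2)<..<m / 2}"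
          have "r < G x"
          proof (rule ccontr)
            assume "\<not> r < G x"
            then have "m \<le> distrib_fun g (G x)" unfolding m_def by (intro distrib_fun_antimono[OF g]) simp
            then show False using elim(1) x by (auto simp: abs_if split: if_splits)
          qed
          then show "x \<in> {x \<in> space M11. cmod (complex_of_real (G x)) > r}" using elim(2) r by auto
        qed
      qed
    qed
    finally show ?thesis by (simp add: m_def distrib_fun_def)
  qed
  show "g \<in> X \<and> N g \<le> N (\<lambda>x. complex_of_real (G x))"
    by (rule X_distrib[OF G g d])
qed

end

text \<open>The symmetric decreasing rearrangement. The origin is set apart because for essentially
  unbounded \<open>f\<close> the infimum at 0 ranges over the empty set.\<close>

definition dstar :: "(real \<Rightarrow> complex) \<Rightarrow> real \<Rightarrow> real" where
  "dstar f x = (if x = 0 then 0 else decr_rearr f (2 * \<bar>x\<bar>))"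

lemma decr_rearr_less_iff:
  assumes f: "f \<in> borel_measurable M11" and s: "0 < s" and r: "0 \<le> r"
  shows "r < decr_rearr f s \<longleftrightarrow> s < distrib_fun f r"
proof
  show "r < decr_rearr f s \<Longrightarrow> s < distrib_fun f r" using decr_rearr_leI[OF r, of f s] by linarith
  show "s < distrib_fun f r \<Longrightarrow> r < decr_rearr f s"
    using distrib_fun_decr_rearr[OF f s] distrib_fun_antimono[OF f, of "decr_rearr f s" r] by linarith
qed

lemma dstar_nonneg: "f \<in> borel_measurable M11 \<Longrightarrow> 0 \<le> dstar f x"
  by (simp add: dstar_def decr_rearr_nonneg)

lemma dstar_greater:
  assumes f: "f \<in> borel_measurable M11" and r: "0 \<le> r"
  shows "r < dstar f x \<longleftrightarrow> x \<noteq> 0 \<and> 2 * \<bar>x\<bar> < distrib_fun f r"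
proof (cases "x = 0")
  case True
  then show ?thesis using r by (simp add: dstar_def)
next
  case False
  then show ?thesis using decr_rearr_less_iff[OF f _ r, of "2 * \<bar>x\<bar>"] by (simp add: dstar_def)
qed

lemma borel_measurable_dstar:
  assumes f: "f \<in> borel_measurable M11" shows "dstar f \<in> borel_measurable borel"
  unfolding borel_measurable_iff_greater
proof
  fix a :: real
  show "{w \<in> space borel. a < dstar f w} \<in> sets borel"
  proof (cases "0 \<le> a")
    case True
    have "{w \<in> space borel. w \<noteq> 0 \<and> 2 * \<bar>w\<bar> < distrib_fun f a} \<in> sets borel" by measurable
    then show ?thesis by (simp add: dstar_greater[OF f True])
  next
    case False
    then have "{w \<in> space borel. a < dstar f w} = space borel" using dstar_nonneg[OF f] by (auto intro: less_le_trans[of a 0])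
    then show ?thesis by simp
  qed
qed

lemma distrib_fun_dstar:
  assumes f: "f \<in> borel_measurable M11" and r: "0 \<le> r"
  shows "distrib_fun (\<lambda>x. complex_of_real (dstar f x)) r \<le> distrib_fun f r"
proof -
  define m where "m = distrib_fun f r"
  have m: "0 \<le> m" using distrib_fun_nonneg by (simp add: m_def)
  have "distrib_fun (\<lambda>x. complex_of_real (dstar f x)) r \<le> measure lborel {- (m / 2)<..<m / 2}"
    unfolding distrib_fun_lborel measure_def
    by (intro enn2real_mono emeasure_mono) (use m r dstar_nonneg[OF f] dstar_greater[OF f r] in \<open>auto simp: m_def\<close>)
  also have "\<dots> = m" using m by simp
  finally show ?thesis by (simp add: m_def)
qed

context rispace begin

lemma dstar_X:
  assumes f: "f \<in> X"
  shows "(\<lambda>x. complex_of_real (dstar f x)) \<in> X \<and> N (\<lambda>x. complex_of_real (dstar f x)) \<le> N f"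
proof (rule X_distrib[OF f _ distrib_fun_dstar[OF X_meas[OF f]]])
  have [measurable]: "dstar f \<in> borel_measurable borel" by (rule borel_measurable_dstar[OF X_meas[OF f]])
  show "(\<lambda>x. complex_of_real (dstar f x)) \<in> borel_measurable M11" by (rule borel_measurable_M11) measurable
qed

end

text \<open>\<open>gser f x\<close> discretises the Calderon operator
  \<open>(1/s) \<integral>\<^sub>0\<^sup>s f* + s powr (-1/2) \<integral>\<^sub>s f*(u) u powr (-1/2) du\<close> at \<open>s = \<bar>x\<bar>\<close>; the two halves are
  bounded on the space exactly because the upper index is below 1 and the lower one above \<open>1/2\<close>.\<close>

definition gterm :: "(real \<Rightarrow> complex) \<Rightarrow> nat \<Rightarrow> real \<Rightarrow> real" where
  "gterm f j x = (1 / 2) ^ j * decr_rearr f (\<bar>x\<bar> / 2 ^ Suc j) + sqrt 2 ^ j * decr_rearr f (2 ^ j * \<bar>x\<bar>)"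

definition gser :: "(real \<Rightarrow> complex) \<Rightarrow> real \<Rightarrow> real" where
  "gser f x = (\<Sum>j. gterm f j x)"

lemma gterm_nonneg: "f \<in> borel_measurable M11 \<Longrightarrow> x \<noteq> 0 \<Longrightarrow> 0 \<le> gterm f j x"
  unfolding gterm_def by (intro add_nonneg_nonneg mult_nonneg_nonneg decr_rearr_nonneg) auto

lemma gterm_mono:
  assumes f: "f \<in> borel_measurable M11" and x: "x \<noteq> 0"
    and le: "\<And>r. 0 \<le> r \<Longrightarrow> distrib_fun g r \<le> distrib_fun f r"
  shows "gterm g j x \<le> gterm f j x"
  unfolding gterm_def using x
  by (intro add_mono mult_left_mono decr_rearr_mono[OF f _ order_refl le]) auto

context boyd_space begin

text \<open>Summability almost everywhere comes from the embedding into L^1; membership and the norm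
  of the sum come from the Fatou property applied to the increasing partial sums.\<close>

lemma X_series:
  fixes h :: "nat \<Rightarrow> real \<Rightarrow> real"
  assumes h: "\<And>j. (\<lambda>x. complex_of_real (h j x)) \<in> X" and nn: "AE x in M11. \<forall>j. 0 \<le> h j x"
    and Nh: "\<And>j. N (\<lambda>x. complex_of_real (h j x)) \<le> D * \<rho> ^ j" and \<rho>: "0 \<le> \<rho>" "\<rho> < 1" and D: "0 \<le> D"
  shows "AE x in M11. summable (\<lambda>j. h j x)"
    and "(\<lambda>x. complex_of_real (\<Sum>j. h j x)) \<in> X \<and> N (\<lambda>x. complex_of_real (\<Sum>j. h j x)) \<le> D / (1 - \<rho>)"
proof -
  obtain K where K: "0 < K" "\<forall>f\<in>X. integrable lborel (cut11 f) \<and> (LINT t|lborel. cmod (cut11 f t)) \<le> K * N f"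
    using X_integrable by (elim exE conjE)
  have hm [measurable]: "h j \<in> borel_measurable M11" for j
  proof -
    have [measurable]: "(\<lambda>x. complex_of_real (h j x)) \<in> borel_measurable M11" by (rule X_meas[OF h])
    have "(\<lambda>x. Re (complex_of_real (h j x))) \<in> borel_measurable M11" by measurable
    then show ?thesis by simp
  qed
  have int: "(\<integral>\<^sup>+x. ennreal (h j x) \<partial>M11) \<le> ennreal (K * D * \<rho> ^ j)" for j
  proof -
    have "(\<integral>\<^sup>+x. ennreal (h j x) \<partial>M11) \<le> (\<integral>\<^sup>+x. ennreal (cmod (complex_of_real (h j x))) \<partial>M11)"
      by (intro nn_integral_mono ennreal_leI) simp
    also have "\<dots> = (\<integral>\<^sup>+x. ennreal (cmod (cut11 (\<lambda>x. complex_of_real (h j x)) x)) \<partial>lborel)"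
      by (rule nn_integral_M11[OF X_meas[OF h], symmetric])
    also have "\<dots> = ennreal (LINT x|lborel. cmod (cut11 (\<lambda>x. complex_of_real (h j x)) x))"
      using X_int[OF h[of j]] by (intro nn_integral_eq_integral) auto
    also have "\<dots> \<le> ennreal (K * (D * \<rho> ^ j))"
    proof (rule ennreal_leI)
      have "(LINT x|lborel. cmod (cut11 (\<lambda>x. complex_of_real (h j x)) x)) \<le> K * N (\<lambda>x. complex_of_real (h j x))"
        using K(2) h by simp
      also have "\<dots> \<le> K * (D * \<rho> ^ j)" using K(1) Nh by (intro mult_left_mono) auto
      finally show "(LINT x|lborel. cmod (cut11 (\<lambda>x. complex_of_real (h j x)) x)) \<le> K * (D * \<rho> ^ j)" .
    qed
    finally show ?thesis by (simp add: mult.assoc)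
  qed
  have sg: "summable (\<lambda>j. c * \<rho> ^ j)" for c using \<rho> by (intro summable_mult summable_geometric) simp
  have "(\<integral>\<^sup>+x. (\<Sum>j. ennreal (h j x)) \<partial>M11) = (\<Sum>j. \<integral>\<^sup>+x. ennreal (h j x) \<partial>M11)"
    by (rule nn_integral_suminf) measurable
  also have "\<dots> \<le> (\<Sum>j. ennreal (K * D * \<rho> ^ j))" by (intro suminf_le int) auto
  also have "\<dots> = ennreal (\<Sum>j. K * D * \<rho> ^ j)"
    using K D \<rho> by (intro suminf_ennreal2 sg) auto
  also have "\<dots> < \<infinity>" by simp
  finally have fin: "(\<integral>\<^sup>+x. (\<Sum>j. ennreal (h j x)) \<partial>M11) \<noteq> \<infinity>" by simp
  have "AE x in M11. (\<Sum>j. ennreal (h j x)) \<noteq> \<infinity>"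
    by (rule nn_integral_PInf_AE[OF _ fin]) measurable
  then show sm: "AE x in M11. summable (\<lambda>j. h j x)"
    using nn by eventually_elim (auto intro: summable_suminf_not_top)
  define S where "S n x = (\<Sum>j<n. h j x)" for n x
  have S: "(\<lambda>x. complex_of_real (S n x)) \<in> X \<and> N (\<lambda>x. complex_of_real (S n x)) \<le> D * (\<Sum>j<n. \<rho> ^ j)" for n
  proof (induction n)
    case 0
    then show ?case using X_zero N_zero_iff[OF X_zero] by (simp add: S_def)
  next
    case (Suc n)
    have eq: "(\<lambda>x. complex_of_real (S (Suc n) x)) = (\<lambda>x. complex_of_real (S n x) + complex_of_real (h n x))" by (simp add: S_def)
    show ?case unfolding eq using X_add[OF conjunct1[OF Suc] h[of n]] N_add[OF conjunct1[OF Suc] h[of n]] Suc Nh[of n]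
      by (simp add: algebra_simps)
  qed
  have le: "N (\<lambda>x. complex_of_real (S n x)) \<le> D / (1 - \<rho>)" for n
  proof -
    have "(\<Sum>j<n. \<rho> ^ j) \<le> (\<Sum>j. \<rho> ^ j)" using \<rho> by (intro sum_le_suminf summable_geometric) auto
    then have "D * (\<Sum>j<n. \<rho> ^ j) \<le> D * (1 / (1 - \<rho>))" using \<rho> D by (intro mult_left_mono) (auto simp: suminf_geometric)
    then show ?thesis using S[of n] by simp
  qed
  have f: "(\<lambda>x. complex_of_real (\<Sum>j. h j x)) \<in> X \<and> N (\<lambda>x. complex_of_real (\<Sum>j. h j x)) = (SUP n. N (\<lambda>x. complex_of_real (S n x)))"
  proof (rule X_fatou)
    show "(\<lambda>x. \<Sum>j. h j x) \<in> borel_measurable M11" by measurable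
    show "AE x in M11. (\<forall>n. 0 \<le> S n x \<and> S n x \<le> S (Suc n) x) \<and> (\<lambda>n. S n x) \<longlonglongrightarrow> (\<Sum>j. h j x)"
      using sm nn
    proof eventually_elim
      case (elim x)
      then show ?case using summable_LIMSEQ[OF elim(1)] by (auto simp: S_def intro: sum_nonneg)
    qed
    show "bdd_above (range (\<lambda>n. N (\<lambda>x. complex_of_real (S n x))))" by (rule bdd_aboveI[of _ "D / (1 - \<rho>)"]) (use le in auto)
  qed (use S in blast)
  moreover have "(SUP n. N (\<lambda>x. complex_of_real (S n x))) \<le> D / (1 - \<rho>)" by (rule cSUP_least) (use le in auto)
  ultimately show "(\<lambda>x. complex_of_real (\<Sum>j. h j x)) \<in> X \<and> N (\<lambda>x. complex_of_real (\<Sum>j. h j x)) \<le> D / (1 - \<rho>)" by simp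
qed

text \<open>Each half of the term is a dilated copy of \<open>dstar f\<close>. The factors combine
  to (1/2)^j 2^(\<beta> j) and sqrt 2 ^ j 2^(-\<alpha> j), so both decay geometrically exactly when
  \<beta> < 1 and \<alpha> > 1/2.\<close>

lemma gterm_X:
  assumes f: "f \<in> X"
  defines "\<rho> \<equiv> max (2 powr (\<beta> - 1)) (2 powr (1 / 2 - \<alpha>))"
  shows "(\<lambda>x. complex_of_real (gterm f j x)) \<in> X \<and>
    N (\<lambda>x. complex_of_real (gterm f j x)) \<le> ((4 powr \<beta> * Cb + 2 * Ca) * N f) * \<rho> ^ j"
proof -
  let ?F = "\<lambda>x. complex_of_real (dstar f x)"
  note m = X_meas[OF f]
  have j2: "(1::real) / 2 ^ (j + 2) \<le> 1"
  proof -
    have "(1::real) \<le> 2 ^ (j + 2)" by (rule one_le_power) simp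
    then show ?thesis by (simp add: divide_le_eq del: power_add_numeral add_2_eq_Suc')
  qed
  have F: "?F \<in> X" "N ?F \<le> N f" using dstar_X[OF f] by auto
  define A where "A = dil (1 / 2 ^ (j + 2)) ?F"
  \<comment> \<open>Because \<open>dstar\<close> has a built-in factor 2, the required dilation is
    by 2^j / 2, below 1 for j = 0. Splitting off the factor 1/2 lets the bound for dilations of
    factor at least 1 serve every j, at the price of a factor 2.\<close>
  define B where "B = dil (1 / 2) (dil (2 ^ j) ?F)"
  have A: "A \<in> X" "N A \<le> Cb * (1 / 2 ^ (j + 2)) powr (- \<beta>) * N f"
  proof -
    show "A \<in> X" unfolding A_def by (rule X_dil_mem[OF F(1)]) simp
    have "N A \<le> Cb * (1 / 2 ^ (j + 2)) powr (- \<beta>) * N ?F" unfolding A_def by (rule dil_le[OF F(1) _ j2]) simp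
    also have "\<dots> \<le> Cb * (1 / 2 ^ (j + 2)) powr (- \<beta>) * N f" using F(2) Cb by (intro mult_left_mono) auto
    finally show "N A \<le> Cb * (1 / 2 ^ (j + 2)) powr (- \<beta>) * N f" .
  qed
  have B: "B \<in> X" "N B \<le> 2 * (Ca * (2 ^ j) powr (- \<alpha>) * N f)"
  proof -
    have d: "dil (2 ^ j) ?F \<in> X" by (rule X_dil_mem[OF F(1)]) simp
    show "B \<in> X" unfolding B_def by (rule X_dil_mem[OF d]) simp
    have "N B \<le> 2 ^ 1 * N (dil (2 ^ j) ?F)" unfolding B_def using X_dil_half_power[OF d, of 1 "1 / 2"] by simp
    also have "N (dil (2 ^ j) ?F) \<le> Ca * (2 ^ j) powr (- \<alpha>) * N ?F" by (rule dil_ge[OF F(1)]) simp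
    also have "\<dots> \<le> Ca * (2 ^ j) powr (- \<alpha>) * N f" using F(2) Ca by (intro mult_left_mono) auto
    finally show "N B \<le> 2 * (Ca * (2 ^ j) powr (- \<alpha>) * N f)" by simp
  qed
  let ?H = "\<lambda>x. complex_of_real ((1 / 2) ^ j) * A x + complex_of_real (sqrt 2 ^ j) * B x"
  have HX: "?H \<in> X" by (intro X_add X_cmult A B)
  have NH: "N ?H \<le> (1 / 2) ^ j * N A + sqrt 2 ^ j * N B"
  proof -
    have "N ?H \<le> N (\<lambda>x. complex_of_real ((1 / 2) ^ j) * A x) + N (\<lambda>x. complex_of_real (sqrt 2 ^ j) * B x)"
      by (intro N_add X_cmult A B)
    also have "\<dots> = (1 / 2) ^ j * N A + sqrt 2 ^ j * N B"
      unfolding N_cmult[OF A(1)] N_cmult[OF B(1)] norm_of_real by simp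
    finally show ?thesis .
  qed
  have ae: "AE x in M11. complex_of_real (gterm f j x) = ?H x"
  proof -
    have "AE x in lborel. x \<noteq> (0::real)" by (rule AE_lborel_singleton)
    then show ?thesis unfolding AE_M11_iff
    proof eventually_elim
      case (elim x)
      show ?case
      proof
        assume x: "x \<in> {-1<..<1}"
        have "\<bar>x\<bar> * (1 / 2 ^ (j + 2)) \<le> 1 * 1" using x j2 by (intro mult_mono) auto
        then have "\<bar>x * (1 / 2 ^ (j + 2))\<bar> \<le> 1" by (simp add: abs_mult)
        moreover have "2 * \<bar>x * (1 / 2 ^ (j + 2))\<bar> = \<bar>x\<bar> / 2 ^ Suc j" by (simp add: abs_mult)
        ultimately have a: "A x = complex_of_real (decr_rearr f (\<bar>x\<bar> / 2 ^ Suc j))"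
          using elim by (simp add: A_def dil_def dstar_def)
        have x2: "\<bar>x * (1 / 2)\<bar> \<le> 1" using x by auto
        have e2: "2 * \<bar>x * (1 / 2) * 2 ^ j\<bar> = 2 ^ j * \<bar>x\<bar>" by (simp add: abs_mult)
        have b: "B x = complex_of_real (decr_rearr f (2 ^ j * \<bar>x\<bar>))"
        proof (cases "\<bar>x * (1 / 2) * 2 ^ j\<bar> \<le> 1")
          case True
          have "B x = ?F (x * (1 / 2) * 2 ^ j)" using x2 True unfolding B_def dil_def by (simp only: if_True)
          also have "\<dots> = complex_of_real (decr_rearr f (2 ^ j * \<bar>x\<bar>))" using elim e2 by (simp add: dstar_def)
          finally show ?thesis .
        next
          case False
          have "B x = 0" using x2 False unfolding B_def dil_def by (simp only: if_True if_False)
          \<comment> \<open>The rearrangement vanishes from 2 on, the length of the interval, so it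
            agrees with the cut-off built into \<open>dil\<close>.\<close>
          moreover have "decr_rearr f (2 ^ j * \<bar>x\<bar>) = 0" using False e2 by (intro decr_rearr_eq_0[OF m]) linarith
          ultimately show ?thesis by simp
        qed
        show "complex_of_real (gterm f j x) = ?H x" by (simp add: gterm_def a b)
      qed
    qed
  qed
  have gm: "(\<lambda>x. complex_of_real (gterm f j x)) \<in> borel_measurable M11"
  proof -
    have [measurable]: "dstar f \<in> borel_measurable borel" by (rule borel_measurable_dstar[OF m])
    have "(\<lambda>x. if x = 0 then complex_of_real (gterm f j 0) else complex_of_real ((1 / 2) ^ j * dstar f (x / 2 ^ (j + 2)) + sqrt 2 ^ j * dstar f (2 ^ j * x / 2))) \<in> borel_measurable borel"
      by measurable
    also have "(\<lambda>x. if x = 0 then complex_of_real (gterm f j 0) else complex_of_real ((1 / 2) ^ j * dstar f (x / 2 ^ (j + 2)) + sqrt 2 ^ j * dstar f (2 ^ j * x / 2)))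
      = (\<lambda>x. complex_of_real (gterm f j x))"
      by (auto simp: gterm_def dstar_def abs_mult fun_eq_iff)
    finally show ?thesis by (rule borel_measurable_M11)
  qed
  have "N (\<lambda>x. complex_of_real (gterm f j x)) = N ?H" "(\<lambda>x. complex_of_real (gterm f j x)) \<in> X"
    using X_cong[OF HX gm ae] by auto
  moreover have "(1 / 2) ^ j * N A + sqrt 2 ^ j * N B \<le> ((4 powr \<beta> * Cb + 2 * Ca) * N f) * \<rho> ^ j"
  proof -
    have pw: "(2 ^ k) powr a = ((2::real) powr a) ^ k" for k a
      by (simp add: powr_realpow[symmetric] powr_powr powr_power mult.commute)
    have p1: "(1 / 2 ^ (j + 2)) powr (- \<beta>) = 4 powr \<beta> * (2 powr \<beta>) ^ j"
    proof -
      have "(1 / 2 ^ (j + 2)) powr (- \<beta>) = ((2::real) ^ (j + 2)) powr \<beta>" by (simp add: powr_minus_divide powr_divide)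
      also have "\<dots> = (4 * 2 ^ j) powr \<beta>" by (simp add: power_add)
      also have "\<dots> = 4 powr \<beta> * (2 ^ j) powr \<beta>" by (rule powr_mult)
      finally show ?thesis unfolding pw .
    qed
    have p2: "(2 ^ j) powr (- \<alpha>) = ((2::real) powr (- \<alpha>)) ^ j" by (rule pw)
    have q1: "(1 / 2) ^ j * (2 powr \<beta>) ^ j = ((2::real) powr (\<beta> - 1)) ^ j"
    proof -
      have "1 / 2 * 2 powr \<beta> = (2::real) powr (\<beta> - 1)" by (simp add: powr_diff)
      then show ?thesis by (metis power_mult_distrib)
    qed
    have q2: "sqrt 2 ^ j * (2 powr (- \<alpha>)) ^ j = ((2::real) powr (1 / 2 - \<alpha>)) ^ j"
    proof -
      have "(2::real) powr (1 / 2 + - \<alpha>) = 2 powr (1 / 2) * 2 powr (- \<alpha>)" by (rule powr_add)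
      then have "sqrt 2 * 2 powr (- \<alpha>) = (2::real) powr (1 / 2 - \<alpha>)" by (simp add: powr_half_sqrt)
      then show ?thesis by (metis power_mult_distrib)
    qed
    have r1: "((2::real) powr (\<beta> - 1)) ^ j \<le> \<rho> ^ j" and r2: "((2::real) powr (1 / 2 - \<alpha>)) ^ j \<le> \<rho> ^ j"
      by (rule power_mono; simp add: \<rho>_def)+
    have "(1 / 2) ^ j * N A \<le> (1 / 2) ^ j * (Cb * (1 / 2 ^ (j + 2)) powr (- \<beta>) * N f)" by (intro mult_left_mono A) auto
    also have "\<dots> = 4 powr \<beta> * Cb * N f * ((1 / 2) ^ j * (2 powr \<beta>) ^ j)" unfolding p1 by (simp only: mult_ac)
    also have "\<dots> \<le> 4 powr \<beta> * Cb * N f * \<rho> ^ j" unfolding q1 using Cb N_nonneg[OF f] r1 by (intro mult_left_mono) auto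
    finally have a: "(1 / 2) ^ j * N A \<le> 4 powr \<beta> * Cb * N f * \<rho> ^ j" .
    have "sqrt 2 ^ j * N B \<le> sqrt 2 ^ j * (2 * (Ca * (2 ^ j) powr (- \<alpha>) * N f))" by (intro mult_left_mono B) auto
    also have "\<dots> = 2 * Ca * N f * (sqrt 2 ^ j * (2 powr (- \<alpha>)) ^ j)" unfolding p2 by (simp only: mult_ac)
    also have "\<dots> \<le> 2 * Ca * N f * \<rho> ^ j" unfolding q2 using Ca N_nonneg[OF f] r2 by (intro mult_left_mono) auto
    finally have "sqrt 2 ^ j * N B \<le> 2 * Ca * N f * \<rho> ^ j" .
    with a show ?thesis by (simp add: algebra_simps)
  qed
  ultimately show ?thesis using NH by simp
qed

lemma gser_X: "\<exists>K>0. \<forall>f\<in>X. (AE x in M11. summable (\<lambda>j. gterm f j x)) \<and>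
    (\<lambda>x. complex_of_real (gser f x)) \<in> X \<and> N (\<lambda>x. complex_of_real (gser f x)) \<le> K * N f"
proof -
  define \<rho> where "\<rho> = max ((2::real) powr (\<beta> - 1)) (2 powr (1 / 2 - \<alpha>))"
  define D where "D = 4 powr \<beta> * Cb + 2 * Ca"
  have D: "0 < D" unfolding D_def using Ca Cb by (intro add_pos_pos mult_pos_pos) auto
  have "(2::real) powr (\<beta> - 1) < 2 powr 0" "(2::real) powr (1 / 2 - \<alpha>) < 2 powr 0"
    using al be by (intro powr_less_mono; simp)+
  then have \<rho>: "0 \<le> \<rho>" "\<rho> < 1" by (auto simp: \<rho>_def le_max_iff_disj)
  have "(AE x in M11. summable (\<lambda>j. gterm f j x)) \<and>
    (\<lambda>x. complex_of_real (gser f x)) \<in> X \<and> N (\<lambda>x. complex_of_real (gser f x)) \<le> D / (1 - \<rho>) * N f" if f: "f \<in> X" for f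
  proof -
    have nn: "AE x in M11. \<forall>j. 0 \<le> gterm f j x"
    proof -
      have "AE x in lborel. x \<noteq> (0::real)" by (rule AE_lborel_singleton)
      then show ?thesis unfolding AE_M11_iff by eventually_elim (use gterm_nonneg[OF X_meas[OF f]] in blast)
    qed
    have D0: "0 \<le> D * N f" using D N_nonneg[OF f] by simp
    have 1: "AE x in M11. summable (\<lambda>j. gterm f j x)"
      by (rule X_series(1)[where D = "D * N f" and \<rho> = \<rho>]) (use gterm_X[OF f] nn \<rho> D0 in \<open>auto simp: D_def \<rho>_def\<close>)
    have 2: "(\<lambda>x. complex_of_real (\<Sum>j. gterm f j x)) \<in> X \<and> N (\<lambda>x. complex_of_real (\<Sum>j. gterm f j x)) \<le> D * N f / (1 - \<rho>)"
      by (rule X_series(2)[where D = "D * N f" and \<rho> = \<rho>]) (use gterm_X[OF f] nn \<rho> D0 in \<open>auto simp: D_def \<rho>_def\<close>)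
    show ?thesis using 1 2 unfolding gser_def by simp
  qed
  moreover have "0 < D / (1 - \<rho>)" using D \<rho> by simp
  ultimately show ?thesis by blast
qed

end

lemma term_le_suminf_ennreal: "(g :: nat \<Rightarrow> ennreal) j \<le> (\<Sum>i. g i)"
proof -
  have "g j = (\<Sum>i\<in>{j}. g i)" by simp
  also have "\<dots> \<le> (\<Sum>i. g i)" by (rule sum_le_suminf) auto
  finally show ?thesis .
qed

text \<open>Values above the rearrangement at s / 2^j occupy measure at most s / 2^j, so only a null
  set exceeds all these heights; elsewhere the first height that is not exceeded names the
  slice.\<close>

lemma upper_slices_ae:
  assumes f: "f \<in> borel_measurable M11" and s: "0 < s"
  shows "AE x in M11. decr_rearr f s < cmod (f x) \<longrightarrow>
    (\<exists>j. cmod (f x) \<le> decr_rearr f (s / 2 ^ Suc j) \<and> decr_rearr f (s / 2 ^ j) < cmod (f x))"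
proof -
  interpret finite_measure M11 by (rule finite_measure_M11)
  define E where "E j = {x \<in> space M11. cmod (f x) > decr_rearr f (s / 2 ^ j)}" for j
  have E: "E j \<in> sets M11" for j unfolding E_def by (rule distrib_set[OF f])
  have I: "(\<Inter>j. E j) \<in> sets M11" using E by auto
  have "measure M11 (\<Inter>j. E j) \<le> s / 2 ^ j" for j
  proof -
    have "measure M11 (\<Inter>j. E j) \<le> measure M11 (E j)" by (rule finite_measure_mono[OF _ E]) auto
    also have "\<dots> \<le> s / 2 ^ j" unfolding E_def distrib_fun_def[symmetric] by (rule distrib_fun_decr_rearr[OF f]) (use s in simp)
    finally show ?thesis .
  qed
  moreover have "(\<lambda>j. s / 2 ^ j) \<longlonglongrightarrow> 0" by real_asymp
  ultimately have "measure M11 (\<Inter>j. E j) \<le> 0" by (intro tendsto_lowerbound[OF _ always_eventually]) auto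
  then have "measure M11 (\<Inter>j. E j) = 0" by (intro order_antisym measure_nonneg)
  then have "(\<Inter>j. E j) \<in> null_sets M11" using I by (simp add: null_sets_def emeasure_eq_measure)
  then have "AE x in M11. x \<notin> (\<Inter>j. E j)" by (rule AE_not_in)
  then show ?thesis using AE_space
  proof eventually_elim
    case (elim x)
    show ?case
    proof
      assume x: "decr_rearr f s < cmod (f x)"
      define P where "P j \<longleftrightarrow> cmod (f x) \<le> decr_rearr f (s / 2 ^ j)" for j :: nat
      have "\<exists>j. P j" using elim by (auto simp: E_def P_def not_less)
      then obtain n where n: "P n" ..
      define k where "k = (LEAST j. P j)"
      have k: "P k" unfolding k_def using n by (rule LeastI)
      have "\<not> P 0" using x by (simp add: P_def)
      then have "k \<noteq> 0" using k by metis
      then obtain i where i: "k = Suc i" by (cases k) auto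
      have "\<not> P i" using not_less_Least[of i P] i by (simp add: k_def)
      then show "\<exists>j. cmod (f x) \<le> decr_rearr f (s / 2 ^ Suc j) \<and> decr_rearr f (s / 2 ^ j) < cmod (f x)"
        using k i by (intro exI[of _ i]) (simp add: P_def)
    qed
  qed
qed

text \<open>The heights reach 0 once 2^j s is at least 2, so every non-zero value falls between two
  consecutive ones.\<close>

lemma lower_slices:
  assumes f: "f \<in> borel_measurable M11" and s: "0 < s" and x: "f x \<noteq> 0" "cmod (f x) \<le> decr_rearr f s"
  shows "\<exists>j. cmod (f x) \<le> decr_rearr f (2 ^ j * s) \<and> decr_rearr f (2 ^ Suc j * s) < cmod (f x)"
proof -
  define P where "P j \<longleftrightarrow> decr_rearr f (2 ^ j * s) < cmod (f x)" for j :: nat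
  have "(1::real) < 2" by simp
  from real_arch_pow[OF this, of "2 / s"] obtain n where n: "2 / s < 2 ^ n" by (elim exE)
  then have "2 \<le> 2 ^ n * s" using s by (simp add: field_simps)
  then have "P n" using decr_rearr_eq_0[OF f] x by (simp add: P_def)
  define k where "k = (LEAST j. P j)"
  have k: "P k" unfolding k_def using \<open>P n\<close> by (rule LeastI)
  have "\<not> P 0" using x by (simp add: P_def)
  then have "k \<noteq> 0" using k by metis
  then obtain i where i: "k = Suc i" by (cases k) auto
  have "\<not> P i" using not_less_Least[of i P] i by (simp add: k_def)
  then show ?thesis using k i by (intro exI[of _ i]) (simp add: P_def)
qed

text \<open>On the j-th slice the height is at most the rearrangement at s / 2^(j+1), while the
  slice lies in a set of measure at most s / 2^j. The sum is the discrete form of integrating the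
  rearrangement from 0 to s.\<close>

lemma nn_integral_upper_part:
  assumes f: "f \<in> borel_measurable M11" and s: "0 < s"
  shows "(\<integral>\<^sup>+x. ennreal (cmod (if decr_rearr f s < cmod (f x) then f x else 0)) \<partial>M11)
    \<le> (\<Sum>j. ennreal (s * ((1 / 2) ^ j * decr_rearr f (s / 2 ^ Suc j))))"
proof -
  interpret finite_measure M11 by (rule finite_measure_M11)
  define E where "E j = {x \<in> space M11. cmod (f x) > decr_rearr f (s / 2 ^ j)}" for j
  have E [measurable]: "E j \<in> sets M11" for j unfolding E_def by (rule distrib_set[OF f])
  have "(\<integral>\<^sup>+x. ennreal (cmod (if decr_rearr f s < cmod (f x) then f x else 0)) \<partial>M11)
    \<le> (\<integral>\<^sup>+x. (\<Sum>j. ennreal (decr_rearr f (s / 2 ^ Suc j)) * indicator (E j) x) \<partial>M11)"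
  proof (rule nn_integral_mono_AE)
    show "AE x in M11. ennreal (cmod (if decr_rearr f s < cmod (f x) then f x else 0)) \<le> (\<Sum>j. ennreal (decr_rearr f (s / 2 ^ Suc j)) * indicator (E j) x)"
      using upper_slices_ae[OF f s] AE_space
    proof eventually_elim
      case (elim x)
      show ?case
      proof (cases "decr_rearr f s < cmod (f x)")
        case True
        then obtain j where j: "cmod (f x) \<le> decr_rearr f (s / 2 ^ Suc j)" "decr_rearr f (s / 2 ^ j) < cmod (f x)" using elim by blast
        have "ennreal (cmod (f x)) \<le> ennreal (decr_rearr f (s / 2 ^ Suc j)) * indicator (E j) x"
          using j elim by (simp add: E_def ennreal_leI del: power_Suc)
        also have "\<dots> \<le> (\<Sum>j. ennreal (decr_rearr f (s / 2 ^ Suc j)) * indicator (E j) x)"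
          by (rule term_le_suminf_ennreal[of "\<lambda>j. ennreal (decr_rearr f (s / 2 ^ Suc j)) * indicator (E j) x"])
        finally show ?thesis using True by simp
      qed simp
    qed
  qed
  also have "\<dots> = (\<Sum>j. \<integral>\<^sup>+x. ennreal (decr_rearr f (s / 2 ^ Suc j)) * indicator (E j) x \<partial>M11)"
    by (rule nn_integral_suminf) measurable
  also have "\<dots> \<le> (\<Sum>j. ennreal (s * ((1 / 2) ^ j * decr_rearr f (s / 2 ^ Suc j))))"
  proof (intro suminf_le)
    fix j :: nat
    have d0: "0 \<le> decr_rearr f (s / 2 ^ Suc j)" using s by (intro decr_rearr_nonneg[OF f]) simp
    have "(\<integral>\<^sup>+x. ennreal (decr_rearr f (s / 2 ^ Suc j)) * indicator (E j) x \<partial>M11) = ennreal (decr_rearr f (s / 2 ^ Suc j)) * emeasure M11 (E j)"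
      by (rule nn_integral_cmult_indicator[OF E])
    also have "emeasure M11 (E j) = ennreal (distrib_fun f (decr_rearr f (s / 2 ^ j)))"
      by (simp add: E_def distrib_fun_def emeasure_eq_measure)
    also have "ennreal (decr_rearr f (s / 2 ^ Suc j)) * \<dots> \<le> ennreal (decr_rearr f (s / 2 ^ Suc j)) * ennreal (s / 2 ^ j)"
      using s by (intro mult_left_mono ennreal_leI distrib_fun_decr_rearr[OF f]) auto
    also have "\<dots> = ennreal (decr_rearr f (s / 2 ^ Suc j) * (s / 2 ^ j))" using s d0 by (intro ennreal_mult[symmetric]) auto
    also have "decr_rearr f (s / 2 ^ Suc j) * (s / 2 ^ j) = s * ((1 / 2) ^ j * decr_rearr f (s / 2 ^ Suc j))" by (simp add: power_one_over)
    finally show "(\<integral>\<^sup>+x. ennreal (decr_rearr f (s / 2 ^ Suc j)) * indicator (E j) x \<partial>M11) \<le> ennreal (s * ((1 / 2) ^ j * decr_rearr f (s / 2 ^ Suc j)))" .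
  qed auto
  finally show ?thesis .
qed

text \<open>Kept general in the power \<open>p\<close> and the weight \<open>v\<close> for two uses:
  squares against Lebesgue measure for the (2,2) estimate, and first powers against the weight
  \<open>rw\<close> for \<open>T_hat\<close>.\<close>

lemma nn_integral_lower_part:
  assumes f: "f \<in> borel_measurable M11" and s: "0 < s" and v: "v \<in> borel_measurable M11"
    and p: "\<And>a b. 0 \<le> a \<Longrightarrow> a \<le> b \<Longrightarrow> p a \<le> (p b :: real)" "p 0 = 0"
    and W: "\<And>E m. E \<in> sets M11 \<Longrightarrow> 0 < m \<Longrightarrow> measure M11 E \<le> m \<Longrightarrow> (\<integral>\<^sup>+x. v x * indicator E x \<partial>M11) \<le> ennreal (V m)"
  shows "(\<integral>\<^sup>+x. ennreal (p (cmod (if decr_rearr f s < cmod (f x) then 0 else f x))) * v x \<partial>M11)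
    \<le> (\<Sum>j. ennreal (p (decr_rearr f (2 ^ j * s))) * ennreal (V (2 ^ Suc j * s)))"
proof -
  interpret finite_measure M11 by (rule finite_measure_M11)
  note [measurable] = v
  define E where "E j = {x \<in> space M11. cmod (f x) > decr_rearr f (2 ^ Suc j * s)}" for j
  have E [measurable]: "E j \<in> sets M11" for j unfolding E_def by (rule distrib_set[OF f])
  have "(\<integral>\<^sup>+x. ennreal (p (cmod (if decr_rearr f s < cmod (f x) then 0 else f x))) * v x \<partial>M11)
    \<le> (\<integral>\<^sup>+x. (\<Sum>j. ennreal (p (decr_rearr f (2 ^ j * s))) * (v x * indicator (E j) x)) \<partial>M11)"
  proof (rule nn_integral_mono)
    fix x assume x: "x \<in> space M11"
    show "ennreal (p (cmod (if decr_rearr f s < cmod (f x) then 0 else f x))) * v x \<le> (\<Sum>j. ennreal (p (decr_rearr f (2 ^ j * s))) * (v x * indicator (E j) x))"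
    proof (cases "f x \<noteq> 0 \<and> \<not> decr_rearr f s < cmod (f x)")
      case True
      then obtain j where j: "cmod (f x) \<le> decr_rearr f (2 ^ j * s)" "decr_rearr f (2 ^ Suc j * s) < cmod (f x)"
        using lower_slices[OF f s, of x] by auto
      have "ennreal (p (cmod (f x))) * v x \<le> ennreal (p (decr_rearr f (2 ^ j * s))) * (v x * indicator (E j) x)"
      proof -
        have "x \<in> E j" using j x by (simp add: E_def)
        then show ?thesis using j(1) by (simp add: mult_right_mono ennreal_leI p(1))
      qed
      also have "\<dots> \<le> (\<Sum>j. ennreal (p (decr_rearr f (2 ^ j * s))) * (v x * indicator (E j) x))"
        by (rule term_le_suminf_ennreal[of "\<lambda>j. ennreal (p (decr_rearr f (2 ^ j * s))) * (v x * indicator (E j) x)"])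
      finally show ?thesis using True by simp
    next
      case False
      then have z: "p (cmod (if decr_rearr f s < cmod (f x) then 0 else f x)) = 0" using p(2) by auto
      show ?thesis unfolding z by simp
    qed
  qed
  also have "\<dots> = (\<Sum>j. \<integral>\<^sup>+x. ennreal (p (decr_rearr f (2 ^ j * s))) * (v x * indicator (E j) x) \<partial>M11)"
    by (rule nn_integral_suminf) measurable
  also have "\<dots> \<le> (\<Sum>j. ennreal (p (decr_rearr f (2 ^ j * s))) * ennreal (V (2 ^ Suc j * s)))"
  proof (intro suminf_le)
    fix j :: nat
    have "(\<integral>\<^sup>+x. ennreal (p (decr_rearr f (2 ^ j * s))) * (v x * indicator (E j) x) \<partial>M11) = ennreal (p (decr_rearr f (2 ^ j * s))) * (\<integral>\<^sup>+x. v x * indicator (E j) x \<partial>M11)"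
      by (rule nn_integral_cmult) measurable
    also have "\<dots> \<le> ennreal (p (decr_rearr f (2 ^ j * s))) * ennreal (V (2 ^ Suc j * s))"
    proof (intro mult_left_mono W E)
      show "0 < 2 ^ Suc j * s" using s by simp
      show "measure M11 (E j) \<le> 2 ^ Suc j * s"
        unfolding E_def distrib_fun_def[symmetric] by (rule distrib_fun_decr_rearr[OF f]) (use s in simp)
    qed simp
    finally show "(\<integral>\<^sup>+x. ennreal (p (decr_rearr f (2 ^ j * s))) * (v x * indicator (E j) x) \<partial>M11) \<le> ennreal (p (decr_rearr f (2 ^ j * s))) * ennreal (V (2 ^ Suc j * s))" .
  qed auto
  finally show ?thesis .
qed

text \<open>The weight is in weak L^2: \<open>rw x > l\<close> forces 1 - x^2 < 1 / l^2, hence a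
  distance below 1 / l^2 from one of the two end points.\<close>

lemma measure_rw_greater:
  assumes l: "0 < l" shows "measure M11 {x \<in> space M11. rw x > l} \<le> 2 / l\<^sup>2"
proof -
  define d where "d = 1 / l\<^sup>2"
  have d: "0 < d" using l by (simp add: d_def)
  have "{x \<in> space M11. rw x > l} \<subseteq> {-1..-1 + d} \<union> {1 - d..1}"
  proof
    fix x assume "x \<in> {x \<in> space M11. rw x > l}"
    then have x: "- 1 < x" "x < 1" "l < 1 / sqrt (1 - x\<^sup>2)" by (auto simp: rw_def)
    have p: "0 < 1 - x\<^sup>2" by (rule one_minus_sq_pos[OF x(1,2)])
    have "l\<^sup>2 < (1 / sqrt (1 - x\<^sup>2))\<^sup>2" using x(3) l by (intro power_strict_mono) auto
    also have "\<dots> = 1 / (1 - x\<^sup>2)" using p by (simp add: power_divide)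
    finally have "1 - x\<^sup>2 < d" using p l by (simp add: d_def field_simps)
    moreover have "1 - \<bar>x\<bar> \<le> 1 - x\<^sup>2"
    proof -
      have "\<bar>x\<bar> * \<bar>x\<bar> \<le> \<bar>x\<bar> * 1" using x by (intro mult_left_mono) auto
      then show ?thesis by (simp add: power2_eq_square)
    qed
    ultimately show "x \<in> {-1..-1 + d} \<union> {1 - d..1}" using x by (auto simp: abs_if split: if_splits)
  qed
  then have "emeasure M11 {x \<in> space M11. rw x > l} \<le> emeasure lborel ({-1..-1 + d} \<union> {1 - d..1})"
    by (subst emeasure_M11) (auto intro!: emeasure_mono)
  also have "\<dots> \<le> emeasure lborel {-1..-1 + d} + emeasure lborel {1 - d..1}" by (rule emeasure_subadditive) auto
  also have "\<dots> = ennreal (2 * d)" using d by (simp add: ennreal_plus[symmetric] del: ennreal_plus)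
  finally show ?thesis using d by (simp add: measure_def enn2real_leI d_def)
qed

text \<open>Splitting the values of the weight at l = 1 / sqrt m balances both parts: below l at
  most l m = sqrt m, above l a dyadic sum of weak L^2 tails bounded by 8 / l = 8 sqrt m.\<close>

lemma nn_integral_rw_set:
  assumes E: "E \<in> sets M11" and m: "0 < m" "measure M11 E \<le> m"
  shows "(\<integral>\<^sup>+x. ennreal (rw x) * indicator E x \<partial>M11) \<le> ennreal (9 * sqrt m)"
proof -
  interpret finite_measure M11 by (rule finite_measure_M11)
  define l where "l = 1 / sqrt m"
  have l: "0 < l" using m by (simp add: l_def)
  define A where "A i = {x \<in> space M11. rw x > 2 ^ i * l}" for i :: nat
  have [measurable]: "rw \<in> borel_measurable M11" by (rule borel_measurable_M11) measurable
  have A [measurable]: "A i \<in> sets M11" for i unfolding A_def by measurable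
  note [measurable] = E
  have "(\<integral>\<^sup>+x. ennreal (rw x) * indicator E x \<partial>M11) \<le> (\<integral>\<^sup>+x. ennreal l * indicator E x + (\<Sum>i. ennreal (2 ^ Suc i * l) * indicator (A i) x) \<partial>M11)"
  proof (rule nn_integral_mono)
    fix x assume x: "x \<in> space M11"
    have "ennreal (rw x) = ennreal l * ennreal (rw x / l)" using l rw_nonneg[of x] by (simp add: ennreal_mult[symmetric])
    also have "\<dots> \<le> ennreal l * (1 + (\<Sum>j. ennreal (2 ^ Suc j) * indicator {v. 2 ^ j < v} (rw x / l)))"
      by (intro mult_left_mono abs_le_dyadic_levels) simp
    also have "\<dots> = ennreal l + (\<Sum>j. ennreal l * (ennreal (2 ^ Suc j) * indicator {v. 2 ^ j < v} (rw x / l)))"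
      by (simp add: distrib_left ennreal_suminf_cmult)
    also have "(\<Sum>j. ennreal l * (ennreal (2 ^ Suc j) * indicator {v. 2 ^ j < v} (rw x / l))) = (\<Sum>i. ennreal (2 ^ Suc i * l) * indicator (A i) x)"
      using l x by (intro suminf_cong) (auto simp: indicator_def A_def field_simps ennreal_mult[symmetric])
    finally have le: "ennreal (rw x) \<le> ennreal l + (\<Sum>i. ennreal (2 ^ Suc i * l) * indicator (A i) x)" .
    show "ennreal (rw x) * indicator E x \<le> ennreal l * indicator E x + (\<Sum>i. ennreal (2 ^ Suc i * l) * indicator (A i) x)"
      using le by (cases "x \<in> E") auto
  qed
  also have "\<dots> = (\<integral>\<^sup>+x. ennreal l * indicator E x \<partial>M11) + (\<integral>\<^sup>+x. (\<Sum>i. ennreal (2 ^ Suc i * l) * indicator (A i) x) \<partial>M11)"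
    by (rule nn_integral_add) measurable
  also have "(\<integral>\<^sup>+x. (\<Sum>i. ennreal (2 ^ Suc i * l) * indicator (A i) x) \<partial>M11) = (\<Sum>i. \<integral>\<^sup>+x. ennreal (2 ^ Suc i * l) * indicator (A i) x \<partial>M11)"
    by (rule nn_integral_suminf) measurable
  also have "\<dots> \<le> (\<Sum>i. ennreal (4 / l * (1 / 2) ^ i))"
  proof (intro suminf_le)
    fix i :: nat
    have "(\<integral>\<^sup>+x. ennreal (2 ^ Suc i * l) * indicator (A i) x \<partial>M11) = ennreal (2 ^ Suc i * l) * emeasure M11 (A i)"
      by (rule nn_integral_cmult_indicator[OF A])
    also have "\<dots> \<le> ennreal (2 ^ Suc i * l) * ennreal (2 / (2 ^ i * l)\<^sup>2)"
      using measure_rw_greater[of "2 ^ i * l"] l by (intro mult_left_mono) (auto simp: A_def emeasure_eq_measure ennreal_leI)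
    also have "\<dots> = ennreal (2 ^ Suc i * l * (2 / (2 ^ i * l)\<^sup>2))" using l by (intro ennreal_mult[symmetric]) auto
    also have "2 ^ Suc i * l * (2 / (2 ^ i * l)\<^sup>2) = 4 / l * (1 / 2) ^ i" using l by (simp add: power2_eq_square power_one_over field_simps)
    finally show "(\<integral>\<^sup>+x. ennreal (2 ^ Suc i * l) * indicator (A i) x \<partial>M11) \<le> ennreal (4 / l * (1 / 2) ^ i)" .
  qed auto
  also have "\<dots> = ennreal (\<Sum>i. 4 / l * (1 / 2) ^ i)"
    using l by (intro suminf_ennreal2) (auto intro!: summable_mult summable_geometric)
  also have "(\<Sum>i. 4 / l * (1 / 2) ^ i) = 8 / l"
    by (subst suminf_mult) (auto simp: suminf_geometric intro!: summable_geometric)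
  also have "(\<integral>\<^sup>+x. ennreal l * indicator E x \<partial>M11) = ennreal l * emeasure M11 E"
    by (rule nn_integral_cmult_indicator[OF E])
  also have "\<dots> \<le> ennreal l * ennreal m" using m by (intro mult_left_mono) (auto simp: emeasure_eq_measure ennreal_leI)
  also have "\<dots> = ennreal (l * m)" using l m by (intro ennreal_mult[symmetric]) auto
  also have "ennreal (l * m) + ennreal (8 / l) = ennreal (l * m + 8 / l)" using l m by (intro ennreal_plus[symmetric]) auto
  also have "l * m + 8 / l = 9 * sqrt m"
  proof -
    have "l * m = sqrt m" using m by (simp add: l_def real_div_sqrt)
    then show ?thesis by (simp add: l_def)
  qed
  finally show ?thesis by (simp add: add_right_mono)
qed

lemma distrib_fun_sum:
  assumes g: "g \<in> borel_measurable M11" and h: "h \<in> borel_measurable M11"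
    and ae: "AE x in M11. cmod (f x) \<le> cmod (g x) + cmod (h x)"
  shows "distrib_fun f (a + b) \<le> distrib_fun g a + distrib_fun h b"
proof -
  interpret finite_measure M11 by (rule finite_measure_M11)
  let ?A = "{x \<in> space M11. cmod (g x) > a}" and ?B = "{x \<in> space M11. cmod (h x) > b}"
  have m: "?A \<in> sets M11" "?B \<in> sets M11" by (rule distrib_set g h)+
  have "distrib_fun f (a + b) \<le> measure M11 (?A \<union> ?B)"
    unfolding distrib_fun_def
    by (rule finite_measure_mono_AE) (use ae m in \<open>auto elim!: eventually_mono\<close>)
  also have "\<dots> \<le> measure M11 ?A + measure M11 ?B" by (rule measure_Un_le[OF m])
  finally show ?thesis by (simp add: distrib_fun_def)
qed

section \<open>Splitting a function at a height of its rearrangement\<close>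

lemma fin_hilbert_add_ae:
  assumes f: "integrable lborel (cut11 f)" and g: "integrable lborel (cut11 g)"
  shows "AE x in M11. fin_hilbert (\<lambda>t. f t + g t) x = fin_hilbert f x + fin_hilbert g x"
  using has_pv_fin_hilbert_ae[OF f] has_pv_fin_hilbert_ae[OF g] AE_space
proof eventually_elim
  case (elim x)
  have "has_pv (cut11 (\<lambda>t. f t + g t)) x (pi * fin_hilbert f x + pi * fin_hilbert g x)"
    unfolding cut11_add by (rule has_pv_add[OF f g elim(1,2)])
  then have "fin_hilbert (\<lambda>t. f t + g t) x = (pi * fin_hilbert f x + pi * fin_hilbert g x) / pi"
    using elim(3) by (intro has_pv_imp_fin_hilbert) auto
  then show ?case by (simp add: add_divide_distrib)
qed

lemma fin_hilbert_cmult_ae: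
  assumes f: "integrable lborel (cut11 f)"
  shows "AE x in M11. fin_hilbert (\<lambda>t. c * f t) x = c * fin_hilbert f x"
  using has_pv_fin_hilbert_ae[OF f] AE_space
proof eventually_elim
  case (elim x)
  have "has_pv (cut11 (\<lambda>t. c * f t)) x (c * (pi * fin_hilbert f x))"
    unfolding cut11_cmult by (rule has_pv_cmult[OF elim(1)])
  then have "fin_hilbert (\<lambda>t. c * f t) x = c * (pi * fin_hilbert f x) / pi"
    using elim(2) by (intro has_pv_imp_fin_hilbert) auto
  then show ?case by simp
qed

text \<open>A sharp cut at the height \<open>decr_rearr f s\<close>: \<open>upart\<close> is
  supported on a set of measure at most \<open>s\<close> and is treated in L^1, the bounded rest
  \<open>lpart\<close> in L^2.\<close>

definition upart :: "(real \<Rightarrow> complex) \<Rightarrow> real \<Rightarrow> real \<Rightarrow> complex" where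
  "upart f s x = (if decr_rearr f s < cmod (f x) then f x else 0)"

definition lpart :: "(real \<Rightarrow> complex) \<Rightarrow> real \<Rightarrow> real \<Rightarrow> complex" where
  "lpart f s x = (if decr_rearr f s < cmod (f x) then 0 else f x)"

definition gup :: "(real \<Rightarrow> complex) \<Rightarrow> real \<Rightarrow> real" where
  "gup f s = (\<Sum>j. (1 / 2) ^ j * decr_rearr f (s / 2 ^ Suc j))"

definition glow :: "(real \<Rightarrow> complex) \<Rightarrow> real \<Rightarrow> real" where
  "glow f s = (\<Sum>j. sqrt 2 ^ j * decr_rearr f (2 ^ j * s))"

context
  fixes f :: "real \<Rightarrow> complex" and x s :: real
  assumes f: "integrable lborel (cut11 f)" and x: "x \<noteq> 0" and sm: "summable (\<lambda>j. gterm f j x)"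
    and s_def: "s = \<bar>x\<bar>"
begin

lemma fm: "f \<in> borel_measurable M11"
proof -
  have "cut11 f \<in> borel_measurable borel" using f by auto
  then show ?thesis by (simp add: borel_measurable_cut11)
qed

lemma s_pos: "0 < s" using x by (simp add: s_def)

lemma up_nonneg: "0 \<le> (1 / 2) ^ j * decr_rearr f (s / 2 ^ Suc j)"
  using s_pos by (intro mult_nonneg_nonneg decr_rearr_nonneg[OF fm]) auto

lemma low_nonneg: "0 \<le> sqrt 2 ^ j * decr_rearr f (2 ^ j * s)"
  using s_pos by (intro mult_nonneg_nonneg decr_rearr_nonneg[OF fm]) auto

lemma summable_up: "summable (\<lambda>j. (1 / 2) ^ j * decr_rearr f (s / 2 ^ Suc j))"
  by (rule summable_comparison_test[OF _ sm])
    (use up_nonneg low_nonneg in \<open>auto simp: gterm_def s_def intro!: exI[of _ 0]\<close>)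

lemma summable_low: "summable (\<lambda>j. sqrt 2 ^ j * decr_rearr f (2 ^ j * s))"
  by (rule summable_comparison_test[OF _ sm])
    (use up_nonneg low_nonneg in \<open>auto simp: gterm_def s_def intro!: exI[of _ 0]\<close>)

lemma gser_eq: "gser f x = gup f s + glow f s"
  unfolding gser_def gterm_def gup_def glow_def s_def[symmetric]
  by (rule suminf_add[OF summable_up summable_low, symmetric])

lemma gup_nonneg: "0 \<le> gup f s" unfolding gup_def by (rule suminf_nonneg[OF summable_up up_nonneg])

lemma glow_nonneg: "0 \<le> glow f s" unfolding glow_def by (rule suminf_nonneg[OF summable_low low_nonneg])

lemma upart_measurable: "upart f s \<in> borel_measurable M11"
proof -
  note [measurable] = fm
  show ?thesis unfolding upart_def by measurable
qed

lemma lpart_measurable: "lpart f s \<in> borel_measurable M11"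
proof -
  note [measurable] = fm
  show ?thesis unfolding lpart_def by measurable
qed

lemma upart_integrable: "integrable lborel (cut11 (upart f s))"
  by (rule integrable_cut_bound[OF f upart_measurable, of 1]) (simp add: upart_def)

lemma lpart_integrable: "integrable lborel (cut11 (lpart f s))"
  by (rule integrable_cut_bound[OF f lpart_measurable, of 1]) (simp add: lpart_def)

lemma integral_upart: "(LINT t|lborel. cmod (cut11 (upart f s) t)) \<le> s * gup f s"
proof -
  have "ennreal (LINT t|lborel. cmod (cut11 (upart f s) t)) = (\<integral>\<^sup>+t. ennreal (cmod (cut11 (upart f s) t)) \<partial>lborel)"
    using upart_integrable by (intro nn_integral_eq_integral[symmetric]) auto
  also have "\<dots> = (\<integral>\<^sup>+t. ennreal (cmod (upart f s t)) \<partial>M11)" by (rule nn_integral_M11[OF upart_measurable])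
  also have "\<dots> \<le> (\<Sum>j. ennreal (s * ((1 / 2) ^ j * decr_rearr f (s / 2 ^ Suc j))))"
    unfolding upart_def by (rule nn_integral_upper_part[OF fm s_pos])
  also have "\<dots> = ennreal (\<Sum>j. s * ((1 / 2) ^ j * decr_rearr f (s / 2 ^ Suc j)))"
    using s_pos by (intro suminf_ennreal2 summable_mult summable_up mult_nonneg_nonneg[OF _ up_nonneg]) auto
  also have "(\<Sum>j. s * ((1 / 2) ^ j * decr_rearr f (s / 2 ^ Suc j))) = s * gup f s"
    unfolding gup_def by (rule suminf_mult[OF summable_up])
  finally show ?thesis using s_pos gup_nonneg by simp
qed

text \<open>The j-th slice has measure at most 2^(j+1) s, and the factor sqrt 2 ^ j in
  \<open>glow\<close> is what produces 2^j after squaring. A sum of squares of non-negative terms is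
  then bounded by the square of their sum.\<close>

lemma nn_integral_lpart_sq: "(\<integral>\<^sup>+t. ennreal ((cmod (cut11 (lpart f s) t))\<^sup>2) \<partial>lborel) \<le> ennreal (2 * s * (glow f s)\<^sup>2)"
proof -
  interpret finite_measure M11 by (rule finite_measure_M11)
  let ?c = "\<lambda>j. sqrt 2 ^ j * decr_rearr f (2 ^ j * s)"
  have "(\<integral>\<^sup>+t. ennreal ((cmod (cut11 (lpart f s) t))\<^sup>2) \<partial>lborel) = (\<integral>\<^sup>+t. ennreal ((cmod (lpart f s t))\<^sup>2) * indicator {-1<..<1} t \<partial>lborel)"
    by (intro nn_integral_cong) (auto simp: cut11_def indicator_def)
  also have "\<dots> = (\<integral>\<^sup>+t. ennreal ((cmod (lpart f s t))\<^sup>2) * 1 \<partial>M11)"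
    unfolding M11_def by (subst nn_integral_restrict_space) auto
  also have "\<dots> \<le> (\<Sum>j. ennreal ((decr_rearr f (2 ^ j * s))\<^sup>2) * ennreal (2 ^ Suc j * s))"
    unfolding lpart_def
    by (rule nn_integral_lower_part[OF fm s_pos, where p = "\<lambda>a. a\<^sup>2" and V = "\<lambda>m. m"])
      (auto intro: power_mono simp: emeasure_eq_measure ennreal_leI)
  also have "\<dots> = (\<Sum>j. ennreal (2 * s * (?c j)\<^sup>2))"
  proof (intro suminf_cong)
    fix j
    have "(decr_rearr f (2 ^ j * s))\<^sup>2 * (2 ^ Suc j * s) = 2 * s * (?c j)\<^sup>2"
    proof -
      have "(sqrt 2 ^ j)\<^sup>2 = (2::real) ^ j" by (simp add: power_mult[symmetric] mult.commute[of j 2]) (simp add: power_mult)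
      then show ?thesis by (simp add: power_mult_distrib)
    qed
    then show "ennreal ((decr_rearr f (2 ^ j * s))\<^sup>2) * ennreal (2 ^ Suc j * s) = ennreal (2 * s * (?c j)\<^sup>2)"
      using s_pos by (simp add: ennreal_mult[symmetric])
  qed
  also have "\<dots> \<le> (\<Sum>j. ennreal (2 * s * glow f s * ?c j))"
  proof (intro suminf_le ennreal_leI)
    fix j
    have "?c j \<le> glow f s" unfolding glow_def
      using sum_le_suminf[OF summable_low, of "{j}"] low_nonneg by simp
    then have "?c j * ?c j \<le> glow f s * ?c j" by (rule mult_right_mono[OF _ low_nonneg])
    then show "2 * s * (?c j)\<^sup>2 \<le> 2 * s * glow f s * ?c j" using s_pos by (simp add: power2_eq_square mult.assoc)
  qed auto
  also have "\<dots> = ennreal (\<Sum>j. 2 * s * glow f s * ?c j)"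
    using s_pos glow_nonneg by (intro suminf_ennreal2 summable_mult summable_low mult_nonneg_nonneg[OF _ low_nonneg]) auto
  also have "(\<Sum>j. 2 * s * glow f s * ?c j) = 2 * s * glow f s * glow f s"
    unfolding glow_def by (rule suminf_mult[OF summable_low])
  finally show ?thesis by (simp add: power2_eq_square mult.assoc)
qed

lemma integrable_lpart_sq: "integrable lborel (\<lambda>t. (cmod (cut11 (lpart f s) t))\<^sup>2)"
  and integral_lpart_sq: "(LINT t|lborel. (cmod (cut11 (lpart f s) t))\<^sup>2) \<le> 2 * s * (glow f s)\<^sup>2"
proof -
  have [measurable]: "cut11 (lpart f s) \<in> borel_measurable borel" using lpart_integrable by auto
  show i: "integrable lborel (\<lambda>t. (cmod (cut11 (lpart f s) t))\<^sup>2)"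
    by (rule integrableI_nonneg) (use nn_integral_lpart_sq in \<open>auto intro: le_less_trans\<close>)
  have "ennreal (LINT t|lborel. (cmod (cut11 (lpart f s) t))\<^sup>2) \<le> ennreal (2 * s * (glow f s)\<^sup>2)"
    using nn_integral_lpart_sq nn_integral_eq_integral[OF i] by simp
  then show "(LINT t|lborel. (cmod (cut11 (lpart f s) t))\<^sup>2) \<le> 2 * s * (glow f s)\<^sup>2" using s_pos by simp
qed

text \<open>The weight integrates over a set of measure m to O(sqrt m), which gives the slices the
  same factors sqrt 2 ^ j as the L^2 estimate. This is why one series controls both \<open>T\<close>
  and \<open>T_hat + T\<close>.\<close>

lemma nn_integral_lpart_rw: "(\<integral>\<^sup>+t. ennreal (cmod (lpart f s t)) * ennreal (rw t) \<partial>M11) \<le> ennreal (13 * sqrt s * glow f s)"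
proof -
  let ?c = "\<lambda>j. sqrt 2 ^ j * decr_rearr f (2 ^ j * s)"
  have rm: "(\<lambda>t. ennreal (rw t)) \<in> borel_measurable M11"
    by (rule measurable_compose[OF borel_measurable_M11[OF borel_measurable_rw] measurable_ennreal])
  have "(\<integral>\<^sup>+t. ennreal (cmod (lpart f s t)) * ennreal (rw t) \<partial>M11)
     \<le> (\<Sum>j. ennreal (decr_rearr f (2 ^ j * s)) * ennreal (9 * sqrt (2 ^ Suc j * s)))"
    unfolding lpart_def
    by (rule nn_integral_lower_part[OF fm s_pos rm, where p = "\<lambda>a. a" and V = "\<lambda>m. 9 * sqrt m"])
      (auto intro: nn_integral_rw_set)
  also have "\<dots> = (\<Sum>j. ennreal (9 * sqrt (2 * s) * ?c j))"
  proof (intro suminf_cong)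
    fix j
    have "sqrt (2 ^ Suc j * s) = sqrt (2 * s) * sqrt 2 ^ j" by (simp add: real_sqrt_mult real_sqrt_power mult_ac)
    then have "decr_rearr f (2 ^ j * s) * (9 * sqrt (2 ^ Suc j * s)) = 9 * sqrt (2 * s) * ?c j" by (simp add: mult_ac)
    moreover have "0 \<le> decr_rearr f (2 ^ j * s)" using s_pos by (intro decr_rearr_nonneg[OF fm]) auto
    ultimately show "ennreal (decr_rearr f (2 ^ j * s)) * ennreal (9 * sqrt (2 ^ Suc j * s)) = ennreal (9 * sqrt (2 * s) * ?c j)"
      using s_pos by (simp only: ennreal_mult'[symmetric])
  qed
  also have "\<dots> = ennreal (\<Sum>j. 9 * sqrt (2 * s) * ?c j)"
    using s_pos by (intro suminf_ennreal2 summable_mult summable_low mult_nonneg_nonneg[OF _ low_nonneg]) auto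
  also have "(\<Sum>j. 9 * sqrt (2 * s) * ?c j) = 9 * sqrt (2 * s) * glow f s"
    unfolding glow_def by (rule suminf_mult[OF summable_low])
  also have "\<dots> \<le> 13 * sqrt s * glow f s"
  proof (rule mult_right_mono[OF _ glow_nonneg])
    \<comment> \<open>9 sqrt 2 = 12.73..., compared through the squares 162 and 169.\<close>
    have "9 * sqrt 2 \<le> (13::real)" by (rule power2_le_imp_le) (auto simp: power_mult_distrib)
    then have "9 * sqrt 2 * sqrt s \<le> 13 * sqrt s" using s_pos by (intro mult_right_mono) auto
    then show "9 * sqrt (2 * s) \<le> 13 * sqrt s" by (simp add: real_sqrt_mult mult.assoc)
  qed
  finally show ?thesis by (simp add: ennreal_leI)
qed

text \<open>Interpolation by hand: each part exceeds its level on a set of measure at most |x|. 2560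
  is the weak (1,1) constant, and it also serves the other part because 2 * 13654 is below 2560^2.
  The extra \<open>e\<close> keeps both levels positive should a series vanish, and right continuity
  removes it.\<close>

lemma distrib_fin_hilbert_gser: "distrib_fun (fin_hilbert f) (2560 * gser f x) \<le> 2 * \<bar>x\<bar>"
proof (rule distrib_fun_right_cont[OF borel_measurable_fin_hilbert[OF f]])
  fix e :: real assume e: "0 < e"
  let ?P = "gup f s" and ?Q = "glow f s"
  have d1: "distrib_fun (fin_hilbert (upart f s)) (2560 * ?P + e / 2) \<le> s"
  proof -
    have p: "0 < 2560 * ?P + e / 2" using gup_nonneg e by simp
    have "distrib_fun (fin_hilbert (upart f s)) (2560 * ?P + e / 2) \<le> 2560 * (LINT t|lborel. cmod (cut11 (upart f s) t)) / (2560 * ?P + e / 2)"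
      by (rule distrib_fin_hilbert_weak11[OF upart_integrable p])
    also have "\<dots> \<le> 2560 * (s * ?P) / (2560 * ?P + e / 2)"
      using integral_upart p by (intro divide_right_mono mult_left_mono) auto
    also have "\<dots> \<le> s" using p s_pos e gup_nonneg by (simp add: divide_le_eq algebra_simps)
    finally show ?thesis .
  qed
  have d2: "distrib_fun (fin_hilbert (lpart f s)) (2560 * ?Q + e / 2) \<le> s"
  proof -
    have p: "0 < 2560 * ?Q + e / 2" using glow_nonneg e by simp
    have "distrib_fun (fin_hilbert (lpart f s)) (2560 * ?Q + e / 2) \<le> 13654 * (LINT t|lborel. (cmod (cut11 (lpart f s) t))\<^sup>2) / (2560 * ?Q + e / 2)\<^sup>2"
      by (rule distrib_fin_hilbert_weak22[OF lpart_integrable integrable_lpart_sq p])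
    also have "\<dots> \<le> 13654 * (2 * s * ?Q\<^sup>2) / (2560 * ?Q + e / 2)\<^sup>2"
      using integral_lpart_sq by (intro divide_right_mono mult_left_mono) auto
    also have "\<dots> \<le> s"
    proof -
      have "(2560 * ?Q)\<^sup>2 \<le> (2560 * ?Q + e / 2)\<^sup>2" using glow_nonneg e by (intro power_mono) auto
      then have "13654 * 2 * ?Q\<^sup>2 \<le> (2560 * ?Q + e / 2)\<^sup>2" by (simp add: power_mult_distrib) (smt (verit) zero_le_power2)
      then have "s * (13654 * 2 * ?Q\<^sup>2) \<le> s * (2560 * ?Q + e / 2)\<^sup>2" using s_pos by (intro mult_left_mono) auto
      then show ?thesis using p by (simp add: divide_le_eq mult_ac)
    qed
    finally show ?thesis .
  qed
  have ae: "AE y in M11. cmod (fin_hilbert f y) \<le> cmod (fin_hilbert (upart f s) y) + cmod (fin_hilbert (lpart f s) y)"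
  proof -
    have eq: "(\<lambda>t. upart f s t + lpart f s t) = f" by (auto simp: upart_def lpart_def)
    have "AE y in M11. fin_hilbert f y = fin_hilbert (upart f s) y + fin_hilbert (lpart f s) y"
      using fin_hilbert_add_ae[OF upart_integrable lpart_integrable] unfolding eq .
    then show ?thesis by eventually_elim (simp add: norm_triangle_ineq)
  qed
  have "distrib_fun (fin_hilbert f) (2560 * gser f x + e) = distrib_fun (fin_hilbert f) ((2560 * ?P + e / 2) + (2560 * ?Q + e / 2))"
    by (simp add: gser_eq algebra_simps)
  also have "\<dots> \<le> distrib_fun (fin_hilbert (upart f s)) (2560 * ?P + e / 2) + distrib_fun (fin_hilbert (lpart f s)) (2560 * ?Q + e / 2)"
    by (rule distrib_fun_sum[OF borel_measurable_fin_hilbert[OF upart_integrable] borel_measurable_fin_hilbert[OF lpart_integrable] ae])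
  also have "\<dots> \<le> 2 * \<bar>x\<bar>" using d1 d2 by (simp add: s_def)
  finally show "distrib_fun (fin_hilbert f) (2560 * gser f x + e) \<le> 2 * \<bar>x\<bar>" .
qed

end

section \<open>The weighted transform\<close>

definition sqm :: "(real \<Rightarrow> complex) \<Rightarrow> real \<Rightarrow> complex" where
  "sqm f = (\<lambda>t. complex_of_real (sqrt (1 - t\<^sup>2)) * f t)"

lemma T_hat_eq: "T_hat f x = - wgt x * fin_hilbert (sqm f) x"
  by (simp add: T_hat_def sqm_def)

lemma wgt_eq_rw: "x \<in> {-1<..<1} \<Longrightarrow> wgt x = complex_of_real (rw x)"
  by (simp add: wgt_def rw_def)

lemma borel_measurable_wgt: "wgt \<in> borel_measurable M11"
  unfolding wgt_def by (rule borel_measurable_M11) measurable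

lemma sqrt_le_1: "x \<in> {-1<..<1} \<Longrightarrow> \<bar>sqrt (1 - x\<^sup>2)\<bar> \<le> (1::real)"
  by (auto simp: abs_square_le_1)

lemma norm_sqm_le: "x \<in> {-1<..<1} \<Longrightarrow> cmod (sqm f x) \<le> cmod (f x)"
  using sqrt_le_1[of x] by (auto simp: sqm_def norm_mult intro: mult_left_le_one_le)

lemma borel_measurable_sqm:
  assumes "f \<in> borel_measurable M11" shows "sqm f \<in> borel_measurable M11"
proof -
  have [measurable]: "(\<lambda>t. complex_of_real (sqrt (1 - t\<^sup>2))) \<in> borel_measurable M11"
    by (rule borel_measurable_M11) measurable
  show ?thesis unfolding sqm_def using assms by measurable
qed

lemma cut11_meas: "integrable lborel (cut11 f) \<Longrightarrow> f \<in> borel_measurable M11"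
  using borel_measurable_cut11[of f] by auto

lemma integrable_sqm:
  assumes f: "integrable lborel (cut11 f)" shows "integrable lborel (cut11 (sqm f))"
  by (rule integrable_cut_bound[OF f borel_measurable_sqm[OF cut11_meas[OF f]], of 1]) (use norm_sqm_le in auto)

lemma borel_measurable_T_hat:
  assumes f: "integrable lborel (cut11 f)" shows "T_hat f \<in> borel_measurable M11"
proof -
  note [measurable] = borel_measurable_wgt borel_measurable_fin_hilbert[OF integrable_sqm[OF f]]
  show ?thesis unfolding T_hat_eq[abs_def] by measurable
qed

text \<open>Rationalising the difference of the roots yields the factor (t - y) (t + y), whose first
  part cancels the kernel; |t + y| <= 2 bounds the second.\<close>

lemma sqrt_commutator_bound:
  assumes y: "y \<in> {-1<..<1}" and t: "t \<in> {-1<..<1}" and e: "0 < e"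
  shows "\<bar>(sqrt (1 - t\<^sup>2) - sqrt (1 - y\<^sup>2)) * hker e (t - y)\<bar> \<le> 2 / (sqrt (1 - t\<^sup>2) + sqrt (1 - y\<^sup>2))"
proof (cases "e < \<bar>t - y\<bar>")
  case True
  have pt: "0 < 1 - t\<^sup>2" and py: "0 < 1 - y\<^sup>2" using one_minus_sq_pos t y by auto
  define a b where "a = sqrt (1 - t\<^sup>2)" and "b = sqrt (1 - y\<^sup>2)"
  have ab: "0 < a" "0 < b" "a * a = 1 - t\<^sup>2" "b * b = 1 - y\<^sup>2" using pt py by (auto simp: a_def b_def)
  have "(a - b) * (a + b) = - ((t - y) * (t + y))" using ab(3,4) by (simp add: algebra_simps power2_eq_square)
  then have "a - b = - ((t - y) * (t + y)) / (a + b)" using ab by (simp add: field_simps)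
  then have "(a - b) * (1 / (t - y)) = - (t + y) / (a + b)" using True e by (simp add: field_simps)
  then have "\<bar>(a - b) * hker e (t - y)\<bar> = \<bar>t + y\<bar> / (a + b)" using True ab by (simp add: hker_def abs_div)
  also have "\<dots> \<le> 2 / (a + b)" using t y ab by (intro divide_right_mono) auto
  finally show ?thesis by (simp add: a_def b_def)
next
  case False
  have "0 \<le> sqrt (1 - t\<^sup>2)" "0 \<le> sqrt (1 - y\<^sup>2)" using t y by (auto simp: abs_square_le_1)
  then show ?thesis using False by (simp add: hker_def)
qed

text \<open>\<open>T_hat + T\<close> is, up to the factor \<open>wgt\<close>, the commutator of \<open>T\<close> with multiplication by
  \<open>sqrt (1 - t\<^sup>2)\<close>, whose kernel has no singularity on the diagonal.\<close>

lemma T_hat_plus_fin_hilbert_bound: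
  assumes f: "integrable lborel (cut11 f)" and x: "x \<noteq> 0" and sm: "summable (\<lambda>j. gterm f j x)"
    and y: "y \<in> {-1<..<1}" and ys: "\<bar>y\<bar> \<le> 1 - \<bar>x\<bar>"
    and pv: "has_pv (cut11 f) y (pi * fin_hilbert f y)" and pvs: "has_pv (cut11 (sqm f)) y (pi * fin_hilbert (sqm f) y)"
  shows "cmod (T_hat f y + fin_hilbert f y) \<le> 13 * gser f x"
proof -
  define s where "s = \<bar>x\<bar>"
  have s: "0 < s" using x by (simp add: s_def)
  note L = f x sm s_def
  define R where "R = sqrt (1 - y\<^sup>2)"
  have py: "0 < 1 - y\<^sup>2" using one_minus_sq_pos y by auto
  have "\<bar>y\<bar> * \<bar>y\<bar> \<le> \<bar>y\<bar> * 1" using y by (intro mult_left_mono) auto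
  then have "s \<le> 1 - y\<^sup>2" using ys by (simp add: s_def power2_eq_square)
  \<comment> \<open>Staying at distance at least s from the end points gives 1 - y^2 >= 1 - |y| >=
    s, the only way in which the position of y enters.\<close>
  then have Rs: "sqrt s \<le> R" by (simp add: R_def)
  have R: "0 < R" using py by (simp add: R_def)
  have s0: "0 < sqrt s" using s by simp
  let ?u = "\<lambda>t. cmod (cut11 (upart f s) t)" and ?l = "\<lambda>t. cmod (cut11 (lpart f s) t) * rw t"
  have iu: "integrable lborel ?u" using upart_integrable[OF L] by simp
  have lm [measurable]: "cut11 (lpart f s) \<in> borel_measurable borel" using lpart_integrable[OF L] by auto
  have ln: "(\<integral>\<^sup>+t. ennreal (?l t) \<partial>lborel) \<le> ennreal (13 * sqrt s * glow f s)"
  proof -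
    have "(\<integral>\<^sup>+t. ennreal (?l t) \<partial>lborel) = (\<integral>\<^sup>+t. ennreal (cmod (lpart f s t)) * ennreal (rw t) * indicator {-1<..<1} t \<partial>lborel)"
      by (intro nn_integral_cong) (auto simp: cut11_def indicator_def rw_nonneg ennreal_mult)
    also have "\<dots> = (\<integral>\<^sup>+t. ennreal (cmod (lpart f s t)) * ennreal (rw t) \<partial>M11)"
      unfolding M11_def by (subst nn_integral_restrict_space) auto
    also have "\<dots> \<le> ennreal (13 * sqrt s * glow f s)" by (rule nn_integral_lpart_rw[OF L])
    finally show ?thesis .
  qed
  have il: "integrable lborel ?l"
    by (rule integrableI_nonneg) (use ln in \<open>auto intro: le_less_trans simp: rw_nonneg\<close>)
  have Il: "(LINT t|lborel. ?l t) \<le> 13 * sqrt s * glow f s"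
  proof -
    have "ennreal (LINT t|lborel. ?l t) \<le> ennreal (13 * sqrt s * glow f s)"
      using ln by (subst nn_integral_eq_integral[OF il, symmetric]) (auto simp: rw_nonneg)
    then show ?thesis using s glow_nonneg[OF L] by simp
  qed
  have bound: "cmod (tru e (cut11 (sqm f)) y - complex_of_real R * tru e (cut11 f) y) \<le> 26 * sqrt s * gser f x" if e: "0 < e" for e
  proof -
    have diff: "tru e (cut11 (sqm f)) y - complex_of_real R * tru e (cut11 f) y =
      (LINT t|lborel. cut11 (sqm f) t * complex_of_real (hker e (t - y)) - complex_of_real R * (cut11 f t * complex_of_real (hker e (t - y))))"
      unfolding tru_def using integrable_mult_hker[OF f e] integrable_mult_hker[OF integrable_sqm[OF f] e] by simp
    have "cmod (tru e (cut11 (sqm f)) y - complex_of_real R * tru e (cut11 f) y) \<le> (LINT t|lborel. 2 / sqrt s * ?u t + 2 * ?l t)"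
      unfolding diff
    proof (rule Bochner_Integration.integral_norm_bound_integral)
      show "integrable lborel (\<lambda>t. cut11 (sqm f) t * complex_of_real (hker e (t - y)) - complex_of_real R * (cut11 f t * complex_of_real (hker e (t - y))))"
        using integrable_mult_hker[OF f e] integrable_mult_hker[OF integrable_sqm[OF f] e] by simp
      show "integrable lborel (\<lambda>t. 2 / sqrt s * ?u t + 2 * ?l t)" using iu il by simp
      fix t
      show "norm (cut11 (sqm f) t * complex_of_real (hker e (t - y)) - complex_of_real R * (cut11 f t * complex_of_real (hker e (t - y)))) \<le> 2 / sqrt s * ?u t + 2 * ?l t"
      proof (cases "t \<in> {-1<..<1}")
        case False
        then show ?thesis by (simp add: cut11_def)
      next
        case True
        define a where "a = sqrt (1 - t\<^sup>2)"
        have a: "0 < a" using True one_minus_sq_pos by (auto simp: a_def)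
        have "cut11 (sqm f) t * complex_of_real (hker e (t - y)) - complex_of_real R * (cut11 f t * complex_of_real (hker e (t - y)))
          = f t * complex_of_real ((a - R) * hker e (t - y))"
          using True by (simp add: sqm_def a_def algebra_simps)
        then have "norm (cut11 (sqm f) t * complex_of_real (hker e (t - y)) - complex_of_real R * (cut11 f t * complex_of_real (hker e (t - y))))
          = cmod (f t) * \<bar>(a - R) * hker e (t - y)\<bar>" by (simp only: norm_mult norm_of_real)
        also have "\<dots> \<le> cmod (f t) * (2 / (a + R))"
          unfolding a_def R_def by (rule mult_left_mono[OF sqrt_commutator_bound[OF y True e]]) simp
        \<comment> \<open>Either summand of the denominator may be kept. For large values of f it is
          R, at least sqrt s, and the L^1 bound applies; for small ones it is sqrt (1 - t^2), whose
          reciprocal is the weight.\<close>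
        also have "\<dots> \<le> 2 / sqrt s * ?u t + 2 * ?l t"
        proof (cases "decr_rearr f s < cmod (f t)")
          case True': True
          have "0 < a + R" "sqrt s \<le> a + R" using a R Rs by linarith+
          from divide_left_mono[OF this(2) _ mult_pos_pos[OF this(1) s0], of 2] have "2 / (a + R) \<le> 2 / sqrt s" by simp
          then have "cmod (f t) * (2 / (a + R)) \<le> cmod (f t) * (2 / sqrt s)" by (rule mult_left_mono) simp
          then show ?thesis using True True' by (simp add: upart_def lpart_def mult.commute)
        next
          case False
          have "0 < a + R" "a \<le> a + R" using a R by linarith+
          from divide_left_mono[OF this(2) _ mult_pos_pos[OF this(1) a], of 2] have "2 / (a + R) \<le> 2 / a" by simp
          then have "cmod (f t) * (2 / (a + R)) \<le> cmod (f t) * (2 / a)" by (rule mult_left_mono) simp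
          then show ?thesis using True False by (simp add: upart_def lpart_def rw_def a_def mult.commute)
        qed
        finally show ?thesis .
      qed
    qed
    also have "\<dots> = (LINT t|lborel. 2 / sqrt s * ?u t) + (LINT t|lborel. 2 * ?l t)"
      by (rule Bochner_Integration.integral_add[OF integrable_mult_right integrable_mult_right]) (rule iu il)+
    also have "\<dots> = 2 / sqrt s * (LINT t|lborel. ?u t) + 2 * (LINT t|lborel. ?l t)" by (simp only: integral_mult_right_zero)
    also have "\<dots> \<le> 2 / sqrt s * (s * gup f s) + 2 * (13 * sqrt s * glow f s)"
    proof (rule add_mono)
      show "2 / sqrt s * (LINT t|lborel. ?u t) \<le> 2 / sqrt s * (s * gup f s)"
        using s0 integral_upart[OF L] by (intro mult_left_mono) (simp_all only: order_refl zero_le_divide_iff, simp)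
      show "2 * (LINT t|lborel. ?l t) \<le> 2 * (13 * sqrt s * glow f s)" using Il by linarith
    qed
    also have "2 / sqrt s * (s * gup f s) = 2 * sqrt s * gup f s"
    proof -
      have "2 / sqrt s * (s * gup f s) = 2 * (s / sqrt s) * gup f s" by simp
      also have "s / sqrt s = sqrt s" using s by (intro real_div_sqrt) simp
      finally show ?thesis .
    qed
    also have "2 * sqrt s * gup f s + 2 * (13 * sqrt s * glow f s) \<le> 26 * sqrt s * gser f x"
    proof -
      have "0 \<le> sqrt s * gup f s" using gup_nonneg[OF L] s0 by (intro mult_nonneg_nonneg) auto
      then show ?thesis unfolding gser_eq[OF L] by (simp add: distrib_left)
    qed
    finally show ?thesis .
  qed
  have "cmod (pi * fin_hilbert (sqm f) y - complex_of_real R * (pi * fin_hilbert f y)) \<le> 26 * sqrt s * gser f x"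
  proof (rule tendsto_upperbound)
    show "((\<lambda>e. cmod (tru e (cut11 (sqm f)) y - complex_of_real R * tru e (cut11 f) y)) \<longlongrightarrow>
      cmod (pi * fin_hilbert (sqm f) y - complex_of_real R * (pi * fin_hilbert f y))) (at_right 0)"
      using pv pvs unfolding has_pv_def by (intro tendsto_intros)
    show "eventually (\<lambda>e. cmod (tru e (cut11 (sqm f)) y - complex_of_real R * tru e (cut11 f) y) \<le> 26 * sqrt s * gser f x) (at_right 0)"
      using eventually_at_right_0 by eventually_elim (rule bound)
  qed simp
  moreover have "pi * fin_hilbert (sqm f) y - complex_of_real R * (pi * fin_hilbert f y) = complex_of_real pi * (- complex_of_real R * (T_hat f y + fin_hilbert f y))"
  proof -
    have "complex_of_real R * wgt y = 1" using R by (simp add: wgt_def R_def)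
    then have "complex_of_real R * T_hat f y = - fin_hilbert (sqm f) y" unfolding T_hat_eq
      by (simp add: mult.assoc[symmetric])
    then show ?thesis by (simp add: algebra_simps)
  qed
  ultimately have "pi * (R * cmod (T_hat f y + fin_hilbert f y)) \<le> 26 * sqrt s * gser f x"
    using R by (simp add: norm_mult)
  \<comment> \<open>Dividing by pi R, which is at least 2 sqrt s, removes sqrt s and turns 26 into
    13.\<close>
  moreover have "2 * (sqrt s * cmod (T_hat f y + fin_hilbert f y)) \<le> pi * (R * cmod (T_hat f y + fin_hilbert f y))"
  proof (rule mult_mono)
    show "sqrt s * cmod (T_hat f y + fin_hilbert f y) \<le> R * cmod (T_hat f y + fin_hilbert f y)"
      by (rule mult_right_mono[OF Rs norm_ge_zero])
    show "0 \<le> sqrt s * cmod (T_hat f y + fin_hilbert f y)" using s0 by (intro mult_nonneg_nonneg norm_ge_zero) simp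
    show "2 \<le> pi" by (rule pi_ge_two)
  qed (rule pi_ge_zero)
  ultimately have "sqrt s * (2 * cmod (T_hat f y + fin_hilbert f y)) \<le> sqrt s * (26 * gser f x)" by (simp add: mult_ac)
  then show ?thesis using s0 by simp
qed

text \<open>The pointwise bound holds off two end intervals of length |x| each; their total measure
  2 |x| is exactly what radial domination permits as exceptional set.\<close>

lemma distrib_T_hat_plus_fin_hilbert:
  assumes f: "integrable lborel (cut11 f)" and x: "x \<noteq> 0" "\<bar>x\<bar> < 1" and sm: "summable (\<lambda>j. gterm f j x)"
  shows "distrib_fun (\<lambda>y. T_hat f y + fin_hilbert f y) (13 * gser f x) \<le> 2 * \<bar>x\<bar>"
proof -
  have m: "(\<lambda>y. T_hat f y + fin_hilbert f y) \<in> borel_measurable M11"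
    using borel_measurable_T_hat[OF f] borel_measurable_fin_hilbert[OF f] by (rule borel_measurable_add)
  let ?B = "{-1..-1 + \<bar>x\<bar>} \<union> {1 - \<bar>x\<bar>..1}"
  have "emeasure lborel ?B \<le> emeasure lborel {-1..-1 + \<bar>x\<bar>} + emeasure lborel {1 - \<bar>x\<bar>..1}" by (rule emeasure_subadditive) auto
  also have "\<dots> = ennreal (2 * \<bar>x\<bar>)" by (simp add: ennreal_plus[symmetric] del: ennreal_plus)
  finally have B: "emeasure lborel ?B \<le> ennreal (2 * \<bar>x\<bar>)" .
  show ?thesis unfolding distrib_fun_def
  proof (rule measure_M11_le_emeasure[OF _ B _ distrib_set[OF m]])
    show "AE y in M11. y \<in> {y \<in> space M11. 13 * gser f x < cmod (T_hat f y + fin_hilbert f y)} \<longrightarrow> y \<in> ?B"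
      using has_pv_fin_hilbert_ae[OF f] has_pv_fin_hilbert_ae[OF integrable_sqm[OF f]] AE_space
    proof eventually_elim
      case (elim y)
      show ?case
      proof
        assume "y \<in> {y \<in> space M11. 13 * gser f x < cmod (T_hat f y + fin_hilbert f y)}"
        then have "\<not> \<bar>y\<bar> \<le> 1 - \<bar>x\<bar>"
          using T_hat_plus_fin_hilbert_bound[OF f x(1) sm _ _ elim(1,2)] by force
        then show "y \<in> ?B" using elim(3) by (auto simp: abs_if split: if_splits)
      qed
    qed
  qed auto
qed

section \<open>Boundedness of the transform and of its weighted companion\<close>

context boyd_space begin

lemma gser_facts:
  obtains K where "0 < K" "\<And>f. f \<in> X \<Longrightarrow> AE x in M11. summable (\<lambda>j. gterm f j x)"
    "\<And>f. f \<in> X \<Longrightarrow> (\<lambda>x. complex_of_real (gser f x)) \<in> X" "\<And>f. f \<in> X \<Longrightarrow> N (\<lambda>x. complex_of_real (gser f x)) \<le> K * N f"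
proof -
  obtain K where K: "0 < K" and B: "\<forall>f\<in>X. (AE x in M11. summable (\<lambda>j. gterm f j x)) \<and>
    (\<lambda>x. complex_of_real (gser f x)) \<in> X \<and> N (\<lambda>x. complex_of_real (gser f x)) \<le> K * N f"
    using gser_X by (elim exE conjE)
  show ?thesis by (rule that[OF K]) (drule bspec[OF B], elim conjE, assumption)+
qed

lemma AE_M11_nonzero: "AE x in M11. x \<noteq> 0 \<and> \<bar>x\<bar> < 1"
proof -
  have "AE x in lborel. x \<noteq> (0::real)" by (rule AE_lborel_singleton)
  then show ?thesis unfolding AE_M11_iff by eventually_elim auto
qed

lemma gser_scaled_X:
  assumes f: "f \<in> X" shows "(\<lambda>x. complex_of_real (c * gser f x)) \<in> X \<and> N (\<lambda>x. complex_of_real (c * gser f x)) = \<bar>c\<bar> * N (\<lambda>x. complex_of_real (gser f x))"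
proof -
  obtain K where g: "(\<lambda>x. complex_of_real (gser f x)) \<in> X" by (rule gser_facts) (use f in blast)
  show ?thesis using X_cmult[OF g, of "complex_of_real c"] N_cmult[OF g, of "complex_of_real c"] by simp
qed

lemma fin_hilbert_radial:
  assumes f: "f \<in> X"
  shows "\<And>r. 0 \<le> r \<Longrightarrow> distrib_fun (fin_hilbert f) r \<le> distrib_fun (\<lambda>x. complex_of_real (2560 * gser f x)) r"
    and "fin_hilbert f \<in> X \<and> N (fin_hilbert f) \<le> N (\<lambda>x. complex_of_real (2560 * gser f x))"
proof -
  obtain K where "AE x in M11. summable (\<lambda>j. gterm f j x)" by (rule gser_facts) (use f in blast)
  then have ae: "AE x in M11. distrib_fun (fin_hilbert f) (2560 * gser f x) \<le> 2 * \<bar>x\<bar>"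
    using AE_M11_nonzero by eventually_elim (use distrib_fin_hilbert_gser[OF X_int[OF f]] in auto)
  note m = borel_measurable_fin_hilbert[OF X_int[OF f]]
  show "\<And>r. 0 \<le> r \<Longrightarrow> distrib_fun (fin_hilbert f) r \<le> distrib_fun (\<lambda>x. complex_of_real (2560 * gser f x)) r"
    by (rule X_radial_dominated(1)[OF conjunct1[OF gser_scaled_X[OF f]] m ae])
  show "fin_hilbert f \<in> X \<and> N (fin_hilbert f) \<le> N (\<lambda>x. complex_of_real (2560 * gser f x))"
    by (rule X_radial_dominated(2)[OF conjunct1[OF gser_scaled_X[OF f]] m ae])
qed

theorem fin_hilbert_bounded: "\<exists>C>0. \<forall>f\<in>X. fin_hilbert f \<in> X \<and> N (fin_hilbert f) \<le> C * N f"
proof -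
  obtain K where K: "0 < K" "\<And>f. f \<in> X \<Longrightarrow> N (\<lambda>x. complex_of_real (gser f x)) \<le> K * N f" by (rule gser_facts) blast
  have "fin_hilbert f \<in> X \<and> N (fin_hilbert f) \<le> 2560 * K * N f" if f: "f \<in> X" for f
    using fin_hilbert_radial(2)[OF f] gser_scaled_X[OF f, of 2560] K(2)[OF f] by (simp del: of_real_mult)
  then show ?thesis using K(1) by (intro exI[of _ "2560 * K"]) simp
qed

text \<open>\<open>T_hat\<close> is recovered from \<open>T_hat + T\<close> by subtracting
  \<open>T\<close>; 2573 = 13 + 2560.\<close>

theorem T_hat_bounded: "\<exists>C>0. \<forall>f\<in>X. T_hat f \<in> X \<and> N (T_hat f) \<le> C * N f"
proof -
  obtain K where K: "0 < K" "\<And>f. f \<in> X \<Longrightarrow> N (\<lambda>x. complex_of_real (gser f x)) \<le> K * N f"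
    "\<And>f. f \<in> X \<Longrightarrow> AE x in M11. summable (\<lambda>j. gterm f j x)" by (rule gser_facts) blast
  have "T_hat f \<in> X \<and> N (T_hat f) \<le> 2573 * K * N f" if f: "f \<in> X" for f
  proof -
    note F = X_int[OF f]
    have m: "(\<lambda>y. T_hat f y + fin_hilbert f y) \<in> borel_measurable M11"
      using borel_measurable_T_hat[OF F] borel_measurable_fin_hilbert[OF F] by (rule borel_measurable_add)
    have ae: "AE x in M11. distrib_fun (\<lambda>y. T_hat f y + fin_hilbert f y) (13 * gser f x) \<le> 2 * \<bar>x\<bar>"
      using K(3)[OF f] AE_M11_nonzero by eventually_elim (use distrib_T_hat_plus_fin_hilbert[OF F] in auto)
    have S: "(\<lambda>y. T_hat f y + fin_hilbert f y) \<in> X \<and> N (\<lambda>y. T_hat f y + fin_hilbert f y) \<le> N (\<lambda>x. complex_of_real (13 * gser f x))"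
      by (rule X_radial_dominated(2)[OF conjunct1[OF gser_scaled_X[OF f]] m ae])
    have H: "fin_hilbert f \<in> X \<and> N (fin_hilbert f) \<le> N (\<lambda>x. complex_of_real (2560 * gser f x))" by (rule fin_hilbert_radial(2)[OF f])
    have mH: "(\<lambda>x. - 1 * fin_hilbert f x) \<in> X" by (rule X_cmult) (use H in blast)
    have NH: "N (\<lambda>x. - 1 * fin_hilbert f x) = N (fin_hilbert f)" using N_cmult[of "fin_hilbert f" "- 1"] H by simp
    have eq: "(\<lambda>y. (T_hat f y + fin_hilbert f y) + - 1 * fin_hilbert f y) = T_hat f" by simp
    have "T_hat f \<in> X" using X_add[OF conjunct1[OF S] mH] unfolding eq .
    moreover have "N (T_hat f) \<le> N (\<lambda>y. T_hat f y + fin_hilbert f y) + N (fin_hilbert f)"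
      using N_add[OF conjunct1[OF S] mH] unfolding eq NH .
    ultimately show ?thesis
      using S H gser_scaled_X[OF f, of 2560] gser_scaled_X[OF f, of 13] K(2)[OF f] by (simp del: of_real_mult)
  qed
  then show ?thesis using K(1) by (intro exI[of _ "2573 * K"]) simp
qed

end

section \<open>Inversion formulas\<close>

lemma AE_eq_0_if_distrib_fun_0:
  assumes f: "f \<in> borel_measurable M11" and z: "\<And>r. 0 < r \<Longrightarrow> distrib_fun f r \<le> 0"
  shows "AE x in M11. f x = 0"
proof -
  interpret finite_measure M11 by (rule finite_measure_M11)
  have "distrib_fun f 0 \<le> 0" by (rule distrib_fun_right_cont[OF f]) (use z in simp)
  then have "distrib_fun f 0 = 0" by (intro order_antisym distrib_fun_nonneg)
  then have "measure M11 {x \<in> space M11. cmod (f x) > 0} = 0" by (simp only: distrib_fun_def)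
  then have "{x \<in> space M11. cmod (f x) > 0} \<in> null_sets M11"
    using distrib_set[OF f, of 0] by (simp add: null_sets_def emeasure_eq_measure)
  then have "AE x in M11. x \<notin> {x \<in> space M11. cmod (f x) > 0}" by (rule AE_not_in)
  then show ?thesis using AE_space by eventually_elim auto
qed

lemma cut11_cong_ae:
  assumes "AE x in M11. f x = g x" shows "AE x in lborel. cut11 f x = cut11 g x"
  using assms unfolding AE_M11_iff by eventually_elim (auto simp: cut11_def indicator_def)

lemma fin_hilbert_cong_ae:
  assumes f: "f \<in> borel_measurable M11" and g: "g \<in> borel_measurable M11" and ae: "AE x in M11. f x = g x"
    and x: "x \<in> {-1<..<1}"
  shows "fin_hilbert f x = fin_hilbert g x"
proof -
  have [measurable]: "cut11 f \<in> borel_measurable borel" "cut11 g \<in> borel_measurable borel"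
    using f g by (simp_all add: borel_measurable_cut11)
  have "tru e (cut11 f) x = tru e (cut11 g) x" for e
    unfolding tru_def
  proof (rule integral_cong_AE)
    show "AE t in lborel. cut11 f t * complex_of_real (hker e (t - x)) = cut11 g t * complex_of_real (hker e (t - x))"
      using cut11_cong_ae[OF ae] by eventually_elim simp
  qed measurable
  then show ?thesis using x by (simp add: fin_hilbert_eq_Lim)
qed

lemma T_hat_cong_ae:
  assumes f: "f \<in> borel_measurable M11" and g: "g \<in> borel_measurable M11" and ae: "AE x in M11. f x = g x"
    and x: "x \<in> {-1<..<1}"
  shows "T_hat f x = T_hat g x"
proof -
  have "AE x in M11. sqm f x = sqm g x" using ae by eventually_elim (simp add: sqm_def)
  then show ?thesis unfolding T_hat_eq
    using fin_hilbert_cong_ae[OF borel_measurable_sqm[OF f] borel_measurable_sqm[OF g] _ x] by simp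
qed

lemma T_hat_linear_ae:
  assumes f: "integrable lborel (cut11 f)" and g: "integrable lborel (cut11 g)"
  shows "AE x in M11. T_hat (\<lambda>y. f y + c * g y) x = T_hat f x + c * T_hat g x"
proof -
  have i: "integrable lborel (cut11 (\<lambda>t. c * sqm g t))"
    unfolding cut11_cmult using integrable_sqm[OF g] by simp
  have eq: "sqm (\<lambda>y. f y + c * g y) = (\<lambda>t. sqm f t + c * sqm g t)" by (auto simp: sqm_def algebra_simps)
  show ?thesis
    using fin_hilbert_add_ae[OF integrable_sqm[OF f] i] fin_hilbert_cmult_ae[OF integrable_sqm[OF g], of c]
    by eventually_elim (simp add: T_hat_eq eq algebra_simps)
qed

lemma sqrt_times_wgt: "x \<in> {-1<..<1} \<Longrightarrow> complex_of_real (sqrt (1 - x\<^sup>2)) * wgt x = 1"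
  using one_minus_sq_pos[of x] by (auto simp: wgt_def)

lemma distrib_fun_tendsto_0_of_ae:
  assumes h: "\<And>n. h n \<in> borel_measurable M11" and lim: "AE x in M11. (\<lambda>n. h n x) \<longlonglongrightarrow> 0" and r: "0 < r"
  shows "(\<lambda>n. distrib_fun (h n) r) \<longlonglongrightarrow> 0"
proof -
  interpret finite_measure M11 by (rule finite_measure_M11)
  have "(\<lambda>n. LINT x|M11. indicator {x \<in> space M11. cmod (h n x) > r} x) \<longlonglongrightarrow> (LINT x|M11. (0::real))"
  proof (rule integral_dominated_convergence[where w = "\<lambda>_. 1"])
    show "AE x in M11. (\<lambda>n. indicator {x \<in> space M11. cmod (h n x) > r} x) \<longlonglongrightarrow> (0::real)"
      using lim
    proof eventually_elim
      case (elim x)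
      have "(\<lambda>n. cmod (h n x)) \<longlonglongrightarrow> 0" using tendsto_norm[OF elim] by simp
      then have "eventually (\<lambda>n. cmod (h n x) < r) sequentially" by (rule order_tendstoD(2)[OF _ r])
      then have "eventually (\<lambda>n. indicator {x \<in> space M11. cmod (h n x) > r} x = (0::real)) sequentially"
        by eventually_elim (simp add: indicator_def)
      then show ?case by (rule tendsto_eventually)
    qed
    show "(\<lambda>x. indicator {x \<in> space M11. cmod (h n x) > r} x :: real) \<in> borel_measurable M11" for n
      by (rule borel_measurable_indicator[OF distrib_set[OF h]])
  qed (auto simp: indicator_def)
  moreover have "(LINT x|M11. indicator {x \<in> space M11. cmod (h n x) > r} x) = distrib_fun (h n) r" for n
  proof -
    have i: "{x \<in> space M11. cmod (h n x) > r} \<inter> space M11 = {x \<in> space M11. cmod (h n x) > r}" by auto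
    show ?thesis by (subst Bochner_Integration.integral_indicator) (simp only: i distrib_fun_def)
  qed
  ultimately show ?thesis by simp
qed

lemma decr_rearr_tendsto_0:
  assumes h: "\<And>n. h n \<in> borel_measurable M11" and lim: "\<And>r. 0 < r \<Longrightarrow> (\<lambda>n. distrib_fun (h n) r) \<longlonglongrightarrow> 0" and s: "0 < s"
  shows "(\<lambda>n. decr_rearr (h n) s) \<longlonglongrightarrow> 0"
proof (rule order_tendstoI)
  fix a :: real assume "a < 0"
  then show "eventually (\<lambda>n. a < decr_rearr (h n) s) sequentially"
    using decr_rearr_nonneg[OF h s] by (intro always_eventually allI) (auto intro: less_le_trans)
next
  fix a :: real assume a: "0 < a"
  have "eventually (\<lambda>n. distrib_fun (h n) (a / 2) < s) sequentially"
    using a by (intro order_tendstoD(2)[OF lim s]) simp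
  then show "eventually (\<lambda>n. decr_rearr (h n) s < a) sequentially"
  proof eventually_elim
    case (elim n)
    have "decr_rearr (h n) s \<le> a / 2" by (rule decr_rearr_leI) (use elim a in auto)
    then show ?case using a by simp
  qed
qed

context boyd_space begin

lemma ae_point_small:
  assumes "AE x in M11. P x" "0 < e" shows "\<exists>x. P x \<and> x \<noteq> 0 \<and> \<bar>x\<bar> < e"
proof (rule ccontr)
  assume n: "\<not> ?thesis"
  define d where "d = min e 1"
  have d: "0 < d" "d \<le> 1" "d \<le> e" using assms(2) by (auto simp: d_def)
  have "AE x in M11. x \<notin> {- d<..<d}"
    using assms(1) AE_M11_nonzero by eventually_elim (use n d in \<open>force simp: abs_less_iff\<close>)
  moreover have s: "{- d<..<d} \<in> sets M11" using d by (auto simp: sets_M11_iff)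
  ultimately have "{- d<..<d} \<in> null_sets M11" using AE_iff_null_sets[OF s] by blast
  moreover have "{- d<..<d} \<subseteq> {-1<..<1}" using d by auto
  ultimately have "emeasure lborel {- d<..<d} = 0" by (simp add: null_sets_def emeasure_M11)
  then show False using d by simp
qed

text \<open>Continuity in measure under a common majorant of the distribution functions. The images
  again have a common majorant, built from the series of \<open>\<phi>\<close>, so the result can be
  applied twice in a row, as the composition of \<open>T_hat\<close> with \<open>T\<close>
  requires.\<close>

lemma fin_hilbert_measure_continuity:
  assumes \<phi>: "\<phi> \<in> X" and h: "\<And>n. h n \<in> borel_measurable M11"
    and dom: "\<And>n r. 0 \<le> r \<Longrightarrow> distrib_fun (h n) r \<le> distrib_fun \<phi> r"
    and lim: "\<And>r. 0 < r \<Longrightarrow> (\<lambda>n. distrib_fun (h n) r) \<longlonglongrightarrow> 0"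
  shows "\<And>n. fin_hilbert (h n) \<in> X"
    and "\<And>n r. 0 \<le> r \<Longrightarrow> distrib_fun (fin_hilbert (h n)) r \<le> distrib_fun (\<lambda>x. complex_of_real (2560 * gser \<phi> x)) r"
    and "\<And>r. 0 < r \<Longrightarrow> (\<lambda>n. distrib_fun (fin_hilbert (h n)) r) \<longlonglongrightarrow> 0"
proof -
  have hX: "h n \<in> X" for n using X_distrib[OF \<phi> h dom] by blast
  obtain K where sm: "\<And>f. f \<in> X \<Longrightarrow> AE x in M11. summable (\<lambda>j. gterm f j x)" by (rule gser_facts) blast
  show "fin_hilbert (h n) \<in> X" for n using fin_hilbert_radial(2)[OF hX] by blast
  have le: "gterm (h n) j x \<le> gterm \<phi> j x" "0 \<le> gterm (h n) j x" if "x \<noteq> 0" for n j x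
    using gterm_mono[OF X_meas[OF \<phi>] that dom] gterm_nonneg[OF h that] by auto
  have smh: "summable (\<lambda>j. gterm (h n) j x)" if "x \<noteq> 0" "summable (\<lambda>j. gterm \<phi> j x)" for n x
    by (rule summable_comparison_test[OF _ that(2)]) (use le[OF that(1)] in \<open>auto intro!: exI[of _ 0]\<close>)
  show "distrib_fun (fin_hilbert (h n)) r \<le> distrib_fun (\<lambda>x. complex_of_real (2560 * gser \<phi> x)) r" if r: "0 \<le> r" for n r
  proof -
    have "distrib_fun (fin_hilbert (h n)) r \<le> distrib_fun (\<lambda>x. complex_of_real (2560 * gser (h n) x)) r"
      by (rule fin_hilbert_radial(1)[OF hX r])
    also have "\<dots> \<le> distrib_fun (\<lambda>x. complex_of_real (2560 * gser \<phi> x)) r"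
    proof (rule distrib_fun_mono[OF X_meas[OF conjunct1[OF gser_scaled_X[OF \<phi>]]]])
      show "AE x in M11. cmod (complex_of_real (2560 * gser (h n) x)) \<le> cmod (complex_of_real (2560 * gser \<phi> x))"
        using sm[OF \<phi>] AE_M11_nonzero
      proof eventually_elim
        case (elim x)
        have "gser (h n) x \<le> gser \<phi> x" "0 \<le> gser (h n) x"
          unfolding gser_def using elim smh[of x n] le[of x n] by (auto intro: suminf_le suminf_nonneg)
        then show ?case by (simp only: norm_of_real)
      qed
    qed simp
    finally show ?thesis .
  qed
  show "(\<lambda>n. distrib_fun (fin_hilbert (h n)) r) \<longlonglongrightarrow> 0" if r: "0 < r" for r
  proof (rule order_tendstoI)
    fix a :: real assume "a < 0"
    then show "eventually (\<lambda>n. a < distrib_fun (fin_hilbert (h n)) r) sequentially"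
      using distrib_fun_nonneg by (intro always_eventually allI) (auto intro: less_le_trans)
  next
    fix a :: real assume a: "0 < a"
    \<comment> \<open>One point with 2 |x| < a suffices: at this x the series of \<open>h n\<close>
      tends to 0 by Tannery's theorem with the terms of \<open>\<phi>\<close> as majorants, so its
      level eventually drops below r while the exceptional measure stays at 2 |x|.\<close>
    obtain x where x: "summable (\<lambda>j. gterm \<phi> j x)" "x \<noteq> 0" "\<bar>x\<bar> < a / 2" using ae_point_small[OF sm[OF \<phi>], of "a / 2"] a by auto
    have "(\<lambda>n. \<Sum>j. gterm (h n) j x) \<longlonglongrightarrow> (\<Sum>j. 0)"
    proof -
      have t: "(\<lambda>n. gterm (h n) j x) \<longlonglongrightarrow> 0" for j
      proof -
        have "(\<lambda>n. (1 / 2) ^ j * decr_rearr (h n) (\<bar>x\<bar> / 2 ^ Suc j) + sqrt 2 ^ j * decr_rearr (h n) (2 ^ j * \<bar>x\<bar>)) \<longlonglongrightarrow> (1 / 2) ^ j * 0 + sqrt 2 ^ j * 0"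
          using x(2) by (intro tendsto_intros decr_rearr_tendsto_0[OF h lim]) auto
        then show ?thesis by (simp add: gterm_def)
      qed
      have "eventually (\<lambda>n. summable (\<lambda>k. norm (gterm (h n) k x))) sequentially \<and> summable (\<lambda>k. norm (0::real)) \<and>
        ((\<lambda>n. suminf (\<lambda>k. gterm (h n) k x)) \<longlongrightarrow> suminf (\<lambda>k. 0)) sequentially"
        by (rule tannerys_theorem[where M = "\<lambda>j. gterm \<phi> j x"])
          (use t x le[OF x(2)] in \<open>auto intro!: always_eventually\<close>)
      then show ?thesis by blast
    qed
    then have "(\<lambda>n. 2560 * gser (h n) x) \<longlonglongrightarrow> 2560 * 0" unfolding gser_def by (intro tendsto_intros) simp
    then have "eventually (\<lambda>n. 2560 * gser (h n) x < r) sequentially" by (intro order_tendstoD(2)) (use r in auto)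
    then show "eventually (\<lambda>n. distrib_fun (fin_hilbert (h n)) r < a) sequentially"
    proof eventually_elim
      case (elim n)
      have "distrib_fun (fin_hilbert (h n)) r \<le> distrib_fun (fin_hilbert (h n)) (2560 * gser (h n) x)"
        using elim by (intro distrib_fun_antimono borel_measurable_fin_hilbert X_int hX) simp
      also have "\<dots> \<le> 2 * \<bar>x\<bar>" by (rule distrib_fin_hilbert_gser[OF X_int[OF hX] x(2) smh[OF x(2,1)] refl])
      finally show ?case using x(3) by simp
    qed
  qed
qed

text \<open>The lower half of the series of the constant 1 already grows like |x|^(-1/2): the last
  index i with 2^i |x| < 2 contributes sqrt 2 ^ i. The weight exceeds |x|^(-1/2) only on measure 2
  |x|, so it is radially dominated by this series, which lies in the space because
  \<open>\<alpha>\<close> is above 1/2.\<close>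

lemma wgt_X: "wgt \<in> X"
proof -
  obtain K where sm: "\<And>f. f \<in> X \<Longrightarrow> AE x in M11. summable (\<lambda>j. gterm f j x)" by (rule gser_facts) blast
  let ?o = "\<lambda>_::real. 1::complex"
  have om: "?o \<in> borel_measurable M11" by simp
  have one: "1 \<le> decr_rearr ?o s" if s: "0 < s" "s < 2" for s
  proof (rule ccontr)
    assume "\<not> ?thesis"
    then have "{x. - 1 < x \<and> x < 1 \<and> cmod (1::complex) > decr_rearr ?o s} = {-1<..<1::real}" by auto
    then have "distrib_fun ?o (decr_rearr ?o s) = 2" unfolding distrib_fun_lborel by (simp only:) simp
    then show False using distrib_fun_decr_rearr[OF om s(1)] s by simp
  qed
  have ae: "AE x in M11. distrib_fun wgt (gser ?o x) \<le> 2 * \<bar>x\<bar>"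
    using sm[OF X_one] AE_M11_nonzero
  proof eventually_elim
    case (elim x)
    have x0: "0 < \<bar>x\<bar>" "\<bar>x\<bar> < 1" using elim by auto
    define P where "P j \<longleftrightarrow> 2 \<le> 2 ^ j * \<bar>x\<bar>" for j :: nat
    have "(1::real) < 2" by simp
    from real_arch_pow[OF this, of "2 / \<bar>x\<bar>"] obtain n where n: "2 / \<bar>x\<bar> < 2 ^ n" by (elim exE)
    then have "P n" using x0 by (simp add: P_def field_simps)
    define k where "k = (LEAST j. P j)"
    have k: "P k" unfolding k_def using \<open>P n\<close> by (rule LeastI)
    have "\<not> P 0" using x0 by (simp add: P_def)
    then have "k \<noteq> 0" using k by metis
    then obtain i where i: "k = Suc i" by (cases k) auto
    have nP: "\<not> P i" using not_less_Least[of i P] i by (simp add: k_def)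
    have "1 \<le> 2 ^ i * \<bar>x\<bar>" using k i by (simp add: P_def)
    then have "1 / \<bar>x\<bar> \<le> 2 ^ i" using x0 by (simp add: field_simps)
    then have "sqrt (1 / \<bar>x\<bar>) \<le> sqrt 2 ^ i" by (simp add: real_sqrt_power[symmetric])
    also have "\<dots> * 1 \<le> sqrt 2 ^ i * decr_rearr ?o (2 ^ i * \<bar>x\<bar>)"
      using nP x0 by (intro mult_left_mono one) (auto simp: P_def)
    also have "\<dots> \<le> gterm ?o i x" unfolding gterm_def using x0 by (simp add: decr_rearr_nonneg[OF om])
    also have "gterm ?o i x \<le> gser ?o x" unfolding gser_def
      using sum_le_suminf[OF elim(1), of "{i}"] gterm_nonneg[OF om] elim by simp
    finally have g: "sqrt (1 / \<bar>x\<bar>) \<le> gser ?o x" by simp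
    have "distrib_fun wgt (gser ?o x) \<le> distrib_fun wgt (sqrt (1 / \<bar>x\<bar>))" by (rule distrib_fun_antimono[OF borel_measurable_wgt g])
    also have "\<dots> = measure M11 {y \<in> space M11. rw y > sqrt (1 / \<bar>x\<bar>)}"
      unfolding distrib_fun_def by (rule arg_cong[where f = "measure M11"]) (auto simp: wgt_eq_rw rw_nonneg)
    also have "\<dots> \<le> 2 / (sqrt (1 / \<bar>x\<bar>))\<^sup>2" using x0 by (intro measure_rw_greater) simp
    also have "\<dots> = 2 * \<bar>x\<bar>" using x0 by simp
    finally show ?case .
  qed
  have G: "(\<lambda>x. complex_of_real (gser ?o x)) \<in> X" using gser_scaled_X[OF X_one, of 1] by simp
  show ?thesis using X_radial_dominated(2)[OF G borel_measurable_wgt ae] by blast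
qed

lemma proj_P_eq: "proj_P f = (\<lambda>x. (complex_of_real (1 / pi) * (LINT t|lborel. cut11 f t)) * wgt x)"
  by (simp add: proj_P_def[abs_def] set_integral_cut11)

definition inv_ok :: "(real \<Rightarrow> complex) \<Rightarrow> bool" where
  "inv_ok f \<longleftrightarrow> (AE x in M11. T_hat (fin_hilbert f) x = f x - proj_P f x)"

lemma fin_hilbert_X: "f \<in> X \<Longrightarrow> fin_hilbert f \<in> X"
  using fin_hilbert_radial(2) by blast

lemma T_hat_X: "f \<in> X \<Longrightarrow> T_hat f \<in> X"
  using T_hat_bounded by (elim exE conjE) (drule (1) bspec, elim conjE)

lemma sqm_X: "f \<in> X \<Longrightarrow> sqm f \<in> X"
  by (rule X_solid[of f _ 1]) (auto intro: borel_measurable_sqm X_meas norm_sqm_le)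

lemma T_hat_fin_hilbert_lin:
  assumes f: "f \<in> X" and g: "g \<in> X"
  shows "AE x in M11. T_hat (fin_hilbert (\<lambda>t. f t + c * g t)) x = T_hat (fin_hilbert f) x + c * T_hat (fin_hilbert g) x"
proof -
  have i: "integrable lborel (cut11 (\<lambda>t. c * g t))" by (rule X_int[OF X_cmult[OF g]])
  have ae: "AE x in M11. fin_hilbert (\<lambda>t. f t + c * g t) x = fin_hilbert f x + c * fin_hilbert g x"
    using fin_hilbert_add_ae[OF X_int[OF f] i] fin_hilbert_cmult_ae[OF X_int[OF g], of c] by eventually_elim simp
  have m: "fin_hilbert (\<lambda>t. f t + c * g t) \<in> borel_measurable M11" "(\<lambda>x. fin_hilbert f x + c * fin_hilbert g x) \<in> borel_measurable M11"
    by (intro X_meas fin_hilbert_X X_add X_cmult f g)+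
  show ?thesis
    using T_hat_linear_ae[OF X_int[OF fin_hilbert_X[OF f]] X_int[OF fin_hilbert_X[OF g]], of c] AE_space
    by eventually_elim (use T_hat_cong_ae[OF m ae] in simp)
qed

lemma proj_P_lin:
  assumes f: "f \<in> X" and g: "g \<in> X"
  shows "proj_P (\<lambda>t. f t + c * g t) x = proj_P f x + c * proj_P g x"
proof -
  have "(LINT t|lborel. cut11 (\<lambda>t. f t + c * g t) t) = (LINT t|lborel. cut11 f t) + c * (LINT t|lborel. cut11 g t)"
    unfolding cut11_add cut11_cmult using X_int[OF f] X_int[OF g] by simp
  then show ?thesis by (simp add: proj_P_eq algebra_simps)
qed

lemma inv_ok_lin:
  assumes f: "f \<in> X" "inv_ok f" and g: "g \<in> X" "inv_ok g"
  shows "inv_ok (\<lambda>t. f t + c * g t)"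
  using f(2) g(2) T_hat_fin_hilbert_lin[OF f(1) g(1), of c] unfolding inv_ok_def
proof eventually_elim
  case (elim x)
  show ?case unfolding elim proj_P_lin[OF f(1) g(1)] by (simp add: algebra_simps)
qed

text \<open>The defect \<open>E\<close> of the formula for \<open>f\<close> equals, for every n, the
  defect of the difference \<open>d n\<close>, since \<open>g n\<close> has none. Multiplied by sqrt
  (1 - x^2), which removes the weight, its summands tend to 0 in measure or as constants; being
  independent of n, the product vanishes.\<close>

lemma inv_ok_limit:
  assumes g: "\<And>n::nat. g n \<in> X" and ok: "\<And>n. inv_ok (g n)" and f: "f \<in> X" and h: "h \<in> X"
    and le: "\<And>n x. x \<in> {-1<..<1} \<Longrightarrow> cmod (g n x) \<le> cmod (h x)"
    and lim: "\<And>x. x \<in> {-1<..<1} \<Longrightarrow> (\<lambda>n. g n x) \<longlonglongrightarrow> f x"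
  shows "inv_ok f"
proof -
  define d where "d n = (\<lambda>t. f t + (- 1) * g n t)" for n
  define H where "H = (\<lambda>t. complex_of_real (cmod (f t) + cmod (h t)))"
  have dX: "d n \<in> X" for n unfolding d_def by (intro X_add X_cmult f g)
  have HX: "H \<in> X"
  proof -
    have [measurable]: "f \<in> borel_measurable M11" "h \<in> borel_measurable M11" using f h by (auto intro: X_meas)
    have "(\<lambda>t. complex_of_real (cmod (f t))) \<in> X" "(\<lambda>t. complex_of_real (cmod (h t))) \<in> X"
      by (rule X_solid[OF f, of _ 1] X_solid[OF h, of _ 1]; simp)+
    from X_add[OF this] show ?thesis by (simp add: H_def)
  qed
  have dH: "cmod (d n x) \<le> cmod (H x)" if "x \<in> {-1<..<1}" for n x
  proof -
    have "cmod (d n x) \<le> cmod (f x) + cmod (g n x)" using norm_triangle_ineq4[of "f x" "g n x"] by (simp add: d_def)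
    also have "\<dots> \<le> cmod (H x)" using le[OF that, of n] unfolding H_def norm_of_real by simp
    finally show ?thesis .
  qed
  have dlim: "(\<lambda>n. d n x) \<longlonglongrightarrow> 0" if "x \<in> {-1<..<1}" for x
    using tendsto_add[OF tendsto_const tendsto_mult[OF tendsto_const lim[OF that]], of "f x" "- 1"] by (simp add: d_def)
  have dae: "AE x in M11. (\<lambda>n. d n x) \<longlonglongrightarrow> 0" unfolding AE_M11_iff using dlim by (intro AE_I2) blast
  have dm: "d n \<in> borel_measurable M11" for n by (rule X_meas[OF dX])
  have d0: "(\<lambda>n. distrib_fun (d n) r) \<longlonglongrightarrow> 0" if "0 < r" for r by (rule distrib_fun_tendsto_0_of_ae[OF dm dae that])
  have dd: "distrib_fun (d n) r \<le> distrib_fun H r" if "0 \<le> r" for n r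
    by (rule distrib_fun_mono[OF X_meas[OF HX]]) (use dH in \<open>auto simp: AE_M11_iff\<close>)
  have c1_1: "fin_hilbert (d n) \<in> X" for n
    by (rule fin_hilbert_measure_continuity(1)[OF HX dm]) (use dd d0 in auto)
  have c1_2: "distrib_fun (fin_hilbert (d n)) r \<le> distrib_fun (\<lambda>x. complex_of_real (2560 * gser H x)) r" if "0 \<le> r" for n r
    by (rule fin_hilbert_measure_continuity(2)[OF HX dm _ _ that]) (use dd d0 in auto)
  have c1_3: "(\<lambda>n. distrib_fun (fin_hilbert (d n)) r) \<longlonglongrightarrow> 0" if "0 < r" for r
    by (rule fin_hilbert_measure_continuity(3)[OF HX dm _ _ that]) (use dd d0 in auto)
  \<comment> \<open>\<open>fin_hilbert (k n)\<close> is, up to sign and weight,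
    \<open>T_hat (fin_hilbert (d n))\<close>. The majorant for this second application of the
    transform is the one delivered by the first.\<close>
  define k where "k n = sqm (fin_hilbert (d n))" for n
  let ?\<phi> = "\<lambda>x. complex_of_real (2560 * gser H x)"
  have \<phi>: "?\<phi> \<in> X" using gser_scaled_X[OF HX] by blast
  have kX: "k n \<in> X" for n unfolding k_def by (intro sqm_X c1_1)
  have kle: "distrib_fun (k n) r \<le> distrib_fun (fin_hilbert (d n)) r" for n r
    unfolding k_def by (rule distrib_fun_mono[OF X_meas[OF c1_1]]) (use norm_sqm_le in \<open>auto simp: AE_M11_iff\<close>)
  have kd: "distrib_fun (k n) r \<le> distrib_fun ?\<phi> r" if "0 \<le> r" for n r
    using kle[of n r] c1_2[OF that, of n] by linarith
  have k0: "(\<lambda>n. distrib_fun (k n) r) \<longlonglongrightarrow> 0" if "0 < r" for r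
    by (rule tendsto_sandwich[OF always_eventually always_eventually tendsto_const c1_3[OF that]])
      (use kle distrib_fun_nonneg in auto)
  have c2_1: "fin_hilbert (k n) \<in> X" for n
    by (rule fin_hilbert_measure_continuity(1)[OF \<phi> X_meas[OF kX]]) (use kd k0 in auto)
  have c2_3: "(\<lambda>n. distrib_fun (fin_hilbert (k n)) r) \<longlonglongrightarrow> 0" if "0 < r" for r
    by (rule fin_hilbert_measure_continuity(3)[OF \<phi> X_meas[OF kX] _ _ that]) (use kd k0 in auto)
  define c where "c n = complex_of_real (1 / pi) * (LINT t|lborel. cut11 (d n) t)" for n
  have c0: "c \<longlonglongrightarrow> 0"
  proof -
    have "(\<lambda>n. LINT t|lborel. cut11 (d n) t) \<longlonglongrightarrow> (LINT t|(lborel::real measure). 0)"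
    proof (rule integral_dominated_convergence[where w = "\<lambda>t. cmod (cut11 H t)"])
      show "cut11 (d n) \<in> borel_measurable lborel" for n using X_int[OF dX[of n]] by auto
      show "integrable lborel (\<lambda>t. cmod (cut11 H t))" using X_int[OF HX] by simp
      show "AE t in lborel. (\<lambda>n. cut11 (d n) t) \<longlonglongrightarrow> 0"
        by (rule AE_I2) (use dlim in \<open>auto simp: cut11_def indicator_def\<close>)
      show "AE t in lborel. norm (cut11 (d n) t) \<le> cmod (cut11 H t)" for n
        by (rule AE_I2) (use dH in \<open>auto simp: cut11_def indicator_def\<close>)
    qed simp
    then have "(\<lambda>n. complex_of_real (1 / pi) * (LINT t|lborel. cut11 (d n) t)) \<longlonglongrightarrow> complex_of_real (1 / pi) * 0" by (intro tendsto_intros) simp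
    then show ?thesis by (simp add: c_def[abs_def])
  qed
  define E where "E = (\<lambda>x. (T_hat (fin_hilbert f) x + (- 1) * f x) + proj_P f x)"
  have PX: "proj_P f \<in> X" unfolding proj_P_eq by (rule X_cmult[OF wgt_X])
  have EX: "E \<in> X" unfolding E_def by (intro X_add X_cmult PX f T_hat_X fin_hilbert_X)
  have bound: "AE x in M11. cmod (sqm E x) \<le> cmod (fin_hilbert (k n) x) + (cmod (d n x) + cmod (c n))" for n
  proof -
    have f_eq: "f = (\<lambda>t. g n t + 1 * d n t)" by (auto simp: d_def)
    have "AE x in M11. T_hat (fin_hilbert f) x = T_hat (fin_hilbert (g n)) x + 1 * T_hat (fin_hilbert (d n)) x"
      using T_hat_fin_hilbert_lin[OF g[of n] dX[of n], of 1] f_eq by simp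
    then show ?thesis using ok[of n, unfolded inv_ok_def] AE_space
    proof eventually_elim
      case (elim x)
      have x: "x \<in> {-1<..<1}" using elim by simp
      let ?R = "complex_of_real (sqrt (1 - x\<^sup>2))"
      have P: "proj_P f x = proj_P (g n) x + proj_P (d n) x" using proj_P_lin[OF g[of n] dX[of n], of 1 x] f_eq by simp
      have "E x = T_hat (fin_hilbert (d n)) x - d n x + proj_P (d n) x"
        using elim unfolding E_def P by (simp add: d_def)
      also have "T_hat (fin_hilbert (d n)) x = - wgt x * fin_hilbert (k n) x" by (simp add: T_hat_eq k_def)
      also have "proj_P (d n) x = c n * wgt x" by (simp add: proj_P_eq c_def)
      finally have Ex: "E x = - wgt x * fin_hilbert (k n) x - d n x + c n * wgt x" .
      have "?R * E x = - ((?R * wgt x) * fin_hilbert (k n) x) - ?R * d n x + c n * (?R * wgt x)" unfolding Ex by algebra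
      then have "sqm E x = - fin_hilbert (k n) x - sqm (d n) x + c n" unfolding sqrt_times_wgt[OF x] by (simp add: sqm_def)
      then have "cmod (sqm E x) \<le> cmod (fin_hilbert (k n) x) + (cmod (sqm (d n) x) + cmod (c n))"
        using norm_triangle_ineq[of "- fin_hilbert (k n) x - sqm (d n) x" "c n"] norm_triangle_ineq4[of "- fin_hilbert (k n) x" "sqm (d n) x"]
        by (simp only: norm_minus_cancel)
      then show ?case using norm_sqm_le[OF x, of "d n"] by linarith
    qed
  qed
  have "AE x in M11. sqm E x = 0"
  proof (rule AE_eq_0_if_distrib_fun_0[OF X_meas[OF sqm_X[OF EX]]])
    fix r :: real assume r: "0 < r"
    have ev: "eventually (\<lambda>n. distrib_fun (sqm E) r \<le> distrib_fun (fin_hilbert (k n)) (r / 2) + distrib_fun (d n) (r / 4)) sequentially"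
    proof -
      have "eventually (\<lambda>n. cmod (c n) < r / 4) sequentially"
        using tendsto_norm[OF c0] r by (intro order_tendstoD(2)) auto
      then show ?thesis
      proof eventually_elim
        case (elim n)
        let ?q = "\<lambda>x. complex_of_real (cmod (d n x) + cmod (c n))"
        have qm: "?q \<in> borel_measurable M11" using dm[of n] by measurable
        have "AE x in M11. cmod (sqm E x) \<le> cmod (fin_hilbert (k n) x) + cmod (?q x)"
        proof -
          have "cmod (?q x) = cmod (d n x) + cmod (c n)" for x unfolding norm_of_real by (rule abs_of_nonneg) simp
          then show ?thesis using bound[of n] by simp
        qed
        then have "distrib_fun (sqm E) (r / 2 + r / 2) \<le> distrib_fun (fin_hilbert (k n)) (r / 2) + distrib_fun ?q (r / 2)"
          by (rule distrib_fun_sum[OF X_meas[OF c2_1] qm])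
        also have "distrib_fun ?q (r / 2) \<le> distrib_fun (d n) (r / 4)"
        proof -
          interpret finite_measure M11 by (rule finite_measure_M11)
          show ?thesis unfolding distrib_fun_def
          proof (rule finite_measure_mono[OF subsetI distrib_set[OF dm]])
            fix x assume x: "x \<in> {x \<in> space M11. r / 2 < cmod (?q x)}"
            have "cmod (?q x) = cmod (d n x) + cmod (c n)" unfolding norm_of_real by (rule abs_of_nonneg) simp
            then have "r / 4 < cmod (d n x)" using x elim by simp
            then show "x \<in> {x \<in> space M11. r / 4 < cmod (d n x)}" using x by simp
          qed
        qed
        finally show ?case by simp
      qed
    qed
    have "(\<lambda>n. distrib_fun (fin_hilbert (k n)) (r / 2) + distrib_fun (d n) (r / 4)) \<longlonglongrightarrow> 0 + 0"
      using r by (intro tendsto_add c2_3 d0) auto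
    then have "distrib_fun (sqm E) r \<le> 0 + 0" by (rule tendsto_lowerbound[OF _ ev]) simp
    then show "distrib_fun (sqm E) r \<le> 0" by simp
  qed
  then show "inv_ok f" unfolding inv_ok_def using AE_space
  proof eventually_elim
    case (elim x)
    have x: "x \<in> {-1<..<1}" using elim by simp
    have "wgt x * sqm E x = (complex_of_real (sqrt (1 - x\<^sup>2)) * wgt x) * E x" by (simp add: sqm_def mult_ac)
    then have "E x = 0" using elim(1) sqrt_times_wgt[OF x] by simp
    then show ?case unfolding E_def by (simp add: algebra_simps add_eq_0_iff)
  qed
qed

end

section \<open>The inversion formula for Chebyshev functions\<close>

lemma fin_hilbert_wgt_cos:
  fixes n :: nat
  assumes x: "x \<in> {-1<..<1}"
  shows "fin_hilbert (\<lambda>t. wgt t * complex_of_real (cos (n * arccos t))) x = complex_of_real (rw x * sin (n * arccos x))"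
proof -
  have eq: "cut11 (\<lambda>t. wgt t * complex_of_real (cos (n * arccos t))) = chw n"
    by (intro ext) (auto simp: cut11_def chw_def indicator_def wgt_eq_rw rw_def)
  have "has_pv (cut11 (\<lambda>t. wgt t * complex_of_real (cos (n * arccos t)))) x (complex_of_real (pi * (rw x * sin (n * arccos x))))"
    unfolding eq by (rule has_pv_chw) (use x in auto)
  then have "fin_hilbert (\<lambda>t. wgt t * complex_of_real (cos (n * arccos t))) x = complex_of_real (pi * (rw x * sin (n * arccos x))) / pi"
    using x by (intro has_pv_imp_fin_hilbert) auto
  then show ?thesis by simp
qed

lemma rw_sqrt: "x \<in> {-1<..<1} \<Longrightarrow> rw x * sqrt (1 - x\<^sup>2) = 1"
  using one_minus_sq_pos[of x] by (auto simp: rw_def)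

text \<open>With t = cos a, the sine is half the difference of cos (n a) and cos ((n + 2) a),
  divided by sin a = sqrt (1 - t^2); this reduces the claim to \<open>has_pv_chw\<close>.
  Classically, sqrt (1 - t^2) U_n is sent to - T_(n+1).\<close>

lemma fin_hilbert_sin:
  assumes x: "x \<in> {-1<..<1}"
  shows "fin_hilbert (\<lambda>t. complex_of_real (sin (Suc n * arccos t))) x = - complex_of_real (cos (Suc n * arccos x))"
proof -
  have tri: "sin (Suc n * a) * sin a = 1 / 2 * cos (n * a) - 1 / 2 * cos (Suc (Suc n) * a)" for a :: real
    using cos_add[of "Suc n * a" a] cos_diff[of "Suc n * a" a] by (simp add: algebra_simps)
  have tri': "1 / 2 * sin (n * a) - 1 / 2 * sin (Suc (Suc n) * a) = - cos (Suc n * a) * sin a" for a :: real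
    using sin_add[of "Suc n * a" a] sin_diff[of "Suc n * a" a] by (simp add: algebra_simps)
  have eq: "cut11 (\<lambda>t. complex_of_real (sin (Suc n * arccos t))) = (\<lambda>t. (1 / 2) * chw n t + (- 1 / 2) * chw (Suc (Suc n)) t)"
  proof
    fix t show "cut11 (\<lambda>t. complex_of_real (sin (Suc n * arccos t))) t = (1 / 2) * chw n t + (- 1 / 2) * chw (Suc (Suc n)) t"
    proof (cases "t \<in> {-1<..<1}")
      case True
      have "sin (arccos t) = sqrt (1 - t\<^sup>2)" using True by (simp add: sin_arccos)
      then have "sin (Suc n * arccos t) = rw t * (sin (Suc n * arccos t) * sin (arccos t))"
        using rw_sqrt[OF True] by (metis mult.left_commute mult.right_neutral)
      also have "\<dots> = 1 / 2 * (rw t * cos (n * arccos t)) + (- 1 / 2) * (rw t * cos (Suc (Suc n) * arccos t))"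
        unfolding tri by algebra
      finally have "complex_of_real (sin (Suc n * arccos t)) = complex_of_real (1 / 2 * (rw t * cos (n * arccos t)) + (- 1 / 2) * (rw t * cos (Suc (Suc n) * arccos t)))"
        by (simp only:)
      then show ?thesis using True by (simp add: chw_def del: of_nat_Suc)
    qed (simp add: cut11_def chw_def rw_def)
  qed
  have "has_pv (\<lambda>t. (1 / 2) * chw n t + (- 1 / 2) * chw (Suc (Suc n)) t) x
    ((1 / 2) * complex_of_real (pi * (rw x * sin (n * arccos x))) + (- 1 / 2) * complex_of_real (pi * (rw x * sin (Suc (Suc n) * arccos x))))"
    using x by (intro has_pv_add has_pv_cmult integrable_mult_right integrable_chw has_pv_chw) auto
  moreover have "(1 / 2) * complex_of_real (pi * (rw x * sin (n * arccos x))) + (- 1 / 2) * complex_of_real (pi * (rw x * sin (Suc (Suc n) * arccos x)))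
    = complex_of_real (- (pi * cos (Suc n * arccos x)))"
  proof -
    have "1 / 2 * (pi * (rw x * sin (n * arccos x))) + (- 1 / 2) * (pi * (rw x * sin (Suc (Suc n) * arccos x)))
      = pi * rw x * (1 / 2 * sin (n * arccos x) - 1 / 2 * sin (Suc (Suc n) * arccos x))" by algebra
    also have "\<dots> = - (pi * cos (Suc n * arccos x)) * (rw x * sin (arccos x))" unfolding tri' by algebra
    also have "rw x * sin (arccos x) = 1" using x rw_sqrt[OF x] by (simp add: sin_arccos)
    finally have "1 / 2 * (pi * (rw x * sin (n * arccos x))) + (- 1 / 2) * (pi * (rw x * sin (Suc (Suc n) * arccos x))) = - (pi * cos (Suc n * arccos x))" by simp
    from arg_cong[OF this, of complex_of_real] show ?thesis by (simp del: of_nat_Suc)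
  qed
  ultimately have "has_pv (cut11 (\<lambda>t. complex_of_real (sin (Suc n * arccos t)))) x (complex_of_real (- (pi * cos (Suc n * arccos x))))"
    unfolding eq by (simp only:)
  then have "fin_hilbert (\<lambda>t. complex_of_real (sin (Suc n * arccos t))) x = complex_of_real (- (pi * cos (Suc n * arccos x))) / pi"
    using x by (intro has_pv_imp_fin_hilbert) auto
  then show ?thesis by (simp del: of_nat_Suc)
qed

lemma fin_hilbert_cong: "(\<And>x. x \<in> {-1<..<1} \<Longrightarrow> f x = g x) \<Longrightarrow> x \<in> {-1<..<1} \<Longrightarrow> fin_hilbert f x = fin_hilbert g x"
  using cut11_cong[of f g] by (simp add: fin_hilbert_eq_Lim)

lemma T_hat_cong: "(\<And>x. x \<in> {-1<..<1} \<Longrightarrow> f x = g x) \<Longrightarrow> x \<in> {-1<..<1} \<Longrightarrow> T_hat f x = T_hat g x"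
  unfolding T_hat_eq using fin_hilbert_cong[of "sqm f" "sqm g" x] by (simp add: sqm_def)

lemma fin_hilbert_0: "x \<in> {-1<..<1} \<Longrightarrow> fin_hilbert (\<lambda>_. 0) x = 0"
  using has_pv_imp_fin_hilbert[of x "\<lambda>_. 0" 0] by (simp add: has_pv_def tru_def cut11_def)

text \<open>For n = 0 the function is the weight, which \<open>T\<close> annihilates and
  \<open>proj_P\<close> fixes; for n > 0 the mean vanishes and the cosine and sine formulas undo
  each other.\<close>

lemma T_hat_fin_hilbert_wgt_cos:
  fixes n :: nat
  assumes x: "x \<in> {-1<..<1}"
  shows "T_hat (fin_hilbert (\<lambda>t. wgt t * complex_of_real (cos (n * arccos t)))) x =
    wgt x * complex_of_real (cos (n * arccos x)) - proj_P (\<lambda>t. wgt t * complex_of_real (cos (n * arccos t))) x"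
proof -
  have c: "cut11 (\<lambda>t. wgt t * complex_of_real (cos (n * arccos t))) = chw n"
    by (intro ext) (auto simp: cut11_def chw_def indicator_def wgt_eq_rw rw_def)
  have P: "proj_P (\<lambda>t. wgt t * complex_of_real (cos (n * arccos t))) x = (if n = 0 then wgt x else 0)"
    unfolding proj_P_def set_integral_cut11 c integral_chw by simp
  have "T_hat (fin_hilbert (\<lambda>t. wgt t * complex_of_real (cos (n * arccos t)))) x = T_hat (\<lambda>t. complex_of_real (rw t * sin (n * arccos t))) x"
    by (rule T_hat_cong[OF fin_hilbert_wgt_cos x])
  also have "\<dots> = - wgt x * fin_hilbert (\<lambda>t. complex_of_real (sin (n * arccos t))) x"
  proof -
    have "sqm (\<lambda>t. complex_of_real (rw t * sin (n * arccos t))) t = complex_of_real (sin (n * arccos t))" if t: "t \<in> {-1<..<1}" for t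
    proof -
      have "sqrt (1 - t\<^sup>2) * (rw t * sin (n * arccos t)) = sin (n * arccos t)" using rw_sqrt[OF t] by algebra
      from arg_cong[OF this, of complex_of_real] show ?thesis by (simp add: sqm_def)
    qed
    then have "fin_hilbert (sqm (\<lambda>t. complex_of_real (rw t * sin (n * arccos t)))) x = fin_hilbert (\<lambda>t. complex_of_real (sin (n * arccos t))) x"
      by (rule fin_hilbert_cong[OF _ x])
    then show ?thesis unfolding T_hat_eq by (rule arg_cong)
  qed
  finally have T': "T_hat (fin_hilbert (\<lambda>t. wgt t * complex_of_real (cos (n * arccos t)))) x = - wgt x * fin_hilbert (\<lambda>t. complex_of_real (sin (n * arccos t))) x" .
  show ?thesis
  proof (cases n)
    case 0
    then show ?thesis unfolding T' P using fin_hilbert_0[OF x] by simp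
  next
    case (Suc k)
    show ?thesis unfolding T' P unfolding Suc fin_hilbert_sin[OF x] by (simp del: of_nat_Suc)
  qed
qed

text \<open>For integrable g, n times the measure of {|g| > n} tends to 0. On an interval of length
  d = |A| / (n + 1) the hypothesis gives |g| > n + 1, so this product would stay at least
  |A|.\<close>

lemma reciprocal_not_integrable:
  fixes A :: complex
  assumes g: "g \<in> borel_measurable M11" and i: "integrable lborel (cut11 g)"
    and lb: "\<And>d. 0 < d \<Longrightarrow> d < 1 \<Longrightarrow> \<exists>a. {a<..<a + d} \<subseteq> {-1<..<1} \<and> (\<forall>x \<in> {a<..<a + d}. cmod A < d * cmod (g x))"
  shows "A = 0"
proof (rule ccontr)
  assume "A \<noteq> 0"
  then have A: "0 < cmod A" by simp
  define B where "B n = {x. cmod (cut11 g x) > real (Suc n)}" for n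
  have [measurable]: "cut11 g \<in> borel_measurable borel" using i by auto
  have Bm [measurable]: "B n \<in> sets borel" for n unfolding B_def by measurable
  have "(\<lambda>n. LINT x|lborel. real (Suc n) * indicator (B n) x) \<longlonglongrightarrow> (LINT x|(lborel::real measure). 0)"
  proof (rule integral_dominated_convergence[where w = "\<lambda>x. cmod (cut11 g x)"])
    show "AE x in lborel. (\<lambda>n. real (Suc n) * indicator (B n) x) \<longlonglongrightarrow> 0"
    proof (rule AE_I2)
      fix x
      obtain N :: nat where N: "cmod (cut11 g x) \<le> real N" using real_arch_simple by blast
      have "eventually (\<lambda>n. real (Suc n) * indicator (B n) x = 0) sequentially"
        using eventually_ge_at_top[of N] by eventually_elim (use N in \<open>auto simp: B_def indicator_def\<close>)
      then show "(\<lambda>n. real (Suc n) * indicator (B n) x) \<longlonglongrightarrow> 0" by (rule tendsto_eventually)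
    qed
    show "AE x in lborel. norm (real (Suc n) * indicator (B n) x) \<le> cmod (cut11 g x)" for n
      by (rule AE_I2) (auto simp: B_def indicator_def)
  qed (use i in auto)
  then have lim: "(\<lambda>n. LINT x|lborel. real (Suc n) * indicator (B n) x) \<longlonglongrightarrow> 0" by simp
  have "eventually (\<lambda>n. cmod A \<le> (LINT x|lborel. real (Suc n) * indicator (B n) x)) sequentially"
  proof -
    have "eventually (\<lambda>n. cmod A < real (Suc n)) sequentially"
    proof -
      obtain N :: nat where N: "cmod A < real N" using reals_Archimedean2 by blast
      show ?thesis using eventually_ge_at_top[of N] by eventually_elim (use N in auto)
    qed
    then show ?thesis
    proof eventually_elim
      case (elim n)
      define d where "d = cmod A / real (Suc n)"
      have d: "0 < d" "d < 1" using A elim by (auto simp: d_def)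
      obtain a where a: "{a<..<a + d} \<subseteq> {-1<..<1}" "\<And>x. x \<in> {a<..<a + d} \<Longrightarrow> cmod A < d * cmod (g x)" using lb[OF d] by blast
      have sub: "{a<..<a + d} \<subseteq> B n"
      proof
        fix x assume x: "x \<in> {a<..<a + d}"
        have "cmod A < cmod A / real (Suc n) * cmod (g x)" using a(2)[OF x] by (simp add: d_def)
        then have "cmod A * real (Suc n) < cmod A * cmod (g x)" by (simp add: field_simps del: of_nat_Suc)
        then have "real (Suc n) < cmod (g x)" using A by simp
        then show "x \<in> B n" using a(1) x by (auto simp: B_def cut11_def)
      qed
      have fin: "emeasure lborel (B n) < \<infinity>"
      proof -
        have "B n \<subseteq> {-1..1}" by (auto simp: B_def cut11_def indicator_def split: if_splits)
        then have "emeasure lborel (B n) \<le> emeasure lborel {-1..1::real}" by (intro emeasure_mono) auto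
        then show ?thesis by (rule le_less_trans) simp
      qed
      have "d = measure lborel {a<..<a + d}" using d by simp
      also have "\<dots> \<le> measure lborel (B n)"
        unfolding measure_def using sub fin by (intro enn2real_mono emeasure_mono) auto
      finally have "real (Suc n) * d \<le> real (Suc n) * measure lborel (B n)" by (intro mult_left_mono) auto
      moreover have "real (Suc n) * d = cmod A" by (simp add: d_def del: of_nat_Suc)
      moreover have "(LINT x|lborel. real (Suc n) * indicator (B n) x) = real (Suc n) * measure lborel (B n)"
        using fin Bm by simp
      ultimately show ?case by linarith
    qed
  qed
  from tendsto_lowerbound[OF lim this] A show False by simp
qed

lemma reciprocal_right:
  assumes i: "integrable lborel (cut11 (\<lambda>x. A / complex_of_real (1 - x)))" shows "A = 0"
proof (rule ccontr)
  assume A: "A \<noteq> 0"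
  have "A = 0"
  proof (rule reciprocal_not_integrable[OF cut11_meas[OF i] i])
    fix d :: real assume d: "0 < d" "d < 1"
    show "\<exists>a. {a<..<a + d} \<subseteq> {-1<..<1} \<and> (\<forall>x \<in> {a<..<a + d}. cmod A < d * cmod (A / complex_of_real (1 - x)))"
    proof (intro exI[of _ "1 - d"] conjI ballI)
      fix x assume "x \<in> {1 - d<..<1 - d + d}"
      then have x: "0 < 1 - x" "1 - x < d" by auto
      have "cmod (A / complex_of_real (1 - x)) = cmod A / (1 - x)" using x unfolding norm_divide norm_of_real by simp
      moreover have "cmod A < d * (cmod A / (1 - x))"
      proof -
        have "(1 - x) * cmod A < d * cmod A" using x A by (intro mult_strict_right_mono) auto
        then show ?thesis using x by (simp add: less_divide_eq mult.commute)
      qed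
      ultimately show "cmod A < d * cmod (A / complex_of_real (1 - x))" by simp
    qed (use d in auto)
  qed
  then show False using A by simp
qed

lemma reciprocal_left:
  assumes i: "integrable lborel (cut11 (\<lambda>x. A / complex_of_real (1 + x)))" shows "A = 0"
proof (rule ccontr)
  assume A: "A \<noteq> 0"
  have "A = 0"
  proof (rule reciprocal_not_integrable[OF cut11_meas[OF i] i])
    fix d :: real assume d: "0 < d" "d < 1"
    show "\<exists>a. {a<..<a + d} \<subseteq> {-1<..<1} \<and> (\<forall>x \<in> {a<..<a + d}. cmod A < d * cmod (A / complex_of_real (1 + x)))"
    proof (intro exI[of _ "- 1"] conjI ballI)
      fix x assume "x \<in> {- 1<..<- 1 + d}"
      then have x: "0 < 1 + x" "1 + x < d" by auto
      have "cmod (A / complex_of_real (1 + x)) = cmod A / (1 + x)" using x unfolding norm_divide norm_of_real by simp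
      moreover have "cmod A < d * (cmod A / (1 + x))"
      proof -
        have "(1 + x) * cmod A < d * cmod A" using x A by (intro mult_strict_right_mono) auto
        then show ?thesis using x by (simp add: less_divide_eq mult.commute)
      qed
      ultimately show "cmod A < d * cmod (A / complex_of_real (1 + x))" by simp
    qed (use d in auto)
  qed
  then show False using A by simp
qed

text \<open>Partial fractions at the two poles: (1 + x) k + c equals (c + d) / (1 - x), and (1 - x)
  k - c equals (d - c) / (1 + x). Both left sides are integrable, so both numerators vanish.\<close>

lemma affine_over_weight_sq_integrable:
  assumes k: "integrable lborel (cut11 k)"
    and eq: "AE x in M11. complex_of_real (1 - x\<^sup>2) * k x = c * complex_of_real x + d"
  shows "c = 0 \<and> d = 0"
proof -
  have km: "k \<in> borel_measurable M11" by (rule cut11_meas[OF k])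
  have one: "integrable lborel (cut11 (\<lambda>_. a))" for a
    unfolding cut11_def[abs_def] by (intro integrable_scaleR_left integrable_real_indicator) auto
  have r: "integrable lborel (cut11 (\<lambda>x. (c + d) / complex_of_real (1 - x)))"
  proof -
    have i: "integrable lborel (cut11 (\<lambda>x. complex_of_real (1 + x) * k x))"
    proof (rule integrable_cut_bound[OF k, of _ 2])
      have [measurable]: "(\<lambda>x. complex_of_real (1 + x)) \<in> borel_measurable M11" by (rule borel_measurable_M11) measurable
      note km [measurable]
      show "(\<lambda>x. complex_of_real (1 + x) * k x) \<in> borel_measurable M11" by measurable
      fix x :: real assume x: "x \<in> {-1<..<1}"
      have "cmod (complex_of_real (1 + x) * k x) = \<bar>1 + x\<bar> * cmod (k x)" by (simp only: norm_mult norm_of_real)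
      also have "\<dots> \<le> 2 * cmod (k x)" using x by (intro mult_right_mono) auto
      finally show "cmod (complex_of_real (1 + x) * k x) \<le> 2 * cmod (k x)" .
    qed
    have j: "integrable lborel (\<lambda>x. cut11 (\<lambda>x. complex_of_real (1 + x) * k x) x + cut11 (\<lambda>_. c) x)"
      by (rule Bochner_Integration.integrable_add[OF i one])
    show ?thesis
    proof (rule integrable_cong_AE_imp[OF j])
      have "(\<lambda>x. (c + d) / complex_of_real (1 - x)) \<in> borel_measurable M11"
        by (rule borel_measurable_M11) measurable
      then show "cut11 (\<lambda>x. (c + d) / complex_of_real (1 - x)) \<in> borel_measurable lborel" by (simp add: borel_measurable_cut11)
      show "AE x in lborel. cut11 (\<lambda>x. complex_of_real (1 + x) * k x) x + cut11 (\<lambda>_. c) x = cut11 (\<lambda>x. (c + d) / complex_of_real (1 - x)) x"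
        using eq unfolding AE_M11_iff
      proof eventually_elim
        case (elim x)
        show ?case
        proof (cases "x \<in> {-1<..<1}")
          case True
          have nz: "complex_of_real (1 - x) \<noteq> 0" using True by (simp only: of_real_eq_0_iff) simp
          have "complex_of_real (1 - x\<^sup>2) = complex_of_real (1 - x) * complex_of_real (1 + x)"
            by (simp add: power2_eq_square algebra_simps)
          then have "complex_of_real (1 - x) * (complex_of_real (1 + x) * k x) = c * complex_of_real x + d" using elim True by (simp add: mult.assoc)
          then have "complex_of_real (1 - x) * (complex_of_real (1 + x) * k x + c) = c + d" by (simp add: algebra_simps)
          then have "complex_of_real (1 + x) * k x + c = (c + d) / complex_of_real (1 - x)" using nz by (simp add: field_simps)
          then show ?thesis using True by simp
        qed (simp add: cut11_def)
      qed
    qed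
  qed
  have l: "integrable lborel (cut11 (\<lambda>x. (d - c) / complex_of_real (1 + x)))"
  proof -
    have i: "integrable lborel (cut11 (\<lambda>x. complex_of_real (1 - x) * k x))"
    proof (rule integrable_cut_bound[OF k, of _ 2])
      have [measurable]: "(\<lambda>x. complex_of_real (1 - x)) \<in> borel_measurable M11" by (rule borel_measurable_M11) measurable
      note km [measurable]
      show "(\<lambda>x. complex_of_real (1 - x) * k x) \<in> borel_measurable M11" by measurable
      fix x :: real assume x: "x \<in> {-1<..<1}"
      have "cmod (complex_of_real (1 - x) * k x) = \<bar>1 - x\<bar> * cmod (k x)" by (simp only: norm_mult norm_of_real)
      also have "\<dots> \<le> 2 * cmod (k x)" using x by (intro mult_right_mono) auto
      finally show "cmod (complex_of_real (1 - x) * k x) \<le> 2 * cmod (k x)" .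
    qed
    have j: "integrable lborel (\<lambda>x. cut11 (\<lambda>x. complex_of_real (1 - x) * k x) x + cut11 (\<lambda>_. - c) x)"
      by (rule Bochner_Integration.integrable_add[OF i one])
    show ?thesis
    proof (rule integrable_cong_AE_imp[OF j])
      have "(\<lambda>x. (d - c) / complex_of_real (1 + x)) \<in> borel_measurable M11"
        by (rule borel_measurable_M11) measurable
      then show "cut11 (\<lambda>x. (d - c) / complex_of_real (1 + x)) \<in> borel_measurable lborel" by (simp add: borel_measurable_cut11)
      show "AE x in lborel. cut11 (\<lambda>x. complex_of_real (1 - x) * k x) x + cut11 (\<lambda>_. - c) x = cut11 (\<lambda>x. (d - c) / complex_of_real (1 + x)) x"
        using eq unfolding AE_M11_iff
      proof eventually_elim
        case (elim x)
        show ?case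
        proof (cases "x \<in> {-1<..<1}")
          case True
          have nz: "complex_of_real (1 + x) \<noteq> 0" using True by (simp only: of_real_eq_0_iff) simp
          have "complex_of_real (1 - x\<^sup>2) = complex_of_real (1 + x) * complex_of_real (1 - x)"
            by (simp add: power2_eq_square algebra_simps)
          then have "complex_of_real (1 + x) * (complex_of_real (1 - x) * k x) = c * complex_of_real x + d" using elim True by (simp add: mult.assoc)
          then have "complex_of_real (1 + x) * (complex_of_real (1 - x) * k x + - c) = d - c" by (simp add: algebra_simps)
          then have "complex_of_real (1 - x) * k x + - c = (d - c) / complex_of_real (1 + x)" using nz by (simp add: field_simps)
          then show ?thesis using True by simp
        qed (simp add: cut11_def)
      qed
    qed
  qed
  have "c + d = 0" "d - c = 0" using reciprocal_right[OF r] reciprocal_left[OF l] by auto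
  then have "d = c" by simp
  with \<open>c + d = 0\<close> have "2 * c = 0" by simp
  then show ?thesis using \<open>d = c\<close> by simp
qed

section \<open>The left inversion formula on the whole space and its consequence for the right
  inverse\<close>

context boyd_space
begin

lemma inv_ok_cong:
  assumes f: "inv_ok f" and eq: "\<And>x. x \<in> {-1<..<1} \<Longrightarrow> f x = g x"
  shows "inv_ok g"
  using f AE_space unfolding inv_ok_def
proof eventually_elim
  case (elim x)
  have x: "x \<in> {-1<..<1}" using elim by simp
  have "T_hat (fin_hilbert f) x = T_hat (fin_hilbert g) x" by (rule T_hat_cong[OF fin_hilbert_cong[OF eq] x])
  moreover have "proj_P f x = proj_P g x" using cut11_cong[OF eq] by (simp add: proj_P_eq)
  ultimately show ?case using elim(1) eq[OF x] by simp
qed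

lemma inv_ok_cmult:
  assumes "f \<in> X" "inv_ok f" shows "inv_ok (\<lambda>t. c * f t)"
  by (rule inv_ok_cong[OF inv_ok_lin[OF assms assms, of "c - 1"]]) (simp add: algebra_simps)

lemma wgt_mult_X:
  assumes p: "continuous_on {-1<..<1} p" and le: "\<And>x. x \<in> {-1<..<1} \<Longrightarrow> \<bar>p x\<bar> \<le> 1"
  shows "(\<lambda>t. wgt t * complex_of_real (p t)) \<in> X"
proof (rule X_solid[OF wgt_X, where K = 1])
  have "(\<lambda>t. complex_of_real (p t)) \<in> borel_measurable M11"
    by (rule borel_measurable_M11_cont) (intro continuous_intros p)
  with borel_measurable_wgt show "(\<lambda>t. wgt t * complex_of_real (p t)) \<in> borel_measurable M11" by (rule borel_measurable_times)
  fix x :: real assume x: "x \<in> {-1<..<1}"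
  have "cmod (wgt x * complex_of_real (p x)) = \<bar>p x\<bar> * cmod (wgt x)" by (simp add: norm_mult)
  also have "\<dots> \<le> 1 * cmod (wgt x)" by (rule mult_right_mono[OF le[OF x]]) simp
  finally show "cmod (wgt x * complex_of_real (p x)) \<le> 1 * cmod (wgt x)" .
qed

lemma wgt_power_cos_X: "(\<lambda>t. wgt t * complex_of_real (t ^ n * cos (real m * arccos t))) \<in> X"
proof (rule wgt_mult_X)
  show "continuous_on {-1<..<1} (\<lambda>t. t ^ n * cos (real m * arccos t))"
    by (intro continuous_intros continuous_on_subset[OF continuous_on_arccos']) auto
  fix x :: real assume "x \<in> {-1<..<1}"
  then have "\<bar>x ^ n\<bar> \<le> 1" unfolding power_abs by (intro power_le_one) auto
  moreover have "\<bar>cos (real m * arccos x)\<bar> \<le> 1" by (rule abs_cos_le_one)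
  ultimately have "\<bar>x ^ n\<bar> * \<bar>cos (real m * arccos x)\<bar> \<le> 1 * 1" by (intro mult_mono) auto
  then show "\<bar>x ^ n * cos (real m * arccos x)\<bar> \<le> 1" by (simp add: abs_mult)
qed

text \<open>The frequency \<open>m\<close> is carried along for the induction on the power: a factor
  t = cos a turns cos (m a) into the mean of its two neighbours, and for m = 0 into cos a.\<close>

lemma inv_ok_wgt_power_cos: "inv_ok (\<lambda>t. wgt t * complex_of_real (t ^ n * cos (real m * arccos t)))"
proof (induction n arbitrary: m)
  case 0
  show ?case unfolding inv_ok_def power_0 mult_1 using AE_space
    by eventually_elim (rule T_hat_fin_hilbert_wgt_cos, simp)
next
  case (Suc n)
  show ?case
  proof (cases m)
    case 0
    show ?thesis
      by (rule inv_ok_cong[OF Suc[of 1]]) (simp add: 0 mult.commute)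
  next
    case (Suc k)
    let ?f = "\<lambda>m t. wgt t * complex_of_real (t ^ n * cos (real m * arccos t))"
    have "inv_ok (\<lambda>t. ?f (Suc (Suc k)) t + 1 * ?f k t)"
      by (rule inv_ok_lin[OF wgt_power_cos_X Suc.IH wgt_power_cos_X Suc.IH])
    from inv_ok_cmult[OF X_add[OF wgt_power_cos_X X_cmult[OF wgt_power_cos_X]] this, of "1 / 2"]
    show ?thesis
    proof (rule inv_ok_cong)
      fix t :: real assume t: "t \<in> {-1<..<1}"
      have ct: "cos (arccos t) = t" using t by simp
      have "cos (real (Suc (Suc k)) * arccos t) + cos (real k * arccos t) = 2 * (t * cos (real m * arccos t))"
        using cos_step[of k "arccos t"] unfolding ct by (simp add: \<open>m = Suc k\<close> algebra_simps)
      then have "t ^ n * cos (real (Suc (Suc k)) * arccos t) + t ^ n * cos (real k * arccos t) = 2 * (t ^ Suc n * cos (real m * arccos t))"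
        unfolding distrib_left[symmetric] by simp
      from arg_cong[OF this, of complex_of_real]
      have "complex_of_real (t ^ n * cos (real (Suc (Suc k)) * arccos t)) + complex_of_real (t ^ n * cos (real k * arccos t)) = 2 * complex_of_real (t ^ Suc n * cos (real m * arccos t))"
        by (simp only: of_real_add of_real_mult of_real_numeral)
      then have "?f (Suc (Suc k)) t + ?f k t = 2 * (wgt t * complex_of_real (t ^ Suc n * cos (real m * arccos t)))"
        unfolding distrib_left[symmetric] by simp
      then show "1 / 2 * (?f (Suc (Suc k)) t + 1 * ?f k t) = wgt t * complex_of_real (t ^ Suc n * cos (real m * arccos t))"
        by simp
    qed
  qed
qed

theorem T_hat_fin_hilbert:
  assumes "f \<in> X" shows "AE x in M11. T_hat (fin_hilbert f) x = f x - proj_P f x"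
proof -
  have "inv_ok f"
  proof (rule dominated_function_induct[where Y = X])
    fix n
    let ?f = "\<lambda>n t. wgt t * complex_of_real (t ^ n * cos (real 0 * arccos t))"
    \<comment> \<open>At frequency 0 the cosine is 1, and sqrt (1 - t^2) = (1 - t^2) / sqrt (1 -
      t^2) makes the base function a difference of two weighted powers.\<close>
    have "inv_ok (\<lambda>t. ?f n t + (- 1) * ?f (n + 2) t)"
      by (intro inv_ok_lin wgt_power_cos_X inv_ok_wgt_power_cos)
    then show "inv_ok (\<lambda>t. complex_of_real (sqrt (1 - t\<^sup>2) * t ^ n))"
    proof (rule inv_ok_cong)
      fix t :: real assume t: "t \<in> {-1<..<1}"
      have "rw t * (1 - t\<^sup>2) = (rw t * sqrt (1 - t\<^sup>2)) * sqrt (1 - t\<^sup>2)" using less_imp_le[OF one_minus_sq_pos[of t]] t by simp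
      then have R: "rw t * (1 - t\<^sup>2) = sqrt (1 - t\<^sup>2)" unfolding rw_sqrt[OF t] by simp
      have "rw t * t ^ n + (- 1) * (rw t * t ^ (n + 2)) = rw t * (1 - t\<^sup>2) * t ^ n"
        by (simp add: algebra_simps power2_eq_square)
      then have "rw t * t ^ n + (- 1) * (rw t * t ^ (n + 2)) = sqrt (1 - t\<^sup>2) * t ^ n" unfolding R .
      from arg_cong[OF this, of complex_of_real]
      show "?f n t + (- 1) * ?f (n + 2) t = complex_of_real (sqrt (1 - t\<^sup>2) * t ^ n)"
        unfolding wgt_eq_rw[OF t] by simp
    qed
  next
    fix f g assume fg: "f \<in> X" "g \<in> X" "inv_ok f" "inv_ok g"
    show "inv_ok (\<lambda>x. f x + g x)" using inv_ok_lin[OF fg(1,3,2,4), of 1] by simp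
  next
    fix g f h assume a: "\<And>n::nat. g n \<in> X" "\<And>n. inv_ok (g n)" "f \<in> X" "h \<in> X"
      "\<And>n x. x \<in> {-1<..<1} \<Longrightarrow> cmod (g n x) \<le> cmod (h x)" "\<And>x. x \<in> {-1<..<1} \<Longrightarrow> (\<lambda>n. g n x) \<longlonglongrightarrow> f x"
    show "inv_ok f" by (rule inv_ok_limit[OF a])
  qed (fact X_meas X_solid X_add X_one inv_ok_cmult assms)+
  then show ?thesis by (simp only: inv_ok_def)
qed

lemma fin_hilbert_wgt: "AE x in M11. fin_hilbert (\<lambda>t. c * wgt t) x = 0"
  using fin_hilbert_cmult_ae[OF X_int[OF wgt_X], of c] AE_space
proof eventually_elim
  case (elim x)
  then show ?case using fin_hilbert_wgt_cos[of x 0] by simp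
qed

text \<open>Applying the left inversion formula to a function with vanishing transform leaves f = P
  f, a multiple of the weight.\<close>

lemma fin_hilbert_kernel:
  assumes f: "f \<in> X" and z: "AE x in M11. fin_hilbert f x = 0"
  shows "AE x in M11. f x = complex_of_real (1 / pi) * (LINT t|lborel. cut11 f t) * wgt x"
  using T_hat_fin_hilbert[OF f] AE_space
proof eventually_elim
  case (elim x)
  have x: "x \<in> {-1<..<1}" using elim by simp
  have "T_hat (fin_hilbert f) x = T_hat (\<lambda>_. 0) x"
    by (rule T_hat_cong_ae[OF X_meas[OF fin_hilbert_X[OF f]] _ z x]) simp
  also have "\<dots> = 0" using fin_hilbert_0[OF x] by (simp add: T_hat_def)
  finally show ?case using elim(1) by (simp add: proj_P_eq)
qed

lemma integral_cut11_wgt: "(LINT t|lborel. cut11 (\<lambda>x. c * wgt x) t) = c * complex_of_real pi"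
proof -
  have "cut11 wgt = chw 0" by (intro ext) (auto simp: cut11_def chw_def indicator_def wgt_eq_rw rw_def)
  then show ?thesis using integral_chw[of 0] by (simp add: cut11_cmult)
qed

text \<open>If \<open>k\<close> is the error \<open>T (T_hat f) - f\<close>, then \<open>T_hat k\<close> is a multiple of the weight by the
  left inversion formula, so that \<open>(1 - x\<^sup>2) k\<close> is affine in \<open>x\<close>; no non-zero affine function
  divided by \<open>1 - x\<^sup>2\<close> is integrable.\<close>

lemma T_hat_right_inverse_and_mean:
  assumes f: "f \<in> X"
  shows "(AE x in M11. fin_hilbert (T_hat f) x = f x) \<and> (LINT t|lborel. cut11 (T_hat f) t) = 0"
proof -
  define g where "g = T_hat f"
  have g: "g \<in> X" unfolding g_def by (rule T_hat_X[OF f])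
  have Tg: "fin_hilbert g \<in> X" by (rule fin_hilbert_X[OF g])
  define c where "c = complex_of_real (1 / pi) * (LINT t|lborel. cut11 g t)"
  define k where "k = (\<lambda>x. fin_hilbert g x + (- 1) * f x)"
  have k: "k \<in> X" unfolding k_def by (intro X_add X_cmult Tg f)
  define w where "w = (\<lambda>t. wgt t * complex_of_real (cos (real 1 * arccos t)))"
  have w: "w \<in> X" using wgt_power_cos_X[of 0 1] by (simp only: w_def power_0 mult_1)
  \<comment> \<open>Left inversion at g reads T_hat (T g) = g - c wgt, and g = T_hat f; hence T_hat
    k = - c wgt. Multiplying by sqrt (1 - x^2) strips the weight from both sides.\<close>
  have Tk: "AE x in M11. fin_hilbert (sqm k) x = c"
    using T_hat_fin_hilbert[OF g] T_hat_linear_ae[OF X_int[OF Tg] X_int[OF f], of "- 1"] AE_space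
  proof eventually_elim
    case (elim x)
    have x: "x \<in> {-1<..<1}" using elim by simp
    have "T_hat k x = - c * wgt x" using elim(1,2) by (simp add: k_def g_def[symmetric] proj_P_eq c_def)
    then have e: "- wgt x * fin_hilbert (sqm k) x = - c * wgt x" by (simp only: T_hat_eq)
    let ?R = "complex_of_real (sqrt (1 - x\<^sup>2))"
    have "(?R * wgt x) * fin_hilbert (sqm k) x = - (?R * (- wgt x * fin_hilbert (sqm k) x))" by simp
    also have "\<dots> = c * (?R * wgt x)" unfolding e by simp
    finally show ?case unfolding sqrt_times_wgt[OF x] by simp
  qed
  \<comment> \<open>\<open>w\<close> is t / sqrt (1 - t^2), the Chebyshev function of order 1. Its
    transform is the constant 1, so c w has the same transform as \<open>sqm k\<close>.\<close>
  have Tw: "fin_hilbert w x = 1" if x: "x \<in> {-1<..<1}" for x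
  proof -
    have "fin_hilbert w x = complex_of_real (rw x * sin (arccos x))" using fin_hilbert_wgt_cos[OF x, of 1] by (simp add: w_def)
    also have "rw x * sin (arccos x) = 1" using x rw_sqrt[OF x] by (simp add: sin_arccos)
    finally show ?thesis by simp
  qed
  define j where "j = (\<lambda>x. sqm k x + (- c) * w x)"
  have j: "j \<in> X" unfolding j_def by (intro X_add X_cmult sqm_X k w)
  have "AE x in M11. fin_hilbert j x = 0"
    using fin_hilbert_add_ae[OF X_int[OF sqm_X[OF k]] X_int[OF X_cmult[OF w]], of "- c"] fin_hilbert_cmult_ae[OF X_int[OF w], of "- c"] Tk AE_space
  proof eventually_elim
    case (elim x)
    then show ?case using Tw[of x] by (simp add: j_def)
  qed
  from fin_hilbert_kernel[OF j this]
  obtain d where d: "AE x in M11. j x = d * wgt x" by blast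
  \<comment> \<open>\<open>j\<close> lies in the kernel and is therefore d times the weight;
    multiplying sqrt (1 - x^2) k = c w + d wgt once more by the root clears all weights.\<close>
  have aff: "AE x in M11. complex_of_real (1 - x\<^sup>2) * k x = c * complex_of_real x + d"
    using d AE_space
  proof eventually_elim
    case (elim x)
    have x: "x \<in> {-1<..<1}" using elim by simp
    let ?R = "complex_of_real (sqrt (1 - x\<^sup>2))"
    have "sqrt (1 - x\<^sup>2) * sqrt (1 - x\<^sup>2) = 1 - x\<^sup>2" using less_imp_le[OF one_minus_sq_pos[of x]] x by simp
    then have R: "complex_of_real (1 - x\<^sup>2) = ?R * ?R" by (metis of_real_mult)
    have cx: "cos (real 1 * arccos x) = x" using x by simp
    have "?R * k x = d * wgt x + c * (wgt x * complex_of_real x)"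
      using elim(1) unfolding j_def w_def sqm_def cx by (simp add: algebra_simps)
    then have "?R * (?R * k x) = d * (?R * wgt x) + c * ((?R * wgt x) * complex_of_real x)" by algebra
    then show ?case unfolding sqrt_times_wgt[OF x] R by (simp add: mult.assoc add.commute)
  qed
  \<comment> \<open>Both claims come out together: c is the integral of g divided by pi, and c = d =
    0 forces k to vanish almost everywhere.\<close>
  from affine_over_weight_sq_integrable[OF X_int[OF k] aff] have cd: "c = 0" "d = 0" by auto
  have "AE x in M11. fin_hilbert g x = f x" using aff AE_space
  proof eventually_elim
    case (elim x)
    have "1 - x\<^sup>2 \<noteq> 0" using one_minus_sq_pos[of x] elim(2) by auto
    then have "k x = 0" using elim(1) unfolding cd by (simp only: mult_zero_left add_0 mult_eq_0_iff of_real_eq_0_iff simp_thms)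
    then show ?case by (simp add: k_def)
  qed
  moreover have "(LINT t|lborel. cut11 g t) = 0" using cd(1) by (simp add: c_def)
  ultimately show ?thesis by (simp only: g_def)
qed

section \<open>The projection, the range and the direct sum\<close>

lemma proj_P_bounded: "\<exists>C. \<forall>f\<in>X. N (proj_P f) \<le> C * N f"
proof -
  from X_integrable obtain K where K: "\<forall>f\<in>X. integrable lborel (cut11 f) \<and> (LINT t|lborel. cmod (cut11 f t)) \<le> K * N f"
    by (elim exE conjE)
  have "N (proj_P f) \<le> (K * N wgt) * N f" if f: "f \<in> X" for f
  proof -
    have "cmod (complex_of_real (1 / pi) * (LINT t|lborel. cut11 f t)) = 1 / pi * cmod (LINT t|lborel. cut11 f t)"
      unfolding norm_mult norm_of_real by simp
    also have "\<dots> \<le> 1 * cmod (LINT t|lborel. cut11 f t)" using pi_ge_two by (intro mult_right_mono) auto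
    also have "cmod (LINT t|lborel. cut11 f t) \<le> (LINT t|lborel. cmod (cut11 f t))" by (rule integral_norm_bound)
    also have "\<dots> \<le> K * N f" using K f by blast
    finally have le: "cmod (complex_of_real (1 / pi) * (LINT t|lborel. cut11 f t)) \<le> K * N f" by simp
    have "N (proj_P f) = cmod (complex_of_real (1 / pi) * (LINT t|lborel. cut11 f t)) * N wgt"
      unfolding proj_P_eq by (rule N_cmult[OF wgt_X])
    also have "\<dots> \<le> (K * N f) * N wgt" by (rule mult_right_mono[OF le N_nonneg[OF wgt_X]])
    finally show ?thesis by (simp add: mult_ac)
  qed
  then show ?thesis by blast
qed

lemma proj_P_idem: "proj_P (proj_P f) x = proj_P f x"
proof -
  have "(LINT t|lborel. cut11 (proj_P f) t) = (LINT t|lborel. cut11 f t)"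
    unfolding proj_P_eq integral_cut11_wgt by simp
  then show ?thesis by (simp only: proj_P_eq)
qed

text \<open>The right inversion formula writes f as the transform of \<open>T_hat f\<close>, so the
  bound of \<open>T\<close> becomes a lower bound for \<open>T_hat\<close>.\<close>

lemma T_hat_bounded_below: "\<exists>c>0. \<forall>f\<in>X. c * N f \<le> N (T_hat f)"
proof -
  from fin_hilbert_bounded obtain C where C: "0 < C" "\<forall>f\<in>X. fin_hilbert f \<in> X \<and> N (fin_hilbert f) \<le> C * N f"
    by (elim exE conjE)
  have "1 / C * N f \<le> N (T_hat f)" if f: "f \<in> X" for f
  proof -
    have "N f = N (fin_hilbert (T_hat f))"
      by (rule X_cong(2)[OF fin_hilbert_X[OF T_hat_X[OF f]] X_meas[OF f]])
        (use T_hat_right_inverse_and_mean[OF f] in \<open>auto elim: eventually_mono\<close>)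
    also have "\<dots> \<le> C * N (T_hat f)" using C(2) T_hat_X[OF f] by blast
    finally show ?thesis using C(1) by (simp add: field_simps)
  qed
  then show ?thesis using C(1) by (intro exI[of _ "1 / C"]) auto
qed

lemma integral_cut11_cong_ae:
  assumes "f \<in> X" "g \<in> X" "AE x in M11. f x = g x"
  shows "(LINT t|lborel. cut11 f t) = (LINT t|lborel. cut11 g t)"
  by (rule integral_cong_AE) (use cut11_cong_ae[OF assms(3)] X_int[OF assms(1)] X_int[OF assms(2)] in auto)

text \<open>A function of mean zero has P g = 0, so left inversion exhibits
  \<open>fin_hilbert g\<close> as a preimage.\<close>

lemma T_hat_range:
  assumes g: "g \<in> X"
  shows "(\<exists>f\<in>X. AE x in M11. T_hat f x = g x) \<longleftrightarrow> (LINT t|lborel. cut11 g t) = 0"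
proof
  assume "\<exists>f\<in>X. AE x in M11. T_hat f x = g x"
  then obtain f where f: "f \<in> X" "AE x in M11. T_hat f x = g x" by (elim bexE)
  show "(LINT t|lborel. cut11 g t) = 0"
    using integral_cut11_cong_ae[OF T_hat_X[OF f(1)] g f(2)] T_hat_right_inverse_and_mean[OF f(1)] by simp
next
  assume "(LINT t|lborel. cut11 g t) = 0"
  then have "AE x in M11. T_hat (fin_hilbert g) x = g x"
    using T_hat_fin_hilbert[OF g] by (simp add: proj_P_eq)
  then show "\<exists>f\<in>X. AE x in M11. T_hat f x = g x" by (rule bexI[OF _ fin_hilbert_X[OF g]])
qed

lemma mean_zero_plus_wgt:
  assumes f: "f \<in> X"
  shows "\<exists>g\<in>X. \<exists>c. (LINT t|lborel. cut11 g t) = 0 \<and> (AE x in M11. f x = g x + c * wgt x)"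
proof -
  define c where "c = complex_of_real (1 / pi) * (LINT t|lborel. cut11 f t)"
  let ?g = "\<lambda>x. f x + (- c) * wgt x"
  have "(LINT t|lborel. cut11 ?g t) = (LINT t|lborel. cut11 f t) + (LINT t|lborel. cut11 (\<lambda>x. (- c) * wgt x) t)"
    unfolding cut11_add by (rule Bochner_Integration.integral_add[OF X_int[OF f] X_int[OF X_cmult[OF wgt_X]]])
  also have "\<dots> = 0" unfolding integral_cut11_wgt by (simp add: c_def)
  finally have "(LINT t|lborel. cut11 ?g t) = 0" .
  moreover have "?g \<in> X" by (intro X_add X_cmult f wgt_X)
  moreover have "AE x in M11. f x = ?g x + c * wgt x" by simp
  ultimately show ?thesis by (intro bexI[of _ ?g] exI[of _ c] conjI)
qed

lemma mean_zero_wgt_independent: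
  assumes g: "g \<in> X" and z: "(LINT t|lborel. cut11 g t) = 0" and s: "AE x in M11. g x + c * wgt x = 0"
  shows "c = 0 \<and> (AE x in M11. g x = 0)"
proof -
  have "AE x in M11. g x = (- c) * wgt x" using s by eventually_elim (simp add: eq_neg_iff_add_eq_0)
  from integral_cut11_cong_ae[OF g X_cmult[OF wgt_X] this] have c: "c = 0" unfolding integral_cut11_wgt z by simp
  with s show ?thesis by simp
qed

end

theorem theorem3p2:
  fixes X :: "(real \<Rightarrow> complex) set" and N :: "(real \<Rightarrow> complex) \<Rightarrow> real"
  assumes ri: "ri_space X N"
    and lo: "1/2 < boyd_lower X N"
    and le: "boyd_lower X N \<le> boyd_upper X N"
    and up: "boyd_upper X N < 1"
  shows
    \<comment> \<open>T_X maps X into X (T_X well-defined)\<close>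
    "(\<forall>f\<in>X. fin_hilbert f \<in> X) \<and>
    \<comment> \<open>(a) Ker T_X = span {wgt}\<close>
     wgt \<in> X \<and>
     (\<forall>f\<in>X. (AE x in M11. fin_hilbert f x = 0) \<longleftrightarrow> (\<exists>c. AE x in M11. f x = c * wgt x)) \<and>
    \<comment> \<open>(b) T-hat bounded linear X -> X, T T-hat = I, integral of T-hat f vanishes\<close>
     (\<forall>f\<in>X. T_hat f \<in> X) \<and>
     (\<forall>f\<in>X. \<forall>g\<in>X. \<forall>c. AE x in M11. T_hat (\<lambda>y. f y + c * g y) x = T_hat f x + c * T_hat g x) \<and>
     (\<exists>C. \<forall>f\<in>X. N (T_hat f) \<le> C * N f) \<and>
     (\<forall>f\<in>X. AE x in M11. fin_hilbert (T_hat f) x = f x) \<and>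
     (\<forall>f\<in>X. set_integrable lborel {-1<..<1} (T_hat f) \<and>
            (LINT x:{-1<..<1}|lborel. T_hat f x) = 0) \<and>
    \<comment> \<open>(c) T_X surjective\<close>
     (\<forall>g\<in>X. \<exists>f\<in>X. AE x in M11. fin_hilbert f x = g x) \<and>
    \<comment> \<open>(d) T-hat T = I - P, P a bounded projection on X\<close>
     (\<forall>f\<in>X. proj_P f \<in> X) \<and>
     (\<exists>C. \<forall>f\<in>X. N (proj_P f) \<le> C * N f) \<and>
     (\<forall>f\<in>X. AE x in M11. proj_P (proj_P f) x = proj_P f x) \<and>
     (\<forall>f\<in>X. AE x in M11. T_hat (fin_hilbert f) x = f x - proj_P f x) \<and>
    \<comment> \<open>(e) T-hat is an isomorphism onto its range, which is the set of mean-zero functions\<close>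
     (\<exists>c>0. \<forall>f\<in>X. c * N f \<le> N (T_hat f)) \<and>
     (\<forall>g\<in>X. (\<exists>f\<in>X. AE x in M11. T_hat f x = g x) \<longleftrightarrow> (LINT x:{-1<..<1}|lborel. g x) = 0) \<and>
    \<comment> \<open>(f) direct sum decompositions\<close>
     (\<forall>f\<in>X. \<exists>g\<in>X. \<exists>c. (LINT x:{-1<..<1}|lborel. g x) = 0 \<and>
                         (AE x in M11. f x = g x + c * wgt x)) \<and>
     (\<forall>g\<in>X. \<forall>c. (LINT x:{-1<..<1}|lborel. g x) = 0 \<longrightarrow>
                 (AE x in M11. g x + c * wgt x = 0) \<longrightarrow> c = 0 \<and> (AE x in M11. g x = 0)) \<and>
     (\<forall>f\<in>X. \<exists>h\<in>X. \<exists>c. AE x in M11. f x = T_hat h x + c * wgt x) \<and>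
     (\<forall>h\<in>X. \<forall>c. (AE x in M11. T_hat h x + c * wgt x = 0) \<longrightarrow>
                 c = 0 \<and> (AE x in M11. T_hat h x = 0))"
proof -
  interpret rispace X N by unfold_locales (rule ri)
  from dil_bound_lower_index[OF lo] obtain \<alpha> Ca where a: "1 / 2 < \<alpha>" "0 < Ca"
    "\<forall>f\<in>X. \<forall>c\<ge>1. N (dil c f) \<le> Ca * c powr (- \<alpha>) * N f" by (elim exE conjE)
  from dil_bound_upper_index[OF up] obtain \<beta> Cb where b: "0 < \<beta>" "\<beta> < 1" "0 < Cb"
    "\<forall>f\<in>X. \<forall>c>0. c \<le> 1 \<longrightarrow> N (dil c f) \<le> Cb * c powr (- \<beta>) * N f" by (elim exE conjE)
  interpret boyd_space X N \<alpha> \<beta> Ca Cb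
    by unfold_locales (use a b in blast)+
  show ?thesis unfolding set_integral_cut11 set_integrable_cut11
  proof (intro conjI ballI allI impI)
    fix f assume f: "f \<in> X"
    show "fin_hilbert f \<in> X" by (rule fin_hilbert_X[OF f])
    show "(AE x in M11. fin_hilbert f x = 0) \<longleftrightarrow> (\<exists>c. AE x in M11. f x = c * wgt x)"
    proof
      assume "AE x in M11. fin_hilbert f x = 0"
      from fin_hilbert_kernel[OF f this] show "\<exists>c. AE x in M11. f x = c * wgt x" by (rule exI)
    next
      assume "\<exists>c. AE x in M11. f x = c * wgt x"
      then obtain c where c: "AE x in M11. f x = c * wgt x" by (elim exE)
      show "AE x in M11. fin_hilbert f x = 0"
        using fin_hilbert_wgt[of c] AE_space
      proof eventually_elim
        case (elim x)
        have "x \<in> {-1<..<1}" using elim by simp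
        from fin_hilbert_cong_ae[OF X_meas[OF f] X_meas[OF X_cmult[OF wgt_X]] c this] elim(1) show ?case by simp
      qed
    qed
    show "T_hat f \<in> X" by (rule T_hat_X[OF f])
    show "AE x in M11. fin_hilbert (T_hat f) x = f x" using T_hat_right_inverse_and_mean[OF f] by (rule conjunct1)
    show "integrable lborel (cut11 (T_hat f))" by (rule X_int[OF T_hat_X[OF f]])
    show "(LINT x|lborel. cut11 (T_hat f) x) = 0" using T_hat_right_inverse_and_mean[OF f] by (rule conjunct2)
    show "proj_P f \<in> X" unfolding proj_P_eq by (rule X_cmult[OF wgt_X])
    show "AE x in M11. proj_P (proj_P f) x = proj_P f x" by (simp add: proj_P_idem)
    show "AE x in M11. T_hat (fin_hilbert f) x = f x - proj_P f x" by (rule T_hat_fin_hilbert[OF f])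
    show "\<exists>g\<in>X. AE x in M11. fin_hilbert g x = f x"
      using T_hat_right_inverse_and_mean[OF f] by (intro bexI[OF _ T_hat_X[OF f]]) (rule conjunct1)
    show "(\<exists>h\<in>X. AE x in M11. T_hat h x = f x) \<longleftrightarrow> (LINT x|lborel. cut11 f x) = 0" by (rule T_hat_range[OF f])
    show "\<exists>g\<in>X. \<exists>c. (LINT x|lborel. cut11 g x) = 0 \<and> (AE x in M11. f x = g x + c * wgt x)"
      by (rule mean_zero_plus_wgt[OF f])
    have "AE x in M11. f x = T_hat (fin_hilbert f) x + complex_of_real (1 / pi) * (LINT t|lborel. cut11 f t) * wgt x"
      using T_hat_fin_hilbert[OF f] by eventually_elim (simp add: proj_P_eq)
    then show "\<exists>h\<in>X. \<exists>c. AE x in M11. f x = T_hat h x + c * wgt x"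
      by (intro bexI[OF _ fin_hilbert_X[OF f]]) (rule exI)
    fix c
    show "AE x in M11. T_hat (\<lambda>y. f y + c * g y) x = T_hat f x + c * T_hat g x" if "g \<in> X" for g
      by (rule T_hat_linear_ae[OF X_int[OF f] X_int[OF that]])
    show "c = 0" "AE x in M11. f x = 0" if "(LINT x|lborel. cut11 f x) = 0" "AE x in M11. f x + c * wgt x = 0"
      using mean_zero_wgt_independent[OF f that] by auto
    show "c = 0" "AE x in M11. T_hat f x = 0" if "AE x in M11. T_hat f x + c * wgt x = 0"
      using mean_zero_wgt_independent[OF T_hat_X[OF f] _ that] T_hat_right_inverse_and_mean[OF f] by auto
  next
    show "wgt \<in> X" by (rule wgt_X)
    show "\<exists>C. \<forall>f\<in>X. N (proj_P f) \<le> C * N f" by (rule proj_P_bounded)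
    show "\<exists>c>0. \<forall>f\<in>X. c * N f \<le> N (T_hat f)" by (rule T_hat_bounded_below)
    from T_hat_bounded obtain C where "\<forall>f\<in>X. T_hat f \<in> X \<and> N (T_hat f) \<le> C * N f" by (elim exE conjE)
    then show "\<exists>C. \<forall>f\<in>X. N (T_hat f) \<le> C * N f" by (intro exI[of _ C]) auto
  qed
qed

end
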